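(* Let $M=X+\mathrm{i}Y$ be a conformal local martingale with respect to a filtration $\{\mathcal{F}_t\}$ satisfying the usual conditions, starting from zero ($M_0=0$). Let $g(t)=\log^{1/2}(1+\log(1+t))$ for $t\ge 0$. Then for every moderate function $F$ there exist two constants $c_F,C_F>0$ such that for every stopping time $\tau$ of the filtration $\{\mathcal{F}_t\}$, $$c_F\,\mathbb{E}F\Bigl(\sqrt{[X,X]_\tau}\Bigr)\le\mathbb{E}F\Bigl(\max_{0\le t\le\tau}|M_t|\Bigr)\le C_F\,\mathbb{E}F\Bigl(\sqrt{[X,X]_\tau}\Bigr)$$ and $$c_F\,\mathbb{E}F\bigl(g([X,X]_\tau)\bigr)\le\mathbb{E}F\biggl(\max_{0\le t\le\tau}\frac{|M_t|}{\sqrt{1+[X,X]_t}}\biggr)\le C_F\,\mathbb{E}F\bigl(g([X,X]_\tau)\bigr).$$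
   Context: $\mathbb{R}_+=[0,\infty)$. A function $F:\mathbb{R}_+\to\mathbb{R}_+$ is called moderate if (a) it is continuous, increasing (in the weak sense) and $F(0)=0$, and (b) there exists $\beta>1$ such that $\sup_{x>0}F(\beta x)/F(x)<\infty$, with the conventions $0/0=1$ and $x/0=\infty$ for $x>0$. Notation: $\log^{1/2}(u)=(\log u)^{1/2}$. Let $M=X+\mathrm{i}Y$ be a continuous complex local martingale, i.e. $X$ and $Y$ are real continuous local martingales. $M$ is called a conformal local martingale if $[M,M]=[X,X]-[Y,Y]+2\mathrm{i}[X,Y]=0$, where $[X,Y]$ denotes the quadratic covariation process of $X$ and $Y$ (equivalently, $[X,X]=[Y,Y]$ and $[X,Y]=0$). *)

theory Defs
  imports "HOL-Probability.Probability"
begin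

text \<open>
  Processes are indexed by \<^typ>\<open>real\<close>, and only the times \<open>t \<ge> 0\<close> matter. The index type of the
  filtration is \<^typ>\<open>ennreal\<close>, so that \<^const>\<open>stopping_time\<close> yields stopping times with values in
  \<open>[0, \<infinity>]\<close>. The value of the filtration at \<open>\<infinity>\<close> can be any sub-\<open>\<sigma>\<close>-algebra containing all the others.
\<close>

locale usual_conditions = prob_space P + filtration "space P" F
  for P :: "'a measure" and F :: "ennreal \<Rightarrow> 'a measure" +
  assumes subalgebras: "\<And>t. subalgebra P (F t)"
    and complete: "\<And>N A. N \<in> null_sets P \<Longrightarrow> A \<subseteq> N \<Longrightarrow> A \<in> sets (F 0)"
    and right_continuous: "\<And>t. t < \<infinity> \<Longrightarrow> sets (F t) = (\<Inter>s\<in>{t<..}. sets (F s))"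

definition adapted :: "(ennreal \<Rightarrow> 'a measure) \<Rightarrow> (real \<Rightarrow> 'a \<Rightarrow> real) \<Rightarrow> bool" where
  "adapted F X \<longleftrightarrow> (\<forall>t\<ge>0. X t \<in> borel_measurable (F (ennreal t)))"

definition martingale ::
  "'a measure \<Rightarrow> (ennreal \<Rightarrow> 'a measure) \<Rightarrow> (real \<Rightarrow> 'a \<Rightarrow> real) \<Rightarrow> bool" where
  "martingale P F X \<longleftrightarrow>
     adapted F X \<and>
     (\<forall>t\<ge>0. integrable P (X t)) \<and>
     (\<forall>s t. 0 \<le> s \<longrightarrow> s \<le> t \<longrightarrow>
        (AE \<omega> in P. real_cond_exp P (F (ennreal s)) (X t) \<omega> = X s \<omega>))"

definition stopped :: "('a \<Rightarrow> ennreal) \<Rightarrow> (real \<Rightarrow> 'a \<Rightarrow> real) \<Rightarrow> real \<Rightarrow> 'a \<Rightarrow> real" where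
  "stopped T X t \<omega> = X (enn2real (min (ennreal t) (T \<omega>))) \<omega>"

definition continuous_paths :: "'a measure \<Rightarrow> (real \<Rightarrow> 'a \<Rightarrow> real) \<Rightarrow> bool" where
  "continuous_paths P X \<longleftrightarrow> (AE \<omega> in P. continuous_on {0..} (\<lambda>t. X t \<omega>))"

text \<open>No integrability of \<open>X 0\<close> is required: the localised object is \<open>X - X 0\<close>.\<close>

definition continuous_local_martingale ::
  "'a measure \<Rightarrow> (ennreal \<Rightarrow> 'a measure) \<Rightarrow> (real \<Rightarrow> 'a \<Rightarrow> real) \<Rightarrow> bool" where
  "continuous_local_martingale P F X \<longleftrightarrow>
     adapted F X \<and> continuous_paths P X \<and>
     (\<exists>T :: nat \<Rightarrow> 'a \<Rightarrow> ennreal.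
        (\<forall>n. stopping_time F (T n)) \<and>
        (AE \<omega> in P. incseq (\<lambda>n. T n \<omega>) \<and> (SUP n. T n \<omega>) = \<infinity>) \<and>
        (\<forall>n. martingale P F (\<lambda>t \<omega>. stopped (T n) X t \<omega> - X 0 \<omega>)))"

text \<open>
  For a continuous local martingale \<open>X\<close>, the process \<open>[X,X]\<close> is the continuous adapted increasing
  process vanishing at \<open>0\<close> for which \<open>X\<^sup>2 - [X,X]\<close> is a local martingale, and \<open>[X,Y]\<close> is obtained by
  polarisation. Both are determined only up to indistinguishability, so they are
  rendered as predicates singling out the versions \<open>A\<close> and \<open>C\<close> of these processes.
\<close>

definition is_quadratic_variation ::
  "'a measure \<Rightarrow> (ennreal \<Rightarrow> 'a measure) \<Rightarrow> (real \<Rightarrow> 'a \<Rightarrow> real) \<Rightarrow> (real \<Rightarrow> 'a \<Rightarrow> real) \<Rightarrow> bool" where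
  "is_quadratic_variation P F X A \<longleftrightarrow>
     adapted F A \<and> continuous_paths P A \<and>
     (AE \<omega> in P. A 0 \<omega> = 0 \<and> mono_on {0..} (\<lambda>t. A t \<omega>)) \<and>
     continuous_local_martingale P F (\<lambda>t \<omega>. (X t \<omega>)\<^sup>2 - A t \<omega>)"

definition is_quadratic_covariation ::
  "'a measure \<Rightarrow> (ennreal \<Rightarrow> 'a measure) \<Rightarrow> (real \<Rightarrow> 'a \<Rightarrow> real) \<Rightarrow> (real \<Rightarrow> 'a \<Rightarrow> real) \<Rightarrow>
    (real \<Rightarrow> 'a \<Rightarrow> real) \<Rightarrow> bool" where
  "is_quadratic_covariation P F X Y C \<longleftrightarrow>
     (\<exists>U V. is_quadratic_variation P F (\<lambda>t \<omega>. X t \<omega> + Y t \<omega>) U \<and>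
            is_quadratic_variation P F (\<lambda>t \<omega>. X t \<omega> - Y t \<omega>) V \<and>
            (\<forall>t\<ge>0. \<forall>\<omega>\<in>space P. C t \<omega> = (U t \<omega> - V t \<omega>) / 4))"

definition conformal_local_martingale ::
  "'a measure \<Rightarrow> (ennreal \<Rightarrow> 'a measure) \<Rightarrow> (real \<Rightarrow> 'a \<Rightarrow> complex) \<Rightarrow> bool" where
  "conformal_local_martingale P F M \<longleftrightarrow>
     (let X = (\<lambda>t \<omega>. Re (M t \<omega>)); Y = (\<lambda>t \<omega>. Im (M t \<omega>)) in
        continuous_local_martingale P F X \<and> continuous_local_martingale P F Y \<and>
        (\<exists>A B C. is_quadratic_variation P F X A \<and> is_quadratic_variation P F Y B \<and>
           is_quadratic_covariation P F X Y C \<and>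
           (AE \<omega> in P. \<forall>t\<ge>0.
              complex_of_real (A t \<omega>) - complex_of_real (B t \<omega>)
                + 2 * \<i> * complex_of_real (C t \<omega>) = 0)))"

text \<open>Quotients in \<open>[0, \<infinity>]\<close> with \<open>0 / 0 = 1\<close>; the division of \<^typ>\<open>ennreal\<close> has \<open>0 / 0 = 0\<close>.\<close>

definition ratio :: "real \<Rightarrow> real \<Rightarrow> ennreal" where
  "ratio a b = (if b = 0 then (if a = 0 then 1 else \<infinity>) else ennreal (a / b))"

definition moderate :: "(real \<Rightarrow> real) \<Rightarrow> bool" where
  "moderate \<Phi> \<longleftrightarrow>
     (\<forall>x\<ge>0. \<Phi> x \<ge> 0) \<and> continuous_on {0..} \<Phi> \<and> mono_on {0..} \<Phi> \<and> \<Phi> 0 = 0 \<and>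
     (\<exists>\<beta>>1. (SUP x\<in>{0<..}. ratio (\<Phi> (\<beta> * x)) (\<Phi> x)) < \<infinity>)"

definition running_max :: "(real \<Rightarrow> 'a \<Rightarrow> real) \<Rightarrow> real \<Rightarrow> 'a \<Rightarrow> real" where
  "running_max Z t \<omega> = (SUP s\<in>{0..t}. Z s \<omega>)"

text \<open>
  The value at \<open>\<tau>\<close> of a process \<open>Z\<close> with nonnegative increasing paths; where \<open>\<tau> = \<infinity>\<close> it is the
  (possibly infinite) limit of \<open>Z t\<close> as \<open>t\<close> tends to \<open>\<infinity>\<close>. For an increasing continuous \<open>\<Phi>\<close> with
  \<open>\<Phi> \<infinity>\<close> read as \<open>sup \<Phi>\<close>, evaluating \<open>\<Phi> \<circ> Z\<close> at \<open>\<tau>\<close> is the same as applying \<open>\<Phi>\<close> to \<open>Z\<close> at \<open>\<tau>\<close>.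
\<close>

definition value_at :: "('a \<Rightarrow> ennreal) \<Rightarrow> (real \<Rightarrow> 'a \<Rightarrow> real) \<Rightarrow> 'a \<Rightarrow> ennreal" where
  "value_at \<tau> Z \<omega> =
     (if \<tau> \<omega> = \<infinity> then (SUP t\<in>{0..}. ennreal (Z t \<omega>)) else ennreal (Z (enn2real (\<tau> \<omega>)) \<omega>))"

definition g :: "real \<Rightarrow> real" where
  "g t = sqrt (ln (1 + ln (1 + t)))"

end

theory Submission
  imports Defs
begin

text \<open>
  Write \<open>R = |M|\<^sup>2 / (1 + c A)\<close> with \<open>c = 0\<close> or \<open>c = 1\<close>. For smooth \<open>f\<close>, Ito's formula gives \<open>f(R)\<close> the
  drift \<open>(f'(R) (2 - c R) + 2 R f''(R)) / (1 + c A)\<close> with respect to \<open>dA\<close>. If \<open>f\<close> is chosen so that the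
  numerator is \<open>1\<close>, then \<open>f(R)\<close> is a nonnegative process whose increments between stopping times have
  the same expectation as those of a clock: \<open>f(r) = r/2\<close> with clock \<open>A\<close> for \<open>c = 0\<close>, and the solution of
  \<open>2 r f'' + (2 - r) f' = 1\<close> with clock \<open>ln (1 + A)\<close> for \<open>c = 1\<close>. In the second case \<open>R\<close> run by its clock
  is the squared modulus of a planar Ornstein-Uhlenbeck process, and
  \<open>exp (r/4) - 1 \<le> f(r) \<le> exp (r/2) - 1\<close>. Hence \<open>ln (1 + f(R))\<close> is comparable with \<open>R\<close>, whereas
  \<open>ln (1 + ln (1 + A))\<close> is the square of \<open>g(A)\<close>: both pairs of inequalities compare \<open>N(f(max R))\<close> with
  \<open>N(clock)\<close>, for \<open>N(x) = \<Phi>(sqrt x)\<close> and for \<open>N(x) = \<Phi>(sqrt (ln (1 + x)))\<close>.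

  The comparison is by good-lambda inequalities. The clock can double while the maximum of \<open>f(R)\<close> stays below
  \<open>\<delta>\<lambda>\<close> only with conditional probability at most \<open>\<delta>\<close> (\<open>lower_good_lambda\<close>), which settles both lower bounds.
  For the converse with \<open>c = 0\<close>, the function \<open>r\<^sup>p\<close> shows that \<open>|M|\<^sup>2\<close> doubles before \<open>A\<close> reaches \<open>\<delta>\<lambda>\<close> with
  conditional probability at most \<open>2\<^sup>-\<^sup>p + p\<^sup>2 \<delta>\<close> (\<open>upper_good_lambda\<close>); a large \<open>p\<close> beats the growth
  constant of \<open>\<Phi>\<close>. With \<open>c = 1\<close> the same argument yields only \<open>2/b\<close> for the passage of \<open>f(R)\<close> from
  \<open>\<lambda>\<close> to \<open>b\<lambda>\<close>. This suffices for levels above \<open>1\<close>, because there \<open>N\<close> grows like a power of a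
  logarithm, so that a large \<open>b\<close> wins. Levels below \<open>1\<close> are treated by stopping when
  \<open>A = 1\<close>: up to that time \<open>g(A)\<close> is comparable with \<open>sqrt A\<close> and the case \<open>c = 0\<close> applies.

  The drift identity is needed in expectation only (\<open>ito_inequality\<close>). It follows from a second-order Taylor
  expansion along a deterministic partition, since the first-order and second-order terms are martingale
  increments as soon as \<open>X\<close>, \<open>Y\<close>, \<open>X\<^sup>2 - A\<close>, \<open>Y\<^sup>2 - A\<close> and \<open>X Y\<close> are local martingales, and the remainder is
  controlled by the second moment of the sum of squared increments. Conformality supplies these five
  local martingales by linear combination.
  Optional stopping reduces everything to times up to which \<open>M\<close> and \<open>A\<close> are bounded, and monotone convergence
  removes the bound.
\<close>

section \<open>Sampling a path along refining grids\<close>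

definition grid :: "real \<Rightarrow> real \<Rightarrow> nat \<Rightarrow> nat \<Rightarrow> real" where
  "grid s t m i = s + (t - s) * real i / real m"

text \<open>
  The point of \<open>[s, t]\<close> nearest to \<open>\<theta>\<close>. The detour through
  \<^typ>\<open>ennreal\<close> admits \<open>\<theta> = \<infinity>\<close>, which a stopping time
  may take.
\<close>

definition clamp :: "real \<Rightarrow> real \<Rightarrow> ennreal \<Rightarrow> real" where
  "clamp s t \<theta> = enn2real (min (ennreal t) (max (ennreal s) \<theta>))"

lemma grid_bounds: "s \<le> t \<Longrightarrow> i \<le> m \<Longrightarrow> s \<le> grid s t m i \<and> grid s t m i \<le> t"
proof -
  assume "s \<le> t" "i \<le> m"
  then have "(t - s) * (real i / real m) \<le> (t - s) * 1"
    by (intro mult_left_mono) (auto simp: divide_le_eq)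
  then show ?thesis using \<open>s \<le> t\<close> by (auto simp: grid_def)
qed

lemma grid_mono: "s \<le> t \<Longrightarrow> i \<le> j \<Longrightarrow> grid s t m i \<le> grid s t m j"
  by (auto simp: grid_def intro!: divide_right_mono mult_left_mono)

lemma grid_0 [simp]: "grid s t m 0 = s" by (simp add: grid_def)
lemma grid_m [simp]: "0 < m \<Longrightarrow> grid s t m m = t" by (simp add: grid_def)

lemma clamp_bounds: "0 \<le> s \<Longrightarrow> s \<le> t \<Longrightarrow> s \<le> clamp s t \<theta> \<and> clamp s t \<theta> \<le> t"
proof -
  assume *: "0 \<le> s" "s \<le> t"
  have fin: "min (ennreal t) (max (ennreal s) \<theta>) < \<infinity>" by (simp add: min_less_iff_disj)
  have "ennreal s \<le> min (ennreal t) (max (ennreal s) \<theta>)" using * by (auto simp: ennreal_leI)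
  then have "enn2real (ennreal s) \<le> clamp s t \<theta>"
    unfolding clamp_def using fin by (intro enn2real_mono) auto
  moreover have "clamp s t \<theta> \<le> enn2real (ennreal t)"
    unfolding clamp_def by (intro enn2real_mono) auto
  ultimately show ?thesis using * by simp
qed

lemma less_clamp_iff:
  assumes "0 \<le> s" "s \<le> x" "x < t"
  shows "ennreal x < \<theta> \<longleftrightarrow> x < clamp s t \<theta>"
proof -
  have fin: "min (ennreal t) (max (ennreal s) \<theta>) < \<infinity>" by (simp add: min_less_iff_disj)
  have "x < clamp s t \<theta> \<longleftrightarrow> ennreal x < ennreal (clamp s t \<theta>)"
    using assms by (auto simp: ennreal_less_iff)
  also have "ennreal (clamp s t \<theta>) = min (ennreal t) (max (ennreal s) \<theta>)"
    unfolding clamp_def using fin by (intro ennreal_enn2real) auto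
  also have "ennreal x < min (ennreal t) (max (ennreal s) \<theta>) \<longleftrightarrow> ennreal x < \<theta>"
    using assms by (auto simp: ennreal_less_iff less_max_iff_disj)
  finally show ?thesis by simp
qed

text \<open>
  Weighting the increments along a grid with the indicator that the clock \<open>\<theta>\<close>
  has not rung yet stops the path at the first grid point beyond \<open>\<theta>\<close>. The index
  of this point depends on \<open>\<theta>\<close> alone, so one grid point serves all paths
  \<open>z\<close>.
\<close>

lemma grid_telescope:
  assumes s: "0 \<le> s" "s \<le> t" and m: "0 < m"
  shows "\<exists>j\<le>m. \<bar>grid s t m j - clamp s t \<theta>\<bar> \<le> (t - s) / real m \<and>
    (\<forall>z :: real \<Rightarrow> real. (\<Sum>i<m. of_bool (ennreal (grid s t m i) < \<theta>) * (z (grid s t m (Suc i)) - z (grid s t m i)))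
        = z (grid s t m j) - z s)"
proof (cases "s = t")
  case True
  have "clamp s t \<theta> = t" using clamp_bounds[of s t \<theta>] s True by auto
  then show ?thesis using True by (intro exI[of _ 0]) (auto simp: grid_def)
next
  case False
  then have st: "s < t" using s by simp
  define x where "x = clamp s t \<theta>"
  have x: "s \<le> x" "x \<le> t" using clamp_bounds[OF s] by (auto simp: x_def)
  define j where "j = nat \<lceil>(x - s) * real m / (t - s)\<rceil>"
  have j0: "0 \<le> (x - s) * real m / (t - s)" using x st by auto
  have jr: "real j = of_int \<lceil>(x - s) * real m / (t - s)\<rceil>" using j0 by (simp add: j_def)
  have j1: "(x - s) * real m / (t - s) \<le> real j" "real j < (x - s) * real m / (t - s) + 1"
    unfolding jr by linarith+
  have "(x - s) * real m / (t - s) \<le> real m"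
    using x st m by (simp add: divide_le_eq mult.commute mult_left_mono)
  then have jm: "j \<le> m" unfolding j_def by (simp add: ceiling_le_iff)
  have lt: "grid s t m i < x \<longleftrightarrow> i < j" for i
  proof -
    have "grid s t m i < x \<longleftrightarrow> real i < (x - s) * real m / (t - s)"
      using st m by (simp add: grid_def field_simps)
    also have "\<dots> \<longleftrightarrow> i < j"
    proof
      assume "real i < (x - s) * real m / (t - s)"
      then have "real i < real j" using j1(1) by linarith
      then show "i < j" by simp
    next
      assume "i < j"
      then have "real i + 1 \<le> real j" by simp
      then show "real i < (x - s) * real m / (t - s)" using j1(2) by linarith
    qed
    finally show ?thesis .
  qed
  have a: "(x - s) \<le> (t - s) * real j / real m" using j1(1) st m by (simp add: field_simps)
  have b: "(t - s) * real j / real m \<le> (x - s) + (t - s) / real m"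
  proof -
    have "(t - s) * real j \<le> (x - s) * real m + (t - s)" using j1(2) st by (simp add: field_simps)
    then have "(t - s) * real j / real m \<le> ((x - s) * real m + (t - s)) / real m"
      by (rule divide_right_mono) simp
    then show ?thesis using m by (simp add: add_divide_distrib)
  qed
  have gap: "\<bar>grid s t m j - x\<bar> \<le> (t - s) / real m" using a b by (simp add: grid_def)
  have "(\<Sum>i<m. of_bool (ennreal (grid s t m i) < \<theta>) * (z (grid s t m (Suc i)) - z (grid s t m i)))
      = z (grid s t m j) - z s" for z :: "real \<Rightarrow> real"
  proof -
    have "(\<Sum>i<m. of_bool (ennreal (grid s t m i) < \<theta>) * (z (grid s t m (Suc i)) - z (grid s t m i)))
      = (\<Sum>i<m. if i < j then z (grid s t m (Suc i)) - z (grid s t m i) else 0)"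
    proof (intro sum.cong refl)
      fix i assume "i \<in> {..<m}"
      then have "(t - s) * real i / real m < (t - s)" using st m by (simp add: divide_less_eq)
      then have "grid s t m i < t" by (simp add: grid_def)
      moreover have "s \<le> grid s t m i" using grid_bounds[of s t i m] \<open>i \<in> _\<close> s by auto
      ultimately have "ennreal (grid s t m i) < \<theta> \<longleftrightarrow> i < j"
        using less_clamp_iff[of s "grid s t m i" t \<theta>] s lt by (simp add: x_def)
      then show "of_bool (ennreal (grid s t m i) < \<theta>) * (z (grid s t m (Suc i)) - z (grid s t m i))
         = (if i < j then z (grid s t m (Suc i)) - z (grid s t m i) else 0)" by simp
    qed
    also have "\<dots> = (\<Sum>i<j. z (grid s t m (Suc i)) - z (grid s t m i))"
      using jm by (intro sum.mono_neutral_cong_right) auto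
    also have "\<dots> = z (grid s t m j) - z s" by (subst sum_lessThan_telescope) simp
    finally show ?thesis .
  qed
  then show ?thesis using jm gap unfolding x_def by blast
qed

lemma grid_telescope_bound:
  fixes z :: "real \<Rightarrow> real"
  assumes "0 \<le> s" "s \<le> t" "0 < m" and C: "\<And>r. s \<le> r \<Longrightarrow> r \<le> t \<Longrightarrow> \<bar>z r\<bar> \<le> C"
  shows "\<bar>\<Sum>i<m. of_bool (ennreal (grid s t m i) < \<theta>) * (z (grid s t m (Suc i)) - z (grid s t m i))\<bar> \<le> 2 * C"
proof -
  obtain j where "j \<le> m" and *: "\<And>z :: real \<Rightarrow> real. (\<Sum>i<m. of_bool (ennreal (grid s t m i) < \<theta>) * (z (grid s t m (Suc i)) - z (grid s t m i)))
        = z (grid s t m j) - z s"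
    using grid_telescope[OF assms(1-3), of \<theta>] by blast
  have "\<bar>z (grid s t m j)\<bar> \<le> C" "\<bar>z s\<bar> \<le> C"
    using C[of s] C[of "grid s t m j"] grid_bounds[of s t j m] \<open>j \<le> m\<close> assms by auto
  then show ?thesis unfolding * by linarith
qed

text \<open>
  The discrete stopping converges to stopping at \<open>\<theta>\<close> itself. Taking
  \<open>\<theta>\<close> to be a stopping time makes every summand measurable at the right
  endpoint, which is how adaptedness, optional stopping and Ito's formula are all reached below.
\<close>

lemma grid_telescope_tendsto:
  fixes z :: "real \<Rightarrow> real"
  assumes s: "0 \<le> s" "s \<le> t" and z: "continuous_on {0..} z"
  shows "(\<lambda>m. \<Sum>i<m. of_bool (ennreal (grid s t m i) < \<theta>) * (z (grid s t m (Suc i)) - z (grid s t m i)))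
     \<longlonglongrightarrow> z (clamp s t \<theta>) - z s"
proof -
  define Q where "Q m j \<longleftrightarrow> j \<le> m \<and> \<bar>grid s t m j - clamp s t \<theta>\<bar> \<le> (t - s) / real m \<and>
     (\<Sum>i<m. of_bool (ennreal (grid s t m i) < \<theta>) * (z (grid s t m (Suc i)) - z (grid s t m i)))
        = z (grid s t m j) - z s" for m j
  have "\<exists>j. Q m j" if "0 < m" for m
    using grid_telescope[OF s that, of \<theta>] unfolding Q_def by blast
  then obtain j where Q: "\<And>m. 0 < m \<Longrightarrow> Q m (j m)" by metis
  have j: "\<And>m. 0 < m \<Longrightarrow> j m \<le> m"
      "\<And>m. 0 < m \<Longrightarrow> \<bar>grid s t m (j m) - clamp s t \<theta>\<bar> \<le> (t - s) / real m"
      "\<And>m. 0 < m \<Longrightarrow> (\<Sum>i<m. of_bool (ennreal (grid s t m i) < \<theta>) * (z (grid s t m (Suc i)) - z (grid s t m i)))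
        = z (grid s t m (j m)) - z s"
    using Q unfolding Q_def by blast+
  have "(\<lambda>m. grid s t m (j m) - clamp s t \<theta>) \<longlonglongrightarrow> 0"
  proof (rule Lim_null_comparison)
    show "\<forall>\<^sub>F m in sequentially. norm (grid s t m (j m) - clamp s t \<theta>) \<le> (t - s) / real m"
      using eventually_gt_at_top[of 0] by eventually_elim (use j in auto)
    show "(\<lambda>m. (t - s) / real m) \<longlonglongrightarrow> 0" by (rule lim_const_over_n)
  qed
  then have lim: "(\<lambda>m. grid s t m (j m)) \<longlonglongrightarrow> clamp s t \<theta>" by (rule LIM_zero_cancel)
  have "\<forall>\<^sub>F m in sequentially. grid s t m (j m) \<in> {0..}"
    using eventually_gt_at_top[of 0]
  proof eventually_elim
    case (elim m) then show ?case using grid_bounds[of s t "j m" m] j(1)[of m] s by auto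
  qed
  then have "(\<lambda>m. z (grid s t m (j m))) \<longlonglongrightarrow> z (clamp s t \<theta>)"
    using clamp_bounds[OF s, of \<theta>] s
    by (intro continuous_on_tendsto_compose[OF z lim]) auto
  then have "(\<lambda>m. z (grid s t m (j m)) - z s) \<longlonglongrightarrow> z (clamp s t \<theta>) - z s"
    by (intro tendsto_intros)
  then show ?thesis
  proof (rule Lim_transform_eventually)
    show "\<forall>\<^sub>F m in sequentially. z (grid s t m (j m)) - z s = (\<Sum>i<m. of_bool (ennreal (grid s t m i) < \<theta>) * (z (grid s t m (Suc i)) - z (grid s t m i)))"
      using eventually_gt_at_top[of 0] by eventually_elim (use j(3) in auto)
  qed
qed

lemma stopped_clamp: "stopped T N t \<omega> = N (clamp 0 t (T \<omega>)) \<omega>"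
  by (simp add: stopped_def clamp_def)

lemma clamp_le: "0 \<le> t \<Longrightarrow> \<theta> \<le> ennreal s \<Longrightarrow> s \<le> t \<Longrightarrow> 0 \<le> s \<Longrightarrow> clamp 0 t \<theta> = clamp 0 s \<theta>"
  using ennreal_leI[of s t] by (simp add: clamp_def min_absorb2 order_trans[of \<theta> "ennreal s" "ennreal t"])

lemma clamp_gt: "0 \<le> s \<Longrightarrow> ennreal s \<le> \<theta> \<Longrightarrow> clamp 0 s \<theta> = s"
  by (simp add: clamp_def min_absorb1)

lemma clamp_base: "ennreal s \<le> \<theta> \<Longrightarrow> clamp s t \<theta> = clamp 0 t \<theta>"
  by (simp add: clamp_def max_absorb2)

section \<open>Optional stopping for continuous martingales\<close>

text \<open>
  A form of uniform integrability that suits martingales: Jensen's inequality for the convex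
  functions \<open>(|x| - K)\<^sup>+\<close> bounds the excess over \<open>K\<close> of each
  \<open>L m\<close> by that of a fixed integrable variable, which tends to \<open>0\<close> as
  \<open>K\<close> grows. What remains after truncation at \<open>K\<close> converges by dominated
  convergence.
\<close>

lemma convergence_of_dominated_excess:
  fixes L :: "nat \<Rightarrow> 'a \<Rightarrow> real"
  assumes "finite_measure P"
    and L: "\<And>m. integrable P (L m)" and Y: "integrable P Y"
    and lim: "\<And>\<omega>. (\<lambda>m. L m \<omega>) \<longlonglongrightarrow> L' \<omega>"
    and excess: "\<And>m K. 0 \<le> K \<Longrightarrow> (\<integral>\<omega>. max (\<bar>L m \<omega>\<bar> - K) 0 \<partial>P) \<le> (\<integral>\<omega>. max (\<bar>Y \<omega>\<bar> - K) 0 \<partial>P)"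
    and B: "B \<in> sets P"
  shows "integrable P L'" "(\<lambda>m. \<integral>\<omega>. indicator B \<omega> * L m \<omega> \<partial>P) \<longlonglongrightarrow> (\<integral>\<omega>. indicator B \<omega> * L' \<omega> \<partial>P)"
proof -
  interpret finite_measure P by fact
  define h where "h K x = max (\<bar>x\<bar> - K) 0" for K x :: real
  have h_meas[measurable]: "h K \<in> borel_measurable borel" for K
    unfolding h_def by measurable
  have [measurable]: "L m \<in> borel_measurable P" "Y \<in> borel_measurable P" "B \<in> sets P" for m using L Y B by auto
  have L'_meas[measurable]: "L' \<in> borel_measurable P"
    by (rule borel_measurable_LIMSEQ_real[where u=L, OF lim]) measurable
  have h_int: "integrable P (\<lambda>\<omega>. h K (f \<omega>))" if "integrable P f" "0 \<le> K" for f K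
    by (rule Bochner_Integration.integrable_bound[OF that(1)]) (use that in \<open>auto simp: h_def\<close>)
  have nnL: "(\<integral>\<^sup>+\<omega>. ennreal (h K (L' \<omega>)) \<partial>P) \<le> ennreal (\<integral>\<omega>. h K (Y \<omega>) \<partial>P)" if K: "0 \<le> K" for K
  proof -
    have "(\<integral>\<^sup>+\<omega>. ennreal (h K (L' \<omega>)) \<partial>P) = (\<integral>\<^sup>+\<omega>. liminf (\<lambda>m. ennreal (h K (L m \<omega>))) \<partial>P)"
    proof (intro nn_integral_cong)
      fix \<omega>
      have "(\<lambda>m. ennreal (h K (L m \<omega>))) \<longlonglongrightarrow> ennreal (h K (L' \<omega>))"
        unfolding h_def by (intro tendsto_ennrealI tendsto_intros lim)
      then show "ennreal (h K (L' \<omega>)) = liminf (\<lambda>m. ennreal (h K (L m \<omega>)))"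
        by (simp add: lim_imp_Liminf)
    qed
    also have "\<dots> \<le> liminf (\<lambda>m. \<integral>\<^sup>+\<omega>. ennreal (h K (L m \<omega>)) \<partial>P)"
      by (rule nn_integral_liminf) measurable
    also have "\<dots> \<le> ennreal (\<integral>\<omega>. h K (Y \<omega>) \<partial>P)"
    proof (rule Liminf_le)
      show "\<forall>\<^sub>F m in sequentially. (\<integral>\<^sup>+\<omega>. ennreal (h K (L m \<omega>)) \<partial>P) \<le> ennreal (\<integral>\<omega>. h K (Y \<omega>) \<partial>P)"
      proof (rule always_eventually, rule allI)
        fix m
        have "(\<integral>\<^sup>+\<omega>. ennreal (h K (L m \<omega>)) \<partial>P) = ennreal (\<integral>\<omega>. h K (L m \<omega>) \<partial>P)"
          using h_int[OF L K] by (intro nn_integral_eq_integral) (auto simp: h_def)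
        then show "(\<integral>\<^sup>+\<omega>. ennreal (h K (L m \<omega>)) \<partial>P) \<le> ennreal (\<integral>\<omega>. h K (Y \<omega>) \<partial>P)"
          using excess[OF K, of m] by (simp add: h_def ennreal_leI)
      qed
    qed simp
    finally show ?thesis .
  qed
  show int: "integrable P L'"
  proof (rule integrableI_bounded)
    show "(\<integral>\<^sup>+\<omega>. ennreal (norm (L' \<omega>)) \<partial>P) < \<infinity>"
      using nnL[of 0] by (auto simp: h_def intro: le_less_trans)
  qed measurable
  have hL': "(\<integral>\<omega>. h K (L' \<omega>) \<partial>P) \<le> (\<integral>\<omega>. h K (Y \<omega>) \<partial>P)" if "0 \<le> K" for K
  proof -
    have "ennreal (\<integral>\<omega>. h K (L' \<omega>) \<partial>P) \<le> ennreal (\<integral>\<omega>. h K (Y \<omega>) \<partial>P)"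
      using nnL[OF that] nn_integral_eq_integral[OF h_int[OF int that]] by (simp add: h_def)
    then show ?thesis by (subst (asm) ennreal_le_iff) (auto intro!: integral_nonneg_AE simp: h_def)
  qed
  have e: "(\<lambda>n. \<integral>\<omega>. h (real n) (Y \<omega>) \<partial>P) \<longlonglongrightarrow> (\<integral>\<omega>. 0 \<partial>P)"
  proof (rule integral_dominated_convergence[where w="\<lambda>\<omega>. \<bar>Y \<omega>\<bar>"])
    show "AE \<omega> in P. (\<lambda>n. h (real n) (Y \<omega>)) \<longlonglongrightarrow> 0"
    proof (intro AE_I2)
      fix \<omega>
      obtain n0 :: nat where "\<bar>Y \<omega>\<bar> \<le> n0" using real_arch_simple by blast
      then have "\<forall>\<^sub>F n in sequentially. h (real n) (Y \<omega>) = 0"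
        unfolding eventually_sequentially h_def by (intro exI[of _ n0]) auto
      then show "(\<lambda>n. h (real n) (Y \<omega>)) \<longlonglongrightarrow> 0" by (rule tendsto_eventually)
    qed
  qed (use Y in \<open>auto simp: h_def\<close>)
  define c where "c K x = max (- K) (min K x)" for K x :: real
  have [measurable]: "c K \<in> borel_measurable borel" for K
    unfolding c_def by measurable
  have xc: "\<bar>x - c K x\<bar> \<le> h K x" if "0 \<le> K" for x K
    using that by (auto simp: h_def c_def max_def min_def)
  have bnd: "\<bar>(\<integral>\<omega>. indicator B \<omega> * f \<omega> \<partial>P) - (\<integral>\<omega>. indicator B \<omega> * c K (f \<omega>) \<partial>P)\<bar> \<le> (\<integral>\<omega>. h K (f \<omega>) \<partial>P)"
    if f: "integrable P f" and K: "0 \<le> K" for f K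
  proof -
    have [measurable]: "f \<in> borel_measurable P" using f by simp
    have 1: "integrable P (\<lambda>\<omega>. indicator B \<omega> * f \<omega>)"
      using f B by (rule_tac Bochner_Integration.integrable_bound[OF f]) (auto simp: indicator_def)
    have 2: "integrable P (\<lambda>\<omega>. indicator B \<omega> * c K (f \<omega>))"
      by (rule integrable_const_bound[where B=K]) (use K in \<open>auto simp: indicator_def c_def\<close>)
    have "\<bar>(\<integral>\<omega>. indicator B \<omega> * f \<omega> \<partial>P) - (\<integral>\<omega>. indicator B \<omega> * c K (f \<omega>) \<partial>P)\<bar>
      = \<bar>\<integral>\<omega>. indicator B \<omega> * f \<omega> - indicator B \<omega> * c K (f \<omega>) \<partial>P\<bar>"
      using 1 2 by simp
    also have "\<dots> \<le> (\<integral>\<omega>. \<bar>indicator B \<omega> * f \<omega> - indicator B \<omega> * c K (f \<omega>)\<bar> \<partial>P)"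
      by (rule integral_abs_bound)
    also have "\<dots> \<le> (\<integral>\<omega>. h K (f \<omega>) \<partial>P)"
      using 1 2 h_int[OF f K] xc[OF K]
      by (intro integral_mono integrable_abs Bochner_Integration.integrable_diff) (auto simp: indicator_def h_def)
    finally show ?thesis .
  qed
  show "(\<lambda>m. \<integral>\<omega>. indicator B \<omega> * L m \<omega> \<partial>P) \<longlonglongrightarrow> (\<integral>\<omega>. indicator B \<omega> * L' \<omega> \<partial>P)"
  proof (rule LIMSEQ_I)
    fix r :: real assume "0 < r"
    then obtain n where n: "(\<integral>\<omega>. h (real n) (Y \<omega>) \<partial>P) < r / 4"
      using order_tendstoD(2)[OF e, of "r/4"] by (auto simp: eventually_sequentially)
    have "(\<lambda>m. \<integral>\<omega>. indicator B \<omega> * c n (L m \<omega>) \<partial>P) \<longlonglongrightarrow> (\<integral>\<omega>. indicator B \<omega> * c n (L' \<omega>) \<partial>P)"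
      by (rule integral_dominated_convergence[where w="\<lambda>_. real n"])
        (auto simp: c_def indicator_def intro!: AE_I2 tendsto_intros lim)
    from LIMSEQ_D[OF this, of "r/4"] obtain m0 where m0: "\<And>m. m0 \<le> m \<Longrightarrow> \<bar>(\<integral>\<omega>. indicator B \<omega> * c n (L m \<omega>) \<partial>P) - (\<integral>\<omega>. indicator B \<omega> * c n (L' \<omega>) \<partial>P)\<bar> < r / 4"
      using \<open>0 < r\<close> unfolding real_norm_def by (metis divide_pos_pos zero_less_numeral)
    show "\<exists>m0. \<forall>m\<ge>m0. norm ((\<integral>\<omega>. indicator B \<omega> * L m \<omega> \<partial>P) - (\<integral>\<omega>. indicator B \<omega> * L' \<omega> \<partial>P)) < r"
    proof (intro exI[of _ m0] allI impI)
      fix m assume "m0 \<le> m"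
      have "(\<integral>\<omega>. h n (L m \<omega>) \<partial>P) \<le> (\<integral>\<omega>. h n (Y \<omega>) \<partial>P)"
        using excess[of "real n" m] by (simp add: h_def)
      then show "norm ((\<integral>\<omega>. indicator B \<omega> * L m \<omega> \<partial>P) - (\<integral>\<omega>. indicator B \<omega> * L' \<omega> \<partial>P)) < r"
        unfolding real_norm_def
        using bnd[OF L[of m], of n] bnd[OF int, of n] hL'[of n] n m0[OF \<open>m0 \<le> m\<close>] by linarith
    qed
  qed
qed

context usual_conditions
begin

lemma measurable_mono: "f \<in> borel_measurable (F s) \<Longrightarrow> s \<le> t \<Longrightarrow> f \<in> borel_measurable (F t)"
  using sets_F_mono[of s t] by (auto simp: measurable_def space_F)

lemma measurable_P: "f \<in> borel_measurable (F s) \<Longrightarrow> f \<in> borel_measurable P"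
  by (rule measurable_from_subalg[OF subalgebras])

lemma sets_mono: "B \<in> sets (F s) \<Longrightarrow> s \<le> t \<Longrightarrow> B \<in> sets (F t)"
  using sets_F_mono[of s t] by auto

lemma sets_P: "B \<in> sets (F s) \<Longrightarrow> B \<in> sets P"
  using subalgebras[of s] by (auto simp: subalgebra_def)

lemma adaptedD: "adapted F N \<Longrightarrow> 0 \<le> t \<Longrightarrow> N t \<in> borel_measurable (F (ennreal t))"
  by (simp add: adapted_def)

lemma adapted_measurable: "adapted F N \<Longrightarrow> 0 \<le> s \<Longrightarrow> s \<le> t \<Longrightarrow> N s \<in> borel_measurable (F (ennreal t))"
  by (rule measurable_mono[OF adaptedD]) (auto simp: ennreal_leI)

lemma adapted_measurable_P: "adapted F N \<Longrightarrow> 0 \<le> s \<Longrightarrow> N s \<in> borel_measurable P"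
  by (rule measurable_P[OF adaptedD])

lemma stopping_time_gt_sets: "stopping_time F T \<Longrightarrow> {\<omega> \<in> space P. s < T \<omega>} \<in> sets (F s)"
  using stopping_timeD2[of F T s] by (simp add: pred_def space_F)

lemma stopping_time_le_sets: "stopping_time F T \<Longrightarrow> {\<omega> \<in> space P. T \<omega> \<le> s} \<in> sets (F s)"
  using stopping_timeD[of F T s] by (simp add: pred_def space_F)

lemma sigma_finite_subalgebra_F: "sigma_finite_subalgebra P (F t)"
  by (rule finite_measure_subalgebra_is_sigma_finite)
     (simp add: finite_measure_subalgebra_def finite_measure_subalgebra_axioms_def subalgebras finite_measure_axioms)

text \<open>
  Integrals over events of the past are easier to pass to limits in than conditional expectations.
\<close>

lemma martingale_iff:
  "martingale P F N \<longleftrightarrow> adapted F N \<and> (\<forall>t\<ge>0. integrable P (N t)) \<and>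
     (\<forall>s t B. 0 \<le> s \<longrightarrow> s \<le> t \<longrightarrow> B \<in> sets (F (ennreal s)) \<longrightarrow>
        (\<integral>\<omega>. indicator B \<omega> * N t \<omega> \<partial>P) = (\<integral>\<omega>. indicator B \<omega> * N s \<omega> \<partial>P))"
proof (cases "adapted F N \<and> (\<forall>t\<ge>0. integrable P (N t))")
  case True
  have *: "(AE \<omega> in P. real_cond_exp P (F (ennreal s)) (N t) \<omega> = N s \<omega>) \<longleftrightarrow>
     (\<forall>B \<in> sets (F (ennreal s)). (\<integral>\<omega>. indicator B \<omega> * N t \<omega> \<partial>P) = (\<integral>\<omega>. indicator B \<omega> * N s \<omega> \<partial>P))"
    if st: "0 \<le> s" "s \<le> t" for s t
  proof
    interpret sigma_finite_subalgebra P "F (ennreal s)" by (rule sigma_finite_subalgebra_F)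
    have int: "integrable P (N t)" "integrable P (N s)" using True st by auto
    have [measurable]: "N s \<in> borel_measurable (F (ennreal s))" using True st by (auto simp: adapted_def)
    have [measurable]: "N s \<in> borel_measurable P" "N t \<in> borel_measurable P" using int by auto
    show "\<forall>B \<in> sets (F (ennreal s)). (\<integral>\<omega>. indicator B \<omega> * N t \<omega> \<partial>P) = (\<integral>\<omega>. indicator B \<omega> * N s \<omega> \<partial>P)"
      if ae: "AE \<omega> in P. real_cond_exp P (F (ennreal s)) (N t) \<omega> = N s \<omega>"
    proof
      fix B assume B: "B \<in> sets (F (ennreal s))"
      have [measurable]: "B \<in> sets P" using B by (rule sets_P)
      have "(\<integral>\<omega>. indicator B \<omega> * N t \<omega> \<partial>P) = (\<integral>\<omega>. indicator B \<omega> * real_cond_exp P (F (ennreal s)) (N t) \<omega> \<partial>P)"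
        using real_cond_exp_intA[OF int(1) B] by (simp add: set_lebesgue_integral_def)
      also have "\<dots> = (\<integral>\<omega>. indicator B \<omega> * N s \<omega> \<partial>P)"
        using ae by (intro integral_cong_AE) auto
      finally show "(\<integral>\<omega>. indicator B \<omega> * N t \<omega> \<partial>P) = (\<integral>\<omega>. indicator B \<omega> * N s \<omega> \<partial>P)" .
    qed
    show "AE \<omega> in P. real_cond_exp P (F (ennreal s)) (N t) \<omega> = N s \<omega>"
      if "\<forall>B \<in> sets (F (ennreal s)). (\<integral>\<omega>. indicator B \<omega> * N t \<omega> \<partial>P) = (\<integral>\<omega>. indicator B \<omega> * N s \<omega> \<partial>P)"
      using that int by (intro real_cond_exp_charact) (auto simp: set_lebesgue_integral_def)
  qed
  show ?thesis unfolding martingale_def using True by (simp only: * Ball_def cong: imp_cong) auto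
qed (auto simp: martingale_def)

lemma martingaleD:
  assumes "martingale P F N"
  shows "adapted F N" "\<And>t. 0 \<le> t \<Longrightarrow> integrable P (N t)"
    "\<And>s t B. 0 \<le> s \<Longrightarrow> s \<le> t \<Longrightarrow> B \<in> sets (F (ennreal s)) \<Longrightarrow>
      (\<integral>\<omega>. indicator B \<omega> * N t \<omega> \<partial>P) = (\<integral>\<omega>. indicator B \<omega> * N s \<omega> \<partial>P)"
  using assms unfolding martingale_iff by (iprover | blast)+

lemma integrable_indicator_mult:
  fixes f :: "'a \<Rightarrow> real"
  shows "B \<in> sets P \<Longrightarrow> integrable P f \<Longrightarrow> integrable P (\<lambda>\<omega>. indicator B \<omega> * f \<omega>)"
  using integrable_mult_indicator[of B P f] by simp

text \<open>
  Jensen's inequality for \<open>(|x| - K)\<^sup>+\<close>, by hand: where this function is positive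
  at time \<open>s\<close>, it is affine in \<open>N s\<close> on each of two events of the past,
  and there it is a lower bound at time \<open>t\<close> as well.
\<close>

lemma martingale_excess_mono:
  assumes N: "martingale P F N" and st: "0 \<le> s" "s \<le> t" and B: "B \<in> sets (F (ennreal s))" and K: "0 \<le> K"
  shows "(\<integral>\<omega>. indicator B \<omega> * max (\<bar>N s \<omega>\<bar> - K) 0 \<partial>P) \<le> (\<integral>\<omega>. indicator B \<omega> * max (\<bar>N t \<omega>\<bar> - K) 0 \<partial>P)"
proof -
  note N' = martingaleD[OF N]
  have [measurable]: "N s \<in> borel_measurable (F (ennreal s))" using adaptedD[OF N'(1)] st by auto
  have int: "integrable P (N t)" "integrable P (N s)" using N'(2) st by auto
  define B1 where "B1 = B \<inter> {\<omega> \<in> space P. K < N s \<omega>}"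
  define B2 where "B2 = B \<inter> {\<omega> \<in> space P. N s \<omega> < - K}"
  have "{\<omega> \<in> space (F (ennreal s)). K < N s \<omega>} \<in> sets (F (ennreal s))"
       "{\<omega> \<in> space (F (ennreal s)). N s \<omega> < - K} \<in> sets (F (ennreal s))" by measurable
  then have Bs: "B1 \<in> sets (F (ennreal s))" "B2 \<in> sets (F (ennreal s))"
    using B unfolding B1_def B2_def space_F by auto
  note BP = sets_P[OF Bs(1)] sets_P[OF Bs(2)] sets_P[OF B]
  have sub: "B \<subseteq> space P" using BP(3) sets.sets_into_space by auto
  have i1: "integrable P (\<lambda>\<omega>. indicator B1 \<omega> * f \<omega>)" "integrable P (\<lambda>\<omega>. indicator B2 \<omega> * f \<omega>)"
    if "integrable P f" for f :: "'a \<Rightarrow> real" using BP that by (auto intro: integrable_indicator_mult)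
  have ic: "integrable P (\<lambda>\<omega>. indicator B1 \<omega> * K)" "integrable P (\<lambda>\<omega>. indicator B2 \<omega> * K)"
    by (rule i1, simp)+
  have "(\<integral>\<omega>. indicator B \<omega> * max (\<bar>N s \<omega>\<bar> - K) 0 \<partial>P) =
    (\<integral>\<omega>. (indicator B1 \<omega> * N s \<omega> - indicator B1 \<omega> * K) - (indicator B2 \<omega> * N s \<omega> + indicator B2 \<omega> * K) \<partial>P)"
    using sub K by (intro Bochner_Integration.integral_cong refl) (auto simp: B1_def B2_def indicator_def)
  also have "\<dots> = (\<integral>\<omega>. (indicator B1 \<omega> * N t \<omega> - indicator B1 \<omega> * K) - (indicator B2 \<omega> * N t \<omega> + indicator B2 \<omega> * K) \<partial>P)"
    using i1[OF int(1)] i1[OF int(2)] ic N'(3)[OF st Bs(1)] N'(3)[OF st Bs(2)] by simp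
  also have "\<dots> \<le> (\<integral>\<omega>. indicator B \<omega> * max (\<bar>N t \<omega>\<bar> - K) 0 \<partial>P)"
  proof (rule integral_mono)
    show "integrable P (\<lambda>\<omega>. (indicator B1 \<omega> * N t \<omega> - indicator B1 \<omega> * K) - (indicator B2 \<omega> * N t \<omega> + indicator B2 \<omega> * K))"
      using i1[OF int(1)] ic by auto
    have "integrable P (\<lambda>\<omega>. max (\<bar>N t \<omega>\<bar> - K) 0)"
      using int by (intro Bochner_Integration.integrable_bound[OF int(1)]) (use K in auto)
    then show "integrable P (\<lambda>\<omega>. indicator B \<omega> * max (\<bar>N t \<omega>\<bar> - K) 0)"
      by (intro integrable_indicator_mult BP)
  qed (use K in \<open>auto simp: B1_def B2_def indicator_def\<close>)
  finally show ?thesis .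
qed

lemma stopped_adapted:
  assumes N: "adapted F N" and c: "\<And>\<omega>. continuous_on {0..} (\<lambda>t. N t \<omega>)" and T: "stopping_time F T"
  shows "adapted F (stopped T N)"
  unfolding adapted_def
proof (intro allI impI)
  fix t :: real assume t: "0 \<le> t"
  define u where "u m \<omega> = N 0 \<omega> + (\<Sum>i<m. of_bool (ennreal (grid 0 t m i) < T \<omega>) *
     (N (grid 0 t m (Suc i)) \<omega> - N (grid 0 t m i) \<omega>))" for m \<omega>
  show "stopped T N t \<in> borel_measurable (F (ennreal t))"
  proof (rule borel_measurable_LIMSEQ_real[where u=u])
    fix \<omega>
    have "(\<lambda>m. u m \<omega>) \<longlonglongrightarrow> N 0 \<omega> + (N (clamp 0 t (T \<omega>)) \<omega> - N 0 \<omega>)"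
      unfolding u_def by (intro tendsto_intros grid_telescope_tendsto[where z="\<lambda>r. N r \<omega>"] c t order_refl)
    then show "(\<lambda>m. u m \<omega>) \<longlonglongrightarrow> stopped T N t \<omega>" by (simp add: stopped_clamp)
  next
    fix m
    have [measurable]: "N (grid 0 t m i) \<in> borel_measurable (F (ennreal t))" if "i \<le> m" for i
      using adapted_measurable[OF N, of "grid 0 t m i" t] grid_bounds[OF t that] by auto
    have 0: "N 0 \<in> borel_measurable (F (ennreal t))" using adapted_measurable[OF N, of 0 t] t by auto
    have [measurable]: "Measurable.pred (F (ennreal t)) (\<lambda>\<omega>. ennreal (grid 0 t m i) < T \<omega>)" if "i \<le> m" for i
    proof -
      have "{\<omega> \<in> space P. ennreal (grid 0 t m i) < T \<omega>} \<in> sets (F (ennreal t))"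
        using grid_bounds[OF t that] by (intro sets_mono[OF stopping_time_gt_sets[OF T]] ennreal_leI) auto
      then show ?thesis by (simp add: pred_def space_F)
    qed
    show "u m \<in> borel_measurable (F (ennreal t))"
      unfolding u_def by (intro borel_measurable_add 0 borel_measurable_sum borel_measurable_times borel_measurable_diff) auto
  qed
qed

end

context usual_conditions
begin

text \<open>
  Stopping earlier decreases the excess. By induction along the grid, the excess on the event that
  \<open>T\<close> has already occurred is at most the excess of the unstopped martingale on the
  same event.
\<close>

lemma stopped_sum_excess:
  assumes N: "martingale P F N" and T: "stopping_time F T" and st: "0 \<le> s" "s \<le> t" and K: "0 \<le> K"
  defines "S \<equiv> \<lambda>m k \<omega>. N s \<omega> + (\<Sum>i<k. of_bool (ennreal (grid s t m i) < T \<omega>) * (N (grid s t m (Suc i)) \<omega> - N (grid s t m i) \<omega>))"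
  shows "integrable P (S m m)"
    and "(\<integral>\<omega>. max (\<bar>S m m \<omega>\<bar> - K) 0 \<partial>P) \<le> (\<integral>\<omega>. max (\<bar>N t \<omega>\<bar> - K) 0 \<partial>P)"
proof -
  note N' = martingaleD[OF N]
  define h where "h x = max (\<bar>x\<bar> - K) 0" for x :: real
  have h_int: "integrable P (\<lambda>\<omega>. h (f \<omega>))" if "integrable P f" for f
    using that unfolding h_def by (intro Bochner_Integration.integrable_bound[OF that]) (use K in auto)
  let ?s = "grid s t m"
  have sb: "0 \<le> ?s k" "?s k \<le> t" if "k \<le> m" for k
    using grid_bounds[OF st(2) that] st by auto
  have gt: "{\<omega> \<in> space P. ennreal (?s k) < T \<omega>} \<in> sets P" for k
    by (rule sets_P[OF stopping_time_gt_sets[OF T]])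
  have le: "{\<omega> \<in> space P. T \<omega> \<le> ennreal (?s k)} \<in> sets P" for k
    by (rule sets_P[OF stopping_time_le_sets[OF T]])
  have intS: "integrable P (S m k)" if "k \<le> m" for k
    unfolding S_def
  proof (intro Bochner_Integration.integrable_add Bochner_Integration.integrable_sum)
    fix i assume i: "i \<in> {..<k}"
    have d: "integrable P (\<lambda>\<omega>. N (?s (Suc i)) \<omega> - N (?s i) \<omega>)"
      using sb[of i] sb[of "Suc i"] i that by (intro Bochner_Integration.integrable_diff N'(2)) auto
    show "integrable P (\<lambda>\<omega>. of_bool (ennreal (?s i) < T \<omega>) * (N (?s (Suc i)) \<omega> - N (?s i) \<omega>))"
      using integrable_indicator_mult[OF gt[of i] d]
      by (rule Bochner_Integration.integrable_cong[THEN iffD1, rotated 2]) (auto simp: indicator_def)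
  qed (use N'(2) st in auto)
  then show "integrable P (S m m)" by simp
  have tel: "S m k \<omega> = N (?s k) \<omega>" if "\<forall>i<k. ennreal (?s i) < T \<omega>" for k \<omega>
  proof -
    have "S m k \<omega> = N s \<omega> + (\<Sum>i<k. N (?s (Suc i)) \<omega> - N (?s i) \<omega>)"
      using that unfolding S_def by (intro arg_cong2[where f="(+)"] sum.cong) auto
    then show ?thesis using sum_lessThan_telescope[of "\<lambda>i. N (?s i) \<omega>" k] by simp
  qed
  have less: "\<forall>i<Suc k. ennreal (?s i) < T \<omega>" if "ennreal (?s k) < T \<omega>" for k \<omega>
  proof (intro allI impI)
    fix i assume "i < Suc k"
    then have "ennreal (?s i) \<le> ennreal (?s k)" using st by (intro ennreal_leI grid_mono) auto
    then show "ennreal (?s i) < T \<omega>" using that by (rule le_less_trans)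
  qed
  \<comment> \<open>The event must be of the form \<open>T \<le> s\<^sub>k\<close>: for a general event of the past of \<open>s\<^sub>k\<close> the comparison fails, as that event may depend on what happens after \<open>T\<close>.\<close>
  have main: "(\<integral>\<omega>. indicator {\<omega> \<in> space P. T \<omega> \<le> ennreal (?s k)} \<omega> * h (S m k \<omega>) \<partial>P)
      \<le> (\<integral>\<omega>. indicator {\<omega> \<in> space P. T \<omega> \<le> ennreal (?s k)} \<omega> * h (N (?s k) \<omega>) \<partial>P)" if "k \<le> m" for k
    using that
  proof (induction k)
    case 0
    show ?case by (simp add: S_def)
  next
    case (Suc k)
    define D where "D = {\<omega> \<in> space P. T \<omega> \<le> ennreal (?s k)}"
    define E where "E = {\<omega> \<in> space P. ennreal (?s k) < T \<omega> \<and> T \<omega> \<le> ennreal (?s (Suc k))}"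
    have DF: "D \<in> sets (F (ennreal (?s k)))" unfolding D_def by (rule stopping_time_le_sets[OF T])
    have D: "D \<in> sets P" by (rule sets_P[OF DF])
    have "E = {\<omega> \<in> space P. ennreal (?s k) < T \<omega>} \<inter> {\<omega> \<in> space P. T \<omega> \<le> ennreal (?s (Suc k))}"
      by (auto simp: E_def)
    then have E: "E \<in> sets P" using gt[of k] le[of "Suc k"] by auto
    have mono: "ennreal (?s k) \<le> ennreal (?s (Suc k))" using st by (intro ennreal_leI grid_mono) auto
    have split: "indicator {\<omega> \<in> space P. T \<omega> \<le> ennreal (?s (Suc k))} \<omega> = (indicator D \<omega> + indicator E \<omega> :: real)" for \<omega>
      using mono by (auto simp: D_def E_def indicator_def not_less intro: order_trans)
    have Nint: "integrable P (N (?s k))" "integrable P (N (?s (Suc k)))"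
      using Suc.prems sb[of k] sb[of "Suc k"] by (auto intro: N'(2))
    note ints = integrable_indicator_mult[OF D h_int[OF intS[of k]]] integrable_indicator_mult[OF E h_int[OF Nint(2)]]
       integrable_indicator_mult[OF D h_int[OF Nint(2)]]
    have "(\<integral>\<omega>. indicator {\<omega> \<in> space P. T \<omega> \<le> ennreal (?s (Suc k))} \<omega> * h (S m (Suc k) \<omega>) \<partial>P)
      = (\<integral>\<omega>. indicator D \<omega> * h (S m k \<omega>) + indicator E \<omega> * h (N (?s (Suc k)) \<omega>) \<partial>P)"
    proof (intro Bochner_Integration.integral_cong refl)
      fix \<omega>
      have "S m (Suc k) \<omega> = S m k \<omega>" if "\<omega> \<in> D"
        using that by (simp add: D_def S_def not_less del: sum_of_bool_mult_eq sum_mult_of_bool_eq)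
      moreover have "S m (Suc k) \<omega> = N (?s (Suc k)) \<omega>" if "\<omega> \<in> E"
        using that less[of k \<omega>] by (intro tel) (auto simp: E_def)
      ultimately show "indicator {\<omega> \<in> space P. T \<omega> \<le> ennreal (?s (Suc k))} \<omega> * h (S m (Suc k) \<omega>)
         = indicator D \<omega> * h (S m k \<omega>) + indicator E \<omega> * h (N (?s (Suc k)) \<omega>)"
        unfolding split by (cases "\<omega> \<in> D"; cases "\<omega> \<in> E") (auto simp: D_def E_def)
    qed
    also have "\<dots> = (\<integral>\<omega>. indicator D \<omega> * h (S m k \<omega>) \<partial>P) + (\<integral>\<omega>. indicator E \<omega> * h (N (?s (Suc k)) \<omega>) \<partial>P)"
      using ints Suc.prems by (intro Bochner_Integration.integral_add) auto
    also have "(\<integral>\<omega>. indicator D \<omega> * h (S m k \<omega>) \<partial>P) \<le> (\<integral>\<omega>. indicator D \<omega> * h (N (?s k) \<omega>) \<partial>P)"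
      using Suc.IH Suc.prems unfolding D_def by simp
    also have "(\<integral>\<omega>. indicator D \<omega> * h (N (?s k) \<omega>) \<partial>P) \<le> (\<integral>\<omega>. indicator D \<omega> * h (N (?s (Suc k)) \<omega>) \<partial>P)"
      unfolding h_def using Suc.prems sb[of k] grid_mono[OF st(2), of k "Suc k" m] DF K
      by (intro martingale_excess_mono[OF N]) auto
    also have "(\<integral>\<omega>. indicator D \<omega> * h (N (?s (Suc k)) \<omega>) \<partial>P) + (\<integral>\<omega>. indicator E \<omega> * h (N (?s (Suc k)) \<omega>) \<partial>P)
       = (\<integral>\<omega>. indicator D \<omega> * h (N (?s (Suc k)) \<omega>) + indicator E \<omega> * h (N (?s (Suc k)) \<omega>) \<partial>P)"
      using ints by (intro Bochner_Integration.integral_add[symmetric]) auto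
    also have "\<dots> = (\<integral>\<omega>. indicator {\<omega> \<in> space P. T \<omega> \<le> ennreal (?s (Suc k))} \<omega> * h (N (?s (Suc k)) \<omega>) \<partial>P)"
      unfolding split by (simp add: distrib_right)
    finally show ?case by simp
  qed
  show "(\<integral>\<omega>. max (\<bar>S m m \<omega>\<bar> - K) 0 \<partial>P) \<le> (\<integral>\<omega>. max (\<bar>N t \<omega>\<bar> - K) 0 \<partial>P)"
  proof (cases "m = 0")
    case True
    have "(\<integral>\<omega>. indicator (space P) \<omega> * max (\<bar>N s \<omega>\<bar> - K) 0 \<partial>P) \<le> (\<integral>\<omega>. indicator (space P) \<omega> * max (\<bar>N t \<omega>\<bar> - K) 0 \<partial>P)"
      by (rule martingale_excess_mono[OF N st _ K]) (metis sets.top space_F)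
    moreover have "(\<integral>\<omega>. indicator (space P) \<omega> * f \<omega> \<partial>P) = (\<integral>\<omega>. f \<omega> \<partial>P)" for f :: "'a \<Rightarrow> real"
      by (intro Bochner_Integration.integral_cong) auto
    ultimately show ?thesis using True by (simp add: S_def)
  next
    case False
    then have [simp]: "?s m = t" by simp
    define D where "D = {\<omega> \<in> space P. T \<omega> \<le> ennreal t}"
    define E where "E = {\<omega> \<in> space P. ennreal t < T \<omega>}"
    have DE: "D \<in> sets P" "E \<in> sets P" using le[of m] gt[of m] by (auto simp: D_def E_def)
    have Nt: "integrable P (N t)" using N'(2) st by auto
    note ints = integrable_indicator_mult[OF DE(1) h_int[OF intS[OF order_refl]]]
      integrable_indicator_mult[OF DE(2) h_int[OF Nt]] integrable_indicator_mult[OF DE(1) h_int[OF Nt]]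
    have "(\<integral>\<omega>. h (S m m \<omega>) \<partial>P) = (\<integral>\<omega>. indicator D \<omega> * h (S m m \<omega>) + indicator E \<omega> * h (N t \<omega>) \<partial>P)"
    proof (intro Bochner_Integration.integral_cong refl)
      fix \<omega> assume "\<omega> \<in> space P"
      moreover have "S m m \<omega> = N t \<omega>" if "\<omega> \<in> E"
        using that less[of m \<omega>] tel[of m \<omega>] by (auto simp: E_def)
      ultimately show "h (S m m \<omega>) = indicator D \<omega> * h (S m m \<omega>) + indicator E \<omega> * h (N t \<omega>)"
        by (auto simp: D_def E_def indicator_def not_less)
    qed
    also have "\<dots> = (\<integral>\<omega>. indicator D \<omega> * h (S m m \<omega>) \<partial>P) + (\<integral>\<omega>. indicator E \<omega> * h (N t \<omega>) \<partial>P)"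
      using ints by (intro Bochner_Integration.integral_add) auto
    also have "(\<integral>\<omega>. indicator D \<omega> * h (S m m \<omega>) \<partial>P) \<le> (\<integral>\<omega>. indicator D \<omega> * h (N t \<omega>) \<partial>P)"
      using main[of m] by (simp add: D_def)
    also have "(\<integral>\<omega>. indicator D \<omega> * h (N t \<omega>) \<partial>P) + (\<integral>\<omega>. indicator E \<omega> * h (N t \<omega>) \<partial>P)
       = (\<integral>\<omega>. indicator D \<omega> * h (N t \<omega>) + indicator E \<omega> * h (N t \<omega>) \<partial>P)"
      using ints by (intro Bochner_Integration.integral_add[symmetric]) auto
    also have "\<dots> = (\<integral>\<omega>. h (N t \<omega>) \<partial>P)"
      by (intro Bochner_Integration.integral_cong refl) (auto simp: D_def E_def indicator_def not_less)
    finally show ?thesis by (simp add: h_def)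
  qed
qed

text \<open>
  For discretised stopping the identity is a sum of martingale increments over events of the past;
  \<open>convergence_of_dominated_excess\<close> carries it to the limit.
\<close>

lemma optional_stopping:
  assumes N: "martingale P F N" and c: "\<And>\<omega>. continuous_on {0..} (\<lambda>t. N t \<omega>)" and T: "stopping_time F T"
  shows "martingale P F (stopped T N)"
proof -
  note N' = martingaleD[OF N]
  define S where "S s t m \<omega> = N s \<omega> + (\<Sum>i<m. of_bool (ennreal (grid s t m i) < T \<omega>) * (N (grid s t m (Suc i)) \<omega> - N (grid s t m i) \<omega>))" for s t m \<omega>
  have lim: "(\<lambda>m. S s t m \<omega>) \<longlonglongrightarrow> N (clamp s t (T \<omega>)) \<omega>" if "0 \<le> s" "s \<le> t" for s t \<omega>
  proof -
    have "(\<lambda>m. S s t m \<omega>) \<longlonglongrightarrow> N s \<omega> + (N (clamp s t (T \<omega>)) \<omega> - N s \<omega>)"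
      unfolding S_def by (intro tendsto_intros grid_telescope_tendsto[where z="\<lambda>r. N r \<omega>"] c that)
    then show ?thesis by simp
  qed
  note exc = stopped_sum_excess[OF N T, folded S_def]
  have conv: "integrable P (\<lambda>\<omega>. N (clamp s t (T \<omega>)) \<omega>)"
    "(\<lambda>m. \<integral>\<omega>. indicator B \<omega> * S s t m \<omega> \<partial>P) \<longlonglongrightarrow> (\<integral>\<omega>. indicator B \<omega> * N (clamp s t (T \<omega>)) \<omega> \<partial>P)"
    if st: "0 \<le> s" "s \<le> t" and B: "B \<in> sets P" for s t B
  proof -
    have "0 \<le> t" using st by simp
    note * = convergence_of_dominated_excess[where L="S s t" and Y="N t" and L'="\<lambda>\<omega>. N (clamp s t (T \<omega>)) \<omega>",
      OF finite_measure_axioms exc(1)[OF st order_refl] N'(2)[OF \<open>0 \<le> t\<close>] lim[OF st] exc(2)[OF st] B]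
    show "integrable P (\<lambda>\<omega>. N (clamp s t (T \<omega>)) \<omega>)"
      "(\<lambda>m. \<integral>\<omega>. indicator B \<omega> * S s t m \<omega> \<partial>P) \<longlonglongrightarrow> (\<integral>\<omega>. indicator B \<omega> * N (clamp s t (T \<omega>)) \<omega> \<partial>P)"
      by (rule *, assumption)+
  qed
  have int: "integrable P (stopped T N t)" if "0 \<le> t" for t
    using conv(1)[of 0 t "{}"] that by (simp add: stopped_clamp[abs_def])
  have inc: "(\<integral>\<omega>. indicator B \<omega> * stopped T N t \<omega> \<partial>P) = (\<integral>\<omega>. indicator B \<omega> * stopped T N s \<omega> \<partial>P)"
    if st: "0 \<le> s" "s \<le> t" and B: "B \<in> sets (F (ennreal s))" for s t B
  proof -
    \<comment> \<open>On the complement of \<open>B'\<close> the stopped path is already constant after \<open>s\<close>, so only \<open>B'\<close> matters.\<close>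
    define B' where "B' = B \<inter> {\<omega> \<in> space P. ennreal s < T \<omega>}"
    have B'F: "B' \<in> sets (F (ennreal s))" unfolding B'_def using B stopping_time_gt_sets[OF T, of "ennreal s"] by auto
    have B': "B' \<in> sets P" by (rule sets_P[OF B'F])
    have BP: "B \<in> sets P" by (rule sets_P[OF B])
    have Ns: "integrable P (N s)" using N'(2) st by auto
    have "(\<integral>\<omega>. indicator B' \<omega> * S s t m \<omega> \<partial>P) = (\<integral>\<omega>. indicator B' \<omega> * N s \<omega> \<partial>P)" for m
    proof -
      have z: "integrable P (\<lambda>\<omega>. indicator B' \<omega> * (of_bool (ennreal (grid s t m i) < T \<omega>) * (N (grid s t m (Suc i)) \<omega> - N (grid s t m i) \<omega>))) \<and>
         (\<integral>\<omega>. indicator B' \<omega> * (of_bool (ennreal (grid s t m i) < T \<omega>) * (N (grid s t m (Suc i)) \<omega> - N (grid s t m i) \<omega>)) \<partial>P) = 0"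
        (is "integrable P ?f \<and> _") if i: "i < m" for i
      proof -
        let ?a = "grid s t m i" and ?b = "grid s t m (Suc i)"
        have ab: "0 \<le> ?a" "s \<le> ?a" "?a \<le> ?b" "0 \<le> ?b"
          using grid_bounds[OF st(2), of i m] grid_bounds[OF st(2), of "Suc i" m] grid_mono[OF st(2), of i "Suc i" m] st i by auto
        define C where "C = B' \<inter> {\<omega> \<in> space P. ennreal ?a < T \<omega>}"
        have "B' \<in> sets (F (ennreal ?a))" using ab by (intro sets_mono[OF B'F] ennreal_leI)
        then have CF: "C \<in> sets (F (ennreal ?a))" unfolding C_def using stopping_time_gt_sets[OF T, of "ennreal ?a"] by auto
        have C: "C \<in> sets P" by (rule sets_P[OF CF])
        have ii: "integrable P (\<lambda>\<omega>. indicator C \<omega> * N ?a \<omega>)" "integrable P (\<lambda>\<omega>. indicator C \<omega> * N ?b \<omega>)"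
          using ab by (auto intro!: integrable_indicator_mult C N'(2))
        have eq: "?f \<omega> = indicator C \<omega> * N ?b \<omega> - indicator C \<omega> * N ?a \<omega>" for \<omega>
          using sets.sets_into_space[OF B'] by (auto simp: C_def indicator_def)
        show ?thesis unfolding eq using ii N'(3)[OF ab(1,3) CF] by simp
      qed
      have "(\<integral>\<omega>. indicator B' \<omega> * S s t m \<omega> \<partial>P) = (\<integral>\<omega>. indicator B' \<omega> * N s \<omega> +
          (\<Sum>i<m. indicator B' \<omega> * (of_bool (ennreal (grid s t m i) < T \<omega>) * (N (grid s t m (Suc i)) \<omega> - N (grid s t m i) \<omega>))) \<partial>P)"
        unfolding S_def distrib_left sum_distrib_left by (rule refl)
      also have "\<dots> = (\<integral>\<omega>. indicator B' \<omega> * N s \<omega> \<partial>P) + (\<integral>\<omega>. (\<Sum>i<m. indicator B' \<omega> * (of_bool (ennreal (grid s t m i) < T \<omega>) * (N (grid s t m (Suc i)) \<omega> - N (grid s t m i) \<omega>))) \<partial>P)"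
        using z by (intro Bochner_Integration.integral_add integrable_indicator_mult[OF B' Ns] Bochner_Integration.integrable_sum) auto
      also have "\<dots> = (\<integral>\<omega>. indicator B' \<omega> * N s \<omega> \<partial>P)"
        using z by (subst Bochner_Integration.integral_sum) auto
      finally show ?thesis .
    qed
    then have "(\<lambda>m. \<integral>\<omega>. indicator B' \<omega> * N s \<omega> \<partial>P) \<longlonglongrightarrow> (\<integral>\<omega>. indicator B' \<omega> * N (clamp s t (T \<omega>)) \<omega> \<partial>P)"
      using conv(2)[OF st B'] by simp
    then have key: "(\<integral>\<omega>. indicator B' \<omega> * N (clamp s t (T \<omega>)) \<omega> \<partial>P) = (\<integral>\<omega>. indicator B' \<omega> * N s \<omega> \<partial>P)"
      using LIMSEQ_unique tendsto_const by blast
    have "0 \<le> t" using st by simp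
    have "(\<integral>\<omega>. indicator B \<omega> * stopped T N t \<omega> \<partial>P) - (\<integral>\<omega>. indicator B \<omega> * stopped T N s \<omega> \<partial>P)
      = (\<integral>\<omega>. indicator B \<omega> * stopped T N t \<omega> - indicator B \<omega> * stopped T N s \<omega> \<partial>P)"
      using integrable_indicator_mult[OF BP int[OF \<open>0 \<le> t\<close>]] integrable_indicator_mult[OF BP int[OF st(1)]]
      by simp
    also have "\<dots> = (\<integral>\<omega>. indicator B' \<omega> * N (clamp s t (T \<omega>)) \<omega> - indicator B' \<omega> * N s \<omega> \<partial>P)"
    proof (intro Bochner_Integration.integral_cong refl)
      fix \<omega> assume "\<omega> \<in> space P"
      show "indicator B \<omega> * stopped T N t \<omega> - indicator B \<omega> * stopped T N s \<omega> =
        indicator B' \<omega> * N (clamp s t (T \<omega>)) \<omega> - indicator B' \<omega> * N s \<omega>"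
      proof (cases "ennreal s < T \<omega>")
        case True
        then have "clamp s t (T \<omega>) = clamp 0 t (T \<omega>)" "clamp 0 s (T \<omega>) = s"
          using st by (auto intro: clamp_base clamp_gt)
        then show ?thesis using \<open>\<omega> \<in> space P\<close> True
          by (simp add: B'_def indicator_def stopped_clamp)
      next
        case False
        then have "clamp 0 t (T \<omega>) = clamp 0 s (T \<omega>)" using st by (intro clamp_le) auto
        then show ?thesis using False by (simp add: B'_def stopped_clamp)
      qed
    qed
    also have "\<dots> = 0" using key conv(1)[OF st B'] Ns B' by (simp add: integrable_indicator_mult)
    finally show ?thesis by simp
  qed
  show ?thesis unfolding martingale_iff
    using stopped_adapted[OF N'(1) c T] int inc by blast
qed

lemma stopped_stopped: "stopped T (stopped S N) = stopped (\<lambda>\<omega>. min (T \<omega>) (S \<omega>)) N"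
proof (intro ext)
  fix t \<omega>
  have "ennreal (enn2real (min (ennreal t) (T \<omega>))) = min (ennreal t) (T \<omega>)"
    by (rule ennreal_enn2real) (simp add: min_less_iff_disj)
  then show "stopped T (stopped S N) t \<omega> = stopped (\<lambda>\<omega>. min (T \<omega>) (S \<omega>)) N t \<omega>"
    by (simp add: stopped_def min.assoc)
qed

lemma stopped_continuous:
  assumes c: "continuous_on {0..} (\<lambda>t. N t \<omega>)"
  shows "continuous_on {0..} (\<lambda>t. stopped T N t \<omega>)"
proof -
  have "continuous_on {0..} (\<lambda>t. clamp 0 t (T \<omega>))"
  proof (cases "T \<omega>")
    case (real r)
    then have "clamp 0 t (T \<omega>) = min t r" if "0 \<le> t" for t
      using that by (auto simp: clamp_def min_def ennreal_le_iff2)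
    moreover have "continuous_on {0..} (\<lambda>t. min t r)" by (intro continuous_intros)
    ultimately show ?thesis by (simp cong: continuous_on_cong_simp)
  next
    case top
    then have "clamp 0 t (T \<omega>) = t" if "0 \<le> t" for t
      using that by (auto simp: clamp_def)
    then show ?thesis by (simp cong: continuous_on_cong_simp)
  qed
  moreover have "(\<lambda>t. clamp 0 t (T \<omega>)) ` {0..} \<subseteq> {0..}" by (auto simp: clamp_def)
  ultimately show ?thesis unfolding stopped_clamp by (rule continuous_on_compose2[OF c])
qed

end

section \<open>Hitting times and running maxima\<close>

definition hit :: "(real \<Rightarrow> 'a \<Rightarrow> real) \<Rightarrow> real \<Rightarrow> 'a \<Rightarrow> ennreal" where
  "hit G l \<omega> = Inf {ennreal t | t. 0 \<le> t \<and> l \<le> G t \<omega>}"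

lemma continuous_on_near:
  fixes z :: "real \<Rightarrow> real"
  assumes "continuous_on {0..} z" "0 \<le> t" "0 < e"
  obtains d where "0 < d" "\<And>r. 0 \<le> r \<Longrightarrow> \<bar>r - t\<bar> < d \<Longrightarrow> \<bar>z r - z t\<bar> < e"
  using assms unfolding continuous_on_iff dist_real_def by (metis atLeast_iff)

text \<open>Continuity makes the infimum in the definition attained.\<close>

lemma hit_le_iff:
  assumes c: "continuous_on {0..} (\<lambda>t. G t \<omega>)" and m: "mono_on {0..} (\<lambda>t. G t \<omega>)" and t: "0 \<le> t"
  shows "hit G l \<omega> \<le> ennreal t \<longleftrightarrow> l \<le> G t \<omega>"
proof
  assume "l \<le> G t \<omega>" then show "hit G l \<omega> \<le> ennreal t"
    unfolding hit_def using t by (intro Inf_lower) auto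
next
  assume le: "hit G l \<omega> \<le> ennreal t"
  show "l \<le> G t \<omega>"
  proof (rule ccontr)
    assume "\<not> l \<le> G t \<omega>"
    then obtain d where d: "0 < d" "\<And>r. 0 \<le> r \<Longrightarrow> \<bar>r - t\<bar> < d \<Longrightarrow> \<bar>G r \<omega> - G t \<omega>\<bar> < l - G t \<omega>"
      using continuous_on_near[OF c t, of "l - G t \<omega>"] by auto
    have "ennreal (t + d) \<le> hit G l \<omega>"
      unfolding hit_def
    proof (intro Inf_greatest)
      fix x assume "x \<in> {ennreal t |t. 0 \<le> t \<and> l \<le> G t \<omega>}"
      then obtain r where r: "x = ennreal r" "0 \<le> r" "l \<le> G r \<omega>" by auto
      have "t + d \<le> r"
      proof (rule ccontr)
        assume "\<not> t + d \<le> r"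
        moreover have "G r \<omega> \<le> G t \<omega>" if "r \<le> t" using mono_onD[OF m, of r t] r t that by auto
        ultimately show False using d(2)[of r] r \<open>\<not> l \<le> G t \<omega>\<close> by (cases "r \<le> t") (auto simp: abs_if split: if_splits)
      qed
      then show "ennreal (t + d) \<le> x" using r by (simp add: ennreal_leI)
    qed
    then have "ennreal (t + d) \<le> ennreal t" using le by (rule order_trans)
    then show False using d t by (simp add: ennreal_le_iff)
  qed
qed

lemma below_hit:
  assumes c: "continuous_on {0..} (\<lambda>t. G t \<omega>)" and m: "mono_on {0..} (\<lambda>t. G t \<omega>)" and t: "0 \<le> t"
    and le: "ennreal t \<le> hit G l \<omega>" and 0: "G 0 \<omega> \<le> l"
  shows "G t \<omega> \<le> l"
proof (rule ccontr)
  assume "\<not> G t \<omega> \<le> l"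
  then obtain d where d: "0 < d" "\<And>r. 0 \<le> r \<Longrightarrow> \<bar>r - t\<bar> < d \<Longrightarrow> \<bar>G r \<omega> - G t \<omega>\<bar> < G t \<omega> - l"
    using continuous_on_near[OF c t, of "G t \<omega> - l"] by auto
  have "0 < t" using \<open>\<not> G t \<omega> \<le> l\<close> 0 t by (cases "t = 0") auto
  define r where "r = max 0 (t - d / 2)"
  have r: "0 \<le> r" "r < t" "\<bar>r - t\<bar> < d" using d(1) \<open>0 < t\<close> by (auto simp: r_def)
  then have "l \<le> G r \<omega>" using d(2)[of r] by linarith
  then have "hit G l \<omega> \<le> ennreal r" using hit_le_iff[of G _, OF c m r(1)] by simp
  then have "ennreal t \<le> ennreal r" using le by (rule order_trans[rotated])
  then show False using r by (simp add: ennreal_le_iff)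
qed

lemma running_max_attained:
  assumes c: "continuous_on {0..} (\<lambda>t. Z t \<omega>)" and t: "0 \<le> t"
  shows "\<exists>s\<ge>0. s \<le> t \<and> running_max Z t \<omega> = Z s \<omega> \<and> (\<forall>r. 0 \<le> r \<longrightarrow> r \<le> t \<longrightarrow> Z r \<omega> \<le> Z s \<omega>)"
proof -
  have "continuous_on {0..t} (\<lambda>t. Z t \<omega>)" by (rule continuous_on_subset[OF c]) auto
  then obtain s where s: "s \<in> {0..t}" "\<And>r. r \<in> {0..t} \<Longrightarrow> Z r \<omega> \<le> Z s \<omega>"
    using continuous_attains_sup[of "{0..t}" "\<lambda>t. Z t \<omega>"] t by auto
  then have "running_max Z t \<omega> = Z s \<omega>"
    unfolding running_max_def by (intro cSup_eq_maximum) auto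
  then show ?thesis using s by (intro exI[of _ s]) auto
qed

lemma running_max_upper:
  assumes c: "continuous_on {0..} (\<lambda>t. Z t \<omega>)" and "0 \<le> s" "s \<le> t"
  shows "Z s \<omega> \<le> running_max Z t \<omega>"
proof -
  have "0 \<le> t" using assms by simp
  from running_max_attained[of Z \<omega> t, OF c this] obtain u where "running_max Z t \<omega> = Z u \<omega>" "\<And>r. 0 \<le> r \<Longrightarrow> r \<le> t \<Longrightarrow> Z r \<omega> \<le> Z u \<omega>"
    by blast
  then show ?thesis using assms by simp
qed

lemma running_max_mono:
  assumes c: "continuous_on {0..} (\<lambda>t. Z t \<omega>)"
  shows "mono_on {0..} (\<lambda>t. running_max Z t \<omega>)"
proof (rule mono_onI)
  fix r s :: real assume rs: "r \<in> {0..}" "s \<in> {0..}" "r \<le> s"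
  then have r0: "0 \<le> r" by simp
  obtain u where "0 \<le> u" "u \<le> r" "running_max Z r \<omega> = Z u \<omega>"
    using running_max_attained[of Z \<omega> r, OF c r0] by blast
  then show "running_max Z r \<omega> \<le> running_max Z s \<omega>"
    using running_max_upper[of Z _, OF c, of u s] rs by simp
qed

lemma running_max_0: "running_max Z 0 \<omega> = Z 0 \<omega>"
  by (simp add: running_max_def)

text \<open>
  Over a short interval the running maximum cannot grow by more than the path oscillates.
\<close>

lemma running_max_continuous:
  assumes c: "continuous_on {0..} (\<lambda>t. Z t \<omega>)"
  shows "continuous_on {0..} (\<lambda>t. running_max Z t \<omega>)"
  unfolding continuous_on_iff
proof (intro ballI allI impI)
  fix t e :: real assume t: "t \<in> {0..}" and e: "0 < e"
  let ?R = "\<lambda>t. running_max Z t \<omega>"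
  have "continuous_on {0..t+1} (\<lambda>t. Z t \<omega>)" by (rule continuous_on_subset[OF c]) auto
  then have "uniformly_continuous_on {0..t+1} (\<lambda>t. Z t \<omega>)"
    by (rule compact_uniformly_continuous) auto
  then obtain d where d: "0 < d" "\<And>r s. r \<in> {0..t+1} \<Longrightarrow> s \<in> {0..t+1} \<Longrightarrow> \<bar>s - r\<bar> < d \<Longrightarrow> \<bar>Z s \<omega> - Z r \<omega>\<bar> < e"
    using e unfolding uniformly_continuous_on_def dist_real_def by metis
  have key: "?R a \<le> ?R b \<and> ?R b < ?R a + e" if ab: "0 \<le> a" "a \<le> b" "b \<le> t + 1" "b - a < d" for a b
  proof
    show "?R a \<le> ?R b" using mono_onD[OF running_max_mono[of Z \<omega>, OF c]] ab by auto
    have b0: "0 \<le> b" using ab by simp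
    obtain u where u: "0 \<le> u" "u \<le> b" "?R b = Z u \<omega>"
      using running_max_attained[of Z \<omega> b, OF c b0] by blast
    show "?R b < ?R a + e"
    proof (cases "u \<le> a")
      case True then show ?thesis using running_max_upper[of Z _, OF c, of u a] u e by linarith
    next
      case False
      then have "\<bar>Z u \<omega> - Z a \<omega>\<bar> < e" using ab u by (intro d(2)) auto
      moreover have "Z a \<omega> \<le> ?R a" using running_max_upper[of Z _, OF c, of a a] ab by simp
      ultimately show ?thesis using u by linarith
    qed
  qed
  show "\<exists>d>0. \<forall>x'\<in>{0..}. dist x' t < d \<longrightarrow> dist (?R x') (?R t) < e"
  proof (intro exI[of _ "min d 1"] conjI ballI impI)
    fix r :: real assume r: "r \<in> {0..}" "dist r t < min d 1"
    show "dist (?R r) (?R t) < e"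
      using key[of r t] key[of t r] r t by (cases "r \<le> t") (auto simp: dist_real_def)
  qed (use d in auto)
qed

context usual_conditions
begin

text \<open>
  By continuity the supremum over \<open>[0, t]\<close> exceeds a level only if some rational time
  or \<open>t\<close> itself does.
\<close>

lemma running_max_adapted:
  assumes c: "\<And>\<omega>. continuous_on {0..} (\<lambda>t. Z t \<omega>)" and Z: "adapted F Z"
  shows "adapted F (running_max Z)"
  unfolding adapted_def
proof (intro allI impI borel_measurableI_greater)
  fix t y :: real assume t: "0 \<le> t"
  define D where "D = {q \<in> \<rat>. 0 \<le> q \<and> q \<le> t} \<union> {t}"
  have cD: "countable D" unfolding D_def by (rule countable_subset[of _ "\<rat> \<union> {t}"]) (auto intro: countable_rat)
  have "(\<exists>q\<in>D. y < Z q \<omega>)" if "y < running_max Z t \<omega>" for \<omega>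
  proof -
    obtain s where s: "0 \<le> s" "s \<le> t" "running_max Z t \<omega> = Z s \<omega>"
      using running_max_attained[of Z \<omega> t, OF c t] by blast
    have pos: "0 < Z s \<omega> - y" using that s by simp
    obtain d where d: "0 < d" "\<And>r. 0 \<le> r \<Longrightarrow> \<bar>r - s\<bar> < d \<Longrightarrow> \<bar>Z r \<omega> - Z s \<omega>\<bar> < Z s \<omega> - y"
      using continuous_on_near[OF c[of \<omega>] s(1) pos] by blast
    show ?thesis
    proof (cases "t = 0")
      case True then show ?thesis using s that by (intro bexI[of _ t]) (auto simp: D_def)
    next
      case False
      then have "max 0 (s - d) < min t (s + d)" using s d t by auto
      then obtain q where q: "q \<in> \<rat>" "max 0 (s - d) < q" "q < min t (s + d)"
        using Rats_dense_in_real by blast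
      then have "\<bar>Z q \<omega> - Z s \<omega>\<bar> < Z s \<omega> - y" by (intro d(2)) auto
      then have "y < Z q \<omega>" by linarith
      then show ?thesis using q by (intro bexI[of _ q]) (auto simp: D_def)
    qed
  qed
  moreover have "Z q \<omega> \<le> running_max Z t \<omega>" if "q \<in> D" for q \<omega>
    using running_max_upper[of Z _, OF c, of q t] that t by (auto simp: D_def)
  ultimately have "{\<omega> \<in> space (F (ennreal t)). y < running_max Z t \<omega>} = (\<Union>q\<in>D. {\<omega> \<in> space (F (ennreal t)). y < Z q \<omega>})"
    by (auto intro: less_le_trans)
  also have "\<dots> \<in> sets (F (ennreal t))"
  proof (intro sets.countable_UN'' cD)
    fix q assume "q \<in> D"
    then have [measurable]: "Z q \<in> borel_measurable (F (ennreal t))"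
      using adapted_measurable[OF Z, of q t] t by (auto simp: D_def)
    show "{\<omega> \<in> space (F (ennreal t)). y < Z q \<omega>} \<in> sets (F (ennreal t))" by measurable
  qed
  finally show "{\<omega> \<in> space (F (ennreal t)). y < running_max Z t \<omega>} \<in> sets (F (ennreal t))" .
qed

lemma stopping_time_hit:
  assumes c: "\<And>\<omega>. continuous_on {0..} (\<lambda>t. G t \<omega>)" and m: "\<And>\<omega>. mono_on {0..} (\<lambda>t. G t \<omega>)"
    and G: "adapted F G"
  shows "stopping_time F (hit G l)"
  unfolding stopping_time_def
proof
  fix t :: ennreal
  show "Measurable.pred (F t) (\<lambda>\<omega>. hit G l \<omega> \<le> t)"
  proof (cases t)
    case (real r)
    have [measurable]: "G r \<in> borel_measurable (F (ennreal r))" by (rule adaptedD[OF G real(1)])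
    have "hit G l \<omega> \<le> t \<longleftrightarrow> l \<le> G r \<omega>" for \<omega> unfolding real(2) by (rule hit_le_iff[of G _, OF c m real(1)])
    then show ?thesis unfolding real(2) by simp
  qed simp
qed

section \<open>Increments of martingales and local martingales\<close>

lemma adapted_linear:
  assumes "adapted F N" "adapted F N'"
  shows "adapted F (\<lambda>t \<omega>. a * N t \<omega> + b * N' t \<omega>)"
  unfolding adapted_def
proof (intro allI impI)
  fix t :: real assume "0 \<le> t"
  then have [measurable]: "N t \<in> borel_measurable (F (ennreal t))" "N' t \<in> borel_measurable (F (ennreal t))"
    using assms by (auto simp: adapted_def)
  show "(\<lambda>\<omega>. a * N t \<omega> + b * N' t \<omega>) \<in> borel_measurable (F (ennreal t))" by measurable
qed

lemma martingale_linear: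
  assumes N: "martingale P F N" "martingale P F N'"
  shows "martingale P F (\<lambda>t \<omega>. a * N t \<omega> + b * N' t \<omega>)"
  unfolding martingale_iff
proof (intro conjI allI impI)
  note D = martingaleD[OF N(1)] and D' = martingaleD[OF N(2)]
  show "adapted F (\<lambda>t \<omega>. a * N t \<omega> + b * N' t \<omega>)"
    using D(1) D'(1) by (rule adapted_linear)
  show "integrable P (\<lambda>\<omega>. a * N t \<omega> + b * N' t \<omega>)" if "0 \<le> t" for t
    using D(2) D'(2) that by auto
  fix s t :: real and B assume st: "0 \<le> s" "s \<le> t" and B: "B \<in> sets (F (ennreal s))"
  have "(\<integral>\<omega>. indicator B \<omega> * (a * N r \<omega> + b * N' r \<omega>) \<partial>P) =
      a * (\<integral>\<omega>. indicator B \<omega> * N r \<omega> \<partial>P) + b * (\<integral>\<omega>. indicator B \<omega> * N' r \<omega> \<partial>P)" if "0 \<le> r" for r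
  proof -
    have "(\<integral>\<omega>. indicator B \<omega> * (a * N r \<omega> + b * N' r \<omega>) \<partial>P) =
      (\<integral>\<omega>. a * (indicator B \<omega> * N r \<omega>) + b * (indicator B \<omega> * N' r \<omega>) \<partial>P)"
      by (intro Bochner_Integration.integral_cong) (auto simp: algebra_simps)
    also have "\<dots> = a * (\<integral>\<omega>. indicator B \<omega> * N r \<omega> \<partial>P) + b * (\<integral>\<omega>. indicator B \<omega> * N' r \<omega> \<partial>P)"
      using integrable_indicator_mult[OF sets_P[OF B] D(2)[OF that]]
        integrable_indicator_mult[OF sets_P[OF B] D'(2)[OF that]] by simp
    finally show ?thesis .
  qed
  then show "(\<integral>\<omega>. indicator B \<omega> * (a * N t \<omega> + b * N' t \<omega>) \<partial>P) = (\<integral>\<omega>. indicator B \<omega> * (a * N s \<omega> + b * N' s \<omega>) \<partial>P)"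
    using D(3)[OF st B] D'(3)[OF st B] st by simp
qed

lemma martingale_increment:
  assumes N: "martingale P F N" and st: "0 \<le> s" "s \<le> t" and h: "h \<in> borel_measurable (F (ennreal s))"
    and C: "\<And>\<omega>. \<bar>h \<omega>\<bar> \<le> C"
  shows "integrable P (\<lambda>\<omega>. h \<omega> * (N t \<omega> - N s \<omega>))" "(\<integral>\<omega>. h \<omega> * (N t \<omega> - N s \<omega>) \<partial>P) = 0"
proof -
  interpret sigma_finite_subalgebra P "F (ennreal s)" by (rule sigma_finite_subalgebra_F)
  note D = martingaleD[OF N]
  have [measurable]: "h \<in> borel_measurable P" by (rule measurable_P[OF h])
  have [measurable]: "h \<in> borel_measurable (F (ennreal s))" by (rule h)
  have i: "integrable P (N t)" "integrable P (N s)" using D(2) st by auto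
  have [measurable]: "N t \<in> borel_measurable P" "N s \<in> borel_measurable P" using i by auto
  have hi: "integrable P (\<lambda>\<omega>. h \<omega> * f \<omega>)" if f: "integrable P f" for f
  proof (rule Bochner_Integration.integrable_bound[OF integrable_mult_right[OF f, of C]])
    have [measurable]: "f \<in> borel_measurable P" using f by simp
    show "(\<lambda>\<omega>. h \<omega> * f \<omega>) \<in> borel_measurable P" by measurable
    show "AE \<omega> in P. norm (h \<omega> * f \<omega>) \<le> norm (C * f \<omega>)"
      using C by (intro AE_I2) (auto simp: abs_mult intro!: mult_right_mono order_trans[OF C])
  qed
  have "AE \<omega> in P. real_cond_exp P (F (ennreal s)) (N t) \<omega> = N s \<omega>"
    using N st unfolding martingale_def by auto
  then have "(\<integral>\<omega>. h \<omega> * N s \<omega> \<partial>P) = (\<integral>\<omega>. h \<omega> * real_cond_exp P (F (ennreal s)) (N t) \<omega> \<partial>P)"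
    by (intro integral_cong_AE) auto
  also have "\<dots> = (\<integral>\<omega>. h \<omega> * N t \<omega> \<partial>P)"
    by (intro real_cond_exp_intg(2) hi i) auto
  finally have "(\<integral>\<omega>. h \<omega> * N t \<omega> \<partial>P) = (\<integral>\<omega>. h \<omega> * N s \<omega> \<partial>P)" by simp
  then show "integrable P (\<lambda>\<omega>. h \<omega> * (N t \<omega> - N s \<omega>))" "(\<integral>\<omega>. h \<omega> * (N t \<omega> - N s \<omega>) \<partial>P) = 0"
    using hi[OF i(1)] hi[OF i(2)] by (auto simp: right_diff_distrib)
qed

text \<open>
  Unlike in \<^const>\<open>continuous_local_martingale\<close>, all paths are continuous, and no
  initial value is subtracted because the processes considered start at \<open>0\<close>.
\<close>

definition local_martingale :: "(real \<Rightarrow> 'a \<Rightarrow> real) \<Rightarrow> bool" where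
  "local_martingale N \<longleftrightarrow> adapted F N \<and> (\<forall>\<omega>. continuous_on {0..} (\<lambda>t. N t \<omega>)) \<and>
    (\<exists>T :: nat \<Rightarrow> 'a \<Rightarrow> ennreal. (\<forall>n. stopping_time F (T n)) \<and>
      (AE \<omega> in P. \<forall>t. \<forall>\<^sub>F n in sequentially. ennreal t < T n \<omega>) \<and>
      (\<forall>n. martingale P F (stopped (T n) N)))"

text \<open>
  The minimum of two localising sequences localises both processes, by optional stopping.
\<close>

lemma local_martingale_linear:
  assumes "local_martingale N" "local_martingale N'"
  shows "local_martingale (\<lambda>t \<omega>. a * N t \<omega> + b * N' t \<omega>)"
proof -
  obtain T where T: "\<And>n :: nat. stopping_time F (T n)" "AE \<omega> in P. \<forall>t. \<forall>\<^sub>F n in sequentially. ennreal t < T n \<omega>"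
      "\<And>n. martingale P F (stopped (T n) N)"
    and N: "adapted F N" "\<And>\<omega>. continuous_on {0..} (\<lambda>t. N t \<omega>)"
    using assms(1) unfolding local_martingale_def by blast
  obtain T' where T': "\<And>n :: nat. stopping_time F (T' n)" "AE \<omega> in P. \<forall>t. \<forall>\<^sub>F n in sequentially. ennreal t < T' n \<omega>"
      "\<And>n. martingale P F (stopped (T' n) N')"
    and N': "adapted F N'" "\<And>\<omega>. continuous_on {0..} (\<lambda>t. N' t \<omega>)"
    using assms(2) unfolding local_martingale_def by blast
  show ?thesis unfolding local_martingale_def
  proof (intro conjI exI[of _ "\<lambda>n \<omega>. min (T n \<omega>) (T' n \<omega>)"] allI)
    show "adapted F (\<lambda>t \<omega>. a * N t \<omega> + b * N' t \<omega>)" using N(1) N'(1) by (rule adapted_linear)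
    show "continuous_on {0..} (\<lambda>t. a * N t \<omega> + b * N' t \<omega>)" for \<omega>
      using N(2)[of \<omega>] N'(2)[of \<omega>] by (intro continuous_intros)
    show "stopping_time F (\<lambda>\<omega>. min (T n \<omega>) (T' n \<omega>))" for n by (intro stopping_time_min T T')
    show "AE \<omega> in P. \<forall>t. \<forall>\<^sub>F n in sequentially. ennreal t < min (T n \<omega>) (T' n \<omega>)"
      using T(2) T'(2)
    proof eventually_elim
      case (elim \<omega>)
      show ?case
      proof
        fix t show "\<forall>\<^sub>F n in sequentially. ennreal t < min (T n \<omega>) (T' n \<omega>)"
          using elim(1)[rule_format, of t] elim(2)[rule_format, of t] by eventually_elim simp
      qed
    qed
    fix n
    have "martingale P F (stopped (T' n) (stopped (T n) N))"
      by (intro optional_stopping T T' stopped_continuous N)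
    moreover have "martingale P F (stopped (T n) (stopped (T' n) N'))"
      by (intro optional_stopping T T' stopped_continuous N')
    ultimately have "martingale P F (\<lambda>t \<omega>. a * stopped (T' n) (stopped (T n) N) t \<omega> + b * stopped (T n) (stopped (T' n) N') t \<omega>)"
      by (rule martingale_linear)
    then show "martingale P F (stopped (\<lambda>\<omega>. min (T n \<omega>) (T' n \<omega>)) (\<lambda>t \<omega>. a * N t \<omega> + b * N' t \<omega>))"
      unfolding stopped_stopped by (simp add: stopped_def[abs_def] min.commute)
  qed
qed

text \<open>Boundedness allows the localising sequence to be removed by dominated convergence.\<close>

lemma local_martingale_bounded:
  assumes N: "local_martingale N" and T: "stopping_time F T"
    and C: "\<And>t \<omega>. 0 \<le> t \<Longrightarrow> \<bar>stopped T N t \<omega>\<bar> \<le> C"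
  shows "martingale P F (stopped T N)"
proof -
  obtain S where S: "\<And>n :: nat. stopping_time F (S n)" "AE \<omega> in P. \<forall>t. \<forall>\<^sub>F n in sequentially. ennreal t < S n \<omega>"
      "\<And>n. martingale P F (stopped (S n) N)"
    and Nc: "adapted F N" "\<And>\<omega>. continuous_on {0..} (\<lambda>t. N t \<omega>)"
    using N unfolding local_martingale_def by blast
  have m: "martingale P F (stopped (S n) (stopped T N))" for n
  proof -
    have "martingale P F (stopped T (stopped (S n) N))"
      by (intro optional_stopping S T stopped_continuous Nc)
    then show ?thesis by (simp add: stopped_stopped min.commute)
  qed
  have ad: "adapted F (stopped T N)" by (rule stopped_adapted[OF Nc T])
  note meas = adapted_measurable_P[OF ad]
  have eq: "AE \<omega> in P. \<forall>t\<ge>0. \<forall>\<^sub>F n in sequentially. stopped (S n) (stopped T N) t \<omega> = stopped T N t \<omega>"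
    using S(2)
  proof eventually_elim
    case (elim \<omega>)
    show ?case
    proof (intro allI impI)
      fix t :: real assume "0 \<le> t"
      show "\<forall>\<^sub>F n in sequentially. stopped (S n) (stopped T N) t \<omega> = stopped T N t \<omega>"
        using elim[rule_format, of t]
        by eventually_elim (use \<open>0 \<le> t\<close> in \<open>simp add: stopped_def min_absorb1\<close>)
    qed
  qed
  have bd: "\<bar>stopped (S n) (stopped T N) t \<omega>\<bar> \<le> C" if "0 \<le> t" for n t \<omega>
    unfolding stopped_clamp[of "S n"] using clamp_bounds[of 0 t] that by (intro C) auto
  have lim: "(\<lambda>n. \<integral>\<omega>. indicator B \<omega> * stopped (S n) (stopped T N) t \<omega> \<partial>P) \<longlonglongrightarrow> (\<integral>\<omega>. indicator B \<omega> * stopped T N t \<omega> \<partial>P)"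
    if t: "0 \<le> t" and B: "B \<in> sets P" for t B
  proof (rule integral_dominated_convergence[where w="\<lambda>_. C"])
    show "AE \<omega> in P. (\<lambda>n. indicator B \<omega> * stopped (S n) (stopped T N) t \<omega>) \<longlonglongrightarrow> indicator B \<omega> * stopped T N t \<omega>"
      using eq
    proof eventually_elim
      case (elim \<omega>)
      have "(\<lambda>n. stopped (S n) (stopped T N) t \<omega>) \<longlonglongrightarrow> stopped T N t \<omega>"
        using elim t by (intro tendsto_eventually) auto
      then show ?case by (intro tendsto_intros)
    qed
    have [measurable]: "B \<in> sets P" by fact
    have [measurable]: "stopped T N t \<in> borel_measurable P" by (rule meas[OF t])
    show "(\<lambda>\<omega>. indicator B \<omega> * stopped T N t \<omega>) \<in> borel_measurable P" by measurable
    have [measurable]: "stopped (S n) (stopped T N) t \<in> borel_measurable P" for n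
      using martingaleD(2)[OF m t] by auto
    show "(\<lambda>\<omega>. indicator B \<omega> * stopped (S n) (stopped T N) t \<omega>) \<in> borel_measurable P" for n by measurable
    have C0: "0 \<le> C" using C[OF t] abs_ge_zero order_trans by blast
    show "AE \<omega> in P. norm (indicator B \<omega> * stopped (S n) (stopped T N) t \<omega>) \<le> C" for n
      using bd[OF t, of n] C0 by (intro AE_I2) (auto simp: indicator_def)
  qed simp
  show ?thesis unfolding martingale_iff
  proof (intro conjI allI impI ad)
    show "integrable P (stopped T N t)" if "0 \<le> t" for t
      using meas[OF that] C[OF that] by (intro integrable_const_bound[where B=C]) auto
    fix s t :: real and B assume st: "0 \<le> s" "s \<le> t" and B: "B \<in> sets (F (ennreal s))"
    have "0 \<le> t" using st by simp
    have "(\<lambda>n. \<integral>\<omega>. indicator B \<omega> * stopped (S n) (stopped T N) t \<omega> \<partial>P) \<longlonglongrightarrow> (\<integral>\<omega>. indicator B \<omega> * stopped T N s \<omega> \<partial>P)"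
      unfolding martingaleD(3)[OF m st B] by (rule lim[OF st(1) sets_P[OF B]])
    then show "(\<integral>\<omega>. indicator B \<omega> * stopped T N t \<omega> \<partial>P) = (\<integral>\<omega>. indicator B \<omega> * stopped T N s \<omega> \<partial>P)"
      using LIMSEQ_unique lim[OF \<open>0 \<le> t\<close> sets_P[OF B]] by blast
  qed
qed

end

section \<open>Ito's formula in expectation\<close>

text \<open>
  Second-order Taylor expansion of \<open>f(R)\<close>, \<open>R = (x\<^sup>2 + y\<^sup>2) / (1 + c
  a)\<close>, in which \<open>\<Delta>x\<close>, \<open>\<Delta>y\<close> count as order one and
  \<open>\<Delta>a\<close> as order two. The remainder is written as a factor that is small with the
  mesh times a factor whose sum over a partition stays bounded in mean square.
\<close>

lemma radial_expansion:
  fixes f f1 f2 :: "real \<Rightarrow> real"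
  assumes K: "0 \<le> K" and c: "0 \<le> c" and L: "0 \<le> L"
    and f1: "\<And>r. 0 \<le> r \<Longrightarrow> r \<le> 2 * K\<^sup>2 \<Longrightarrow> \<bar>f1 r\<bar> \<le> L"
    and f2: "\<And>r. 0 \<le> r \<Longrightarrow> r \<le> 2 * K\<^sup>2 \<Longrightarrow> \<bar>f2 r\<bar> \<le> L"
    and taylor: "\<And>r r'. 0 \<le> r \<Longrightarrow> r \<le> 2 * K\<^sup>2 \<Longrightarrow> 0 \<le> r' \<Longrightarrow> r' \<le> 2 * K\<^sup>2 \<Longrightarrow>
       \<bar>f r' - f r - f1 r * (r' - r) - f2 r * (r' - r)\<^sup>2 / 2\<bar> \<le> L * \<bar>r' - r\<bar> ^ 3"
  obtains C where "0 \<le> C" "\<And>x y a x' y' a'. \<lbrakk>\<bar>x\<bar> \<le> K; \<bar>y\<bar> \<le> K; \<bar>x'\<bar> \<le> K; \<bar>y'\<bar> \<le> K; 0 \<le> a; a \<le> a'; a' \<le> K\<rbrakk> \<Longrightarrow>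
     \<bar>f ((x'\<^sup>2 + y'\<^sup>2) / (1 + c * a')) - f ((x\<^sup>2 + y\<^sup>2) / (1 + c * a))
       - (f1 ((x\<^sup>2 + y\<^sup>2) / (1 + c * a)) * ((2 * x * (x' - x) + 2 * y * (y' - y) + (x' - x)\<^sup>2 + (y' - y)\<^sup>2
              - c * ((x\<^sup>2 + y\<^sup>2) / (1 + c * a)) * (a' - a)) / (1 + c * a))
          + 2 * f2 ((x\<^sup>2 + y\<^sup>2) / (1 + c * a)) * ((x * (x' - x) + y * (y' - y)) / (1 + c * a))\<^sup>2)\<bar>
      \<le> C * ((\<bar>x' - x\<bar> + \<bar>y' - y\<bar> + (a' - a)) * ((x' - x)\<^sup>2 + (y' - y)\<^sup>2 + (a' - a)))"
proof -
  define C1 where "C1 = 4 * K + 2 * c * K\<^sup>2"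
  define C2 where "C2 = 1 + 2 * c * K\<^sup>2"
  define C where "C = L * (C1 ^ 3 * (3 * (1 + K))) + L * (c * C1) + L / 2 * (C2 * (C1 + 2 * K))"
  have C1: "0 \<le> C1" and C2: "0 \<le> C2" using K c by (auto simp: C1_def C2_def)
  have "0 \<le> C" unfolding C_def using C1 C2 K c L by (intro add_nonneg_nonneg mult_nonneg_nonneg) auto
  moreover have "\<bar>f r' - f r - (f1 r * ((2 * x * (x' - x) + 2 * y * (y' - y) + (x' - x)\<^sup>2 + (y' - y)\<^sup>2
              - c * r * (a' - a)) / (1 + c * a)) + 2 * f2 r * ((x * (x' - x) + y * (y' - y)) / (1 + c * a))\<^sup>2)\<bar>
      \<le> C * ((\<bar>x' - x\<bar> + \<bar>y' - y\<bar> + (a' - a)) * ((x' - x)\<^sup>2 + (y' - y)\<^sup>2 + (a' - a)))"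
    if h: "\<bar>x\<bar> \<le> K" "\<bar>y\<bar> \<le> K" "\<bar>x'\<bar> \<le> K" "\<bar>y'\<bar> \<le> K" "0 \<le> a" "a \<le> a'" "a' \<le> K"
      and r_def: "r = (x\<^sup>2 + y\<^sup>2) / (1 + c * a)" and r'_def: "r' = (x'\<^sup>2 + y'\<^sup>2) / (1 + c * a')"
    for x y a x' y' a' r r'
  proof -
    define k where "k = 1 + c * a"
    have k: "1 \<le> k" using c h by (simp add: k_def)
    have k': "1 \<le> 1 + c * a'" using c h by simp
    have rb: "0 \<le> (u\<^sup>2 + v\<^sup>2) / w" "(u\<^sup>2 + v\<^sup>2) / w \<le> 2 * K\<^sup>2" if "\<bar>u\<bar> \<le> K" "\<bar>v\<bar> \<le> K" "1 \<le> w" for u v w :: real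
    proof -
      have "u\<^sup>2 \<le> K\<^sup>2" "v\<^sup>2 \<le> K\<^sup>2" using that K by (auto simp: abs_le_square_iff[symmetric])
      then have "(u\<^sup>2 + v\<^sup>2) / w \<le> (2 * K\<^sup>2) / 1" using that by (intro frac_le) auto
      then show "(u\<^sup>2 + v\<^sup>2) / w \<le> 2 * K\<^sup>2" by simp
      show "0 \<le> (u\<^sup>2 + v\<^sup>2) / w" using that by auto
    qed
    have r: "0 \<le> r" "r \<le> 2 * K\<^sup>2" using rb[of x y k] h k by (auto simp: r_def k_def)
    have r': "0 \<le> r'" "r' \<le> 2 * K\<^sup>2" using rb[of x' y' "1 + c * a'"] h k' by (auto simp: r'_def)
    define dx where "dx = x' - x"
    define dy where "dy = y' - y"
    define da where "da = a' - a"
    have da: "0 \<le> da" "da \<le> K" using h by (auto simp: da_def)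
    have dx: "\<bar>dx\<bar> \<le> 2 * K" "\<bar>dy\<bar> \<le> 2 * K" using h by (auto simp: dx_def dy_def)
    define e where "e = \<bar>dx\<bar> + \<bar>dy\<bar> + da"
    define q where "q = dx\<^sup>2 + dy\<^sup>2 + da"
    have e0: "0 \<le> e" and q0: "0 \<le> q" using da by (auto simp: e_def q_def)
    have daq: "da \<le> q" by (simp add: q_def)
    have eq2: "e\<^sup>2 \<le> 3 * (1 + K) * q"
    proof -
      have "e\<^sup>2 \<le> 3 * (\<bar>dx\<bar>\<^sup>2 + \<bar>dy\<bar>\<^sup>2 + da\<^sup>2)"
        unfolding e_def
        using sum_squares_bound[of "\<bar>dx\<bar>" "\<bar>dy\<bar>"] sum_squares_bound[of "\<bar>dx\<bar>" da] sum_squares_bound[of "\<bar>dy\<bar>" da]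
        by (simp add: power2_eq_square algebra_simps)
      also have "\<dots> \<le> 3 * (dx\<^sup>2 + dy\<^sup>2 + K * da)"
        using da by (simp add: power2_eq_square mult_right_mono)
      also have "\<dots> \<le> 3 * ((1 + K) * q)"
      proof -
        have "dx\<^sup>2 + dy\<^sup>2 + K * da + (K * (dx\<^sup>2 + dy\<^sup>2) + da) = (1 + K) * q" by (simp add: q_def algebra_simps)
        moreover have "0 \<le> K * (dx\<^sup>2 + dy\<^sup>2) + da" using K da by auto
        ultimately have "dx\<^sup>2 + dy\<^sup>2 + K * da \<le> (1 + K) * q" by (metis le_add_same_cancel1)
        then show ?thesis by simp
      qed
      finally show ?thesis by (simp only: mult.assoc)
    qed
    define p where "p = 2 * x * dx + 2 * y * dy + dx\<^sup>2 + dy\<^sup>2"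
    define d where "d = r' - r"
    have dk: "d * k = p - c * r' * da"
    proof -
      have 1: "r * k = x\<^sup>2 + y\<^sup>2" using k by (simp add: r_def k_def)
      have kda: "k + c * da = 1 + c * a'" by (simp add: k_def da_def algebra_simps)
      have 2: "r' * (k + c * da) = x'\<^sup>2 + y'\<^sup>2" unfolding kda r'_def using k' by simp
      have 3: "x'\<^sup>2 + y'\<^sup>2 = x\<^sup>2 + y\<^sup>2 + p" by (simp add: p_def dx_def dy_def power2_eq_square algebra_simps)
      show ?thesis using 1 2 3 by (simp add: d_def algebra_simps)
    qed
    define l where "l = (p - c * r * da) / k"
    define w where "w = 2 * ((x * dx + y * dy) / k)"
    have d_eq: "d = (p - c * r' * da) / k" using dk k by (simp add: field_simps)
    have xdx: "\<bar>x * dx\<bar> \<le> K * \<bar>dx\<bar>" "\<bar>y * dy\<bar> \<le> K * \<bar>dy\<bar>"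
      using h by (auto simp: abs_mult intro: mult_right_mono)
    have dx2: "dx\<^sup>2 \<le> 2 * K * \<bar>dx\<bar>" "dy\<^sup>2 \<le> 2 * K * \<bar>dy\<bar>"
      using mult_right_mono[OF dx(1), of "\<bar>dx\<bar>"] mult_right_mono[OF dx(2), of "\<bar>dy\<bar>"] by (auto simp: power2_eq_square)
    have crda: "0 \<le> c * r' * da" "c * r' * da \<le> 2 * c * K\<^sup>2 * da"
    proof -
      show "0 \<le> c * r' * da" using c r' da by simp
      have "c * (r' * da) \<le> c * (2 * K\<^sup>2 * da)" using c r' da by (intro mult_left_mono mult_right_mono) auto
      then show "c * r' * da \<le> 2 * c * K\<^sup>2 * da" by (simp add: mult_ac)
    qed
    have divk: "\<bar>z / k\<bar> \<le> \<bar>z\<bar>" for z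
    proof -
      have "\<bar>z\<bar> / k \<le> \<bar>z\<bar> / 1" using k by (intro divide_left_mono) auto
      then show ?thesis using k by simp
    qed
    have d_le: "\<bar>d\<bar> \<le> C1 * e"
    proof -
      have "\<bar>d\<bar> \<le> \<bar>p - c * r' * da\<bar>" unfolding d_eq by (rule divk)
      also have "\<dots> \<le> 2 * \<bar>x * dx\<bar> + 2 * \<bar>y * dy\<bar> + dx\<^sup>2 + dy\<^sup>2 + c * r' * da"
        using crda(1) unfolding p_def by (simp only: mult.assoc) (smt (verit) zero_le_power2)
      also have "\<dots> \<le> 4 * K * (\<bar>dx\<bar> + \<bar>dy\<bar>) + 2 * c * K\<^sup>2 * da"
        using xdx dx2 crda by (simp add: algebra_simps)
      also have "\<dots> \<le> C1 * e"
      proof -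
        have "C1 * e - (4 * K * (\<bar>dx\<bar> + \<bar>dy\<bar>) + 2 * c * K\<^sup>2 * da) = 4 * K * da + 2 * c * K\<^sup>2 * (\<bar>dx\<bar> + \<bar>dy\<bar>)"
          by (simp add: C1_def e_def algebra_simps)
        moreover have "0 \<le> 4 * K * da + 2 * c * K\<^sup>2 * (\<bar>dx\<bar> + \<bar>dy\<bar>)" using K c da by auto
        ultimately show ?thesis by linarith
      qed
      finally show ?thesis .
    qed
    have dl: "\<bar>d - l\<bar> \<le> c * C1 * (e * q)"
    proof -
      have "d - l = ((p - c * r' * da) - (p - c * r * da)) / k" by (simp only: d_eq l_def diff_divide_distrib)
      also have "(p - c * r' * da) - (p - c * r * da) = - (c * d * da)" by (simp add: d_def algebra_simps)
      finally have "d - l = (- (c * d * da)) / k" .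
      then have "\<bar>d - l\<bar> \<le> \<bar>c * d * da\<bar>" using divk[of "- (c * d * da)"] by simp
      also have "\<dots> = c * (\<bar>d\<bar> * da)" using c da by (simp add: abs_mult)
      also have "\<dots> \<le> c * (C1 * e * q)"
        using c C1 e0 daq da by (intro mult_left_mono mult_mono d_le) auto
      finally show ?thesis by (simp add: mult.assoc)
    qed
    have dw: "\<bar>d - w\<bar> \<le> C2 * q"
    proof -
      have "d - w = (dx\<^sup>2 + dy\<^sup>2 - c * r' * da) / k"
        unfolding d_eq w_def p_def using k by (simp add: field_simps)
      then have "\<bar>d - w\<bar> \<le> \<bar>dx\<^sup>2 + dy\<^sup>2 - c * r' * da\<bar>" using divk by simp
      also have "\<dots> \<le> dx\<^sup>2 + dy\<^sup>2 + c * r' * da" using crda(1) by (smt (verit) zero_le_power2)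
      also have "\<dots> \<le> dx\<^sup>2 + dy\<^sup>2 + 2 * c * K\<^sup>2 * da" using crda(2) by simp
      also have "\<dots> \<le> C2 * q"
      proof -
        have "C2 * q - (dx\<^sup>2 + dy\<^sup>2 + 2 * c * K\<^sup>2 * da) = da + 2 * c * K\<^sup>2 * (dx\<^sup>2 + dy\<^sup>2)"
          by (simp add: C2_def q_def algebra_simps)
        moreover have "0 \<le> da + 2 * c * K\<^sup>2 * (dx\<^sup>2 + dy\<^sup>2)" using c da by auto
        ultimately show ?thesis by linarith
      qed
      finally show ?thesis .
    qed
    have w_le: "\<bar>w\<bar> \<le> 2 * K * e"
    proof -
      have "\<bar>w\<bar> \<le> 2 * \<bar>x * dx + y * dy\<bar>" unfolding w_def abs_mult[of 2] abs_numeral by (intro mult_left_mono divk) auto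
      also have "\<dots> \<le> 2 * (K * \<bar>dx\<bar> + K * \<bar>dy\<bar>)"
        by (intro mult_left_mono order_trans[OF abs_triangle_ineq] add_mono xdx) auto
      also have "\<dots> \<le> 2 * K * e" using K da by (simp add: e_def algebra_simps)
      finally show ?thesis .
    qed
    have dw2: "\<bar>d\<^sup>2 - w\<^sup>2\<bar> \<le> C2 * (C1 + 2 * K) * (e * q)"
    proof -
      have "\<bar>d\<^sup>2 - w\<^sup>2\<bar> = \<bar>d - w\<bar> * \<bar>d + w\<bar>" by (simp add: abs_mult[symmetric] power2_eq_square algebra_simps)
      also have "\<dots> \<le> (C2 * q) * (C1 * e + 2 * K * e)"
        using d_le w_le C2 q0 by (intro mult_mono dw) auto
      finally show ?thesis by (simp add: algebra_simps)
    qed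
    have d3: "\<bar>d\<bar> ^ 3 \<le> C1 ^ 3 * (3 * (1 + K)) * (e * q)"
    proof -
      have "\<bar>d\<bar> ^ 3 \<le> (C1 * e) ^ 3" using d_le by (intro power_mono) auto
      also have "\<dots> = C1 ^ 3 * (e * e\<^sup>2)" by (simp add: power_mult_distrib power2_eq_square power3_eq_cube)
      also have "\<dots> \<le> C1 ^ 3 * (e * (3 * (1 + K) * q))" using eq2 C1 e0 by (intro mult_left_mono) auto
      finally show ?thesis by (simp add: algebra_simps)
    qed
    have eq: "f r' - f r - (f1 r * l + f2 r * w\<^sup>2 / 2) = (f r' - f r - f1 r * d - f2 r * d\<^sup>2 / 2) + f1 r * (d - l) + f2 r / 2 * (d\<^sup>2 - w\<^sup>2)"
      by (simp add: field_simps)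
    have "\<bar>f r' - f r - (f1 r * l + f2 r * w\<^sup>2 / 2)\<bar> \<le> \<bar>f r' - f r - f1 r * d - f2 r * d\<^sup>2 / 2\<bar> + \<bar>f1 r\<bar> * \<bar>d - l\<bar> + \<bar>f2 r\<bar> / 2 * \<bar>d\<^sup>2 - w\<^sup>2\<bar>"
    proof -
      have "\<bar>f1 r * (d - l)\<bar> = \<bar>f1 r\<bar> * \<bar>d - l\<bar>" "\<bar>f2 r / 2 * (d\<^sup>2 - w\<^sup>2)\<bar> = \<bar>f2 r\<bar> / 2 * \<bar>d\<^sup>2 - w\<^sup>2\<bar>"
        by (simp_all add: abs_mult)
      moreover have "\<bar>u + v + z\<bar> \<le> \<bar>u\<bar> + \<bar>v\<bar> + \<bar>z\<bar>" for u v z :: real by linarith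
      ultimately show ?thesis using eq by metis
    qed
    also have "\<dots> \<le> L * (C1 ^ 3 * (3 * (1 + K)) * (e * q)) + L * (c * C1 * (e * q)) + L / 2 * (C2 * (C1 + 2 * K) * (e * q))"
    proof (intro add_mono mult_mono)
      show "\<bar>f r' - f r - f1 r * d - f2 r * d\<^sup>2 / 2\<bar> \<le> L * (C1 ^ 3 * (3 * (1 + K)) * (e * q))"
        using taylor[OF r r'] mult_left_mono[OF d3 L] by (simp add: d_def)
    qed (use f1[OF r] f2[OF r] dl dw2 L in auto)
    also have "\<dots> = C * (e * q)" by (simp add: C_def algebra_simps)
    finally have "\<bar>f r' - f r - (f1 r * l + f2 r * w\<^sup>2 / 2)\<bar> \<le> C * (e * q)" .
    moreover have "f2 r * w\<^sup>2 / 2 = 2 * f2 r * ((x * dx + y * dy) / k)\<^sup>2" unfolding w_def power_mult_distrib by simp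
    ultimately show ?thesis unfolding l_def p_def k_def[symmetric] dx_def[symmetric] dy_def[symmetric] da_def[symmetric] e_def q_def by simp
  qed
  ultimately show ?thesis by (rule that) (assumption | rule refl)+
qed

context usual_conditions
begin

lemma integrable_bounded:
  fixes f :: "'a \<Rightarrow> real"
  shows "f \<in> borel_measurable P \<Longrightarrow> (\<And>\<omega>. \<bar>f \<omega>\<bar> \<le> B) \<Longrightarrow> integrable P f"
  by (rule integrable_const_bound[where B=B]) auto

text \<open>
  \<open>(\<Delta>N)\<^sup>2 - \<Delta>B\<close> differs from the increment of \<open>N\<^sup>2 -
  B\<close> by \<open>2 N \<Delta>N\<close>, and both have mean zero against weights of the past.
\<close>

lemma squared_increment:
  assumes N: "martingale P F N" and NB: "martingale P F (\<lambda>t \<omega>. (N t \<omega>)\<^sup>2 - B t \<omega>)"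
    and st: "0 \<le> s" "s \<le> t" and h: "h \<in> borel_measurable (F (ennreal s))" "\<And>\<omega>. \<bar>h \<omega>\<bar> \<le> C"
    and K: "\<And>t \<omega>. 0 \<le> t \<Longrightarrow> \<bar>N t \<omega>\<bar> \<le> K"
  shows "integrable P (\<lambda>\<omega>. h \<omega> * ((N t \<omega> - N s \<omega>)\<^sup>2 - (B t \<omega> - B s \<omega>)))"
    "(\<integral>\<omega>. h \<omega> * ((N t \<omega> - N s \<omega>)\<^sup>2 - (B t \<omega> - B s \<omega>)) \<partial>P) = 0"
proof -
  have [measurable]: "h \<in> borel_measurable (F (ennreal s))" "N s \<in> borel_measurable (F (ennreal s))"
    using h(1) adaptedD[OF martingaleD(1)[OF N] st(1)] by auto
  have C: "0 \<le> C" using h(2) abs_ge_zero order_trans by blast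
  have hb: "\<bar>h \<omega> * (2 * N s \<omega>)\<bar> \<le> C * (2 * K)" for \<omega>
    unfolding abs_mult[of "h \<omega>"] using h(2)[of \<omega>] K[OF st(1), of \<omega>] C by (intro mult_mono) auto
  have hm: "(\<lambda>\<omega>. h \<omega> * (2 * N s \<omega>)) \<in> borel_measurable (F (ennreal s))" by measurable
  have 1: "integrable P (\<lambda>\<omega>. h \<omega> * (2 * N s \<omega>) * (N t \<omega> - N s \<omega>))"
      "(\<integral>\<omega>. h \<omega> * (2 * N s \<omega>) * (N t \<omega> - N s \<omega>) \<partial>P) = 0"
    by (rule martingale_increment[OF N st hm hb])+
  note 2 = martingale_increment[OF NB st h]
  have eq: "h \<omega> * ((N t \<omega> - N s \<omega>)\<^sup>2 - (B t \<omega> - B s \<omega>)) =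
    h \<omega> * (((N t \<omega>)\<^sup>2 - B t \<omega>) - ((N s \<omega>)\<^sup>2 - B s \<omega>)) - h \<omega> * (2 * N s \<omega>) * (N t \<omega> - N s \<omega>)" for \<omega>
    by (simp add: power2_eq_square algebra_simps)
  show "integrable P (\<lambda>\<omega>. h \<omega> * ((N t \<omega> - N s \<omega>)\<^sup>2 - (B t \<omega> - B s \<omega>)))"
    "(\<integral>\<omega>. h \<omega> * ((N t \<omega> - N s \<omega>)\<^sup>2 - (B t \<omega> - B s \<omega>)) \<partial>P) = 0"
    unfolding eq using 1 2 by auto
qed

lemma product_increment:
  assumes N: "martingale P F N" and N': "martingale P F N'" and NN: "martingale P F (\<lambda>t \<omega>. N t \<omega> * N' t \<omega>)"
    and st: "0 \<le> s" "s \<le> t" and h: "h \<in> borel_measurable (F (ennreal s))" "\<And>\<omega>. \<bar>h \<omega>\<bar> \<le> C"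
    and K: "\<And>t \<omega>. 0 \<le> t \<Longrightarrow> \<bar>N t \<omega>\<bar> \<le> K" "\<And>t \<omega>. 0 \<le> t \<Longrightarrow> \<bar>N' t \<omega>\<bar> \<le> K"
  shows "integrable P (\<lambda>\<omega>. h \<omega> * ((N t \<omega> - N s \<omega>) * (N' t \<omega> - N' s \<omega>)))"
    "(\<integral>\<omega>. h \<omega> * ((N t \<omega> - N s \<omega>) * (N' t \<omega> - N' s \<omega>)) \<partial>P) = 0"
proof -
  have [measurable]: "h \<in> borel_measurable (F (ennreal s))" "N s \<in> borel_measurable (F (ennreal s))" "N' s \<in> borel_measurable (F (ennreal s))"
    using h(1) adaptedD[OF martingaleD(1)[OF N] st(1)] adaptedD[OF martingaleD(1)[OF N'] st(1)] by auto
  have C: "0 \<le> C" using h(2) abs_ge_zero order_trans by blast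
  have hb: "\<bar>h \<omega> * N s \<omega>\<bar> \<le> C * K" "\<bar>h \<omega> * N' s \<omega>\<bar> \<le> C * K" for \<omega>
    unfolding abs_mult[of "h \<omega>"] using h(2)[of \<omega>] K(1)[OF st(1), of \<omega>] K(2)[OF st(1), of \<omega>] C by (intro mult_mono; simp)+
  have hm: "(\<lambda>\<omega>. h \<omega> * N s \<omega>) \<in> borel_measurable (F (ennreal s))" "(\<lambda>\<omega>. h \<omega> * N' s \<omega>) \<in> borel_measurable (F (ennreal s))" by measurable
  have 1: "integrable P (\<lambda>\<omega>. h \<omega> * N s \<omega> * (N' t \<omega> - N' s \<omega>))"
      "(\<integral>\<omega>. h \<omega> * N s \<omega> * (N' t \<omega> - N' s \<omega>) \<partial>P) = 0"
      "integrable P (\<lambda>\<omega>. h \<omega> * N' s \<omega> * (N t \<omega> - N s \<omega>))"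
      "(\<integral>\<omega>. h \<omega> * N' s \<omega> * (N t \<omega> - N s \<omega>) \<partial>P) = 0"
    by (rule martingale_increment[OF N' st hm(1) hb(1)] martingale_increment[OF N st hm(2) hb(2)])+
  note 2 = martingale_increment[OF NN st h]
  have eq: "h \<omega> * ((N t \<omega> - N s \<omega>) * (N' t \<omega> - N' s \<omega>)) =
    h \<omega> * (N t \<omega> * N' t \<omega> - N s \<omega> * N' s \<omega>) - h \<omega> * N s \<omega> * (N' t \<omega> - N' s \<omega>) - h \<omega> * N' s \<omega> * (N t \<omega> - N s \<omega>)" for \<omega>
    by (simp add: algebra_simps)
  show "integrable P (\<lambda>\<omega>. h \<omega> * ((N t \<omega> - N s \<omega>) * (N' t \<omega> - N' s \<omega>)))"
    "(\<integral>\<omega>. h \<omega> * ((N t \<omega> - N s \<omega>) * (N' t \<omega> - N' s \<omega>)) \<partial>P) = 0"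
    unfolding eq using 1 2 by auto
qed

text \<open>
  The sums of \<open>(\<Delta>N)\<^sup>2 - \<Delta>B\<close> have orthogonal increments, so their
  second moment is the sum of the second moments of the summands. Each of these is at most a
  constant times the mean of \<open>\<Delta>B\<close>, and the \<open>\<Delta>B\<close> add up to at
  most \<open>K\<close>. The bound is independent of the partition.
\<close>

lemma sum_of_squares_second_moment:
  assumes N: "martingale P F N" and NB: "martingale P F (\<lambda>t \<omega>. (N t \<omega>)\<^sup>2 - B t \<omega>)" and B: "adapted F B"
    and K: "\<And>t \<omega>. 0 \<le> t \<Longrightarrow> \<bar>N t \<omega>\<bar> \<le> K"
    and BK: "\<And>t \<omega>. 0 \<le> t \<Longrightarrow> 0 \<le> B t \<omega>" "\<And>t \<omega>. 0 \<le> t \<Longrightarrow> B t \<omega> \<le> K"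
    and B_mono: "\<And>s t \<omega>. 0 \<le> s \<Longrightarrow> s \<le> t \<Longrightarrow> B s \<omega> \<le> B t \<omega>"
    and n: "0 \<le> n"
  shows "(\<integral>\<omega>. (\<Sum>i<m. (N (grid 0 n m (Suc i)) \<omega> - N (grid 0 n m i) \<omega>)\<^sup>2)\<^sup>2 \<partial>P) \<le> 6 * K\<^sup>2 + 16 * K ^ 3"
proof -
  let ?t = "grid 0 n m"
  have K0: "0 \<le> K" using K[of 0] abs_ge_zero order_trans by blast
  have t0: "0 \<le> ?t i" for i using n by (simp add: grid_def)
  have t_mono: "?t i \<le> ?t j" if "i \<le> j" for i j using grid_mono[OF n that] by simp
  have N_meas: "N (?t i) \<in> borel_measurable (F (ennreal (?t k)))" if "i \<le> k" for i k
    by (rule adapted_measurable[OF martingaleD(1)[OF N] t0 t_mono[OF that]])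
  have B_meas: "B (?t i) \<in> borel_measurable (F (ennreal (?t k)))" if "i \<le> k" for i k
    by (rule adapted_measurable[OF B t0 t_mono[OF that]])
  have [measurable]: "N (?t i) \<in> borel_measurable P" "B (?t i) \<in> borel_measurable P" for i
    using measurable_P[OF N_meas[OF order_refl]] measurable_P[OF B_meas[OF order_refl]] by auto
  define q where "q i \<omega> = (N (?t (Suc i)) \<omega> - N (?t i) \<omega>)\<^sup>2" for i \<omega>
  define b where "b i \<omega> = B (?t (Suc i)) \<omega> - B (?t i) \<omega>" for i \<omega>
  define s where "s k \<omega> = (\<Sum>i<k. q i \<omega> - b i \<omega>)" for k \<omega>
  have q: "0 \<le> q i \<omega>" "q i \<omega> \<le> 4 * K\<^sup>2" for i \<omega>
  proof -
    have "\<bar>N (?t (Suc i)) \<omega> - N (?t i) \<omega>\<bar> \<le> 2 * K" using K[OF t0, of "Suc i" \<omega>] K[OF t0, of i \<omega>] by linarith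
    then have "(N (?t (Suc i)) \<omega> - N (?t i) \<omega>)\<^sup>2 \<le> (2 * K)\<^sup>2" using K0 by (subst abs_le_square_iff[symmetric]) auto
    then show "q i \<omega> \<le> 4 * K\<^sup>2" by (simp add: q_def power_mult_distrib)
  qed (simp add: q_def)
  have b: "0 \<le> b i \<omega>" "b i \<omega> \<le> K" for i \<omega>
    using B_mono[OF t0 t_mono, of i "Suc i" \<omega>] BK[OF t0, of i \<omega>] BK[OF t0, of "Suc i" \<omega>] by (auto simp: b_def)
  have [measurable]: "q i \<in> borel_measurable P" "b i \<in> borel_measurable P" "s k \<in> borel_measurable P" for i k
    unfolding q_def[abs_def] b_def[abs_def] s_def[abs_def] by measurable
  have d: "\<bar>q i \<omega> - b i \<omega>\<bar> \<le> 4 * K\<^sup>2 + K" for i \<omega> using q[of i \<omega>] b[of i \<omega>] K0 by (auto simp: abs_if)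
  have sb: "\<bar>s k \<omega>\<bar> \<le> real k * (4 * K\<^sup>2 + K)" for k \<omega>
  proof -
    have "\<bar>s k \<omega>\<bar> \<le> (\<Sum>i<k. \<bar>q i \<omega> - b i \<omega>\<bar>)" unfolding s_def by (rule sum_abs)
    also have "\<dots> \<le> (\<Sum>i<k. 4 * K\<^sup>2 + K)" by (intro sum_mono d)
    finally show ?thesis by simp
  qed
  have ib: "integrable P (q i)" "integrable P (b i)" for i
    using q b by (auto intro!: integrable_bounded[where B="4*K\<^sup>2"] integrable_bounded[where B=K and f="b i"] simp: abs_of_nonneg)
  have sq2: "(u + v)\<^sup>2 \<le> 2 * u\<^sup>2 + 2 * v\<^sup>2" for u v :: real
    using sum_squares_bound[of u v] by (simp add: power2_sum)
  have sqb: "\<bar>u\<^sup>2\<bar> \<le> v\<^sup>2" if "\<bar>u\<bar> \<le> v" for u v :: real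
    using power_mono[OF that, of 2] by simp
  have iq2: "integrable P (\<lambda>\<omega>. (q i \<omega> - b i \<omega>)\<^sup>2)" for i
    by (rule integrable_bounded[where B="(4*K\<^sup>2 + K)\<^sup>2"]) (measurable, rule sqb[OF d])
  have is2: "integrable P (\<lambda>\<omega>. (s k \<omega>)\<^sup>2)" for k
    by (rule integrable_bounded[where B="(real k * (4*K\<^sup>2 + K))\<^sup>2"]) (measurable, rule sqb[OF sb])
  have s_meas: "s k \<in> borel_measurable (F (ennreal (?t k)))" for k
    unfolding s_def[abs_def] q_def b_def
    by (intro borel_measurable_sum borel_measurable_diff borel_measurable_power N_meas B_meas) auto
  have orth: "integrable P (\<lambda>\<omega>. s k \<omega> * (q k \<omega> - b k \<omega>))" "(\<integral>\<omega>. s k \<omega> * (q k \<omega> - b k \<omega>) \<partial>P) = 0" for k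
    unfolding q_def b_def
    using squared_increment[OF N NB t0 t_mono[of k "Suc k"] s_meas sb K] by auto
  have mean: "(\<integral>\<omega>. q k \<omega> \<partial>P) = (\<integral>\<omega>. b k \<omega> \<partial>P)" for k
  proof -
    have "(\<integral>\<omega>. 1 * (q k \<omega> - b k \<omega>) \<partial>P) = 0"
      unfolding q_def b_def by (rule squared_increment(2)[OF N NB t0 t_mono[of k "Suc k"], of "\<lambda>_. 1" 1 K]) (auto intro: K)
    then show ?thesis using ib by simp
  qed
  have sumb: "(\<Sum>i<k. b i \<omega>) = B (?t k) \<omega> - B (?t 0) \<omega>" for k \<omega>
    unfolding b_def by (rule sum_lessThan_telescope)
  have sumb': "0 \<le> (\<Sum>i<k. b i \<omega>)" "(\<Sum>i<k. b i \<omega>) \<le> K" for k \<omega>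
  proof -
    show "0 \<le> (\<Sum>i<k. b i \<omega>)" by (intro sum_nonneg b)
    show "(\<Sum>i<k. b i \<omega>) \<le> K" unfolding sumb using BK(2)[OF t0, of k \<omega>] BK(1)[OF t0, of 0 \<omega>] by linarith
  qed
  have D: "(\<integral>\<omega>. (q i \<omega> - b i \<omega>)\<^sup>2 \<partial>P) \<le> (8 * K\<^sup>2 + 2 * K) * (\<integral>\<omega>. b i \<omega> \<partial>P)" for i
  proof -
    have "(\<integral>\<omega>. (q i \<omega> - b i \<omega>)\<^sup>2 \<partial>P) \<le> (\<integral>\<omega>. 8 * K\<^sup>2 * q i \<omega> + 2 * K * b i \<omega> \<partial>P)"
    proof (rule integral_mono)
      fix \<omega>
      have "(q i \<omega> - b i \<omega>)\<^sup>2 \<le> 2 * (q i \<omega>)\<^sup>2 + 2 * (b i \<omega>)\<^sup>2"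
        using sum_squares_bound[of "q i \<omega>" "- b i \<omega>"] by (simp add: power2_diff)
      also have "\<dots> \<le> 2 * (4 * K\<^sup>2 * q i \<omega>) + 2 * (K * b i \<omega>)"
        unfolding power2_eq_square[of "q i \<omega>"] power2_eq_square[of "b i \<omega>"]
        using q[of i \<omega>] b[of i \<omega>] by (intro add_mono mult_left_mono mult_right_mono) auto
      finally show "(q i \<omega> - b i \<omega>)\<^sup>2 \<le> 8 * K\<^sup>2 * q i \<omega> + 2 * K * b i \<omega>" by simp
    qed (use iq2 ib in auto)
    also have "\<dots> = (8 * K\<^sup>2 + 2 * K) * (\<integral>\<omega>. b i \<omega> \<partial>P)" using ib mean[of i] by (simp add: algebra_simps)
    finally show ?thesis .
  qed
  have s2: "(\<integral>\<omega>. (s k \<omega>)\<^sup>2 \<partial>P) \<le> (8 * K\<^sup>2 + 2 * K) * (\<integral>\<omega>. (\<Sum>i<k. b i \<omega>) \<partial>P)" for k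
  proof (induction k)
    case (Suc k)
    have "(\<integral>\<omega>. (s (Suc k) \<omega>)\<^sup>2 \<partial>P) = (\<integral>\<omega>. (s k \<omega>)\<^sup>2 + 2 * (s k \<omega> * (q k \<omega> - b k \<omega>)) + (q k \<omega> - b k \<omega>)\<^sup>2 \<partial>P)"
      by (intro Bochner_Integration.integral_cong) (auto simp: s_def power2_eq_square algebra_simps)
    also have "\<dots> = (\<integral>\<omega>. (s k \<omega>)\<^sup>2 \<partial>P) + (\<integral>\<omega>. (q k \<omega> - b k \<omega>)\<^sup>2 \<partial>P)"
      using is2[of k] orth[of k] iq2[of k] by simp
    also have "\<dots> \<le> (8 * K\<^sup>2 + 2 * K) * (\<integral>\<omega>. (\<Sum>i<k. b i \<omega>) \<partial>P) + (8 * K\<^sup>2 + 2 * K) * (\<integral>\<omega>. b k \<omega> \<partial>P)"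
      by (intro add_mono Suc.IH D)
    also have "\<dots> = (8 * K\<^sup>2 + 2 * K) * (\<integral>\<omega>. (\<Sum>i<Suc k. b i \<omega>) \<partial>P)" using ib by (simp add: distrib_left)
    finally show ?case .
  qed (simp add: s_def)
  have ibs: "integrable P (\<lambda>\<omega>. \<Sum>i<m. b i \<omega>)" using ib by auto
  have "(\<integral>\<omega>. (\<Sum>i<m. b i \<omega>) \<partial>P) \<le> (\<integral>\<omega>. K \<partial>P)" using ibs sumb' by (intro integral_mono) auto
  then have Eb: "(\<integral>\<omega>. (\<Sum>i<m. b i \<omega>) \<partial>P) \<le> K" by (simp add: prob_space)
  have "(\<integral>\<omega>. (\<Sum>i<m. q i \<omega>)\<^sup>2 \<partial>P) \<le> (\<integral>\<omega>. 2 * K\<^sup>2 + 2 * (s m \<omega>)\<^sup>2 \<partial>P)"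
  proof (rule integral_mono)
    have qb: "\<bar>\<Sum>i<m. q i \<omega>\<bar> \<le> real m * (4 * K\<^sup>2)" for \<omega>
    proof -
      have "(\<Sum>i<m. q i \<omega>) \<le> (\<Sum>i<m. 4 * K\<^sup>2)" by (intro sum_mono q)
      then show ?thesis using q by (simp add: sum_nonneg abs_of_nonneg)
    qed
    show "integrable P (\<lambda>\<omega>. (\<Sum>i<m. q i \<omega>)\<^sup>2)"
      by (rule integrable_bounded[where B="(real m * (4 * K\<^sup>2))\<^sup>2"]) (measurable, rule sqb[OF qb])
    show "integrable P (\<lambda>\<omega>. 2 * K\<^sup>2 + 2 * (s m \<omega>)\<^sup>2)" using is2 by auto
    fix \<omega>
    have "(\<Sum>i<m. q i \<omega>) = (\<Sum>i<m. b i \<omega>) + s m \<omega>" by (simp add: s_def sum_subtractf)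
    then have "(\<Sum>i<m. q i \<omega>)\<^sup>2 \<le> 2 * (\<Sum>i<m. b i \<omega>)\<^sup>2 + 2 * (s m \<omega>)\<^sup>2"
      by (simp only: sq2)
    moreover have "(\<Sum>i<m. b i \<omega>)\<^sup>2 \<le> K\<^sup>2" by (intro power_mono sumb')
    ultimately show "(\<Sum>i<m. q i \<omega>)\<^sup>2 \<le> 2 * K\<^sup>2 + 2 * (s m \<omega>)\<^sup>2" by linarith
  qed
  also have "\<dots> = 2 * K\<^sup>2 + 2 * (\<integral>\<omega>. (s m \<omega>)\<^sup>2 \<partial>P)" using is2 by (simp add: prob_space)
  also have "\<dots> \<le> 2 * K\<^sup>2 + 2 * ((8 * K\<^sup>2 + 2 * K) * K)"
    using order_trans[OF s2[of m] mult_left_mono[OF Eb]] K0 by simp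
  also have "\<dots> = 6 * K\<^sup>2 + 16 * K ^ 3" by (simp add: power2_eq_square power3_eq_cube algebra_simps)
  finally show ?thesis unfolding q_def .
qed

end

text \<open>
  The expansion of \<open>f(R) - D u(A)\<close> sorted by martingale increments:
  \<open>(\<Delta>x)\<^sup>2\<close> and \<open>(\<Delta>y)\<^sup>2\<close> are compensated by
  \<open>\<Delta>a\<close>, and what is left over multiplies \<open>\<Delta>a\<close> by the
  generator of \<open>R\<close> applied to \<open>f\<close>, which is at most \<open>D\<close>.
\<close>

lemma drift_step:
  fixes f f1 f2 u :: "real \<Rightarrow> real"
  assumes K: "0 \<le> K" and c: "0 \<le> c" and L: "0 \<le> L"
    and f1: "\<And>r. 0 \<le> r \<Longrightarrow> r \<le> 2 * K\<^sup>2 \<Longrightarrow> \<bar>f1 r\<bar> \<le> L"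
    and f2: "\<And>r. 0 \<le> r \<Longrightarrow> r \<le> 2 * K\<^sup>2 \<Longrightarrow> \<bar>f2 r\<bar> \<le> L"
    and taylor: "\<And>r r'. 0 \<le> r \<Longrightarrow> r \<le> 2 * K\<^sup>2 \<Longrightarrow> 0 \<le> r' \<Longrightarrow> r' \<le> 2 * K\<^sup>2 \<Longrightarrow>
       \<bar>f r' - f r - f1 r * (r' - r) - f2 r * (r' - r)\<^sup>2 / 2\<bar> \<le> L * \<bar>r' - r\<bar> ^ 3"
    and u: "\<And>a a'. 0 \<le> a \<Longrightarrow> a \<le> a' \<Longrightarrow> a' \<le> K \<Longrightarrow> \<bar>u a' - u a - (a' - a) / (1 + c * a)\<bar> \<le> L * (a' - a)\<^sup>2"
  obtains C where "0 \<le> C" "\<And>x y a x' y' a' k r. \<lbrakk>\<bar>x\<bar> \<le> K; \<bar>y\<bar> \<le> K; \<bar>x'\<bar> \<le> K; \<bar>y'\<bar> \<le> K; 0 \<le> a; a \<le> a'; a' \<le> K;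
      k = 1 + c * a; r = (x\<^sup>2 + y\<^sup>2) / k; f1 r * (2 - c * r) + 2 * r * f2 r \<le> D\<rbrakk> \<Longrightarrow>
     (f ((x'\<^sup>2 + y'\<^sup>2) / (1 + c * a')) - D * u a') - (f r - D * u a)
      \<le> 2 * f1 r * x / k * (x' - x) + 2 * f1 r * y / k * (y' - y)
        + (f1 r / k + 2 * f2 r * (x / k)\<^sup>2) * ((x' - x)\<^sup>2 - (a' - a)) + (f1 r / k + 2 * f2 r * (y / k)\<^sup>2) * ((y' - y)\<^sup>2 - (a' - a))
        + 4 * f2 r * (x / k) * (y / k) * ((x' - x) * (y' - y))
        + C * ((\<bar>x' - x\<bar> + \<bar>y' - y\<bar> + (a' - a)) * ((x' - x)\<^sup>2 + (y' - y)\<^sup>2 + (a' - a)))"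
proof -
  obtain C where C: "0 \<le> C" "\<And>x y a x' y' a'. \<lbrakk>\<bar>x\<bar> \<le> K; \<bar>y\<bar> \<le> K; \<bar>x'\<bar> \<le> K; \<bar>y'\<bar> \<le> K; 0 \<le> a; a \<le> a'; a' \<le> K\<rbrakk> \<Longrightarrow>
     \<bar>f ((x'\<^sup>2 + y'\<^sup>2) / (1 + c * a')) - f ((x\<^sup>2 + y\<^sup>2) / (1 + c * a))
       - (f1 ((x\<^sup>2 + y\<^sup>2) / (1 + c * a)) * ((2 * x * (x' - x) + 2 * y * (y' - y) + (x' - x)\<^sup>2 + (y' - y)\<^sup>2
              - c * ((x\<^sup>2 + y\<^sup>2) / (1 + c * a)) * (a' - a)) / (1 + c * a))
          + 2 * f2 ((x\<^sup>2 + y\<^sup>2) / (1 + c * a)) * ((x * (x' - x) + y * (y' - y)) / (1 + c * a))\<^sup>2)\<bar>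
      \<le> C * ((\<bar>x' - x\<bar> + \<bar>y' - y\<bar> + (a' - a)) * ((x' - x)\<^sup>2 + (y' - y)\<^sup>2 + (a' - a)))"
    using radial_expansion[OF K c L f1 f2 taylor] by blast
  show ?thesis
  proof (rule that[of "C + \<bar>D\<bar> * L"])
    show "0 \<le> C + \<bar>D\<bar> * L" using C L by simp
    fix x y a x' y' a' k r :: real
    assume h: "\<bar>x\<bar> \<le> K" "\<bar>y\<bar> \<le> K" "\<bar>x'\<bar> \<le> K" "\<bar>y'\<bar> \<le> K" "0 \<le> a" "a \<le> a'" "a' \<le> K"
      and k: "k = 1 + c * a" and r: "r = (x\<^sup>2 + y\<^sup>2) / k" and D: "f1 r * (2 - c * r) + 2 * r * f2 r \<le> D"
    define dx where "dx = x' - x"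
    define dy where "dy = y' - y"
    define da where "da = a' - a"
    define e where "e = \<bar>dx\<bar> + \<bar>dy\<bar> + da"
    define q where "q = dx\<^sup>2 + dy\<^sup>2 + da"
    have da: "0 \<le> da" using h by (simp add: da_def)
    have k1: "1 \<le> k" using c h k by simp
    have 1: "\<bar>f ((x'\<^sup>2 + y'\<^sup>2) / (1 + c * a')) - f r - (f1 r * ((2 * x * dx + 2 * y * dy + dx\<^sup>2 + dy\<^sup>2 - c * r * da) / k) + 2 * f2 r * ((x * dx + y * dy) / k)\<^sup>2)\<bar> \<le> C * (e * q)"
      using C(2)[OF h] unfolding k[symmetric] r[symmetric] dx_def dy_def da_def e_def q_def by simp
    have 2: "\<bar>D * (u a' - u a) - D * (da / k)\<bar> \<le> \<bar>D\<bar> * (L * da\<^sup>2)"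
      using mult_left_mono[OF u[OF h(5-7)], of "\<bar>D\<bar>"] unfolding k[symmetric] da_def
      by (simp add: abs_mult[symmetric] right_diff_distrib)
    have "da\<^sup>2 \<le> e * q" unfolding power2_eq_square using da by (intro mult_mono) (auto simp: e_def q_def)
    then have 3: "\<bar>D\<bar> * (L * da\<^sup>2) \<le> \<bar>D\<bar> * L * (e * q)" using L by (simp add: mult.assoc mult_left_mono)
    have rk: "(x / k)\<^sup>2 + (y / k)\<^sup>2 = r / k" unfolding r by (simp add: power_divide power2_eq_square add_divide_distrib)
    have "f1 r * ((2 * x * dx + 2 * y * dy + dx\<^sup>2 + dy\<^sup>2 - c * r * da) / k) + 2 * f2 r * ((x * dx + y * dy) / k)\<^sup>2
      = 2 * f1 r * x / k * dx + 2 * f1 r * y / k * dy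
        + (f1 r / k + 2 * f2 r * (x / k)\<^sup>2) * (dx\<^sup>2 - da) + (f1 r / k + 2 * f2 r * (y / k)\<^sup>2) * (dy\<^sup>2 - da)
        + 4 * f2 r * (x / k) * (y / k) * (dx * dy) + (f1 r * (2 - c * r) * da / k + 2 * f2 r * da * ((x / k)\<^sup>2 + (y / k)\<^sup>2))"
      by (simp add: divide_inverse power2_eq_square algebra_simps)
    also have "f1 r * (2 - c * r) * da / k + 2 * f2 r * da * ((x / k)\<^sup>2 + (y / k)\<^sup>2) = (f1 r * (2 - c * r) + 2 * r * f2 r) * (da / k)"
      unfolding rk by (simp add: divide_inverse algebra_simps)
    finally have 4: "f1 r * ((2 * x * dx + 2 * y * dy + dx\<^sup>2 + dy\<^sup>2 - c * r * da) / k) + 2 * f2 r * ((x * dx + y * dy) / k)\<^sup>2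
      = 2 * f1 r * x / k * dx + 2 * f1 r * y / k * dy
        + (f1 r / k + 2 * f2 r * (x / k)\<^sup>2) * (dx\<^sup>2 - da) + (f1 r / k + 2 * f2 r * (y / k)\<^sup>2) * (dy\<^sup>2 - da)
        + 4 * f2 r * (x / k) * (y / k) * (dx * dy) + (f1 r * (2 - c * r) + 2 * r * f2 r) * (da / k)" .
    have 5: "(f1 r * (2 - c * r) + 2 * r * f2 r) * (da / k) \<le> D * (da / k)"
      using D da k1 by (intro mult_right_mono) auto
    have "(f ((x'\<^sup>2 + y'\<^sup>2) / (1 + c * a')) - D * u a') - (f r - D * u a) = (f ((x'\<^sup>2 + y'\<^sup>2) / (1 + c * a')) - f r) - D * (u a' - u a)"
      by (simp add: algebra_simps)
    also have "\<dots> \<le> 2 * f1 r * x / k * dx + 2 * f1 r * y / k * dy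
        + (f1 r / k + 2 * f2 r * (x / k)\<^sup>2) * (dx\<^sup>2 - da) + (f1 r / k + 2 * f2 r * (y / k)\<^sup>2) * (dy\<^sup>2 - da)
        + 4 * f2 r * (x / k) * (y / k) * (dx * dy) + (C * (e * q) + \<bar>D\<bar> * L * (e * q))"
      using 1 2 3 5 unfolding 4 by (simp only: abs_le_iff) linarith
    finally show "(f ((x'\<^sup>2 + y'\<^sup>2) / (1 + c * a')) - D * u a') - (f r - D * u a)
      \<le> 2 * f1 r * x / k * (x' - x) + 2 * f1 r * y / k * (y' - y)
        + (f1 r / k + 2 * f2 r * (x / k)\<^sup>2) * ((x' - x)\<^sup>2 - (a' - a)) + (f1 r / k + 2 * f2 r * (y / k)\<^sup>2) * ((y' - y)\<^sup>2 - (a' - a))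
        + 4 * f2 r * (x / k) * (y / k) * ((x' - x) * (y' - y))
        + (C + \<bar>D\<bar> * L) * ((\<bar>x' - x\<bar> + \<bar>y' - y\<bar> + (a' - a)) * ((x' - x)\<^sup>2 + (y' - y)\<^sup>2 + (a' - a)))"
      unfolding dx_def dy_def da_def e_def q_def by (simp add: distrib_right)
  qed
qed

lemma clamp_le_self: "ennreal (clamp 0 t \<theta>) \<le> \<theta>"
  by (simp add: clamp_def min_less_iff_disj)

lemma clamp_mono: "s \<le> t \<Longrightarrow> clamp 0 s \<theta> \<le> clamp 0 t \<theta>"
  unfolding clamp_def by (intro enn2real_mono min.mono ennreal_leI) (auto simp: min_less_iff_disj)

text \<open>
  The index \<open>m\<close> is included to keep the set nonempty for \<open>m = 0\<close>.
\<close>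

definition mesh_oscillation :: "(real \<Rightarrow> real) \<Rightarrow> real \<Rightarrow> nat \<Rightarrow> real" where
  "mesh_oscillation v n m = Max ((\<lambda>i. \<bar>v (grid 0 n m (Suc i)) - v (grid 0 n m i)\<bar>) ` {..<Suc m})"

lemma mesh_oscillation_ge:
  "i \<le> m \<Longrightarrow> \<bar>v (grid 0 n m (Suc i)) - v (grid 0 n m i)\<bar> \<le> mesh_oscillation v n m"
  unfolding mesh_oscillation_def by (intro Max_ge) auto

lemma mesh_oscillation_le:
  assumes n: "0 \<le> n" and K: "\<And>t. 0 \<le> t \<Longrightarrow> \<bar>v t\<bar> \<le> K"
  shows "mesh_oscillation v n m \<le> 2 * K"
  unfolding mesh_oscillation_def
proof (intro Max.boundedI)
  fix r assume "r \<in> (\<lambda>i. \<bar>v (grid 0 n m (Suc i)) - v (grid 0 n m i)\<bar>) ` {..<Suc m}"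
  then obtain i where r: "r = \<bar>v (grid 0 n m (Suc i)) - v (grid 0 n m i)\<bar>" by auto
  have "0 \<le> grid 0 n m (Suc i)" "0 \<le> grid 0 n m i" using n by (auto simp: grid_def)
  then show "r \<le> 2 * K" using K[of "grid 0 n m (Suc i)"] K[of "grid 0 n m i"] unfolding r by linarith
qed auto

text \<open>
  Uniform continuity on \<open>[0, 2 n]\<close>; the interval is longer than \<open>[0, n]\<close>
  because the last increment reaches one mesh width beyond \<open>n\<close>.
\<close>

lemma mesh_oscillation_tendsto:
  assumes v: "continuous_on {0..} v" and n: "0 < n"
  shows "(\<lambda>m. mesh_oscillation v n m) \<longlonglongrightarrow> 0"
proof (rule LIMSEQ_I)
  fix \<epsilon> :: real assume \<epsilon>: "0 < \<epsilon>"
  have "uniformly_continuous_on {0..2*n} v"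
    by (intro compact_uniformly_continuous continuous_on_subset[OF v]) auto
  then obtain d where d: "0 < d" "\<And>s t. s \<in> {0..2*n} \<Longrightarrow> t \<in> {0..2*n} \<Longrightarrow> \<bar>t - s\<bar> < d \<Longrightarrow> \<bar>v t - v s\<bar> < \<epsilon>"
    using \<epsilon> unfolding uniformly_continuous_on_def dist_real_def by blast
  obtain m0 :: nat where m0: "n / d < real m0" using reals_Archimedean2 by blast
  have m0_pos: "0 < real m0" using less_trans[OF divide_pos_pos[OF n d(1)] m0] .
  show "\<exists>m0. \<forall>m\<ge>m0. norm (mesh_oscillation v n m - 0) < \<epsilon>"
  proof (intro exI[of _ m0] allI impI)
    fix m assume m: "m0 \<le> m"
    have mp: "0 < real m" using m m0_pos by simp
    have "n / d < real m" using m0 m by (smt (verit) of_nat_mono)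
    then have small: "n / real m < d" using d(1) mp by (simp add: divide_less_eq mult.commute)
    have "\<bar>v (grid 0 n m (Suc i)) - v (grid 0 n m i)\<bar> < \<epsilon>" if i: "i \<le> m" for i
    proof (rule d(2))
      have diff: "grid 0 n m (Suc i) - grid 0 n m i = n / real m" by (simp add: grid_def algebra_simps add_divide_distrib)
      then show "\<bar>grid 0 n m (Suc i) - grid 0 n m i\<bar> < d" using small n mp by simp
      have pos: "0 \<le> grid 0 n m i" using n by (simp add: grid_def)
      have "grid 0 n m (Suc i) = n * (real (Suc i) / real m)" by (simp add: grid_def)
      also have "\<dots> \<le> n * 2" using i mp n by (intro mult_left_mono) (auto simp: divide_le_eq)
      finally have top: "grid 0 n m (Suc i) \<le> 2 * n" by simp
      have "grid 0 n m i \<le> grid 0 n m (Suc i)" using n by (intro grid_mono) auto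
      then show "grid 0 n m (Suc i) \<in> {0..2*n}" "grid 0 n m i \<in> {0..2*n}" using pos top by auto
    qed
    then have "mesh_oscillation v n m < \<epsilon>" unfolding mesh_oscillation_def by (subst Max_less_iff) auto
    moreover have "0 \<le> mesh_oscillation v n m" by (rule order_trans[OF abs_ge_zero mesh_oscillation_ge[OF order_refl]])
    ultimately show "norm (mesh_oscillation v n m - 0) < \<epsilon>" by simp
  qed
qed

text \<open>
  The normal form of a conformal local martingale \<open>X + \<i> Y\<close> started at
  \<open>0\<close>: the exceptional null sets have been removed, and \<open>A\<close> is the common
  quadratic variation.
\<close>

locale planar_martingale = usual_conditions P F
  for P :: "'a measure" and F :: "ennreal \<Rightarrow> 'a measure" +
  fixes X Y A :: "real \<Rightarrow> 'a \<Rightarrow> real"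
  assumes X_local: "local_martingale X" and Y_local: "local_martingale Y"
    and XX_local: "local_martingale (\<lambda>t \<omega>. (X t \<omega>)\<^sup>2 - A t \<omega>)"
    and YY_local: "local_martingale (\<lambda>t \<omega>. (Y t \<omega>)\<^sup>2 - A t \<omega>)"
    and XY_local: "local_martingale (\<lambda>t \<omega>. X t \<omega> * Y t \<omega>)"
    and A_adapted: "adapted F A" and A_continuous: "\<And>\<omega>. continuous_on {0..} (\<lambda>t. A t \<omega>)"
    and A_mono: "\<And>\<omega>. mono_on {0..} (\<lambda>t. A t \<omega>)"
    and start: "\<And>\<omega>. X 0 \<omega> = 0" "\<And>\<omega>. Y 0 \<omega> = 0" "\<And>\<omega>. A 0 \<omega> = 0"
begin

lemma XY_adapted: "adapted F X" "adapted F Y"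
  and XY_continuous: "\<And>\<omega>. continuous_on {0..} (\<lambda>t. X t \<omega>)" "\<And>\<omega>. continuous_on {0..} (\<lambda>t. Y t \<omega>)"
  using X_local Y_local by (auto simp: local_martingale_def)

lemma A_nonneg: "0 \<le> t \<Longrightarrow> 0 \<le> A t \<omega>"
  using mono_onD[OF A_mono, of 0 t \<omega>] start(3)[of \<omega>] by simp

text \<open>
  The squared modulus, divided by \<open>1 + c A\<close>; only \<open>c = 0\<close> and \<open>c =
  1\<close> are of interest.
\<close>

definition R :: "real \<Rightarrow> real \<Rightarrow> 'a \<Rightarrow> real" where
  "R c t \<omega> = ((X t \<omega>)\<^sup>2 + (Y t \<omega>)\<^sup>2) / (1 + c * A t \<omega>)"

lemma R_continuous: "0 \<le> c \<Longrightarrow> continuous_on {0..} (\<lambda>t. R c t \<omega>)"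
  unfolding R_def using XY_continuous[of \<omega>] A_continuous[of \<omega>] A_nonneg[of _ \<omega>]
  by (intro continuous_intros) (auto simp: add_nonneg_eq_0_iff)

lemma R_nonneg: "0 \<le> c \<Longrightarrow> 0 \<le> t \<Longrightarrow> 0 \<le> R c t \<omega>"
  using A_nonneg[of t \<omega>] by (simp add: R_def)

lemma R_adapted: "adapted F (R c)"
  unfolding adapted_def
proof (intro allI impI)
  fix t :: real assume t: "0 \<le> t"
  have [measurable]: "X t \<in> borel_measurable (F (ennreal t))" "Y t \<in> borel_measurable (F (ennreal t))" "A t \<in> borel_measurable (F (ennreal t))"
    using adaptedD[OF XY_adapted(1) t] adaptedD[OF XY_adapted(2) t] adaptedD[OF A_adapted t] by auto
  show "R c t \<in> borel_measurable (F (ennreal t))" unfolding R_def[abs_def] by measurable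
qed

text \<open>
  Ito's formula for \<open>f(R)\<close> between the stopping times \<open>S \<and> T\<close> and
  \<open>T\<close>, in expectation and as an inequality, so that a bound of the drift by a multiple
  of the derivative \<open>1 / (1 + c a)\<close> of \<open>u\<close> suffices. The process
  \<open>f(R) - D u(A)\<close> is expanded along a partition of \<open>[0, n]\<close>; summing over
  the partition points after \<open>S\<close> takes care of the lower stopping time at the same
  time.
\<close>

lemma ito_inequality:
  fixes f f1 f2 u :: "real \<Rightarrow> real"
  assumes T: "stopping_time F T" and S: "stopping_time F S" and Tn: "\<And>\<omega>. T \<omega> \<le> ennreal n" and n: "0 < n"
    and bounded: "\<And>t \<omega>. 0 \<le> t \<Longrightarrow> ennreal t \<le> T \<omega> \<Longrightarrow> \<bar>X t \<omega>\<bar> \<le> K \<and> \<bar>Y t \<omega>\<bar> \<le> K \<and> A t \<omega> \<le> K"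
    and c: "0 \<le> c" and L: "0 \<le> L"
    and f1: "\<And>r. 0 \<le> r \<Longrightarrow> r \<le> 2 * K\<^sup>2 \<Longrightarrow> \<bar>f1 r\<bar> \<le> L"
    and f2: "\<And>r. 0 \<le> r \<Longrightarrow> r \<le> 2 * K\<^sup>2 \<Longrightarrow> \<bar>f2 r\<bar> \<le> L"
    and taylor: "\<And>r r'. 0 \<le> r \<Longrightarrow> r \<le> 2 * K\<^sup>2 \<Longrightarrow> 0 \<le> r' \<Longrightarrow> r' \<le> 2 * K\<^sup>2 \<Longrightarrow>
       \<bar>f r' - f r - f1 r * (r' - r) - f2 r * (r' - r)\<^sup>2 / 2\<bar> \<le> L * \<bar>r' - r\<bar> ^ 3"
    and u: "\<And>a a'. 0 \<le> a \<Longrightarrow> a \<le> a' \<Longrightarrow> a' \<le> K \<Longrightarrow> \<bar>u a' - u a - (a' - a) / (1 + c * a)\<bar> \<le> L * (a' - a)\<^sup>2"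
    and meas[measurable]: "f \<in> borel_measurable borel" "f1 \<in> borel_measurable borel" "f2 \<in> borel_measurable borel" "u \<in> borel_measurable borel"
    and cont: "continuous_on {0..} f" "continuous_on {0..} u"
    and drift: "\<And>t \<omega>. 0 \<le> t \<Longrightarrow> ennreal t \<le> T \<omega> \<Longrightarrow> f1 (R c t \<omega>) * (2 - c * R c t \<omega>) + 2 * R c t \<omega> * f2 (R c t \<omega>) \<le> D"
  shows "(\<integral>\<omega>. f (stopped T (R c) n \<omega>) - f (stopped (\<lambda>\<omega>. min (S \<omega>) (T \<omega>)) (R c) n \<omega>) \<partial>P)
     \<le> D * (\<integral>\<omega>. u (stopped T A n \<omega>) - u (stopped (\<lambda>\<omega>. min (S \<omega>) (T \<omega>)) A n \<omega>) \<partial>P)"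
proof -
  define x where "x = stopped T X"
  define y where "y = stopped T Y"
  define a where "a = stopped T A"
  define k where "k t \<omega> = 1 + c * a t \<omega>" for t \<omega>
  define r where "r t \<omega> = ((x t \<omega>)\<^sup>2 + (y t \<omega>)\<^sup>2) / k t \<omega>" for t \<omega>
  define z where "z t \<omega> = f (r t \<omega>) - D * u (a t \<omega>)" for t \<omega>
  have r_eq: "r t \<omega> = stopped T (R c) t \<omega>" for t \<omega> by (simp add: r_def k_def x_def y_def a_def R_def stopped_def)
  have bd: "\<bar>x t \<omega>\<bar> \<le> K" "\<bar>y t \<omega>\<bar> \<le> K" "0 \<le> a t \<omega>" "a t \<omega> \<le> K" if "0 \<le> t" for t \<omega>
    using bounded[of "clamp 0 t (T \<omega>)" \<omega>] clamp_le_self[of t "T \<omega>"] clamp_bounds[of 0 t "T \<omega>"] that A_nonneg[of "clamp 0 t (T \<omega>)" \<omega>]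
    by (auto simp: x_def y_def a_def stopped_clamp)
  have K: "0 \<le> K" using bd(1)[of 0] abs_ge_zero order_trans by blast
  have a_mono: "a s \<omega> \<le> a t \<omega>" if "0 \<le> s" "s \<le> t" for s t \<omega>
    unfolding a_def stopped_clamp using clamp_mono[of s t "T \<omega>"] clamp_bounds[of 0 s "T \<omega>"] that
    by (intro mono_onD[OF A_mono]) auto
  have k1: "1 \<le> k t \<omega>" if "0 \<le> t" for t \<omega> using bd(3)[OF that, of \<omega>] c by (simp add: k_def)
  have r_bd: "0 \<le> r t \<omega>" "r t \<omega> \<le> 2 * K\<^sup>2" if "0 \<le> t" for t \<omega>
  proof -
    have "(x t \<omega>)\<^sup>2 \<le> K\<^sup>2" "(y t \<omega>)\<^sup>2 \<le> K\<^sup>2" using bd[OF that, of \<omega>] K by (auto simp: abs_le_square_iff[symmetric])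
    then have "r t \<omega> \<le> (2 * K\<^sup>2) / 1" unfolding r_def using k1[OF that, of \<omega>] by (intro frac_le) auto
    then show "r t \<omega> \<le> 2 * K\<^sup>2" by simp
    show "0 \<le> r t \<omega>" using k1[OF that, of \<omega>] by (simp add: r_def)
  qed
  have mx: "martingale P F x" unfolding x_def using bd(1) by (intro local_martingale_bounded[OF X_local T, where C=K]) (simp add: x_def)
  have my: "martingale P F y" unfolding y_def using bd(2) by (intro local_martingale_bounded[OF Y_local T, where C=K]) (simp add: y_def)
  have sq: "\<bar>v\<^sup>2 - b\<bar> \<le> K\<^sup>2 + K" "\<bar>v * w\<bar> \<le> K * K" if "\<bar>v\<bar> \<le> K" "\<bar>w\<bar> \<le> K" "0 \<le> b" "b \<le> K" for v w b :: real
  proof -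
    have "v\<^sup>2 \<le> K\<^sup>2" using that K by (auto simp: abs_le_square_iff[symmetric])
    then show "\<bar>v\<^sup>2 - b\<bar> \<le> K\<^sup>2 + K"
      unfolding abs_le_iff using that(3,4) K zero_le_power2[of v] zero_le_power2[of K] by (intro conjI; linarith)
    show "\<bar>v * w\<bar> \<le> K * K" unfolding abs_mult using that K by (intro mult_mono) auto
  qed
  have mxx: "martingale P F (\<lambda>t \<omega>. (x t \<omega>)\<^sup>2 - a t \<omega>)"
  proof -
    have e: "stopped T (\<lambda>t \<omega>. (X t \<omega>)\<^sup>2 - A t \<omega>) = (\<lambda>t \<omega>. (x t \<omega>)\<^sup>2 - a t \<omega>)" by (intro ext) (simp add: x_def a_def stopped_def)
    have "\<bar>stopped T (\<lambda>t \<omega>. (X t \<omega>)\<^sup>2 - A t \<omega>) t \<omega>\<bar> \<le> K\<^sup>2 + K" if t: "0 \<le> t" for t \<omega>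
      unfolding e by (rule sq(1)[OF bd(1)[OF t] bd(2)[OF t] bd(3)[OF t] bd(4)[OF t]])
    from local_martingale_bounded[OF XX_local T this] show ?thesis unfolding e .
  qed
  have myy: "martingale P F (\<lambda>t \<omega>. (y t \<omega>)\<^sup>2 - a t \<omega>)"
  proof -
    have e: "stopped T (\<lambda>t \<omega>. (Y t \<omega>)\<^sup>2 - A t \<omega>) = (\<lambda>t \<omega>. (y t \<omega>)\<^sup>2 - a t \<omega>)" by (intro ext) (simp add: y_def a_def stopped_def)
    have "\<bar>stopped T (\<lambda>t \<omega>. (Y t \<omega>)\<^sup>2 - A t \<omega>) t \<omega>\<bar> \<le> K\<^sup>2 + K" if t: "0 \<le> t" for t \<omega>
      unfolding e by (rule sq(1)[OF bd(2)[OF t] bd(1)[OF t] bd(3)[OF t] bd(4)[OF t]])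
    from local_martingale_bounded[OF YY_local T this] show ?thesis unfolding e .
  qed
  have mxy: "martingale P F (\<lambda>t \<omega>. x t \<omega> * y t \<omega>)"
  proof -
    have e: "stopped T (\<lambda>t \<omega>. X t \<omega> * Y t \<omega>) = (\<lambda>t \<omega>. x t \<omega> * y t \<omega>)" by (intro ext) (simp add: x_def y_def stopped_def)
    have "\<bar>stopped T (\<lambda>t \<omega>. X t \<omega> * Y t \<omega>) t \<omega>\<bar> \<le> K * K" if t: "0 \<le> t" for t \<omega>
      unfolding e by (rule sq(2)[OF bd(1)[OF t] bd(2)[OF t] bd(3)[OF t] bd(4)[OF t]])
    from local_martingale_bounded[OF XY_local T this] show ?thesis unfolding e .
  qed
  have ad: "adapted F x" "adapted F y" "adapted F a"
    using martingaleD(1)[OF mx] martingaleD(1)[OF my] stopped_adapted[OF A_adapted A_continuous T] by (auto simp: a_def)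
  have c_xya: "continuous_on {0..} (\<lambda>t. x t \<omega>)" "continuous_on {0..} (\<lambda>t. y t \<omega>)" "continuous_on {0..} (\<lambda>t. a t \<omega>)" for \<omega>
    unfolding x_def y_def a_def by (intro stopped_continuous XY_continuous A_continuous)+
  have c_r: "continuous_on {0..} (\<lambda>t. r t \<omega>)" for \<omega>
    unfolding r_eq by (intro stopped_continuous R_continuous c)
  have c_z: "continuous_on {0..} (\<lambda>t. z t \<omega>)" for \<omega>
    unfolding z_def using r_bd(1) bd(3)
    by (intro continuous_intros continuous_on_compose2[OF cont(1) c_r] continuous_on_compose2[OF cont(2) c_xya(3)]) auto
  obtain Bf where Bf: "\<And>v. 0 \<le> v \<Longrightarrow> v \<le> 2 * K\<^sup>2 \<Longrightarrow> \<bar>f v\<bar> \<le> Bf"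
  proof -
    have "bounded (f ` {0..2 * K\<^sup>2})"
      by (intro compact_imp_bounded compact_continuous_image continuous_on_subset[OF cont(1)]) auto
    then show ?thesis using that unfolding bounded_iff by (metis atLeastAtMost_iff imageI real_norm_def)
  qed
  obtain Bu where Bu: "\<And>v. 0 \<le> v \<Longrightarrow> v \<le> K \<Longrightarrow> \<bar>u v\<bar> \<le> Bu"
  proof -
    have "bounded (u ` {0..K})"
      by (intro compact_imp_bounded compact_continuous_image continuous_on_subset[OF cont(2)]) auto
    then show ?thesis using that unfolding bounded_iff by (metis atLeastAtMost_iff imageI real_norm_def)
  qed
  define B where "B = Bf + \<bar>D\<bar> * Bu"
  have zB: "\<bar>z t \<omega>\<bar> \<le> B" if "0 \<le> t" for t \<omega>
  proof -
    have "\<bar>z t \<omega>\<bar> \<le> \<bar>f (r t \<omega>)\<bar> + \<bar>D * u (a t \<omega>)\<bar>" unfolding z_def by (rule abs_triangle_ineq4)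
    also have "\<bar>D * u (a t \<omega>)\<bar> \<le> \<bar>D\<bar> * Bu" unfolding abs_mult using bd[OF that] by (intro mult_left_mono Bu) auto
    also have "\<bar>f (r t \<omega>)\<bar> \<le> Bf" using r_bd[OF that] by (intro Bf)
    finally show ?thesis by (simp add: B_def)
  qed
  obtain C where C: "0 \<le> C" "\<And>x y a x' y' a' k r. \<lbrakk>\<bar>x\<bar> \<le> K; \<bar>y\<bar> \<le> K; \<bar>x'\<bar> \<le> K; \<bar>y'\<bar> \<le> K; 0 \<le> a; a \<le> a'; a' \<le> K;
      k = 1 + c * a; r = (x\<^sup>2 + y\<^sup>2) / k; f1 r * (2 - c * r) + 2 * r * f2 r \<le> D\<rbrakk> \<Longrightarrow>
     (f ((x'\<^sup>2 + y'\<^sup>2) / (1 + c * a')) - D * u a') - (f r - D * u a)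
      \<le> 2 * f1 r * x / k * (x' - x) + 2 * f1 r * y / k * (y' - y)
        + (f1 r / k + 2 * f2 r * (x / k)\<^sup>2) * ((x' - x)\<^sup>2 - (a' - a)) + (f1 r / k + 2 * f2 r * (y / k)\<^sup>2) * ((y' - y)\<^sup>2 - (a' - a))
        + 4 * f2 r * (x / k) * (y / k) * ((x' - x) * (y' - y))
        + C * ((\<bar>x' - x\<bar> + \<bar>y' - y\<bar> + (a' - a)) * ((x' - x)\<^sup>2 + (y' - y)\<^sup>2 + (a' - a)))"
    using drift_step[OF K c L f1 f2 taylor u, of D] by blast
  have sqle: "v\<^sup>2 \<le> b\<^sup>2" if "\<bar>v\<bar> \<le> b" for v b :: real
    using power_mono[OF that, of 2] by simp
  define tt where "tt m i = grid 0 n m i" for m i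
  have n0: "0 \<le> n" using n by simp
  have tt0: "0 \<le> tt m i" for m i using n by (simp add: tt_def grid_def)
  have tt_mono: "tt m i \<le> tt m (Suc i)" for m i unfolding tt_def using n0 by (intro grid_mono) auto
  have xm: "x (tt m i) \<in> borel_measurable (F (ennreal (tt m i)))" "y (tt m i) \<in> borel_measurable (F (ennreal (tt m i)))"
    "a (tt m i) \<in> borel_measurable (F (ennreal (tt m i)))" for m i
    using adaptedD[OF ad(1) tt0] adaptedD[OF ad(2) tt0] adaptedD[OF ad(3) tt0] by auto
  have xP[measurable]: "x (tt m i) \<in> borel_measurable P" "y (tt m i) \<in> borel_measurable P" "a (tt m i) \<in> borel_measurable P" for m i
    using xm[of m i] measurable_P by blast+
  have kP[measurable]: "k (tt m i) \<in> borel_measurable P" "r (tt m i) \<in> borel_measurable P" "z (tt m i) \<in> borel_measurable P" for m i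
    unfolding k_def[abs_def] r_def[abs_def] z_def[abs_def] by measurable
  define ind where "ind m i \<omega> = (of_bool (S \<omega> \<le> ennreal (tt m i)) :: real)" for m i \<omega>
  have ind01: "ind m i \<omega> = 0 \<or> ind m i \<omega> = 1" for m i \<omega> by (simp add: ind_def)
  have indm: "ind m i \<in> borel_measurable (F (ennreal (tt m i)))" for m i
  proof -
    have [measurable]: "Measurable.pred (F (ennreal (tt m i))) (\<lambda>\<omega>. S \<omega> \<le> ennreal (tt m i))" by (rule stopping_timeD[OF S])
    show ?thesis unfolding ind_def[abs_def] by measurable
  qed
  have indP[measurable]: "ind m i \<in> borel_measurable P" for m i by (rule measurable_P[OF indm])
  define I where "I m \<omega> = (\<Sum>i<m. ind m i \<omega> * (z (tt m (Suc i)) \<omega> - z (tt m i) \<omega>))" for m \<omega>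
  have [measurable]: "I m \<in> borel_measurable P" for m unfolding I_def[abs_def] by measurable
  define J where "J m \<omega> = (\<Sum>i<m. of_bool (ennreal (tt m i) < S \<omega>) * (z (tt m (Suc i)) \<omega> - z (tt m i) \<omega>))" for m \<omega>
  have I_eq: "I m \<omega> = z n \<omega> - z 0 \<omega> - J m \<omega>" if "0 < m" for m \<omega>
  proof -
    have "z n \<omega> - z 0 \<omega> = (\<Sum>i<m. z (tt m (Suc i)) \<omega> - z (tt m i) \<omega>)"
      using sum_lessThan_telescope[of "\<lambda>i. z (tt m i) \<omega>" m] that by (simp add: tt_def)
    then have "z n \<omega> - z 0 \<omega> - J m \<omega> = (\<Sum>i<m. (z (tt m (Suc i)) \<omega> - z (tt m i) \<omega>) - of_bool (ennreal (tt m i) < S \<omega>) * (z (tt m (Suc i)) \<omega> - z (tt m i) \<omega>))"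
      unfolding J_def by (simp only: sum_subtractf)
    also have "\<dots> = I m \<omega>" unfolding I_def ind_def by (intro sum.cong refl) (auto simp: not_less)
    finally show ?thesis by simp
  qed
  have Jlim: "(\<lambda>m. J m \<omega>) \<longlonglongrightarrow> z (clamp 0 n (S \<omega>)) \<omega> - z 0 \<omega>" for \<omega>
    unfolding J_def tt_def by (rule grid_telescope_tendsto[OF order_refl n0 c_z])
  have Ilim: "(\<lambda>m. I m \<omega>) \<longlonglongrightarrow> z n \<omega> - z (clamp 0 n (S \<omega>)) \<omega>" for \<omega>
  proof -
    have "(\<lambda>m. z n \<omega> - z 0 \<omega> - J m \<omega>) \<longlonglongrightarrow> z n \<omega> - z 0 \<omega> - (z (clamp 0 n (S \<omega>)) \<omega> - z 0 \<omega>)"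
      by (intro tendsto_intros Jlim)
    then have "(\<lambda>m. z n \<omega> - z 0 \<omega> - J m \<omega>) \<longlonglongrightarrow> z n \<omega> - z (clamp 0 n (S \<omega>)) \<omega>" by simp
    then show ?thesis
    proof (rule Lim_transform_eventually)
      show "\<forall>\<^sub>F m in sequentially. z n \<omega> - z 0 \<omega> - J m \<omega> = I m \<omega>"
        using eventually_gt_at_top[of 0] by eventually_elim (simp only: I_eq)
    qed
  qed
  have B0: "0 \<le> B" using zB[of 0] abs_ge_zero order_trans by blast
  have Ibd: "\<bar>I m \<omega>\<bar> \<le> 4 * B" for m \<omega>
  proof (cases "m = 0")
    case True then show ?thesis using B0 by (simp add: I_def)
  next
    case False
    then have m: "0 < m" by simp
    have "\<bar>J m \<omega>\<bar> \<le> 2 * B" unfolding J_def tt_def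
      by (rule grid_telescope_bound[OF order_refl n0 m]) (intro zB)
    then show ?thesis using zB[OF n0, of \<omega>] zB[of 0 \<omega>] I_eq[OF m, of \<omega>] by (simp add: abs_le_iff)
  qed
  have zlim_meas[measurable]: "(\<lambda>\<omega>. z n \<omega> - z (clamp 0 n (S \<omega>)) \<omega>) \<in> borel_measurable P"
    by (rule borel_measurable_LIMSEQ_real[where u=I, OF Ilim]) measurable
  have EI: "(\<lambda>m. \<integral>\<omega>. I m \<omega> \<partial>P) \<longlonglongrightarrow> (\<integral>\<omega>. z n \<omega> - z (clamp 0 n (S \<omega>)) \<omega> \<partial>P)"
    by (rule integral_dominated_convergence[where w="\<lambda>_. 4 * B"]) (auto intro!: AE_I2 Ilim Ibd)
  define e where "e m i \<omega> = \<bar>x (tt m (Suc i)) \<omega> - x (tt m i) \<omega>\<bar> + \<bar>y (tt m (Suc i)) \<omega> - y (tt m i) \<omega>\<bar> + (a (tt m (Suc i)) \<omega> - a (tt m i) \<omega>)" for m i \<omega>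
  define q where "q m i \<omega> = (x (tt m (Suc i)) \<omega> - x (tt m i) \<omega>)\<^sup>2 + (y (tt m (Suc i)) \<omega> - y (tt m i) \<omega>)\<^sup>2 + (a (tt m (Suc i)) \<omega> - a (tt m i) \<omega>)" for m i \<omega>
  define W where "W m \<omega> = (\<Sum>i<m. e m i \<omega> * q m i \<omega>)" for m \<omega>
  have da: "0 \<le> a (tt m (Suc i)) \<omega> - a (tt m i) \<omega>" for m i \<omega> using a_mono[OF tt0 tt_mono] by simp
  have e0: "0 \<le> e m i \<omega>" and q0: "0 \<le> q m i \<omega>" for m i \<omega> using da by (auto simp: e_def q_def)
  have e5: "e m i \<omega> \<le> 5 * K" for m i \<omega>
    using bd[OF tt0, of m "Suc i" \<omega>] bd[OF tt0, of m i \<omega>] unfolding e_def by linarith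
  have q9: "q m i \<omega> \<le> 8 * K\<^sup>2 + K" for m i \<omega>
  proof -
    have dd: "\<bar>x (tt m (Suc i)) \<omega> - x (tt m i) \<omega>\<bar> \<le> 2 * K" "\<bar>y (tt m (Suc i)) \<omega> - y (tt m i) \<omega>\<bar> \<le> 2 * K"
      using bd(1,2)[OF tt0, of m "Suc i" \<omega>] bd(1,2)[OF tt0, of m i \<omega>] by linarith+
    have "(x (tt m (Suc i)) \<omega> - x (tt m i) \<omega>)\<^sup>2 \<le> (2 * K)\<^sup>2" "(y (tt m (Suc i)) \<omega> - y (tt m i) \<omega>)\<^sup>2 \<le> (2 * K)\<^sup>2"
      by (rule sqle[OF dd(1)], rule sqle[OF dd(2)])
    moreover have "a (tt m (Suc i)) \<omega> - a (tt m i) \<omega> \<le> K"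
      using bd[OF tt0, of m "Suc i" \<omega>] bd[OF tt0, of m i \<omega>] by simp
    ultimately show ?thesis by (simp add: q_def power_mult_distrib)
  qed
  have eqP[measurable]: "e m i \<in> borel_measurable P" "q m i \<in> borel_measurable P" "W m \<in> borel_measurable P" for m i
    unfolding e_def[abs_def] q_def[abs_def] W_def[abs_def] by measurable
  have W_int: "integrable P (W m)" for m
  proof -
    have "integrable P (\<lambda>\<omega>. e m i \<omega> * q m i \<omega>)" for i
    proof (rule integrable_bounded)
      show "\<bar>e m i \<omega> * q m i \<omega>\<bar> \<le> 5 * K * (8 * K\<^sup>2 + K)" for \<omega>
        using e0[of m i \<omega>] q0[of m i \<omega>] e5[of m i \<omega>] q9[of m i \<omega>] K by (simp add: abs_mult) (intro mult_mono, auto)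
    qed measurable
    then show ?thesis unfolding W_def by simp
  qed
  define lin where "lin m i \<omega> = (let t = tt m i; t' = tt m (Suc i) in
      2 * f1 (r t \<omega>) * x t \<omega> / k t \<omega> * (x t' \<omega> - x t \<omega>) + 2 * f1 (r t \<omega>) * y t \<omega> / k t \<omega> * (y t' \<omega> - y t \<omega>)
        + (f1 (r t \<omega>) / k t \<omega> + 2 * f2 (r t \<omega>) * (x t \<omega> / k t \<omega>)\<^sup>2) * ((x t' \<omega> - x t \<omega>)\<^sup>2 - (a t' \<omega> - a t \<omega>))
        + (f1 (r t \<omega>) / k t \<omega> + 2 * f2 (r t \<omega>) * (y t \<omega> / k t \<omega>)\<^sup>2) * ((y t' \<omega> - y t \<omega>)\<^sup>2 - (a t' \<omega> - a t \<omega>))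
        + 4 * f2 (r t \<omega>) * (x t \<omega> / k t \<omega>) * (y t \<omega> / k t \<omega>) * ((x t' \<omega> - x t \<omega>) * (y t' \<omega> - y t \<omega>)))" for m i \<omega>
  \<comment> \<open>Up to the remainder, an increment of \<open>z\<close> is bounded by terms of mean zero.\<close>
  have step: "z (tt m (Suc i)) \<omega> - z (tt m i) \<omega> \<le> lin m i \<omega> + C * (e m i \<omega> * q m i \<omega>)" for m i \<omega>
  proof -
    have dr: "f1 (r (tt m i) \<omega>) * (2 - c * r (tt m i) \<omega>) + 2 * r (tt m i) \<omega> * f2 (r (tt m i) \<omega>) \<le> D"
      unfolding r_eq stopped_clamp using clamp_bounds[OF order_refl tt0, of m i "T \<omega>"] by (intro drift clamp_le_self) auto
    have r': "r (tt m (Suc i)) \<omega> = ((x (tt m (Suc i)) \<omega>)\<^sup>2 + (y (tt m (Suc i)) \<omega>)\<^sup>2) / (1 + c * a (tt m (Suc i)) \<omega>)"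
      by (simp add: r_def k_def)
    show ?thesis
      unfolding z_def lin_def Let_def e_def q_def r'
      by (rule C(2)[OF bd(1)[OF tt0] bd(2)[OF tt0] bd(1)[OF tt0] bd(2)[OF tt0] bd(3)[OF tt0] a_mono[OF tt0 tt_mono] bd(4)[OF tt0]
         k_def r_def dr])
  qed
  have lin0: "integrable P (\<lambda>\<omega>. ind m i \<omega> * lin m i \<omega>) \<and> (\<integral>\<omega>. ind m i \<omega> * lin m i \<omega> \<partial>P) = 0" for m i
  proof -
    let ?t = "tt m i" and ?t' = "tt m (Suc i)"
    let ?G = "F (ennreal ?t)"
    note st = tt0[of m i] tt_mono[of m i]
    have [measurable]: "x ?t \<in> borel_measurable ?G" "y ?t \<in> borel_measurable ?G" "a ?t \<in> borel_measurable ?G" "ind m i \<in> borel_measurable ?G"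
      using xm[of m i] indm[of m i] by auto
    have [measurable]: "k ?t \<in> borel_measurable ?G" unfolding k_def[abs_def] by measurable
    have [measurable]: "r ?t \<in> borel_measurable ?G" unfolding r_def[abs_def] by measurable
    have F1: "\<bar>f1 (r ?t \<omega>)\<bar> \<le> L" "\<bar>f2 (r ?t \<omega>)\<bar> \<le> L" for \<omega> using r_bd[OF tt0] by (auto intro: f1 f2)
    have divk: "\<bar>v / k ?t \<omega>\<bar> \<le> \<bar>v\<bar>" for v \<omega>
    proof -
      have "\<bar>v\<bar> / k ?t \<omega> \<le> \<bar>v\<bar> / 1" using k1[OF tt0, of m i \<omega>] by (intro divide_left_mono) auto
      then show ?thesis using k1[OF tt0, of m i \<omega>] by simp
    qed
    have xk: "\<bar>x ?t \<omega> / k ?t \<omega>\<bar> \<le> K" "\<bar>y ?t \<omega> / k ?t \<omega>\<bar> \<le> K" for \<omega>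
      using order_trans[OF divk bd(1)[OF tt0]] order_trans[OF divk bd(2)[OF tt0]] by auto
    have xk2: "\<bar>(x ?t \<omega> / k ?t \<omega>)\<^sup>2\<bar> \<le> K\<^sup>2" "\<bar>(y ?t \<omega> / k ?t \<omega>)\<^sup>2\<bar> \<le> K\<^sup>2" for \<omega>
      unfolding abs_power2 by (rule sqle[OF xk(1)], rule sqle[OF xk(2)])
    have ib: "\<bar>ind m i \<omega> * v\<bar> \<le> \<bar>v\<bar>" for \<omega> v using ind01[of m i \<omega>] by auto
    have h1: "\<bar>ind m i \<omega> * (2 * f1 (r ?t \<omega>) * (x ?t \<omega> / k ?t \<omega>))\<bar> \<le> 2 * L * K"
      "\<bar>ind m i \<omega> * (2 * f1 (r ?t \<omega>) * (y ?t \<omega> / k ?t \<omega>))\<bar> \<le> 2 * L * K" for \<omega>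
    proof -
      have *: "\<bar>2 * f1 (r ?t \<omega>) * v\<bar> \<le> 2 * L * K" if "\<bar>v\<bar> \<le> K" for v
        unfolding abs_mult using that F1(1)[of \<omega>] L by (intro mult_mono) auto
      show "\<bar>ind m i \<omega> * (2 * f1 (r ?t \<omega>) * (x ?t \<omega> / k ?t \<omega>))\<bar> \<le> 2 * L * K"
        by (rule order_trans[OF ib *[OF xk(1)]])
      show "\<bar>ind m i \<omega> * (2 * f1 (r ?t \<omega>) * (y ?t \<omega> / k ?t \<omega>))\<bar> \<le> 2 * L * K"
        by (rule order_trans[OF ib *[OF xk(2)]])
    qed
    have h3: "\<bar>ind m i \<omega> * (f1 (r ?t \<omega>) / k ?t \<omega> + 2 * f2 (r ?t \<omega>) * (x ?t \<omega> / k ?t \<omega>)\<^sup>2)\<bar> \<le> L + 2 * L * K\<^sup>2"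
      "\<bar>ind m i \<omega> * (f1 (r ?t \<omega>) / k ?t \<omega> + 2 * f2 (r ?t \<omega>) * (y ?t \<omega> / k ?t \<omega>)\<^sup>2)\<bar> \<le> L + 2 * L * K\<^sup>2" for \<omega>
    proof -
      have *: "\<bar>2 * f2 (r ?t \<omega>) * v\<bar> \<le> 2 * L * K\<^sup>2" if "\<bar>v\<bar> \<le> K\<^sup>2" for v
        unfolding abs_mult using that F1(2)[of \<omega>] L by (intro mult_mono) auto
      show "\<bar>ind m i \<omega> * (f1 (r ?t \<omega>) / k ?t \<omega> + 2 * f2 (r ?t \<omega>) * (x ?t \<omega> / k ?t \<omega>)\<^sup>2)\<bar> \<le> L + 2 * L * K\<^sup>2"
        by (rule order_trans[OF ib], rule order_trans[OF abs_triangle_ineq], intro add_mono * xk2 order_trans[OF divk F1(1)])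
      show "\<bar>ind m i \<omega> * (f1 (r ?t \<omega>) / k ?t \<omega> + 2 * f2 (r ?t \<omega>) * (y ?t \<omega> / k ?t \<omega>)\<^sup>2)\<bar> \<le> L + 2 * L * K\<^sup>2"
        by (rule order_trans[OF ib], rule order_trans[OF abs_triangle_ineq], intro add_mono * xk2 order_trans[OF divk F1(1)])
    qed
    have h5: "\<bar>ind m i \<omega> * (4 * f2 (r ?t \<omega>) * (x ?t \<omega> / k ?t \<omega>) * (y ?t \<omega> / k ?t \<omega>))\<bar> \<le> 4 * L * K * K" for \<omega>
    proof (rule order_trans[OF ib])
      show "\<bar>4 * f2 (r ?t \<omega>) * (x ?t \<omega> / k ?t \<omega>) * (y ?t \<omega> / k ?t \<omega>)\<bar> \<le> 4 * L * K * K"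
        unfolding abs_mult using xk[of \<omega>] F1(2)[of \<omega>] L K by (intro mult_mono) auto
    qed
    note i1 = martingale_increment[OF mx st _ h1(1)]
    note i2 = martingale_increment[OF my st _ h1(2)]
    note i3 = squared_increment[OF mx mxx st _ h3(1) bd(1)]
    note i4 = squared_increment[OF my myy st _ h3(2) bd(2)]
    note i5 = product_increment[OF mx my mxy st _ h5 bd(1) bd(2)]
    have eq: "ind m i \<omega> * lin m i \<omega> =
        ind m i \<omega> * (2 * f1 (r ?t \<omega>) * (x ?t \<omega> / k ?t \<omega>)) * (x ?t' \<omega> - x ?t \<omega>)
      + ind m i \<omega> * (2 * f1 (r ?t \<omega>) * (y ?t \<omega> / k ?t \<omega>)) * (y ?t' \<omega> - y ?t \<omega>)
      + ind m i \<omega> * (f1 (r ?t \<omega>) / k ?t \<omega> + 2 * f2 (r ?t \<omega>) * (x ?t \<omega> / k ?t \<omega>)\<^sup>2) * ((x ?t' \<omega> - x ?t \<omega>)\<^sup>2 - (a ?t' \<omega> - a ?t \<omega>))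
      + ind m i \<omega> * (f1 (r ?t \<omega>) / k ?t \<omega> + 2 * f2 (r ?t \<omega>) * (y ?t \<omega> / k ?t \<omega>)\<^sup>2) * ((y ?t' \<omega> - y ?t \<omega>)\<^sup>2 - (a ?t' \<omega> - a ?t \<omega>))
      + ind m i \<omega> * (4 * f2 (r ?t \<omega>) * (x ?t \<omega> / k ?t \<omega>) * (y ?t \<omega> / k ?t \<omega>)) * ((x ?t' \<omega> - x ?t \<omega>) * (y ?t' \<omega> - y ?t \<omega>))" for \<omega>
      using ind01[of m i \<omega>] by (elim disjE) (simp_all add: lin_def Let_def)
    have M: "(\<lambda>\<omega>. ind m i \<omega> * (2 * f1 (r ?t \<omega>) * (x ?t \<omega> / k ?t \<omega>))) \<in> borel_measurable ?G"
      "(\<lambda>\<omega>. ind m i \<omega> * (2 * f1 (r ?t \<omega>) * (y ?t \<omega> / k ?t \<omega>))) \<in> borel_measurable ?G"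
      "(\<lambda>\<omega>. ind m i \<omega> * (f1 (r ?t \<omega>) / k ?t \<omega> + 2 * f2 (r ?t \<omega>) * (x ?t \<omega> / k ?t \<omega>)\<^sup>2)) \<in> borel_measurable ?G"
      "(\<lambda>\<omega>. ind m i \<omega> * (f1 (r ?t \<omega>) / k ?t \<omega> + 2 * f2 (r ?t \<omega>) * (y ?t \<omega> / k ?t \<omega>)\<^sup>2)) \<in> borel_measurable ?G"
      "(\<lambda>\<omega>. ind m i \<omega> * (4 * f2 (r ?t \<omega>) * (x ?t \<omega> / k ?t \<omega>) * (y ?t \<omega> / k ?t \<omega>))) \<in> borel_measurable ?G"
      by measurable
    show ?thesis unfolding eq using i1[OF M(1)] i2[OF M(2)] i3[OF M(3)] i4[OF M(4)] i5[OF M(5)] by simp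
  qed
  have EI_le: "(\<integral>\<omega>. I m \<omega> \<partial>P) \<le> C * (\<integral>\<omega>. W m \<omega> \<partial>P)" for m
  proof -
    have "(\<integral>\<omega>. I m \<omega> \<partial>P) \<le> (\<integral>\<omega>. (\<Sum>i<m. ind m i \<omega> * lin m i \<omega>) + C * W m \<omega> \<partial>P)"
    proof (rule integral_mono)
      show "integrable P (I m)" by (rule integrable_bounded[OF _ Ibd]) measurable
      show "integrable P (\<lambda>\<omega>. (\<Sum>i<m. ind m i \<omega> * lin m i \<omega>) + C * W m \<omega>)" using lin0 W_int by auto
      fix \<omega>
      have "I m \<omega> \<le> (\<Sum>i<m. ind m i \<omega> * lin m i \<omega> + C * (e m i \<omega> * q m i \<omega>))"
        unfolding I_def
      proof (intro sum_mono)
        fix i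
        have "0 \<le> C * (e m i \<omega> * q m i \<omega>)" using C(1) e0 q0 by simp
        then show "ind m i \<omega> * (z (tt m (Suc i)) \<omega> - z (tt m i) \<omega>) \<le> ind m i \<omega> * lin m i \<omega> + C * (e m i \<omega> * q m i \<omega>)"
          using step[of m i \<omega>] ind01[of m i \<omega>] by auto
      qed
      then show "I m \<omega> \<le> (\<Sum>i<m. ind m i \<omega> * lin m i \<omega>) + C * W m \<omega>"
        by (simp add: W_def sum.distrib sum_distrib_left)
    qed
    also have "\<dots> = (\<integral>\<omega>. (\<Sum>i<m. ind m i \<omega> * lin m i \<omega>) \<partial>P) + (\<integral>\<omega>. C * W m \<omega> \<partial>P)"
      using lin0 W_int by (intro Bochner_Integration.integral_add) auto
    also have "(\<integral>\<omega>. (\<Sum>i<m. ind m i \<omega> * lin m i \<omega>) \<partial>P) = 0" using lin0 by (subst Bochner_Integration.integral_sum) auto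
    finally show ?thesis by simp
  qed
  define w where "w m \<omega> = mesh_oscillation (\<lambda>t. x t \<omega>) n m + mesh_oscillation (\<lambda>t. y t \<omega>) n m + mesh_oscillation (\<lambda>t. a t \<omega>) n m" for m \<omega>
  have w_meas[measurable]: "w m \<in> borel_measurable P" for m
    unfolding w_def mesh_oscillation_def tt_def[symmetric] by (intro borel_measurable_add borel_measurable_Max) auto
  have w_ge: "e m i \<omega> \<le> w m \<omega>" if "i \<le> m" for m i \<omega>
    unfolding w_def e_def tt_def by (intro add_mono mesh_oscillation_ge order_trans[OF abs_ge_self mesh_oscillation_ge] that)
  have w_bd: "0 \<le> w m \<omega>" "w m \<omega> \<le> 6 * K" for m \<omega>
  proof -
    show "0 \<le> w m \<omega>" by (rule order_trans[OF e0 w_ge[OF order_refl]])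
    have "mesh_oscillation (\<lambda>t. v t) n m \<le> 2 * K" if "\<And>t. 0 \<le> t \<Longrightarrow> \<bar>v t\<bar> \<le> K" for v
      by (rule mesh_oscillation_le[OF n0 that])
    from this[of "\<lambda>t. x t \<omega>"] this[of "\<lambda>t. y t \<omega>"] this[of "\<lambda>t. a t \<omega>"] show "w m \<omega> \<le> 6 * K"
      unfolding w_def using bd by (simp add: abs_of_nonneg)
  qed
  have w_lim: "(\<lambda>m. w m \<omega>) \<longlonglongrightarrow> 0" for \<omega>
    unfolding w_def using c_xya[of \<omega>] n by (intro tendsto_add_zero mesh_oscillation_tendsto)
  have w2_int: "integrable P (\<lambda>\<omega>. (w m \<omega>)\<^sup>2)" for m
  proof (rule integrable_bounded)
    show "\<bar>(w m \<omega>)\<^sup>2\<bar> \<le> (6 * K)\<^sup>2" for \<omega> using power_mono[OF w_bd(2)[of m \<omega>] w_bd(1)[of m \<omega>], of 2] by simp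
  qed measurable
  have "(\<lambda>m. \<integral>\<omega>. (w m \<omega>)\<^sup>2 \<partial>P) \<longlonglongrightarrow> (\<integral>\<omega>. 0 \<partial>P)"
  proof (rule integral_dominated_convergence[where w="\<lambda>_. (6 * K)\<^sup>2"])
    show "AE \<omega> in P. (\<lambda>m. (w m \<omega>)\<^sup>2) \<longlonglongrightarrow> 0" using tendsto_power[OF w_lim, of _ 2] by (intro AE_I2) simp
    show "AE \<omega> in P. norm ((w m \<omega>)\<^sup>2) \<le> (6 * K)\<^sup>2" for m
      using power_mono[OF w_bd(2) w_bd(1), of m _ 2] by (intro AE_I2) simp
  qed auto
  then have Ew: "(\<lambda>m. \<integral>\<omega>. (w m \<omega>)\<^sup>2 \<partial>P) \<longlonglongrightarrow> 0" by simp
  define Q where "Q m \<omega> = (\<Sum>i<m. q m i \<omega>)" for m \<omega>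
  have Qm[measurable]: "Q m \<in> borel_measurable P" for m unfolding Q_def[abs_def] by measurable
  have Q0: "0 \<le> Q m \<omega>" for m \<omega> unfolding Q_def by (intro sum_nonneg q0)
  define C3 where "C3 = 3 * (2 * (6 * K\<^sup>2 + 16 * K ^ 3) + K\<^sup>2)"
  have sumsq_int: "integrable P (\<lambda>\<omega>. (\<Sum>i<m. (v (tt m (Suc i)) \<omega> - v (tt m i) \<omega>)\<^sup>2)\<^sup>2)"
    if "\<And>t \<omega>. 0 \<le> t \<Longrightarrow> \<bar>v t \<omega>\<bar> \<le> K" "\<And>i. v (tt m i) \<in> borel_measurable P" for v m
  proof (rule integrable_bounded)
    have [measurable]: "v (tt m i) \<in> borel_measurable P" for i by (rule that)
    show "(\<lambda>\<omega>. (\<Sum>i<m. (v (tt m (Suc i)) \<omega> - v (tt m i) \<omega>)\<^sup>2)\<^sup>2) \<in> borel_measurable P" by measurable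
    fix \<omega>
    have "(v (tt m (Suc i)) \<omega> - v (tt m i) \<omega>)\<^sup>2 \<le> (2 * K)\<^sup>2" for i
      using that(1)[OF tt0, of m i \<omega>] that(1)[OF tt0, of m "Suc i" \<omega>] by (intro sqle) linarith
    then have "(\<Sum>i<m. (v (tt m (Suc i)) \<omega> - v (tt m i) \<omega>)\<^sup>2) \<le> (\<Sum>i<m. (2 * K)\<^sup>2)" by (intro sum_mono)
    then have "(\<Sum>i<m. (v (tt m (Suc i)) \<omega> - v (tt m i) \<omega>)\<^sup>2)\<^sup>2 \<le> (\<Sum>i<m. (2 * K)\<^sup>2)\<^sup>2"
      by (intro power_mono sum_nonneg) auto
    then show "\<bar>(\<Sum>i<m. (v (tt m (Suc i)) \<omega> - v (tt m i) \<omega>)\<^sup>2)\<^sup>2\<bar> \<le> (\<Sum>i<m. (2 * K)\<^sup>2)\<^sup>2" by simp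
  qed
  have EQ: "integrable P (\<lambda>\<omega>. (Q m \<omega>)\<^sup>2)" "(\<integral>\<omega>. (Q m \<omega>)\<^sup>2 \<partial>P) \<le> C3" for m
  proof -
    define Qx where "Qx \<omega> = (\<Sum>i<m. (x (tt m (Suc i)) \<omega> - x (tt m i) \<omega>)\<^sup>2)" for \<omega>
    define Qy where "Qy \<omega> = (\<Sum>i<m. (y (tt m (Suc i)) \<omega> - y (tt m i) \<omega>)\<^sup>2)" for \<omega>
    define Qa where "Qa \<omega> = (\<Sum>i<m. a (tt m (Suc i)) \<omega> - a (tt m i) \<omega>)" for \<omega>
    have Q_eq: "Q m \<omega> = Qx \<omega> + Qy \<omega> + Qa \<omega>" for \<omega> by (simp add: Q_def q_def Qx_def Qy_def Qa_def sum.distrib)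
    have Qa: "0 \<le> Qa \<omega>" "Qa \<omega> \<le> K" for \<omega>
    proof -
      show "0 \<le> Qa \<omega>" unfolding Qa_def by (intro sum_nonneg da)
      show "Qa \<omega> \<le> K" unfolding Qa_def sum_lessThan_telescope[of "\<lambda>i. a (tt m i) \<omega>"] using bd(3)[OF tt0, of m 0 \<omega>] bd(4)[OF tt0, of m m \<omega>] by linarith
    qed
    have ix: "integrable P (\<lambda>\<omega>. (Qx \<omega>)\<^sup>2)" unfolding Qx_def by (intro sumsq_int bd) auto
    have iy: "integrable P (\<lambda>\<omega>. (Qy \<omega>)\<^sup>2)" unfolding Qy_def by (intro sumsq_int bd) auto
    have Ex: "(\<integral>\<omega>. (Qx \<omega>)\<^sup>2 \<partial>P) \<le> 6 * K\<^sup>2 + 16 * K ^ 3"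
      unfolding Qx_def tt_def by (rule sum_of_squares_second_moment[OF mx mxx ad(3) bd(1) bd(3) bd(4) a_mono n0])
    have Ey: "(\<integral>\<omega>. (Qy \<omega>)\<^sup>2 \<partial>P) \<le> 6 * K\<^sup>2 + 16 * K ^ 3"
      unfolding Qy_def tt_def by (rule sum_of_squares_second_moment[OF my myy ad(3) bd(2) bd(3) bd(4) a_mono n0])
    have le: "(Q m \<omega>)\<^sup>2 \<le> 3 * ((Qx \<omega>)\<^sup>2 + (Qy \<omega>)\<^sup>2 + K\<^sup>2)" for \<omega>
    proof -
      have "(Q m \<omega>)\<^sup>2 \<le> 3 * ((Qx \<omega>)\<^sup>2 + (Qy \<omega>)\<^sup>2 + (Qa \<omega>)\<^sup>2)"
        unfolding Q_eq using sum_squares_bound[of "Qx \<omega>" "Qy \<omega>"] sum_squares_bound[of "Qx \<omega>" "Qa \<omega>"] sum_squares_bound[of "Qy \<omega>" "Qa \<omega>"]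
        by (simp add: power2_eq_square algebra_simps)
      also have "\<dots> \<le> 3 * ((Qx \<omega>)\<^sup>2 + (Qy \<omega>)\<^sup>2 + K\<^sup>2)" using Qa by (intro mult_left_mono add_left_mono power_mono) auto
      finally show ?thesis .
    qed
    have i3: "integrable P (\<lambda>\<omega>. 3 * ((Qx \<omega>)\<^sup>2 + (Qy \<omega>)\<^sup>2 + K\<^sup>2))" using ix iy by auto
    show iQ: "integrable P (\<lambda>\<omega>. (Q m \<omega>)\<^sup>2)"
      by (rule Bochner_Integration.integrable_bound[OF i3]) (auto intro!: AE_I2 order_trans[OF le])
    have "(\<integral>\<omega>. (Q m \<omega>)\<^sup>2 \<partial>P) \<le> (\<integral>\<omega>. 3 * ((Qx \<omega>)\<^sup>2 + (Qy \<omega>)\<^sup>2 + K\<^sup>2) \<partial>P)"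
      by (rule integral_mono[OF iQ i3 le])
    also have "\<dots> = 3 * ((\<integral>\<omega>. (Qx \<omega>)\<^sup>2 \<partial>P) + (\<integral>\<omega>. (Qy \<omega>)\<^sup>2 \<partial>P) + K\<^sup>2)" using ix iy by (simp add: prob_space)
    also have "\<dots> \<le> C3" using Ex Ey by (simp add: C3_def)
    finally show "(\<integral>\<omega>. (Q m \<omega>)\<^sup>2 \<partial>P) \<le> C3" .
  qed
  \<comment> \<open>The weight \<open>j\<close> in \<open>2 w Q \<le> j w\<^sup>2 + Q\<^sup>2 / j\<close> is sent to infinity only after the mesh has been refined.\<close>
  have EW: "(\<integral>\<omega>. W m \<omega> \<partial>P) \<le> (j * (\<integral>\<omega>. (w m \<omega>)\<^sup>2 \<partial>P) + C3 / j) / 2" if j: "0 < j" for m j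
  proof -
    have "(\<integral>\<omega>. W m \<omega> \<partial>P) \<le> (\<integral>\<omega>. (j * (w m \<omega>)\<^sup>2 + (Q m \<omega>)\<^sup>2 / j) / 2 \<partial>P)"
    proof (rule integral_mono[OF W_int])
      show "integrable P (\<lambda>\<omega>. (j * (w m \<omega>)\<^sup>2 + (Q m \<omega>)\<^sup>2 / j) / 2)" using w2_int EQ(1) by auto
      fix \<omega>
      have "W m \<omega> \<le> (\<Sum>i<m. w m \<omega> * q m i \<omega>)" unfolding W_def by (intro sum_mono mult_right_mono w_ge q0) auto
      also have "\<dots> = w m \<omega> * Q m \<omega>" by (simp add: Q_def sum_distrib_left)
      also have "\<dots> \<le> (j * (w m \<omega>)\<^sup>2 + (Q m \<omega>)\<^sup>2 / j) / 2"
      proof -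
        have "2 * (j * w m \<omega>) * Q m \<omega> \<le> (j * w m \<omega>)\<^sup>2 + (Q m \<omega>)\<^sup>2" by (rule sum_squares_bound)
        then show ?thesis using j by (simp add: field_simps power2_eq_square)
      qed
      finally show "W m \<omega> \<le> (j * (w m \<omega>)\<^sup>2 + (Q m \<omega>)\<^sup>2 / j) / 2" .
    qed
    also have "\<dots> = (j * (\<integral>\<omega>. (w m \<omega>)\<^sup>2 \<partial>P) + (\<integral>\<omega>. (Q m \<omega>)\<^sup>2 \<partial>P) / j) / 2" using w2_int EQ(1) by simp
    also have "\<dots> \<le> (j * (\<integral>\<omega>. (w m \<omega>)\<^sup>2 \<partial>P) + C3 / j) / 2" using EQ(2)[of m] j by (simp add: divide_right_mono)
    finally show ?thesis .
  qed
  have lim_le: "(\<integral>\<omega>. z n \<omega> - z (clamp 0 n (S \<omega>)) \<omega> \<partial>P) \<le> C * ((C3 / j) / 2)" if j: "0 < j" for j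
  proof (rule LIMSEQ_le[OF EI])
    have "(\<lambda>m. C * ((j * (\<integral>\<omega>. (w m \<omega>)\<^sup>2 \<partial>P) + C3 / j) / 2)) \<longlonglongrightarrow> C * ((j * 0 + C3 / j) / 2)"
      by (intro tendsto_intros Ew) simp
    then show "(\<lambda>m. C * ((j * (\<integral>\<omega>. (w m \<omega>)\<^sup>2 \<partial>P) + C3 / j) / 2)) \<longlonglongrightarrow> C * ((C3 / j) / 2)" by simp
    show "\<exists>N. \<forall>m\<ge>N. (\<integral>\<omega>. I m \<omega> \<partial>P) \<le> C * ((j * (\<integral>\<omega>. (w m \<omega>)\<^sup>2 \<partial>P) + C3 / j) / 2)"
      using order_trans[OF EI_le mult_left_mono[OF EW[OF j] C(1)]] by blast
  qed
  have nonpos: "(\<integral>\<omega>. z n \<omega> - z (clamp 0 n (S \<omega>)) \<omega> \<partial>P) \<le> 0"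
  proof (rule tendsto_le[OF sequentially_bot _ tendsto_const])
    show "\<forall>\<^sub>F j in sequentially. (\<integral>\<omega>. z n \<omega> - z (clamp 0 n (S \<omega>)) \<omega> \<partial>P) \<le> C * ((C3 / real j) / 2)"
      using eventually_gt_at_top[of 0] by eventually_elim (rule lim_le, simp)
    have "(\<lambda>j. C * ((C3 / real j) / 2)) \<longlonglongrightarrow> C * (0 / 2)" by (intro tendsto_intros lim_const_over_n) simp
    then show "(\<lambda>j. C * ((C3 / real j) / 2)) \<longlonglongrightarrow> 0" by simp
  qed
  have s_eq: "stopped (\<lambda>\<omega>. min (S \<omega>) (T \<omega>)) N n \<omega> = stopped T N (clamp 0 n (S \<omega>)) \<omega>" for N \<omega>
    unfolding stopped_stopped[symmetric] by (rule stopped_clamp)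
  have ST: "stopping_time F (\<lambda>\<omega>. min (S \<omega>) (T \<omega>))" by (rule stopping_time_min[OF S T])
  have clS: "0 \<le> clamp 0 n (S \<omega>)" for \<omega> using clamp_bounds[OF order_refl n0] by simp
  have m1[measurable]: "(\<lambda>\<omega>. stopped T (R c) (clamp 0 n (S \<omega>)) \<omega>) \<in> borel_measurable P"
    using adapted_measurable_P[OF stopped_adapted[OF R_adapted R_continuous[OF c] ST] n0] unfolding s_eq[symmetric] by simp
  have m2[measurable]: "(\<lambda>\<omega>. a (clamp 0 n (S \<omega>)) \<omega>) \<in> borel_measurable P"
    using adapted_measurable_P[OF stopped_adapted[OF A_adapted A_continuous ST] n0] unfolding a_def s_eq[symmetric] by simp
  have m3[measurable]: "stopped T (R c) n \<in> borel_measurable P"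
    by (rule adapted_measurable_P[OF stopped_adapted[OF R_adapted R_continuous[OF c] T] n0])
  have m4[measurable]: "a n \<in> borel_measurable P" by (rule adapted_measurable_P[OF ad(3) n0])
  have i1: "integrable P (\<lambda>\<omega>. f (stopped T (R c) n \<omega>))"
    by (rule integrable_bounded[where B=Bf]) (measurable, auto intro!: Bf simp: r_eq[symmetric] r_bd n0)
  have i2: "integrable P (\<lambda>\<omega>. f (stopped T (R c) (clamp 0 n (S \<omega>)) \<omega>))"
    by (rule integrable_bounded[where B=Bf]) (measurable, auto intro!: Bf simp: r_eq[symmetric] r_bd clS)
  have i3: "integrable P (\<lambda>\<omega>. u (a n \<omega>))"
    by (rule integrable_bounded[where B=Bu]) (measurable, auto intro!: Bu simp: bd n0)
  have i4: "integrable P (\<lambda>\<omega>. u (a (clamp 0 n (S \<omega>)) \<omega>))"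
    by (rule integrable_bounded[where B=Bu]) (measurable, auto intro!: Bu simp: bd clS)
  have "(\<integral>\<omega>. z n \<omega> - z (clamp 0 n (S \<omega>)) \<omega> \<partial>P) =
     (\<integral>\<omega>. f (stopped T (R c) n \<omega>) - f (stopped T (R c) (clamp 0 n (S \<omega>)) \<omega>) \<partial>P) - D * (\<integral>\<omega>. u (a n \<omega>) - u (a (clamp 0 n (S \<omega>)) \<omega>) \<partial>P)"
    unfolding z_def r_eq using i1 i2 i3 i4 by (simp add: right_diff_distrib)
  then show ?thesis using nonpos unfolding s_eq a_def by simp
qed

end

lemma taylor_bound:
  fixes f f1 f2 f3 :: "real \<Rightarrow> real"
  assumes d: "\<And>x. DERIV f x :> f1 x" "\<And>x. DERIV f1 x :> f2 x" "\<And>x. DERIV f2 x :> f3 x"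
    and c: "\<And>x. isCont f3 x" and M: "0 \<le> M"
  obtains L where "1 \<le> L" "\<And>r. 0 \<le> r \<Longrightarrow> r \<le> M \<Longrightarrow> \<bar>f1 r\<bar> \<le> L" "\<And>r. 0 \<le> r \<Longrightarrow> r \<le> M \<Longrightarrow> \<bar>f2 r\<bar> \<le> L"
    "\<And>r r'. 0 \<le> r \<Longrightarrow> r \<le> M \<Longrightarrow> 0 \<le> r' \<Longrightarrow> r' \<le> M \<Longrightarrow> \<bar>f r' - f r - f1 r * (r' - r) - f2 r * (r' - r)\<^sup>2 / 2\<bar> \<le> L * \<bar>r' - r\<bar> ^ 3"
proof -
  have bnd: "\<exists>B. \<forall>r\<in>{0..M}. \<bar>h r\<bar> \<le> B" if "\<And>x. isCont h x" for h :: "real \<Rightarrow> real"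
  proof -
    have "bounded (h ` {0..M})"
      using that by (intro compact_imp_bounded compact_continuous_image continuous_at_imp_continuous_on) auto
    then show ?thesis by (auto simp: bounded_iff)
  qed
  obtain B1 B2 B3 where B: "\<forall>r\<in>{0..M}. \<bar>f1 r\<bar> \<le> B1" "\<forall>r\<in>{0..M}. \<bar>f2 r\<bar> \<le> B2" "\<forall>r\<in>{0..M}. \<bar>f3 r\<bar> \<le> B3"
    using bnd[of f1] bnd[of f2] bnd[of f3] DERIV_isCont[OF d(2)] DERIV_isCont[OF d(3)] c by blast
  define L where "L = 1 + \<bar>B1\<bar> + \<bar>B2\<bar> + \<bar>B3\<bar>"
  show ?thesis
  proof (rule that[of L])
    show "1 \<le> L" by (simp add: L_def)
    show "\<bar>f1 r\<bar> \<le> L" "\<bar>f2 r\<bar> \<le> L" if "0 \<le> r" "r \<le> M" for r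
      using B(1)[rule_format, of r] B(2)[rule_format, of r] that by (auto simp: L_def)
    fix r r' assume h: "0 \<le> r" "r \<le> M" "0 \<le> r'" "r' \<le> M"
    show "\<bar>f r' - f r - f1 r * (r' - r) - f2 r * (r' - r)\<^sup>2 / 2\<bar> \<le> L * \<bar>r' - r\<bar> ^ 3"
    proof (cases "r = r'")
      case False
      define diff where "diff m = (if m = 0 then f else if m = 1 then f1 else if m = 2 then f2 else f3)" for m :: nat
      have "\<exists>t. (if r' < r then r' < t \<and> t < r else r < t \<and> t < r') \<and>
          f r' = (\<Sum>m<3. diff m r / fact m * (r' - r) ^ m) + diff 3 t / fact 3 * (r' - r) ^ 3"
        using h False by (intro Taylor[where a=0 and b=M]) (auto simp: diff_def d less_Suc_eq numeral_3_eq_3)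
      then obtain t where "if r' < r then r' < t \<and> t < r else r < t \<and> t < r'"
          and t3: "f r' = (\<Sum>m<3. diff m r / fact m * (r' - r) ^ m) + diff 3 t / fact 3 * (r' - r) ^ 3" by blast
      then have t: "0 \<le> t" "t \<le> M" "f r' = (\<Sum>m<3. diff m r / fact m * (r' - r) ^ m) + diff 3 t / fact 3 * (r' - r) ^ 3"
        using h t3 by (auto split: if_splits)
      have "f r' - f r - f1 r * (r' - r) - f2 r * (r' - r)\<^sup>2 / 2 = f3 t / 6 * (r' - r) ^ 3"
        using t(3) by (simp add: diff_def numeral_3_eq_3 lessThan_Suc fact_numeral power2_eq_square)
      then have "\<bar>f r' - f r - f1 r * (r' - r) - f2 r * (r' - r)\<^sup>2 / 2\<bar> = \<bar>f3 t\<bar> / 6 * \<bar>r' - r\<bar> ^ 3"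
        by (simp only: abs_mult power_abs abs_divide abs_numeral)
      also have "\<dots> \<le> L * \<bar>r' - r\<bar> ^ 3"
        using B(3)[rule_format, of t] t(1,2) by (intro mult_right_mono) (auto simp: L_def)
      finally show ?thesis .
    qed simp
  qed
qed

context planar_martingale
begin

text \<open>On a bounded range the Taylor remainder is controlled by the third derivative.\<close>

lemma ito_smooth:
  fixes f f1 f2 f3 u :: "real \<Rightarrow> real"
  assumes d: "\<And>x. DERIV f x :> f1 x" "\<And>x. DERIV f1 x :> f2 x" "\<And>x. DERIV f2 x :> f3 x" "\<And>x. isCont f3 x"
    and u: "\<And>a a'. 0 \<le> a \<Longrightarrow> a \<le> a' \<Longrightarrow> \<bar>u a' - u a - (a' - a) / (1 + c * a)\<bar> \<le> (a' - a)\<^sup>2"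
      "continuous_on {0..} u" "u \<in> borel_measurable borel"
    and c: "0 \<le> c"
    and T: "stopping_time F T" and S: "stopping_time F S" and Tn: "\<And>\<omega>. T \<omega> \<le> ennreal n" and n: "0 < n"
    and bounded: "\<And>t \<omega>. 0 \<le> t \<Longrightarrow> ennreal t \<le> T \<omega> \<Longrightarrow> \<bar>X t \<omega>\<bar> \<le> K \<and> \<bar>Y t \<omega>\<bar> \<le> K \<and> A t \<omega> \<le> K"
    and drift: "\<And>t \<omega>. 0 \<le> t \<Longrightarrow> ennreal t \<le> T \<omega> \<Longrightarrow> f1 (R c t \<omega>) * (2 - c * R c t \<omega>) + 2 * R c t \<omega> * f2 (R c t \<omega>) \<le> D"
  shows "(\<integral>\<omega>. f (stopped T (R c) n \<omega>) - f (stopped (\<lambda>\<omega>. min (S \<omega>) (T \<omega>)) (R c) n \<omega>) \<partial>P)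
     \<le> D * (\<integral>\<omega>. u (stopped T A n \<omega>) - u (stopped (\<lambda>\<omega>. min (S \<omega>) (T \<omega>)) A n \<omega>) \<partial>P)"
proof -
  obtain L where L: "1 \<le> L" "\<And>r. 0 \<le> r \<Longrightarrow> r \<le> 2 * K\<^sup>2 \<Longrightarrow> \<bar>f1 r\<bar> \<le> L" "\<And>r. 0 \<le> r \<Longrightarrow> r \<le> 2 * K\<^sup>2 \<Longrightarrow> \<bar>f2 r\<bar> \<le> L"
    "\<And>r r'. 0 \<le> r \<Longrightarrow> r \<le> 2 * K\<^sup>2 \<Longrightarrow> 0 \<le> r' \<Longrightarrow> r' \<le> 2 * K\<^sup>2 \<Longrightarrow> \<bar>f r' - f r - f1 r * (r' - r) - f2 r * (r' - r)\<^sup>2 / 2\<bar> \<le> L * \<bar>r' - r\<bar> ^ 3"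
    by (rule taylor_bound[OF d, of "2 * K\<^sup>2"]) (simp, rule that, assumption+)
  have cont: "continuous_on UNIV f" "continuous_on UNIV f1" "continuous_on UNIV f2"
    using d(1-3) DERIV_isCont by (intro continuous_at_imp_continuous_on; blast)+
  have u': "\<bar>u a' - u a - (a' - a) / (1 + c * a)\<bar> \<le> L * (a' - a)\<^sup>2" if "0 \<le> a" "a \<le> a'" "a' \<le> K" for a a'
  proof -
    have "1 * (a' - a)\<^sup>2 \<le> L * (a' - a)\<^sup>2" using L(1) by (intro mult_right_mono) auto
    then show ?thesis using u(1)[OF that(1,2)] by simp
  qed
  have L0: "0 \<le> L" using L(1) by simp
  show ?thesis
    by (rule ito_inequality[OF T S Tn n bounded c L0 L(2-4) u' borel_measurable_continuous_onI[OF cont(1)]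
        borel_measurable_continuous_onI[OF cont(2)] borel_measurable_continuous_onI[OF cont(3)] u(3) continuous_on_subset[OF cont(1)] u(2) drift])
       auto
qed

text \<open>
  With constant drift both \<open>f\<close> and \<open>- f\<close> satisfy the inequality.
\<close>

lemma ito_equality:
  fixes f f1 f2 f3 u :: "real \<Rightarrow> real"
  assumes d: "\<And>x. DERIV f x :> f1 x" "\<And>x. DERIV f1 x :> f2 x" "\<And>x. DERIV f2 x :> f3 x" "\<And>x. isCont f3 x"
    and u: "\<And>a a'. 0 \<le> a \<Longrightarrow> a \<le> a' \<Longrightarrow> \<bar>u a' - u a - (a' - a) / (1 + c * a)\<bar> \<le> (a' - a)\<^sup>2"
      "continuous_on {0..} u" "u \<in> borel_measurable borel"
    and c: "0 \<le> c"
    and T: "stopping_time F T" and S: "stopping_time F S" and Tn: "\<And>\<omega>. T \<omega> \<le> ennreal n" and n: "0 < n"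
    and bounded: "\<And>t \<omega>. 0 \<le> t \<Longrightarrow> ennreal t \<le> T \<omega> \<Longrightarrow> \<bar>X t \<omega>\<bar> \<le> K \<and> \<bar>Y t \<omega>\<bar> \<le> K \<and> A t \<omega> \<le> K"
    and drift: "\<And>r. f1 r * (2 - c * r) + 2 * r * f2 r = 1"
  shows "(\<integral>\<omega>. f (stopped T (R c) n \<omega>) - f (stopped (\<lambda>\<omega>. min (S \<omega>) (T \<omega>)) (R c) n \<omega>) \<partial>P)
     = (\<integral>\<omega>. u (stopped T A n \<omega>) - u (stopped (\<lambda>\<omega>. min (S \<omega>) (T \<omega>)) A n \<omega>) \<partial>P)" (is "?l = ?r")
proof (rule antisym)
  have "?l \<le> 1 * ?r" by (rule ito_smooth[OF d u c T S Tn n bounded]) (auto simp: drift)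
  then show "?l \<le> ?r" by simp
  have d': "DERIV (\<lambda>x. - f x) x :> - f1 x" "DERIV (\<lambda>x. - f1 x) x :> - f2 x" "DERIV (\<lambda>x. - f2 x) x :> - f3 x" "isCont (\<lambda>x. - f3 x) x" for x
    using d by (auto intro!: derivative_eq_intros)
  have "(\<integral>\<omega>. - f (stopped T (R c) n \<omega>) - - f (stopped (\<lambda>\<omega>. min (S \<omega>) (T \<omega>)) (R c) n \<omega>) \<partial>P) \<le> (-1) * ?r"
  proof (rule ito_smooth[OF d' u c T S Tn n bounded])
    show "- f1 (R c t \<omega>) * (2 - c * R c t \<omega>) + 2 * R c t \<omega> * - f2 (R c t \<omega>) \<le> - 1" for t \<omega>
      using drift[of "R c t \<omega>"] by simp
  qed
  moreover have "(\<integral>\<omega>. - f (stopped T (R c) n \<omega>) - - f (stopped (\<lambda>\<omega>. min (S \<omega>) (T \<omega>)) (R c) n \<omega>) \<partial>P)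
     = - ?l"
    unfolding Bochner_Integration.integral_minus[symmetric] by (intro Bochner_Integration.integral_cong) auto
  ultimately show "?r \<le> ?l" by linarith
qed

end

section \<open>Good-lambda inequalities\<close>

lemma ennreal_clamp: "\<theta> \<le> ennreal n \<Longrightarrow> ennreal (clamp 0 n \<theta>) = \<theta>"
  by (simp add: clamp_def min_absorb2) (metis ennreal_enn2real ennreal_less_top le_less_trans)

context planar_martingale
begin

definition rho :: "real \<Rightarrow> real \<Rightarrow> 'a \<Rightarrow> real" where
  "rho c = running_max (\<lambda>t \<omega>. sqrt (R c t \<omega>))"

lemma sqrtR_continuous: "0 \<le> c \<Longrightarrow> continuous_on {0..} (\<lambda>t. sqrt (R c t \<omega>))"
  by (intro continuous_intros R_continuous)

lemma sqrtR_adapted: "adapted F (\<lambda>t \<omega>. sqrt (R c t \<omega>))"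
  using R_adapted[of c] unfolding adapted_def by (auto intro: borel_measurable_sqrt)

lemma rho_continuous: "0 \<le> c \<Longrightarrow> continuous_on {0..} (\<lambda>t. rho c t \<omega>)"
  unfolding rho_def by (rule running_max_continuous[OF sqrtR_continuous])

lemma rho_mono: "0 \<le> c \<Longrightarrow> mono_on {0..} (\<lambda>t. rho c t \<omega>)"
  unfolding rho_def by (rule running_max_mono[OF sqrtR_continuous])

lemma rho_adapted: "0 \<le> c \<Longrightarrow> adapted F (rho c)"
  unfolding rho_def by (rule running_max_adapted[OF sqrtR_continuous sqrtR_adapted])

lemma rho_0: "rho c 0 \<omega> = 0"
  by (simp add: rho_def running_max_0 R_def start)

lemma rho_nonneg: "0 \<le> c \<Longrightarrow> 0 \<le> t \<Longrightarrow> 0 \<le> rho c t \<omega>"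
  using mono_onD[OF rho_mono[of c \<omega>], of 0 t] rho_0[of c \<omega>] by simp

lemma R_le_rho: "0 \<le> c \<Longrightarrow> 0 \<le> t \<Longrightarrow> rho c t \<omega> \<le> b \<Longrightarrow> R c t \<omega> \<le> b\<^sup>2"
proof -
  assume *: "0 \<le> c" "0 \<le> t" "rho c t \<omega> \<le> b"
  have "sqrt (R c t \<omega>) \<le> rho c t \<omega>"
    unfolding rho_def using running_max_upper[of "\<lambda>t \<omega>. sqrt (R c t \<omega>)" \<omega>, OF sqrtR_continuous[OF *(1)], of t t] *(2) by simp
  then have "sqrt (R c t \<omega>) \<le> b" using *(3) by (rule order_trans)
  then show ?thesis using R_nonneg[OF *(1,2), of \<omega>] real_le_rsqrt sqrt_le_D by blast
qed

text \<open>
  The running maximum can reach a new level only through the current value of the path.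
\<close>

lemma R_at_hit_rho:
  assumes c: "0 \<le> c" and b: "0 \<le> b" and h: "0 \<le> h" "ennreal h = hit (rho c) b \<omega>"
  shows "b\<^sup>2 \<le> R c h \<omega>"
proof -
  note hit = hit_le_iff[of "rho c" \<omega>, OF rho_continuous[OF c] rho_mono[OF c]]
  have "b \<le> rho c h \<omega>" using hit[OF h(1), of b] h(2) by simp
  moreover obtain s where s: "0 \<le> s" "s \<le> h" "rho c h \<omega> = sqrt (R c s \<omega>)"
    using running_max_attained[of "\<lambda>t \<omega>. sqrt (R c t \<omega>)" \<omega> h, OF sqrtR_continuous[OF c] h(1)] unfolding rho_def by blast
  ultimately have bs: "b \<le> sqrt (R c s \<omega>)" by simp
  also have "\<dots> \<le> rho c s \<omega>"
    unfolding rho_def using running_max_upper[of "\<lambda>t \<omega>. sqrt (R c t \<omega>)" \<omega>, OF sqrtR_continuous[OF c], of s s] s by simp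
  finally have "hit (rho c) b \<omega> \<le> ennreal s" using hit[OF s(1)] by simp
  then have "h \<le> s" unfolding h(2)[symmetric] using s(1) by (simp add: ennreal_le_iff)
  then have "s = h" using s by simp
  then have "b \<le> sqrt (R c h \<omega>)" using bs by simp
  then have "b\<^sup>2 \<le> (sqrt (R c h \<omega>))\<^sup>2" using b by (intro power_mono)
  then show ?thesis using R_nonneg[OF c h(1), of \<omega>] by simp
qed

lemma stopped_at_bounded_time:
  assumes "T \<omega> \<le> ennreal n" "0 \<le> n"
  shows "stopped T N n \<omega> = N (clamp 0 n (T \<omega>)) \<omega>" "ennreal (clamp 0 n (T \<omega>)) = T \<omega>" "0 \<le> clamp 0 n (T \<omega>)"
  using assms ennreal_clamp clamp_bounds[of 0 n] by (auto simp: stopped_clamp)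

lemma clock_process:
  assumes u: "mono_on {0..} u" "continuous_on {0..} u" "u 0 = 0" "u \<in> borel_measurable borel"
  shows "continuous_on {0..} (\<lambda>t. u (A t \<omega>))" "mono_on {0..} (\<lambda>t. u (A t \<omega>))" "adapted F (\<lambda>t \<omega>. u (A t \<omega>))"
    "u (A 0 \<omega>) = 0" "0 \<le> t \<Longrightarrow> 0 \<le> u (A t \<omega>)"
proof -
  show "continuous_on {0..} (\<lambda>t. u (A t \<omega>))"
    using A_nonneg by (intro continuous_on_compose2[OF u(2) A_continuous]) auto
  show m: "mono_on {0..} (\<lambda>t. u (A t \<omega>))"
    by (intro mono_onI mono_onD[OF u(1)] mono_onD[OF A_mono]) (auto intro: A_nonneg)
  show "adapted F (\<lambda>t \<omega>. u (A t \<omega>))"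
    using A_adapted u(4) unfolding adapted_def by (auto intro: measurable_compose)
  show z: "u (A 0 \<omega>) = 0" by (simp add: start u)
  show "0 \<le> u (A t \<omega>)" if "0 \<le> t" using mono_onD[OF m, of 0 t] that z by simp
qed

text \<open>
  Start when the modulus reaches \<open>a\<close> and stop when it reaches \<open>b\<close> or the
  clock reaches \<open>d\<close>. In between, \<open>f(R)\<close> gains at least \<open>f(b\<^sup>2)
  - f(a\<^sup>2)\<close> on the event in question and loses at most \<open>f(a\<^sup>2)\<close>
  otherwise, while the clock gains at most \<open>d\<close>; nothing happens unless level
  \<open>a\<close> is reached.
\<close>

lemma upper_good_lambda:
  assumes \<tau>: "stopping_time F \<tau>" "\<And>\<omega>. \<tau> \<omega> \<le> ennreal n" "0 < n"
    and c: "0 \<le> c" and f: "mono_on {0..} f" "f 0 = 0" "f \<in> borel_measurable borel"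
    and u: "mono_on {0..} u" "continuous_on {0..} u" "u 0 = 0" "u \<in> borel_measurable borel"
    and ab: "0 \<le> a" "a \<le> b" and d: "0 \<le> d" and D: "0 \<le> D"
    and ito: "\<And>S T. stopping_time F S \<Longrightarrow> stopping_time F T \<Longrightarrow> (\<And>\<omega>. T \<omega> \<le> \<tau> \<omega>) \<Longrightarrow>
      (\<And>t \<omega>. 0 \<le> t \<Longrightarrow> ennreal t \<le> T \<omega> \<Longrightarrow> R c t \<omega> \<le> b\<^sup>2) \<Longrightarrow>
      (\<integral>\<omega>. f (stopped T (R c) n \<omega>) - f (stopped (\<lambda>\<omega>. min (S \<omega>) (T \<omega>)) (R c) n \<omega>) \<partial>P)
        \<le> D * (\<integral>\<omega>. u (stopped T A n \<omega>) - u (stopped (\<lambda>\<omega>. min (S \<omega>) (T \<omega>)) A n \<omega>) \<partial>P)"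
  shows "f (b\<^sup>2) * measure P {\<omega> \<in> space P. b \<le> stopped \<tau> (rho c) n \<omega> \<and> u (stopped \<tau> A n \<omega>) < d}
     \<le> (f (a\<^sup>2) + D * d) * measure P {\<omega> \<in> space P. a \<le> stopped \<tau> (rho c) n \<omega>}"
proof -
  note uA = clock_process[OF u]
  note rc = rho_continuous[OF c] and rm = rho_mono[OF c] and ra = rho_adapted[OF c]
  define S where "S = hit (rho c) a"
  define T where "T \<omega> = min (min (hit (rho c) b \<omega>) (hit (\<lambda>t \<omega>. u (A t \<omega>)) d \<omega>)) (\<tau> \<omega>)" for \<omega>
  define W where "W \<omega> = min (S \<omega>) (T \<omega>)" for \<omega>
  have S: "stopping_time F S" unfolding S_def by (rule stopping_time_hit[OF rc rm ra])
  have T: "stopping_time F T" unfolding T_def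
    by (intro stopping_time_min stopping_time_hit[OF rc rm ra] stopping_time_hit[OF uA(1-3)] \<tau>)
  have W: "stopping_time F W" unfolding W_def by (rule stopping_time_min[OF S T])
  have n0: "0 \<le> n" using \<tau>(3) by simp
  have T\<tau>: "T \<omega> \<le> \<tau> \<omega>" for \<omega> by (simp add: T_def)
  have Tn: "T \<omega> \<le> ennreal n" for \<omega> using T\<tau> \<tau>(2) by (rule order_trans)
  have Wn: "W \<omega> \<le> ennreal n" for \<omega> using Tn[of \<omega>] by (simp add: W_def min_le_iff_disj)
  define h where "h \<omega> = clamp 0 n (T \<omega>)" for \<omega>
  define w where "w \<omega> = clamp 0 n (W \<omega>)" for \<omega>
  define s where "s \<omega> = clamp 0 n (\<tau> \<omega>)" for \<omega>
  have sT: "stopped T N n \<omega> = N (h \<omega>) \<omega>" "ennreal (h \<omega>) = T \<omega>" "0 \<le> h \<omega>" for N \<omega>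
    unfolding h_def using stopped_at_bounded_time[of T \<omega> n, OF Tn n0] by auto
  have sW: "stopped W N n \<omega> = N (w \<omega>) \<omega>" "ennreal (w \<omega>) = W \<omega>" "0 \<le> w \<omega>" for N \<omega>
    unfolding w_def using stopped_at_bounded_time[of W \<omega> n, OF Wn n0] by auto
  have s\<tau>: "stopped \<tau> N n \<omega> = N (s \<omega>) \<omega>" "ennreal (s \<omega>) = \<tau> \<omega>" "0 \<le> s \<omega>" for N \<omega>
    unfolding s_def using stopped_at_bounded_time[of \<tau> \<omega> n, OF \<tau>(2) n0] by auto
  have rb: "rho c t \<omega> \<le> b" if "0 \<le> t" "ennreal t \<le> T \<omega>" for t \<omega>
    using that ab by (rule_tac below_hit[of "rho c" \<omega>, OF rc rm]) (auto simp: T_def rho_0)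
  have Rb: "R c t \<omega> \<le> b\<^sup>2" if "0 \<le> t" "ennreal t \<le> T \<omega>" for t \<omega>
    by (rule R_le_rho[OF c that(1) rb[OF that]])
  have ub: "u (A t \<omega>) \<le> d" if "0 \<le> t" "ennreal t \<le> T \<omega>" for t \<omega>
    using that d by (rule_tac below_hit[of "\<lambda>t \<omega>. u (A t \<omega>)" \<omega>, OF uA(1,2)]) (auto simp: T_def uA(4))
  have Ra: "R c (w \<omega>) \<omega> \<le> a\<^sup>2" for \<omega>
    using ab sW(2,3)[of \<omega>] by (rule_tac R_le_rho[OF c], simp, rule_tac below_hit[of "rho c" \<omega>, OF rc rm]) (auto simp: W_def S_def rho_0)
  have f0: "0 \<le> f r" if "0 \<le> r" for r using mono_onD[OF f(1), of 0 r] that f(2) by simp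
  have fb: "0 \<le> f (b\<^sup>2)" "0 \<le> f (a\<^sup>2)" by (auto intro: f0)
  define G where "G = {\<omega> \<in> space P. b \<le> stopped \<tau> (rho c) n \<omega> \<and> u (stopped \<tau> A n \<omega>) < d}"
  define B where "B = {\<omega> \<in> space P. a \<le> stopped \<tau> (rho c) n \<omega>}"
  have [measurable]: "stopped \<tau> (rho c) n \<in> borel_measurable P"
    by (rule adapted_measurable_P[OF stopped_adapted[OF ra rc \<tau>(1)] n0])
  have [measurable]: "stopped \<tau> A n \<in> borel_measurable P" "stopped T A n \<in> borel_measurable P" "stopped W A n \<in> borel_measurable P"
    by (rule adapted_measurable_P[OF stopped_adapted[OF A_adapted A_continuous] n0], fact)+
  have [measurable]: "stopped T (R c) n \<in> borel_measurable P" "stopped W (R c) n \<in> borel_measurable P"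
    by (rule adapted_measurable_P[OF stopped_adapted[OF R_adapted R_continuous[OF c]] n0], fact)+
  have [measurable]: "u \<in> borel_measurable borel" "f \<in> borel_measurable borel" by fact+
  have [measurable]: "G \<in> sets P" "B \<in> sets P" unfolding G_def B_def by measurable
  have notB: "w \<omega> = h \<omega>" if "\<not> a \<le> rho c (s \<omega>) \<omega>" for \<omega>
  proof -
    have "\<not> S \<omega> \<le> \<tau> \<omega>" unfolding S_def s\<tau>(2)[symmetric] hit_le_iff[of "rho c" \<omega>, OF rc rm s\<tau>(3)] by (rule that)
    then have "W \<omega> = T \<omega>" using T\<tau>[of \<omega>] order_trans[of "S \<omega>" "T \<omega>" "\<tau> \<omega>"] by (auto simp: W_def min_def)
    then show ?thesis by (simp add: w_def h_def)
  qed
  have onG: "b\<^sup>2 \<le> R c (h \<omega>) \<omega>" if "b \<le> rho c (s \<omega>) \<omega>" "u (A (s \<omega>) \<omega>) < d" for \<omega>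
  proof -
    have 1: "hit (rho c) b \<omega> \<le> \<tau> \<omega>" unfolding s\<tau>(2)[symmetric] hit_le_iff[of "rho c" \<omega>, OF rc rm s\<tau>(3)] by (rule that)
    have "\<not> hit (\<lambda>t \<omega>. u (A t \<omega>)) d \<omega> \<le> \<tau> \<omega>"
      unfolding s\<tau>(2)[symmetric] hit_le_iff[of "\<lambda>t \<omega>. u (A t \<omega>)" \<omega>, OF uA(1,2) s\<tau>(3)] using that by simp
    then have "T \<omega> = hit (rho c) b \<omega>" using 1 by (auto simp: T_def min_def)
    then show ?thesis using sT(2,3)[of \<omega>] ab by (intro R_at_hit_rho[OF c]) auto
  qed
  have pw1: "f (b\<^sup>2) * indicator G \<omega> - f (a\<^sup>2) * indicator B \<omega> \<le> f (stopped T (R c) n \<omega>) - f (stopped W (R c) n \<omega>)" if "\<omega> \<in> space P" for \<omega>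
  proof (cases "a \<le> rho c (s \<omega>) \<omega>")
    case True
    then have B: "\<omega> \<in> B" using that by (simp add: B_def s\<tau>)
    have 1: "f (R c (w \<omega>) \<omega>) \<le> f (a\<^sup>2)" using R_nonneg[OF c sW(3)] Ra by (intro mono_onD[OF f(1)]) auto
    have 2: "f (b\<^sup>2) * indicator G \<omega> \<le> f (R c (h \<omega>) \<omega>)"
    proof (cases "\<omega> \<in> G")
      case True
      then have "b\<^sup>2 \<le> R c (h \<omega>) \<omega>" by (intro onG) (auto simp: G_def s\<tau>)
      then have "f (b\<^sup>2) \<le> f (R c (h \<omega>) \<omega>)" by (intro mono_onD[OF f(1)]) (auto intro: R_nonneg[OF c sT(3)])
      then show ?thesis using True by simp
    qed (auto intro: f0 R_nonneg[OF c sT(3)])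
    show ?thesis using 1 2 B by (simp add: sT sW)
  next
    case False
    then have "\<omega> \<notin> B" "\<omega> \<notin> G" using ab by (auto simp: B_def G_def s\<tau>)
    then show ?thesis using notB[OF False] by (simp add: sT sW)
  qed
  have pw2: "u (stopped T A n \<omega>) - u (stopped W A n \<omega>) \<le> d * indicator B \<omega>" if "\<omega> \<in> space P" for \<omega>
  proof (cases "a \<le> rho c (s \<omega>) \<omega>")
    case True
    then have B: "\<omega> \<in> B" using that by (simp add: B_def s\<tau>)
    show ?thesis using B ub[of "h \<omega>" \<omega>] sT(2,3)[of \<omega>] uA(5)[OF sW(3)[of \<omega>], of \<omega>] by (simp add: sT(1) sW(1))
  next
    case False
    then have "\<omega> \<notin> B" by (auto simp: B_def s\<tau>)
    then show ?thesis using notB[OF False] by (simp add: sT sW)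
  qed
  have uK: "0 \<le> u (A (h \<omega>) \<omega>)" "u (A (h \<omega>) \<omega>) \<le> d" "0 \<le> u (A (w \<omega>) \<omega>)" "u (A (w \<omega>) \<omega>) \<le> d" for \<omega>
  proof -
    show "0 \<le> u (A (h \<omega>) \<omega>)" "0 \<le> u (A (w \<omega>) \<omega>)" by (rule uA(5)[OF sT(3)], rule uA(5)[OF sW(3)])
    have "W \<omega> \<le> T \<omega>" by (simp add: W_def)
    then show "u (A (h \<omega>) \<omega>) \<le> d" "u (A (w \<omega>) \<omega>) \<le> d" using sT(2,3)[of \<omega>] sW(2,3)[of \<omega>] by (auto intro: ub)
  qed
  have fR: "0 \<le> f (R c (h \<omega>) \<omega>)" "f (R c (h \<omega>) \<omega>) \<le> f (b\<^sup>2)" "0 \<le> f (R c (w \<omega>) \<omega>)" "f (R c (w \<omega>) \<omega>) \<le> f (b\<^sup>2)" for \<omega>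
  proof -
    have "W \<omega> \<le> T \<omega>" by (simp add: W_def)
    then have "R c (h \<omega>) \<omega> \<le> b\<^sup>2" "R c (w \<omega>) \<omega> \<le> b\<^sup>2" using sT(2,3)[of \<omega>] sW(2,3)[of \<omega>] by (auto intro: Rb)
    then show "0 \<le> f (R c (h \<omega>) \<omega>)" "f (R c (h \<omega>) \<omega>) \<le> f (b\<^sup>2)" "0 \<le> f (R c (w \<omega>) \<omega>)" "f (R c (w \<omega>) \<omega>) \<le> f (b\<^sup>2)"
      using R_nonneg[OF c sT(3)] R_nonneg[OF c sW(3)] by (auto intro!: f0 mono_onD[OF f(1)])
  qed
  have i1: "integrable P (\<lambda>\<omega>. f (stopped T (R c) n \<omega>) - f (stopped W (R c) n \<omega>))"
  proof (intro Bochner_Integration.integrable_diff integrable_bounded[where B="f (b\<^sup>2)"])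
    show "\<bar>f (stopped T (R c) n \<omega>)\<bar> \<le> f (b\<^sup>2)" "\<bar>f (stopped W (R c) n \<omega>)\<bar> \<le> f (b\<^sup>2)" for \<omega>
      using fR[of \<omega>] by (simp_all add: sT(1) sW(1))
  qed measurable
  have i2: "integrable P (\<lambda>\<omega>. u (stopped T A n \<omega>) - u (stopped W A n \<omega>))"
  proof (intro Bochner_Integration.integrable_diff integrable_bounded[where B=d])
    show "\<bar>u (stopped T A n \<omega>)\<bar> \<le> d" "\<bar>u (stopped W A n \<omega>)\<bar> \<le> d" for \<omega>
      using uK[of \<omega>] by (simp_all add: sT(1) sW(1))
  qed measurable
  have "f (b\<^sup>2) * measure P G - f (a\<^sup>2) * measure P B = (\<integral>\<omega>. f (b\<^sup>2) * indicator G \<omega> - f (a\<^sup>2) * indicator B \<omega> \<partial>P)"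
    by (subst Bochner_Integration.integral_diff) (auto simp: less_top[symmetric])
  also have "\<dots> \<le> (\<integral>\<omega>. f (stopped T (R c) n \<omega>) - f (stopped W (R c) n \<omega>) \<partial>P)"
    by (intro integral_mono Bochner_Integration.integrable_diff i1 pw1) (auto simp: less_top[symmetric])
  also have "\<dots> \<le> D * (\<integral>\<omega>. u (stopped T A n \<omega>) - u (stopped W A n \<omega>) \<partial>P)"
    unfolding W_def by (intro ito S T T\<tau> Rb)
  also have "(\<integral>\<omega>. u (stopped T A n \<omega>) - u (stopped W A n \<omega>) \<partial>P) \<le> (\<integral>\<omega>. d * indicator B \<omega> \<partial>P)"
    by (intro integral_mono i2 pw2) (auto simp: less_top[symmetric])
  also have "(\<integral>\<omega>. d * indicator B \<omega> \<partial>P) = d * measure P B" by simp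
  finally have "f (b\<^sup>2) * measure P G - f (a\<^sup>2) * measure P B \<le> D * (d * measure P B)" using D by (simp add: mult_left_mono)
  then show ?thesis unfolding G_def[symmetric] B_def[symmetric] by (simp add: algebra_simps)
qed

text \<open>
  The roles of clock and modulus are exchanged: the clock gains \<open>b - a\<close> on the event in
  question, while \<open>f(R)\<close>, being nonnegative, gains at most its largest value
  \<open>f(d\<^sup>2)\<close>.
\<close>

lemma lower_good_lambda:
  assumes \<tau>: "stopping_time F \<tau>" "\<And>\<omega>. \<tau> \<omega> \<le> ennreal n" "0 < n"
    and c: "0 \<le> c" and f: "mono_on {0..} f" "f 0 = 0" "f \<in> borel_measurable borel"
    and u: "mono_on {0..} u" "continuous_on {0..} u" "u 0 = 0" "u \<in> borel_measurable borel"
    and ab: "0 \<le> a" "a \<le> b" and d: "0 \<le> d"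
    and ito: "\<And>S T. stopping_time F S \<Longrightarrow> stopping_time F T \<Longrightarrow> (\<And>\<omega>. T \<omega> \<le> \<tau> \<omega>) \<Longrightarrow>
      (\<integral>\<omega>. u (stopped T A n \<omega>) - u (stopped (\<lambda>\<omega>. min (S \<omega>) (T \<omega>)) A n \<omega>) \<partial>P)
      \<le> (\<integral>\<omega>. f (stopped T (R c) n \<omega>) - f (stopped (\<lambda>\<omega>. min (S \<omega>) (T \<omega>)) (R c) n \<omega>) \<partial>P)"
  shows "(b - a) * measure P {\<omega> \<in> space P. b \<le> u (stopped \<tau> A n \<omega>) \<and> stopped \<tau> (rho c) n \<omega> < d}
     \<le> f (d\<^sup>2) * measure P {\<omega> \<in> space P. a \<le> u (stopped \<tau> A n \<omega>)}"
proof -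
  note uA = clock_process[OF u]
  note rc = rho_continuous[OF c] and rm = rho_mono[OF c] and ra = rho_adapted[OF c]
  let ?U = "\<lambda>t \<omega>. u (A t \<omega>)"
  define S where "S = hit ?U a"
  define T where "T \<omega> = min (min (hit ?U b \<omega>) (hit (rho c) d \<omega>)) (\<tau> \<omega>)" for \<omega>
  define W where "W \<omega> = min (S \<omega>) (T \<omega>)" for \<omega>
  have S: "stopping_time F S" unfolding S_def by (rule stopping_time_hit[OF uA(1-3)])
  have T: "stopping_time F T" unfolding T_def
    by (intro stopping_time_min stopping_time_hit[OF rc rm ra] stopping_time_hit[OF uA(1-3)] \<tau>)
  have W: "stopping_time F W" unfolding W_def by (rule stopping_time_min[OF S T])
  have n0: "0 \<le> n" using \<tau>(3) by simp
  have T\<tau>: "T \<omega> \<le> \<tau> \<omega>" for \<omega> by (simp add: T_def)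
  have Tn: "T \<omega> \<le> ennreal n" for \<omega> using T\<tau> \<tau>(2) by (rule order_trans)
  have Wn: "W \<omega> \<le> ennreal n" for \<omega> using Tn[of \<omega>] by (simp add: W_def min_le_iff_disj)
  define h where "h \<omega> = clamp 0 n (T \<omega>)" for \<omega>
  define w where "w \<omega> = clamp 0 n (W \<omega>)" for \<omega>
  define s where "s \<omega> = clamp 0 n (\<tau> \<omega>)" for \<omega>
  have sT: "stopped T N n \<omega> = N (h \<omega>) \<omega>" "ennreal (h \<omega>) = T \<omega>" "0 \<le> h \<omega>" for N \<omega>
    unfolding h_def using stopped_at_bounded_time[of T \<omega> n, OF Tn n0] by auto
  have sW: "stopped W N n \<omega> = N (w \<omega>) \<omega>" "ennreal (w \<omega>) = W \<omega>" "0 \<le> w \<omega>" for N \<omega>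
    unfolding w_def using stopped_at_bounded_time[of W \<omega> n, OF Wn n0] by auto
  have s\<tau>: "stopped \<tau> N n \<omega> = N (s \<omega>) \<omega>" "ennreal (s \<omega>) = \<tau> \<omega>" "0 \<le> s \<omega>" for N \<omega>
    unfolding s_def using stopped_at_bounded_time[of \<tau> \<omega> n, OF \<tau>(2) n0] by auto
  have wh: "w \<omega> \<le> h \<omega>" for \<omega> using sW(2)[of \<omega>] sT(2,3)[of \<omega>] by (metis W_def ennreal_le_iff min.cobounded2)
  have WT: "W \<omega> \<le> T \<omega>" for \<omega> by (simp add: W_def)
  have Rd: "R c t \<omega> \<le> d\<^sup>2" if "0 \<le> t" "ennreal t \<le> T \<omega>" for t \<omega>
    using that d by (rule_tac R_le_rho[OF c], simp, rule_tac below_hit[of "rho c" \<omega>, OF rc rm]) (auto simp: T_def rho_0)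
  have ub: "u (A t \<omega>) \<le> b" if "0 \<le> t" "ennreal t \<le> T \<omega>" for t \<omega>
    using that ab by (rule_tac below_hit[of ?U \<omega>, OF uA(1,2)]) (auto simp: T_def uA(4))
  have ua: "u (A (w \<omega>) \<omega>) \<le> a" for \<omega>
    using ab sW(2,3)[of \<omega>] by (rule_tac below_hit[of ?U \<omega>, OF uA(1,2)]) (auto simp: W_def S_def uA(4))
  have f0: "0 \<le> f r" if "0 \<le> r" for r using mono_onD[OF f(1), of 0 r] that f(2) by simp
  define G where "G = {\<omega> \<in> space P. b \<le> u (stopped \<tau> A n \<omega>) \<and> stopped \<tau> (rho c) n \<omega> < d}"
  define B where "B = {\<omega> \<in> space P. a \<le> u (stopped \<tau> A n \<omega>)}"
  have [measurable]: "stopped \<tau> (rho c) n \<in> borel_measurable P"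
    by (rule adapted_measurable_P[OF stopped_adapted[OF ra rc \<tau>(1)] n0])
  have [measurable]: "stopped \<tau> A n \<in> borel_measurable P" "stopped T A n \<in> borel_measurable P" "stopped W A n \<in> borel_measurable P"
    by (rule adapted_measurable_P[OF stopped_adapted[OF A_adapted A_continuous] n0], fact)+
  have [measurable]: "stopped T (R c) n \<in> borel_measurable P" "stopped W (R c) n \<in> borel_measurable P"
    by (rule adapted_measurable_P[OF stopped_adapted[OF R_adapted R_continuous[OF c]] n0], fact)+
  have [measurable]: "u \<in> borel_measurable borel" "f \<in> borel_measurable borel" by fact+
  have [measurable]: "G \<in> sets P" "B \<in> sets P" unfolding G_def B_def by measurable
  have notB: "w \<omega> = h \<omega>" if "\<not> a \<le> u (A (s \<omega>) \<omega>)" for \<omega>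
  proof -
    have "\<not> S \<omega> \<le> \<tau> \<omega>" unfolding S_def s\<tau>(2)[symmetric] hit_le_iff[of ?U \<omega>, OF uA(1,2) s\<tau>(3)] by (rule that)
    then have "W \<omega> = T \<omega>" using T\<tau>[of \<omega>] order_trans[of "S \<omega>" "T \<omega>" "\<tau> \<omega>"] by (auto simp: W_def min_def)
    then show ?thesis by (simp add: w_def h_def)
  qed
  have onG: "b \<le> u (A (h \<omega>) \<omega>)" if "b \<le> u (A (s \<omega>) \<omega>)" "rho c (s \<omega>) \<omega> < d" for \<omega>
  proof -
    have 1: "hit ?U b \<omega> \<le> \<tau> \<omega>" unfolding s\<tau>(2)[symmetric] hit_le_iff[of ?U \<omega>, OF uA(1,2) s\<tau>(3)] by (rule that)
    have "\<not> hit (rho c) d \<omega> \<le> \<tau> \<omega>"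
      unfolding s\<tau>(2)[symmetric] hit_le_iff[of "rho c" \<omega>, OF rc rm s\<tau>(3)] using that by simp
    then have "hit ?U b \<omega> = ennreal (h \<omega>)" using 1 unfolding sT(2) by (auto simp: T_def min_def)
    then show ?thesis using hit_le_iff[of ?U \<omega> "h \<omega>" b, OF uA(1,2) sT(3)] by simp
  qed
  have uK: "0 \<le> u (A (h \<omega>) \<omega>)" "u (A (h \<omega>) \<omega>) \<le> b" "0 \<le> u (A (w \<omega>) \<omega>)" "u (A (w \<omega>) \<omega>) \<le> b" for \<omega>
    using uA(5)[OF sT(3)[of \<omega>], of \<omega>] uA(5)[OF sW(3)[of \<omega>], of \<omega>] ub[OF sT(3), of \<omega>] sT(2)[of \<omega>] ua[of \<omega>] ab by auto
  have fR: "0 \<le> f (R c (h \<omega>) \<omega>)" "f (R c (h \<omega>) \<omega>) \<le> f (d\<^sup>2)" "0 \<le> f (R c (w \<omega>) \<omega>)" "f (R c (w \<omega>) \<omega>) \<le> f (d\<^sup>2)" for \<omega>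
  proof -
    have "R c (h \<omega>) \<omega> \<le> d\<^sup>2" "R c (w \<omega>) \<omega> \<le> d\<^sup>2" using sT(2,3)[of \<omega>] sW(2,3)[of \<omega>] WT[of \<omega>] by (auto intro: Rd)
    then show "0 \<le> f (R c (h \<omega>) \<omega>)" "f (R c (h \<omega>) \<omega>) \<le> f (d\<^sup>2)" "0 \<le> f (R c (w \<omega>) \<omega>)" "f (R c (w \<omega>) \<omega>) \<le> f (d\<^sup>2)"
      using R_nonneg[OF c sT(3)] R_nonneg[OF c sW(3)] by (auto intro!: f0 mono_onD[OF f(1)])
  qed
  have pw1: "(b - a) * indicator G \<omega> \<le> u (stopped T A n \<omega>) - u (stopped W A n \<omega>)" if "\<omega> \<in> space P" for \<omega>
  proof (cases "\<omega> \<in> G")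
    case True
    then have "b \<le> u (A (h \<omega>) \<omega>)" by (intro onG) (auto simp: G_def s\<tau>)
    then show ?thesis using True ua[of \<omega>] by (simp add: sT(1) sW(1))
  next
    case False
    have "u (A (w \<omega>) \<omega>) \<le> u (A (h \<omega>) \<omega>)" using wh[of \<omega>] sT(3)[of \<omega>] sW(3)[of \<omega>] by (auto intro!: mono_onD[OF uA(2)])
    then show ?thesis using False by (simp add: sT(1) sW(1))
  qed
  have pw2: "f (stopped T (R c) n \<omega>) - f (stopped W (R c) n \<omega>) \<le> f (d\<^sup>2) * indicator B \<omega>" if "\<omega> \<in> space P" for \<omega>
  proof (cases "a \<le> u (A (s \<omega>) \<omega>)")
    case True
    then have "\<omega> \<in> B" using that by (simp add: B_def s\<tau>)
    then show ?thesis using fR[of \<omega>] by (simp add: sT(1) sW(1))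
  next
    case False
    then have "\<omega> \<notin> B" by (auto simp: B_def s\<tau>)
    then show ?thesis using notB[OF False] by (simp add: sT sW)
  qed
  have i1: "integrable P (\<lambda>\<omega>. f (stopped T (R c) n \<omega>) - f (stopped W (R c) n \<omega>))"
  proof (intro Bochner_Integration.integrable_diff integrable_bounded[where B="f (d\<^sup>2)"])
    show "\<bar>f (stopped T (R c) n \<omega>)\<bar> \<le> f (d\<^sup>2)" "\<bar>f (stopped W (R c) n \<omega>)\<bar> \<le> f (d\<^sup>2)" for \<omega>
      using fR[of \<omega>] by (simp_all add: sT(1) sW(1))
  qed measurable
  have i2: "integrable P (\<lambda>\<omega>. u (stopped T A n \<omega>) - u (stopped W A n \<omega>))"
  proof (intro Bochner_Integration.integrable_diff integrable_bounded[where B=b])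
    show "\<bar>u (stopped T A n \<omega>)\<bar> \<le> b" "\<bar>u (stopped W A n \<omega>)\<bar> \<le> b" for \<omega>
      using uK[of \<omega>] by (simp_all add: sT(1) sW(1))
  qed measurable
  have "(b - a) * measure P G = (\<integral>\<omega>. (b - a) * indicator G \<omega> \<partial>P)" by simp
  also have "\<dots> \<le> (\<integral>\<omega>. u (stopped T A n \<omega>) - u (stopped W A n \<omega>) \<partial>P)"
    by (intro integral_mono i2 pw1) (auto simp: less_top[symmetric])
  also have "\<dots> \<le> (\<integral>\<omega>. f (stopped T (R c) n \<omega>) - f (stopped W (R c) n \<omega>) \<partial>P)"
    unfolding W_def by (intro ito S T T\<tau>)
  also have "\<dots> \<le> (\<integral>\<omega>. f (d\<^sup>2) * indicator B \<omega> \<partial>P)"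
    by (intro integral_mono i1 pw2) (auto simp: less_top[symmetric])
  also have "\<dots> = f (d\<^sup>2) * measure P B" by simp
  finally show ?thesis unfolding G_def B_def .
qed

end

text \<open>
  Fubini's theorem for the measure \<open>dN\<close>, since \<open>N(x)\<close> is the mass of
  \<open>(0, x]\<close>.
\<close>

lemma layer_cake:
  fixes N :: "real \<Rightarrow> real" and h :: "'a \<Rightarrow> real"
  assumes "prob_space P" and h[measurable]: "h \<in> borel_measurable P" and h0: "\<And>\<omega>. 0 \<le> h \<omega>"
    and N: "mono_on {0..} N" "continuous_on {0..} N" "N 0 = 0"
  shows "(\<integral>\<^sup>+\<omega>. ennreal (N (h \<omega>)) \<partial>P) =
    (\<integral>\<^sup>+l. indicator {0<..} l * emeasure P {\<omega> \<in> space P. l \<le> h \<omega>} \<partial>interval_measure (\<lambda>x. N (max 0 x)))"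
proof -
  interpret prob_space P by fact
  define N' where "N' x = N (max 0 x)" for x
  have mono: "N' x \<le> N' y" if "x \<le> y" for x y unfolding N'_def by (rule mono_onD[OF N(1)]) (use that in auto)
  have cont: "continuous_on UNIV N'" unfolding N'_def by (intro continuous_on_compose2[OF N(2)] continuous_intros) auto
  have right: "continuous (at_right x) N'" for x
    using cont by (simp add: continuous_on_eq_continuous_at continuous_at_imp_continuous_at_within)
  let ?M = "interval_measure N'"
  interpret M: sigma_finite_measure ?M by (rule sigma_finite_interval_measure[OF mono right])
  interpret pair_sigma_finite P ?M ..
  have [measurable]: "(\<lambda>z. snd z) \<in> borel_measurable (P \<Otimes>\<^sub>M ?M)"
    using measurable_snd[of P ?M] by (simp add: measurable_cong_sets[OF refl sets_interval_measure])
  have [measurable]: "(\<lambda>z. fst z) \<in> measurable (P \<Otimes>\<^sub>M ?M) P" by simp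
  have meas: "(\<lambda>(\<omega>, l). indicator {0<..h \<omega>} l :: ennreal) \<in> borel_measurable (P \<Otimes>\<^sub>M ?M)"
  proof -
    have "(\<lambda>z. if 0 < snd z \<and> snd z \<le> h (fst z) then 1 else 0 :: ennreal) \<in> borel_measurable (P \<Otimes>\<^sub>M ?M)"
      by measurable
    also have "(\<lambda>z. if 0 < snd z \<and> snd z \<le> h (fst z) then 1 else 0 :: ennreal) = (\<lambda>(\<omega>, l). indicator {0<..h \<omega>} l)"
      by (auto simp: fun_eq_iff)
    finally show ?thesis .
  qed
  have "(\<integral>\<^sup>+\<omega>. ennreal (N (h \<omega>)) \<partial>P) = (\<integral>\<^sup>+\<omega>. (\<integral>\<^sup>+l. indicator {0<..h \<omega>} l \<partial>?M) \<partial>P)"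
  proof (intro nn_integral_cong)
    fix \<omega>
    have "(\<integral>\<^sup>+l. indicator {0<..h \<omega>} l \<partial>?M) = emeasure ?M {0<..h \<omega>}" by (rule nn_integral_indicator) simp
    also have "\<dots> = ennreal (N' (h \<omega>) - N' 0)" using emeasure_interval_measure_Ioc[OF h0 mono right] by simp
    finally show "ennreal (N (h \<omega>)) = (\<integral>\<^sup>+l. indicator {0<..h \<omega>} l \<partial>?M)" using h0[of \<omega>] N(3) by (simp add: N'_def)
  qed
  also have "\<dots> = (\<integral>\<^sup>+l. (\<integral>\<^sup>+\<omega>. indicator {0<..h \<omega>} l \<partial>P) \<partial>?M)"
    using Fubini'[OF meas] by simp
  also have "\<dots> = (\<integral>\<^sup>+l. indicator {0<..} l * emeasure P {\<omega> \<in> space P. l \<le> h \<omega>} \<partial>?M)"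
  proof (intro nn_integral_cong)
    fix l :: real
    have "(\<integral>\<^sup>+\<omega>. indicator {0<..h \<omega>} l \<partial>P) = (\<integral>\<^sup>+\<omega>. indicator {0<..} l * indicator {\<omega> \<in> space P. l \<le> h \<omega>} \<omega> \<partial>P)"
      by (intro nn_integral_cong) (auto simp: indicator_def)
    also have "\<dots> = indicator {0<..} l * emeasure P {\<omega> \<in> space P. l \<le> h \<omega>}"
      by (simp add: nn_integral_cmult)
    finally show "(\<integral>\<^sup>+\<omega>. indicator {0<..h \<omega>} l \<partial>P) = indicator {0<..} l * emeasure P {\<omega> \<in> space P. l \<le> h \<omega>}" .
  qed
  finally show ?thesis by (simp add: N'_def[abs_def])
qed

text \<open>
  Integration of the hypothesis against \<open>dN\<close>. Levels up to \<open>l0\<close> carry no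
  mass, so the hypothesis is asked for above \<open>l0\<close> only.
\<close>

lemma good_lambda_integral:
  fixes N :: "real \<Rightarrow> real"
  assumes P: "prob_space P" and GH[measurable]: "G \<in> borel_measurable P" "H \<in> borel_measurable P"
    and GH0: "\<And>\<omega>. 0 \<le> G \<omega>" "\<And>\<omega>. 0 \<le> H \<omega>"
    and N: "mono_on {0..} N" "continuous_on {0..} N" "N 0 = 0" and N0: "0 \<le> l0" "N l0 = 0"
    and b: "0 < b" and d: "0 < d" and e: "0 \<le> e"
    and gl: "\<And>l. l0 < l \<Longrightarrow> measure P {\<omega> \<in> space P. b * l \<le> G \<omega> \<and> H \<omega> < d * l} \<le> e * measure P {\<omega> \<in> space P. l \<le> G \<omega>}"
  shows "(\<integral>\<^sup>+\<omega>. ennreal (N (G \<omega> / b)) \<partial>P) \<le> ennreal e * (\<integral>\<^sup>+\<omega>. ennreal (N (G \<omega>)) \<partial>P) + (\<integral>\<^sup>+\<omega>. ennreal (N (H \<omega> / d)) \<partial>P)"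
proof -
  interpret prob_space P by fact
  define N' where "N' x = N (max 0 x)" for x
  have mono: "N' x \<le> N' y" if "x \<le> y" for x y unfolding N'_def by (rule mono_onD[OF N(1)]) (use that in auto)
  have cont: "continuous_on UNIV N'" unfolding N'_def by (intro continuous_on_compose2[OF N(2)] continuous_intros) auto
  have right: "continuous (at_right x) N'" for x
    using cont by (simp add: continuous_on_eq_continuous_at continuous_at_imp_continuous_at_within)
  let ?M = "interval_measure N'"
  have nullset: "AE l in ?M. \<not> (0 < l \<and> l \<le> l0)"
  proof (rule AE_I[where N="{0<..l0}"])
    show "emeasure ?M {0<..l0} = 0" using emeasure_interval_measure_Ioc[OF N0(1) mono right] N0 N(3) by (simp add: N'_def)
  qed auto
  have me: "(\<lambda>l. emeasure P {\<omega> \<in> space P. l \<le> h \<omega>}) \<in> borel_measurable ?M" if [measurable]: "h \<in> borel_measurable P" for h :: "'a \<Rightarrow> real"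
  proof -
    have m: "(\<lambda>z. snd z) \<in> measurable (?M \<Otimes>\<^sub>M P) P" "(\<lambda>z. fst z) \<in> borel_measurable (?M \<Otimes>\<^sub>M P)"
      using measurable_fst[of ?M P] by (simp_all add: measurable_cong_sets[OF refl sets_interval_measure])
    note [measurable] = m
    have "{z \<in> space (?M \<Otimes>\<^sub>M P). fst z \<le> h (snd z)} \<in> sets (?M \<Otimes>\<^sub>M P)" by measurable
    from measurable_emeasure_Pair[OF this] show ?thesis
      by (rule measurable_cong[THEN iffD1, rotated]) (auto simp: space_pair_measure intro!: arg_cong[where f="emeasure P"])
  qed
  have G1: "(\<integral>\<^sup>+\<omega>. ennreal (N (G \<omega> / b)) \<partial>P) = (\<integral>\<^sup>+l. indicator {0<..} l * emeasure P {\<omega> \<in> space P. l \<le> G \<omega> / b} \<partial>?M)"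
    unfolding N'_def by (rule layer_cake[OF P _ _ N]) (use b GH0 in auto)
  have G2: "(\<integral>\<^sup>+\<omega>. ennreal (N (G \<omega>)) \<partial>P) = (\<integral>\<^sup>+l. indicator {0<..} l * emeasure P {\<omega> \<in> space P. l \<le> G \<omega>} \<partial>?M)"
    unfolding N'_def by (rule layer_cake[OF P _ _ N]) (use b GH0 in auto)
  have G3: "(\<integral>\<^sup>+\<omega>. ennreal (N (H \<omega> / d)) \<partial>P) = (\<integral>\<^sup>+l. indicator {0<..} l * emeasure P {\<omega> \<in> space P. l \<le> H \<omega> / d} \<partial>?M)"
    unfolding N'_def by (rule layer_cake[OF P _ _ N]) (use d GH0 in auto)
  have pw: "emeasure P {\<omega> \<in> space P. l \<le> G \<omega> / b} \<le> ennreal e * emeasure P {\<omega> \<in> space P. l \<le> G \<omega>} + emeasure P {\<omega> \<in> space P. l \<le> H \<omega> / d}"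
    if "l0 < l" for l
  proof -
    have "measure P {\<omega> \<in> space P. l \<le> G \<omega> / b} \<le> measure P ({\<omega> \<in> space P. b * l \<le> G \<omega> \<and> H \<omega> < d * l} \<union> {\<omega> \<in> space P. l \<le> H \<omega> / d})"
      using b d by (intro finite_measure_mono) (auto simp: field_simps)
    also have "\<dots> \<le> measure P {\<omega> \<in> space P. b * l \<le> G \<omega> \<and> H \<omega> < d * l} + measure P {\<omega> \<in> space P. l \<le> H \<omega> / d}"
      by (intro measure_Un_le) auto
    also have "\<dots> \<le> e * measure P {\<omega> \<in> space P. l \<le> G \<omega>} + measure P {\<omega> \<in> space P. l \<le> H \<omega> / d}"
      using gl[OF that] by simp
    finally have "ennreal (measure P {\<omega> \<in> space P. l \<le> G \<omega> / b}) \<le> ennreal (e * measure P {\<omega> \<in> space P. l \<le> G \<omega>} + measure P {\<omega> \<in> space P. l \<le> H \<omega> / d})"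
      by (rule ennreal_leI)
    then show ?thesis unfolding emeasure_eq_measure using e by (simp add: ennreal_plus ennreal_mult)
  qed
  have "(\<integral>\<^sup>+\<omega>. ennreal (N (G \<omega> / b)) \<partial>P) \<le> (\<integral>\<^sup>+l. ennreal e * (indicator {0<..} l * emeasure P {\<omega> \<in> space P. l \<le> G \<omega>}) + indicator {0<..} l * emeasure P {\<omega> \<in> space P. l \<le> H \<omega> / d} \<partial>?M)"
    unfolding G1
  proof (rule nn_integral_mono_AE)
    show "AE l in ?M. indicator {0<..} l * emeasure P {\<omega> \<in> space P. l \<le> G \<omega> / b} \<le> ennreal e * (indicator {0<..} l * emeasure P {\<omega> \<in> space P. l \<le> G \<omega>}) + indicator {0<..} l * emeasure P {\<omega> \<in> space P. l \<le> H \<omega> / d}"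
      using nullset
    proof eventually_elim
      case (elim l)
      then show ?case using pw[of l] by (cases "0 < l") auto
    qed
  qed
  also have "\<dots> = ennreal e * (\<integral>\<^sup>+\<omega>. ennreal (N (G \<omega>)) \<partial>P) + (\<integral>\<^sup>+\<omega>. ennreal (N (H \<omega> / d)) \<partial>P)"
    unfolding G2 G3
    using me[of G] me[of "\<lambda>\<omega>. H \<omega> / d"] by (subst nn_integral_add) (auto simp: nn_integral_cmult)
  finally show ?thesis .
qed

section \<open>A potential for the planar Ornstein-Uhlenbeck process\<close>

text \<open>
  Power series coefficients, with value \<open>0\<close> at \<open>k = 0\<close> because division by
  \<open>0\<close> gives \<open>0\<close>. The sum of the series is
  \<open>\<integral>\<^sub>0\<^sup>r (exp (s/2) - 1) / s ds\<close>; the series shows that it is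
  smooth at \<open>0\<close> too.
\<close>

definition ou_coeff :: "nat \<Rightarrow> real" where "ou_coeff k = 1 / (2 ^ k * real k * fact k)"
definition ou_potential :: "real \<Rightarrow> real" where "ou_potential r = (\<Sum>k. ou_coeff k * r ^ k)"
definition ou_potential1 :: "real \<Rightarrow> real" where "ou_potential1 r = (\<Sum>k. diffs ou_coeff k * r ^ k)"
definition ou_potential2 :: "real \<Rightarrow> real" where "ou_potential2 r = (\<Sum>k. diffs (diffs ou_coeff) k * r ^ k)"
definition ou_potential3 :: "real \<Rightarrow> real" where "ou_potential3 r = (\<Sum>k. diffs (diffs (diffs ou_coeff)) k * r ^ k)"

lemma ou_coeff_summable: "summable (\<lambda>k. ou_coeff k * r ^ k)"
proof (rule summable_comparison_test'[OF summable_exp[of "\<bar>r\<bar> / 2"], of 0])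
  fix k :: nat
  have "norm (ou_coeff k * r ^ k) = (1 / real k) * (inverse (fact k) * (\<bar>r\<bar> / 2) ^ k)"
    by (simp add: ou_coeff_def abs_mult power_abs field_simps power_divide)
  also have "\<dots> \<le> 1 * (inverse (fact k) * (\<bar>r\<bar> / 2) ^ k)"
    by (intro mult_right_mono) (auto simp: divide_le_eq)
  finally show "norm (ou_coeff k * r ^ k) \<le> inverse (fact k) * (\<bar>r\<bar> / 2) ^ k" by simp
qed

lemma ou_potential_deriv: "DERIV ou_potential r :> ou_potential1 r" "DERIV ou_potential1 r :> ou_potential2 r" "DERIV ou_potential2 r :> ou_potential3 r" "isCont ou_potential3 r"
proof -
  have s1: "summable (\<lambda>k. diffs ou_coeff k * r ^ k)" for r :: real by (rule termdiff_converges_all[OF ou_coeff_summable])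
  have s2: "summable (\<lambda>k. diffs (diffs ou_coeff) k * r ^ k)" for r :: real by (rule termdiff_converges_all[OF s1])
  have s3: "summable (\<lambda>k. diffs (diffs (diffs ou_coeff)) k * r ^ k)" for r :: real by (rule termdiff_converges_all[OF s2])
  show "DERIV ou_potential r :> ou_potential1 r" unfolding ou_potential_def[abs_def] ou_potential1_def by (rule termdiffs_strong_converges_everywhere[OF ou_coeff_summable])
  show "DERIV ou_potential1 r :> ou_potential2 r" unfolding ou_potential1_def[abs_def] ou_potential2_def by (rule termdiffs_strong_converges_everywhere[OF s1])
  show "DERIV ou_potential2 r :> ou_potential3 r" unfolding ou_potential2_def[abs_def] ou_potential3_def by (rule termdiffs_strong_converges_everywhere[OF s2])
  show "isCont ou_potential3 r" unfolding ou_potential3_def[abs_def] by (rule DERIV_isCont[OF termdiffs_strong_converges_everywhere[OF s3]])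
qed

lemma ou_potential1_eq: "r * ou_potential1 r = exp (r / 2) - 1"
proof -
  have s: "summable (\<lambda>k. diffs ou_coeff k * r ^ k)" by (rule termdiff_converges_all[OF ou_coeff_summable])
  have e: "r * (diffs ou_coeff k * r ^ k) = inverse (fact (Suc k)) * (r / 2) ^ Suc k" for k
  proof -
    have "diffs ou_coeff k = 1 / (2 ^ Suc k * fact (Suc k))"
      unfolding diffs_def ou_coeff_def by (simp del: fact_Suc power_Suc of_nat_Suc)
    then show ?thesis by (simp add: power_divide inverse_eq_divide mult_ac del: fact_Suc)
  qed
  have "r * ou_potential1 r = (\<Sum>k. inverse (fact (Suc k)) * (r / 2) ^ Suc k)"
    unfolding ou_potential1_def suminf_mult[OF s, symmetric] e ..
  also have "\<dots> = (\<Sum>k. inverse (fact k) * (r / 2) ^ k) - 1"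
    by (subst suminf_split_head[OF summable_exp]) simp
  also have "(\<Sum>k. inverse (fact k) * (r / 2) ^ k) = exp (r / 2)" unfolding exp_def by (simp only: real_scaleR_def)
  finally show ?thesis .
qed

text \<open>
  Differentiating \<open>r f'(r) = exp (r/2) - 1\<close> yields \<open>f' + r f'' = exp (r/2) /
  2\<close>; twice this minus the original identity is the claim.
\<close>

lemma ou_potential_generator: "ou_potential1 r * (2 - 1 * r) + 2 * r * ou_potential2 r = 1"
proof -
  have "DERIV (\<lambda>r. r * ou_potential1 r) r :> ou_potential1 r + r * ou_potential2 r"
    by (auto intro!: derivative_eq_intros ou_potential_deriv)
  moreover have "DERIV (\<lambda>r. exp (r / 2) - 1) r :> exp (r / 2) / 2"
    by (auto intro!: derivative_eq_intros)
  ultimately have "ou_potential1 r + r * ou_potential2 r = exp (r / 2) / 2"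
    unfolding ou_potential1_eq by (rule DERIV_unique)
  then show ?thesis using ou_potential1_eq[of r] by (simp add: algebra_simps)
qed

text \<open>
  Termwise comparison with the exponential series, using \<open>1 \<le> k \<le> 2\<^sup>k\<close>.
\<close>

lemma ou_potential_bounds:
  assumes r: "0 \<le> r"
  shows "exp (r / 4) - 1 \<le> ou_potential r" "ou_potential r \<le> exp (r / 2) - 1"
proof -
  have ex: "(\<lambda>k. (if k = 0 then 0 else inverse (fact k) * x ^ k)) sums (exp x - 1)" for x :: real
  proof -
    have "(\<lambda>k. inverse (fact k) * x ^ k - (if k = 0 then 1 else 0)) sums (exp x - 1)"
      using exp_converges[of x] sums_single[of 0 "\<lambda>_. 1 :: real"]
      unfolding real_scaleR_def by (intro sums_diff) auto
    also have "(\<lambda>k. inverse (fact k) * x ^ k - (if k = 0 then 1 else 0)) = (\<lambda>k. (if k = 0 then 0 else inverse (fact k) * x ^ k))"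
      by auto
    finally show ?thesis .
  qed
  have h: "(\<lambda>k. ou_coeff k * r ^ k) sums ou_potential r" unfolding ou_potential_def by (rule summable_sums[OF ou_coeff_summable])
  have ou_coeff_eq: "ou_coeff k * r ^ k = (1 / real k) * (inverse (fact k) * (r / 2) ^ k)" for k
    by (simp add: ou_coeff_def field_simps power_divide)
  show "ou_potential r \<le> exp (r / 2) - 1"
  proof (rule sums_le[OF _ h ex])
    fix k :: nat
    have "(1 / real k) * (inverse (fact k) * (r / 2) ^ k) \<le> 1 * (inverse (fact k) * (r / 2) ^ k)"
      using r by (intro mult_right_mono) (auto simp: divide_le_eq)
    then show "ou_coeff k * r ^ k \<le> (if k = 0 then 0 else inverse (fact k) * (r / 2) ^ k)" unfolding ou_coeff_eq by simp
  qed
  show "exp (r / 4) - 1 \<le> ou_potential r"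
  proof (rule sums_le[OF _ ex h])
    fix k :: nat
    show "(if k = 0 then 0 else inverse (fact k) * (r / 4) ^ k) \<le> ou_coeff k * r ^ k"
    proof (cases "k = 0")
      case False
      have q: "(r / 4) ^ k = (1 / 2 ^ k) * (r / 2) ^ k" by (simp add: power_mult_distrib[symmetric] power_one_over[symmetric])
      have "real k \<le> 2 ^ k" using of_nat_less_two_power[of k] by simp
      then have "1 / 2 ^ k \<le> 1 / real k" using False by (intro divide_left_mono) auto
      then have "(1 / 2 ^ k) * (inverse (fact k) * (r / 2) ^ k) \<le> (1 / real k) * (inverse (fact k) * (r / 2) ^ k)"
        using r by (intro mult_right_mono) auto
      then show ?thesis unfolding ou_coeff_eq q using False by (simp add: mult_ac)
    qed (simp add: ou_coeff_def)
  qed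
qed

lemma ou_potential_0 [simp]: "ou_potential 0 = 0"
  using ou_potential_bounds[of 0] by simp

lemma ou_potential_less:
  assumes "0 \<le> r" "r < s" shows "ou_potential r < ou_potential s"
proof (rule DERIV_pos_imp_increasing[OF assms(2)])
  fix x assume x: "r \<le> x" "x \<le> s"
  have "0 < ou_potential1 x"
  proof (cases "x = 0")
    case True
    have "ou_potential1 0 = diffs ou_coeff 0" unfolding ou_potential1_def by (rule powser_zero)
    then show ?thesis using True by (simp add: diffs_def ou_coeff_def)
  next
    case False
    then have "0 < x" using x assms by simp
    then have "0 < x * ou_potential1 x" unfolding ou_potential1_eq by simp
    then show ?thesis using \<open>0 < x\<close> by (simp add: zero_less_mult_iff)
  qed
  then show "\<exists>y. DERIV ou_potential x :> y \<and> 0 < y" using ou_potential_deriv(1) by blast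
qed

lemma ou_potential_le_iff: "0 \<le> r \<Longrightarrow> 0 \<le> s \<Longrightarrow> ou_potential r \<le> ou_potential s \<longleftrightarrow> r \<le> s"
  using ou_potential_less[of r s] ou_potential_less[of s r] by (metis less_eq_real_def not_less)

lemma ou_potential_mono: "mono_on {0..} ou_potential"
  by (rule mono_onI) (simp add: ou_potential_le_iff)

lemma ou_potential_surj:
  assumes "0 \<le> y" obtains r where "0 \<le> r" "ou_potential (r\<^sup>2) = y"
proof -
  have "continuous_on {0..4 * ln (1 + y)} ou_potential"
    using ou_potential_deriv(1) DERIV_isCont by (intro continuous_at_imp_continuous_on) blast
  moreover have "y \<le> ou_potential (4 * ln (1 + y))" using ou_potential_bounds(1)[of "4 * ln (1 + y)"] assms by simp
  ultimately obtain x where "0 \<le> x" "ou_potential x = y"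
    using IVT'[of ou_potential 0 y "4 * ln (1 + y)"] assms by auto
  then show ?thesis using that[of "sqrt x"] by simp
qed

lemma ou_potential_meas [measurable]: "ou_potential \<in> borel_measurable borel"
  using ou_potential_deriv(1) DERIV_isCont
  by (intro borel_measurable_continuous_onI continuous_at_imp_continuous_on) blast

lemma ln_step:
  fixes a a' :: real
  assumes "0 \<le> a" "a \<le> a'"
  shows "\<bar>ln (1 + a') - ln (1 + a) - (a' - a) / (1 + 1 * a)\<bar> \<le> (a' - a)\<^sup>2"
proof -
  define y where "y = (a' - a) / (1 + a)"
  have y: "0 \<le> y" "y \<le> a' - a" using assms by (auto simp: y_def divide_le_eq mult_le_cancel_left1)
  have "(1 + a') / (1 + a) = 1 + y" using assms by (simp add: y_def field_simps)
  then have e: "ln (1 + a') - ln (1 + a) = ln (1 + y)" using assms ln_div[of "1 + a'" "1 + a"] by simp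
  have up: "ln (1 + y) \<le> y" using y by (intro ln_add_one_self_le_self)
  have lo: "y - y\<^sup>2 \<le> ln (1 + y)"
  proof (cases "y \<le> 1")
    case True then show ?thesis using ln_one_plus_pos_lower_bound[of y] y by simp
  next
    case False
    then have "y - y\<^sup>2 \<le> 0" by (simp add: power2_eq_square)
    also have "0 \<le> ln (1 + y)" using y by simp
    finally show ?thesis .
  qed
  have "y\<^sup>2 \<le> (a' - a)\<^sup>2" using y by (intro power_mono)
  then show ?thesis unfolding e mult_1 y_def[symmetric] abs_le_iff using up lo zero_le_power2[of "a' - a"] by (intro conjI; linarith)
qed

section \<open>Moderate functions and domination\<close>

lemma measurable_comp_nonneg:
  fixes N :: "real \<Rightarrow> real"
  assumes N: "continuous_on {0..} N" and h: "h \<in> borel_measurable M" "\<And>\<omega>. 0 \<le> h \<omega>"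
  shows "(\<lambda>\<omega>. N (h \<omega>)) \<in> borel_measurable M"
proof -
  have "continuous_on UNIV (\<lambda>x. N (max 0 x))" by (intro continuous_on_compose2[OF N] continuous_intros) auto
  then have "(\<lambda>x. N (max 0 x)) \<in> borel_measurable borel" by (rule borel_measurable_continuous_onI)
  from measurable_compose[OF h(1) this] show ?thesis using h(2) by (simp add: max_absorb2)
qed

text \<open>Finiteness of \<open>I\<close> is what permits subtracting \<open>e I\<close>.\<close>

lemma ennreal_absorb:
  fixes I Z :: ennreal
  assumes "I < \<infinity>" "I \<le> ennreal e * I + Z" "0 \<le> e" "e \<le> 1 / 2"
  shows "I \<le> 2 * Z"
proof (cases Z)
  case (real z)
  obtain i where i: "I = ennreal i" "0 \<le> i" using assms(1) by (cases I) auto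
  have "ennreal i \<le> ennreal (e * i + z)" using assms(2) assms(3) real i by (simp add: ennreal_plus ennreal_mult)
  then have "i \<le> e * i + z" using i real assms(3) by (subst (asm) ennreal_le_iff) auto
  moreover have "e * i \<le> 1 / 2 * i" using assms i by (intro mult_right_mono) auto
  ultimately have "i \<le> 2 * z" by simp
  then have "ennreal i \<le> ennreal (2 * z)" by (rule ennreal_leI)
  then show ?thesis using i real by (simp add: ennreal_mult)
qed (simp add: ennreal_mult_top)

text \<open>
  The growth of \<open>N\<close> turns the bound for \<open>N(G/b)\<close> into one for
  \<open>N(G)\<close>, and \<open>e k \<le> 1/2\<close> lets the right-hand side be absorbed;
  \<open>G\<close> is bounded so that the absorbed term is finite.
\<close>

lemma good_lambda_domination:
  fixes N :: "real \<Rightarrow> real"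
  assumes P: "prob_space P" and GH: "G \<in> borel_measurable P" "H \<in> borel_measurable P"
    and GH0: "\<And>\<omega>. 0 \<le> G \<omega>" "\<And>\<omega>. 0 \<le> H \<omega>" and GM: "\<And>\<omega>. G \<omega> \<le> M"
    and N: "mono_on {0..} N" "continuous_on {0..} N" "N 0 = 0"
    and b: "0 < b" and d: "0 < d" and e: "0 \<le> e" and k: "0 \<le> k" "0 \<le> k'" "e * k \<le> 1 / 2"
    and Nk: "\<And>x. 0 \<le> x \<Longrightarrow> N (b * x) \<le> k * N x" "\<And>x. 0 \<le> x \<Longrightarrow> N (x / d) \<le> k' * N x"
    and gl: "\<And>l. 0 < l \<Longrightarrow> measure P {\<omega> \<in> space P. b * l \<le> G \<omega> \<and> H \<omega> < d * l} \<le> e * measure P {\<omega> \<in> space P. l \<le> G \<omega>}"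
  shows "(\<integral>\<^sup>+\<omega>. ennreal (N (G \<omega>)) \<partial>P) \<le> ennreal (2 * k * k') * (\<integral>\<^sup>+\<omega>. ennreal (N (H \<omega>)) \<partial>P)"
proof -
  interpret prob_space P by fact
  have N0: "0 \<le> N x" if "0 \<le> x" for x using mono_onD[OF N(1), of 0 x] that N(3) by simp
  have [measurable]: "(\<lambda>\<omega>. N (G \<omega> / b)) \<in> borel_measurable P" "(\<lambda>\<omega>. N (H \<omega> / d)) \<in> borel_measurable P"
      "(\<lambda>\<omega>. N (H \<omega>)) \<in> borel_measurable P" "(\<lambda>\<omega>. N (G \<omega>)) \<in> borel_measurable P"
    using GH GH0 b d by (auto intro!: measurable_comp_nonneg[OF N(2)])
  let ?I = "\<integral>\<^sup>+\<omega>. ennreal (N (G \<omega>)) \<partial>P" and ?J = "\<integral>\<^sup>+\<omega>. ennreal (N (H \<omega>)) \<partial>P"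
  have "?I \<le> (\<integral>\<^sup>+\<omega>. ennreal (N M) \<partial>P)"
    using GM order_trans[OF GH0(1) GM] GH0(1) by (intro nn_integral_mono ennreal_leI mono_onD[OF N(1)]) auto
  also have "\<dots> < \<infinity>" by (simp add: emeasure_space_1)
  finally have fin: "?I < \<infinity>" .
  have "?I \<le> (\<integral>\<^sup>+\<omega>. ennreal k * ennreal (N (G \<omega> / b)) \<partial>P)"
  proof (intro nn_integral_mono)
    fix \<omega>
    have "N (G \<omega>) \<le> k * N (G \<omega> / b)" using Nk(1)[of "G \<omega> / b"] GH0(1)[of \<omega>] b by simp
    then show "ennreal (N (G \<omega>)) \<le> ennreal k * ennreal (N (G \<omega> / b))"
      using k(1) b GH0(1)[of \<omega>] by (simp add: ennreal_mult[symmetric] N0 ennreal_leI)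
  qed
  also have "\<dots> = ennreal k * (\<integral>\<^sup>+\<omega>. ennreal (N (G \<omega> / b)) \<partial>P)" by (rule nn_integral_cmult) measurable
  also have "\<dots> \<le> ennreal k * (ennreal e * ?I + (\<integral>\<^sup>+\<omega>. ennreal (N (H \<omega> / d)) \<partial>P))"
    by (intro mult_left_mono good_lambda_integral[OF P GH GH0 N order_refl N(3) b d e gl]) auto
  also have "(\<integral>\<^sup>+\<omega>. ennreal (N (H \<omega> / d)) \<partial>P) \<le> (\<integral>\<^sup>+\<omega>. ennreal k' * ennreal (N (H \<omega>)) \<partial>P)"
    using Nk(2)[OF GH0(2)] k(2) GH0(2) by (intro nn_integral_mono) (simp add: ennreal_mult[symmetric] N0 ennreal_leI)
  also have "\<dots> = ennreal k' * ?J" by (rule nn_integral_cmult) measurable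
  finally have "?I \<le> ennreal k * (ennreal e * ?I + ennreal k' * ?J)" by (simp add: mult_left_mono)
  also have "\<dots> = ennreal (e * k) * ?I + ennreal (k * k') * ?J"
    using e k by (simp add: distrib_left ennreal_mult mult_ac)
  finally have "?I \<le> 2 * (ennreal (k * k') * ?J)" using e k by (intro ennreal_absorb[OF fin]) auto
  also have "\<dots> = ennreal (2 * k * k') * ?J" using k by (simp add: ennreal_mult mult_ac)
  finally show ?thesis .
qed

lemma moderateD:
  assumes "moderate \<Phi>"
  shows "\<And>x. 0 \<le> x \<Longrightarrow> 0 \<le> \<Phi> x" "continuous_on {0..} \<Phi>" "mono_on {0..} \<Phi>" "\<Phi> 0 = 0"
  using assms by (auto simp: moderate_def)

text \<open>
  Iteration of the defining growth condition. Where \<open>\<Phi> x = 0\<close>, finiteness of the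
  ratio forces \<open>\<Phi> (\<beta> x) = 0\<close>.
\<close>

lemma moderate_growth:
  assumes "moderate \<Phi>" "0 \<le> q"
  obtains C where "1 \<le> C" "\<And>x. 0 \<le> x \<Longrightarrow> \<Phi> (q * x) \<le> C * \<Phi> x"
proof -
  note m = moderateD[OF assms(1)]
  obtain \<beta> where \<beta>: "1 < \<beta>" and fin: "(SUP x\<in>{0<..}. ratio (\<Phi> (\<beta> * x)) (\<Phi> x)) < \<infinity>"
    using assms(1) by (auto simp: moderate_def)
  then obtain S where S: "(SUP x\<in>{0<..}. ratio (\<Phi> (\<beta> * x)) (\<Phi> x)) = ennreal S" "0 \<le> S"
    by (cases "SUP x\<in>{0<..}. ratio (\<Phi> (\<beta> * x)) (\<Phi> x)") auto
  define B where "B = max 1 S"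
  have step: "\<Phi> (\<beta> * x) \<le> B * \<Phi> x" if "0 \<le> x" for x
  proof (cases "x = 0")
    case False
    then have x: "0 < x" using that by simp
    have r: "ratio (\<Phi> (\<beta> * x)) (\<Phi> x) \<le> ennreal S"
      unfolding S(1)[symmetric] using x by (intro SUP_upper) auto
    show ?thesis
    proof (cases "\<Phi> x = 0")
      case True
      then show ?thesis using r by (auto simp: ratio_def split: if_splits simp: top_unique)
    next
      case False
      then have "0 < \<Phi> x" using m(1)[OF that] by simp
      moreover have "\<Phi> (\<beta> * x) / \<Phi> x \<le> S" using r False S(2) by (simp add: ratio_def ennreal_le_iff)
      ultimately have "\<Phi> (\<beta> * x) \<le> S * \<Phi> x" by (simp add: divide_le_eq)
      also have "\<dots> \<le> B * \<Phi> x" using \<open>0 < \<Phi> x\<close> by (intro mult_right_mono) (auto simp: B_def)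
      finally show ?thesis .
    qed
  qed (simp add: m(4))
  have B1: "1 \<le> B" by (simp add: B_def)
  have pow: "\<Phi> (\<beta> ^ j * x) \<le> B ^ j * \<Phi> x" if "0 \<le> x" for j x
  proof (induction j)
    case (Suc j)
    have "\<Phi> (\<beta> ^ Suc j * x) = \<Phi> (\<beta> * (\<beta> ^ j * x))" by (simp add: mult.assoc)
    also have "\<dots> \<le> B * \<Phi> (\<beta> ^ j * x)" using that \<beta> by (intro step) auto
    also have "\<dots> \<le> B * (B ^ j * \<Phi> x)" using B1 by (intro mult_left_mono Suc.IH) auto
    finally show ?case by (simp add: mult.assoc)
  qed simp
  obtain j where j: "q < \<beta> ^ j" using real_arch_pow[OF \<beta>] by blast
  show ?thesis
  proof (rule that[of "B ^ j"])
    show "1 \<le> B ^ j" using B1 by (rule one_le_power)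
    fix x :: real assume x: "0 \<le> x"
    show "\<Phi> (q * x) \<le> B ^ j * \<Phi> x"
    proof -
      have "\<Phi> (q * x) \<le> \<Phi> (\<beta> ^ j * x)"
        using assms(2) x j \<beta> by (intro mono_onD[OF m(3)]) (auto intro: mult_right_mono)
      then show ?thesis using pow[OF x, of j] by (rule order_trans)
    qed
  qed
qed

section \<open>The clock and the maximal modulus\<close>

context planar_martingale
begin

text \<open>Stopping times up to which everything is bounded, hence all expectations are finite.\<close>

definition bounded_time :: "('a \<Rightarrow> ennreal) \<Rightarrow> real \<Rightarrow> real \<Rightarrow> bool" where
  "bounded_time \<tau> n K \<longleftrightarrow> stopping_time F \<tau> \<and> (\<forall>\<omega>. \<tau> \<omega> \<le> ennreal n) \<and> 0 < n \<and>
    (\<forall>t \<omega>. 0 \<le> t \<longrightarrow> ennreal t \<le> \<tau> \<omega> \<longrightarrow> \<bar>X t \<omega>\<bar> \<le> K \<and> \<bar>Y t \<omega>\<bar> \<le> K \<and> A t \<omega> \<le> K)"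

lemma bounded_timeD:
  assumes "bounded_time \<tau> n K"
  shows "stopping_time F \<tau>" "\<And>\<omega>. \<tau> \<omega> \<le> ennreal n" "0 < n"
    "\<And>t \<omega>. 0 \<le> t \<Longrightarrow> ennreal t \<le> \<tau> \<omega> \<Longrightarrow> \<bar>X t \<omega>\<bar> \<le> K \<and> \<bar>Y t \<omega>\<bar> \<le> K \<and> A t \<omega> \<le> K"
  using assms by (auto simp: bounded_time_def)

lemma bounded_time_subset:
  assumes "bounded_time \<tau> n K" "stopping_time F \<sigma>" "\<And>\<omega>. \<sigma> \<omega> \<le> \<tau> \<omega>"
  shows "bounded_time \<sigma> n K"
  using assms unfolding bounded_time_def by (meson order_trans)

lemma bounded_time_values:
  assumes \<tau>: "bounded_time \<tau> n K" and c: "0 \<le> c"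
  shows "stopped \<tau> A n \<in> borel_measurable P" "0 \<le> stopped \<tau> A n \<omega>" "stopped \<tau> A n \<omega> \<le> K"
    "stopped \<tau> (rho c) n \<in> borel_measurable P" "0 \<le> stopped \<tau> (rho c) n \<omega>" "stopped \<tau> (rho c) n \<omega> \<le> 2 * K"
proof -
  note D = bounded_timeD[OF \<tau>]
  have n0: "0 \<le> n" using D(3) by simp
  define s where "s = clamp 0 n (\<tau> \<omega>)"
  have s: "stopped \<tau> N n \<omega> = N s \<omega>" "ennreal s = \<tau> \<omega>" "0 \<le> s" for N
    unfolding s_def using stopped_at_bounded_time[of \<tau> \<omega> n, OF D(2) n0] by auto
  show "stopped \<tau> A n \<in> borel_measurable P" by (rule adapted_measurable_P[OF stopped_adapted[OF A_adapted A_continuous D(1)] n0])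
  show "stopped \<tau> (rho c) n \<in> borel_measurable P"
    by (rule adapted_measurable_P[OF stopped_adapted[OF rho_adapted[OF c] rho_continuous[OF c] D(1)] n0])
  show "0 \<le> stopped \<tau> A n \<omega>" unfolding s(1) by (rule A_nonneg[OF s(3)])
  show "0 \<le> stopped \<tau> (rho c) n \<omega>" unfolding s(1) by (rule rho_nonneg[OF c s(3)])
  show "stopped \<tau> A n \<omega> \<le> K" unfolding s(1) using D(4)[OF s(3), of \<omega>] s(2) by simp
  obtain t where t: "0 \<le> t" "t \<le> s" "rho c s \<omega> = sqrt (R c t \<omega>)"
    using running_max_attained[of "\<lambda>t \<omega>. sqrt (R c t \<omega>)" \<omega> s, OF sqrtR_continuous[OF c] s(3)] unfolding rho_def by blast
  have "ennreal t \<le> \<tau> \<omega>" unfolding s(2)[symmetric] using t(2) by (rule ennreal_leI)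
  from D(4)[OF t(1) this] have b: "\<bar>X t \<omega>\<bar> \<le> K" "\<bar>Y t \<omega>\<bar> \<le> K" by auto
  have K: "0 \<le> K" using b(1) abs_ge_zero order_trans by blast
  have "(X t \<omega>)\<^sup>2 \<le> K\<^sup>2" "(Y t \<omega>)\<^sup>2 \<le> K\<^sup>2" using power_mono[OF b(1), of 2] power_mono[OF b(2), of 2] by auto
  moreover have "1 \<le> 1 + c * A t \<omega>" using c A_nonneg[OF t(1), of \<omega>] by simp
  ultimately have "R c t \<omega> \<le> (2 * K\<^sup>2) / 1" unfolding R_def by (intro frac_le) auto
  also have "\<dots> \<le> (2 * K)\<^sup>2" by (simp add: power_mult_distrib)
  finally have "sqrt (R c t \<omega>) \<le> 2 * K" using K by (intro real_le_lsqrt) auto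
  then show "stopped \<tau> (rho c) n \<omega> \<le> 2 * K" unfolding s(1) t(3) .
qed

lemma sqrt_moderate:
  assumes "moderate \<Phi>"
  shows "mono_on {0..} (\<lambda>x. \<Phi> (sqrt x))" "continuous_on {0..} (\<lambda>x. \<Phi> (sqrt x))" "\<Phi> (sqrt 0) = 0"
proof -
  note m = moderateD[OF assms]
  show "mono_on {0..} (\<lambda>x. \<Phi> (sqrt x))" by (intro mono_onI mono_onD[OF m(3)]) auto
  show "continuous_on {0..} (\<lambda>x. \<Phi> (sqrt x))" by (intro continuous_on_compose2[OF m(2)] continuous_intros) auto
  show "\<Phi> (sqrt 0) = 0" using m by simp
qed

text \<open>
  For \<open>f(r) = r/2\<close> the lower good-lambda inequality holds with the factor
  \<open>d/2\<close>, and \<open>d\<close> is at our disposal once the growth constant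
  \<open>k\<close> is known.
\<close>

lemma clock_bounded_by_maximum:
  assumes \<Phi>: "moderate \<Phi>"
  obtains C where "\<And>\<tau> n K. bounded_time \<tau> n K \<Longrightarrow>
    (\<integral>\<^sup>+\<omega>. ennreal (\<Phi> (sqrt (stopped \<tau> A n \<omega>))) \<partial>P) \<le> ennreal C * (\<integral>\<^sup>+\<omega>. ennreal (\<Phi> (stopped \<tau> (rho 0) n \<omega>)) \<partial>P)"
proof -
  note m = moderateD[OF \<Phi>]
  obtain k where k: "1 \<le> k" "\<And>x. 0 \<le> x \<Longrightarrow> \<Phi> (sqrt 2 * x) \<le> k * \<Phi> x"
    by (rule moderate_growth[OF \<Phi>, of "sqrt 2"]) (simp, blast)
  define d where "d = 1 / k"
  have d: "0 < d" using k by (simp add: d_def)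
  obtain k' where k': "1 \<le> k'" "\<And>x. 0 \<le> x \<Longrightarrow> \<Phi> (sqrt (1 / d) * x) \<le> k' * \<Phi> x"
    by (rule moderate_growth[OF \<Phi>, of "sqrt (1 / d)"]) (use d in simp, blast)
  show ?thesis
  proof (rule that[of "2 * k * k'"])
    fix \<tau> n K assume \<tau>: "bounded_time \<tau> n K"
    note D = bounded_timeD[OF \<tau>] and V = bounded_time_values[OF \<tau> order_refl]
    have "(\<integral>\<^sup>+\<omega>. ennreal (\<Phi> (sqrt (stopped \<tau> A n \<omega>))) \<partial>P) \<le> ennreal (2 * k * k') * (\<integral>\<^sup>+\<omega>. ennreal (\<Phi> (sqrt ((stopped \<tau> (rho 0) n \<omega>)\<^sup>2))) \<partial>P)"
    proof (rule good_lambda_domination[OF prob_space_axioms V(1) _ V(2) _ V(3) sqrt_moderate[OF \<Phi>], where b=2 and d=d and e="d/2"])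
      show "(\<lambda>\<omega>. (stopped \<tau> (rho 0) n \<omega>)\<^sup>2) \<in> borel_measurable P" using V(4) by measurable
      show "\<Phi> (sqrt (2 * x)) \<le> k * \<Phi> (sqrt x)" if "0 \<le> x" for x using k(2)[of "sqrt x"] that by (simp add: real_sqrt_mult)
      show "\<Phi> (sqrt (x / d)) \<le> k' * \<Phi> (sqrt x)" if "0 \<le> x" for x using k'(2)[of "sqrt x"] that by (simp add: real_sqrt_divide)
      fix l :: real assume l: "0 < l"
      have "(2 * l - l) * measure P {\<omega> \<in> space P. 2 * l \<le> stopped \<tau> A n \<omega> \<and> stopped \<tau> (rho 0) n \<omega> < sqrt (d * l)}
         \<le> (sqrt (d * l))\<^sup>2 / 2 * measure P {\<omega> \<in> space P. l \<le> stopped \<tau> A n \<omega>}"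
      proof (rule lower_good_lambda[OF D(1-3) order_refl, where f="\<lambda>r. r / 2" and u="\<lambda>a. a"])
        fix S T assume S: "stopping_time F S" and T: "stopping_time F T" and le: "\<And>\<omega>. T \<omega> \<le> \<tau> \<omega>"
        note DT = bounded_timeD[OF bounded_time_subset[OF \<tau> T le]]
        have "(\<integral>\<omega>. stopped T (R 0) n \<omega> / 2 - stopped (\<lambda>\<omega>. min (S \<omega>) (T \<omega>)) (R 0) n \<omega> / 2 \<partial>P)
            = (\<integral>\<omega>. stopped T A n \<omega> - stopped (\<lambda>\<omega>. min (S \<omega>) (T \<omega>)) A n \<omega> \<partial>P)"
          by (rule ito_equality[where ?f="\<lambda>r. r/2" and ?f1.0="\<lambda>_. 1/2" and ?f2.0="\<lambda>_. 0" and ?f3.0="\<lambda>_. 0" and u="\<lambda>a. a" and c=0, OF _ _ _ _ _ _ _ order_refl T S DT(2,3,4)])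
             (auto intro!: derivative_eq_intros)
        then show "(\<integral>\<omega>. stopped T A n \<omega> - stopped (\<lambda>\<omega>. min (S \<omega>) (T \<omega>)) A n \<omega> \<partial>P) \<le>
           (\<integral>\<omega>. stopped T (R 0) n \<omega> / 2 - stopped (\<lambda>\<omega>. min (S \<omega>) (T \<omega>)) (R 0) n \<omega> / 2 \<partial>P)" by simp
      qed (use l d in \<open>auto intro!: mono_onI\<close>)
      then have "l * measure P {\<omega> \<in> space P. 2 * l \<le> stopped \<tau> A n \<omega> \<and> stopped \<tau> (rho 0) n \<omega> < sqrt (d * l)}
         \<le> l * (d / 2 * measure P {\<omega> \<in> space P. l \<le> stopped \<tau> A n \<omega>})"
        using l d by (simp add: mult_ac)
      then have "measure P {\<omega> \<in> space P. 2 * l \<le> stopped \<tau> A n \<omega> \<and> stopped \<tau> (rho 0) n \<omega> < sqrt (d * l)}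
         \<le> d / 2 * measure P {\<omega> \<in> space P. l \<le> stopped \<tau> A n \<omega>}" using l by (simp only: mult_le_cancel_left_pos)
      moreover have "(stopped \<tau> (rho 0) n \<omega>)\<^sup>2 < d * l \<longleftrightarrow> stopped \<tau> (rho 0) n \<omega> < sqrt (d * l)" for \<omega>
        using V(5)[of \<omega>] by (metis abs_of_nonneg real_sqrt_abs real_sqrt_less_iff)
      ultimately show "measure P {\<omega> \<in> space P. 2 * l \<le> stopped \<tau> A n \<omega> \<and> (stopped \<tau> (rho 0) n \<omega>)\<^sup>2 < d * l}
         \<le> d / 2 * measure P {\<omega> \<in> space P. l \<le> stopped \<tau> A n \<omega>}" by simp
    qed (use d k k' in \<open>auto simp: d_def\<close>)
    then show "(\<integral>\<^sup>+\<omega>. ennreal (\<Phi> (sqrt (stopped \<tau> A n \<omega>))) \<partial>P) \<le> ennreal (2 * k * k') * (\<integral>\<^sup>+\<omega>. ennreal (\<Phi> (stopped \<tau> (rho 0) n \<omega>)) \<partial>P)"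
      using V(5) by simp
  qed
qed

text \<open>
  The function \<open>r\<^sup>p\<close> has drift \<open>2 p\<^sup>2
  r\<^sup>p\<^sup>-\<^sup>1\<close>, at most \<open>2 p\<^sup>2 (2
  l)\<^sup>p\<^sup>-\<^sup>1\<close> while \<open>R \<le> 2 l\<close>. Passing from \<open>l\<close>
  to \<open>2 l\<close> multiplies it by \<open>2\<^sup>p\<close>, so the probability of doing so is
  at most \<open>2\<^sup>-\<^sup>p + p\<^sup>2 d\<close>; this is why a single \<open>p\<close>,
  chosen after the growth constant of \<open>\<Phi>\<close>, suffices.
\<close>

lemma maximum_bounded_by_clock:
  assumes \<Phi>: "moderate \<Phi>"
  obtains C where "\<And>\<tau> n K. bounded_time \<tau> n K \<Longrightarrow>
    (\<integral>\<^sup>+\<omega>. ennreal (\<Phi> (stopped \<tau> (rho 0) n \<omega>)) \<partial>P) \<le> ennreal C * (\<integral>\<^sup>+\<omega>. ennreal (\<Phi> (sqrt (stopped \<tau> A n \<omega>))) \<partial>P)"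
proof -
  note m = moderateD[OF \<Phi>]
  obtain k where k: "1 \<le> k" "\<And>x. 0 \<le> x \<Longrightarrow> \<Phi> (sqrt 2 * x) \<le> k * \<Phi> x"
    by (rule moderate_growth[OF \<Phi>, of "sqrt 2"]) (simp, blast)
  obtain j where "4 * k < 2 ^ j" using real_arch_pow[of 2 "4 * k"] by auto
  define p where "p = j + 2"
  have p: "2 \<le> p" by (simp add: p_def)
  have pk: "4 * k \<le> 2 ^ p"
  proof -
    have "(2::real) ^ j \<le> 2 ^ p" unfolding p_def by (intro power_increasing) auto
    then show ?thesis using \<open>4 * k < 2 ^ j\<close> by linarith
  qed
  define d where "d = 1 / (4 * k * (real p)\<^sup>2)"
  have d: "0 < d" using k p by (simp add: d_def)
  define e where "e = 1 / 2 ^ p + (real p)\<^sup>2 * d"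
  have ek: "e * k \<le> 1 / 2"
  proof -
    have "1 / 2 ^ p * k \<le> 1 / 4" using pk by (simp add: field_simps)
    moreover have "(real p)\<^sup>2 * d * k = 1 / 4" using k p by (simp add: d_def field_simps)
    ultimately show ?thesis unfolding e_def distrib_right by linarith
  qed
  obtain k' where k': "1 \<le> k'" "\<And>x. 0 \<le> x \<Longrightarrow> \<Phi> (sqrt (1 / d) * x) \<le> k' * \<Phi> x"
    by (rule moderate_growth[OF \<Phi>, of "sqrt (1 / d)"]) (use d in simp, blast)
  show ?thesis
  proof (rule that[of "2 * k * k'"])
    fix \<tau> n K assume \<tau>: "bounded_time \<tau> n K"
    note D = bounded_timeD[OF \<tau>] and V = bounded_time_values[OF \<tau> order_refl]
    have "(\<integral>\<^sup>+\<omega>. ennreal (\<Phi> (sqrt ((stopped \<tau> (rho 0) n \<omega>)\<^sup>2))) \<partial>P) \<le> ennreal (2 * k * k') * (\<integral>\<^sup>+\<omega>. ennreal (\<Phi> (sqrt (stopped \<tau> A n \<omega>))) \<partial>P)"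
    proof (rule good_lambda_domination[OF prob_space_axioms _ V(1) _ V(2) _ sqrt_moderate[OF \<Phi>], where b=2 and d=d and e=e and M="(2 * K)\<^sup>2"])
      show "(\<lambda>\<omega>. (stopped \<tau> (rho 0) n \<omega>)\<^sup>2) \<in> borel_measurable P" using V(4) by measurable
      show "(stopped \<tau> (rho 0) n \<omega>)\<^sup>2 \<le> (2 * K)\<^sup>2" for \<omega> using V(5,6) by (intro power_mono)
      show "\<Phi> (sqrt (2 * x)) \<le> k * \<Phi> (sqrt x)" if "0 \<le> x" for x using k(2)[of "sqrt x"] that by (simp add: real_sqrt_mult)
      show "\<Phi> (sqrt (x / d)) \<le> k' * \<Phi> (sqrt x)" if "0 \<le> x" for x using k'(2)[of "sqrt x"] that by (simp add: real_sqrt_divide)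
      fix l :: real assume l: "0 < l"
      let ?G = "measure P {\<omega> \<in> space P. sqrt (2 * l) \<le> stopped \<tau> (rho 0) n \<omega> \<and> stopped \<tau> A n \<omega> < d * l}"
      let ?B = "measure P {\<omega> \<in> space P. sqrt l \<le> stopped \<tau> (rho 0) n \<omega>}"
      have "((sqrt (2 * l))\<^sup>2) ^ p * ?G \<le> (((sqrt l)\<^sup>2) ^ p + (2 * (real p)\<^sup>2 * (2 * l) ^ (p - 1)) * (d * l)) * ?B"
      proof (rule upper_good_lambda[OF D(1-3) order_refl, where f="\<lambda>r. r ^ p" and u="\<lambda>a. a"])
        fix S T assume S: "stopping_time F S" and T: "stopping_time F T" and le: "\<And>\<omega>. T \<omega> \<le> \<tau> \<omega>"
          and Rb: "\<And>t \<omega>. 0 \<le> t \<Longrightarrow> ennreal t \<le> T \<omega> \<Longrightarrow> R 0 t \<omega> \<le> (sqrt (2 * l))\<^sup>2"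
        note DT = bounded_timeD[OF bounded_time_subset[OF \<tau> T le]]
        show "(\<integral>\<omega>. (stopped T (R 0) n \<omega>) ^ p - (stopped (\<lambda>\<omega>. min (S \<omega>) (T \<omega>)) (R 0) n \<omega>) ^ p \<partial>P)
            \<le> 2 * (real p)\<^sup>2 * (2 * l) ^ (p - 1) * (\<integral>\<omega>. stopped T A n \<omega> - stopped (\<lambda>\<omega>. min (S \<omega>) (T \<omega>)) A n \<omega> \<partial>P)"
        proof (rule ito_smooth[where ?f="\<lambda>r. r ^ p" and ?f1.0="\<lambda>r. real p * r ^ (p - 1)" and ?f2.0="\<lambda>r. real p * (real (p - 1) * r ^ (p - 1 - 1))"
              and ?f3.0="\<lambda>r. real p * (real (p - 1) * (real (p - 1 - 1) * r ^ (p - 1 - 1 - 1)))" and u="\<lambda>a. a" and c=0, OF _ _ _ _ _ _ _ order_refl T S DT(2,3,4)])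
          fix t \<omega> assume t: "0 \<le> t" "ennreal t \<le> T \<omega>"
          define r where "r = R 0 t \<omega>"
          have r: "0 \<le> r" "r \<le> 2 * l" using R_nonneg[OF order_refl t(1)] Rb[OF t] l by (auto simp: r_def)
          have "r * r ^ (p - 1 - 1) = r ^ (p - 1)" using p by (cases p; cases "p - 1") auto
          then have "real p * r ^ (p - 1) * (2 - 0 * r) + 2 * r * (real p * (real (p - 1) * r ^ (p - 1 - 1))) = 2 * (real p * (1 + real (p - 1))) * r ^ (p - 1)"
            by (simp add: algebra_simps)
          also have "\<dots> = 2 * (real p)\<^sup>2 * r ^ (p - 1)" using p by (simp add: of_nat_diff power2_eq_square)
          also have "\<dots> \<le> 2 * (real p)\<^sup>2 * (2 * l) ^ (p - 1)" using r by (intro mult_left_mono power_mono) auto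
          finally show "real p * R 0 t \<omega> ^ (p - 1) * (2 - 0 * R 0 t \<omega>) + 2 * R 0 t \<omega> * (real p * (real (p - 1) * R 0 t \<omega> ^ (p - 1 - 1))) \<le> 2 * (real p)\<^sup>2 * (2 * l) ^ (p - 1)"
            unfolding r_def .
        qed (auto intro!: derivative_eq_intros continuous_intros)
      qed (use l d p in \<open>auto intro!: mono_onI power_mono\<close>)
      then have "(2 * l) ^ p * ?G \<le> (l ^ p + 2 * (real p)\<^sup>2 * (2 * l) ^ (p - 1) * (d * l)) * ?B" using l by simp
      also have "l ^ p + 2 * (real p)\<^sup>2 * (2 * l) ^ (p - 1) * (d * l) = (2 * l) ^ p * e"
      proof -
        have "(2 * l) ^ p = 2 * l * (2 * l) ^ (p - 1)" using p by (cases p) auto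
        then have "2 * (real p)\<^sup>2 * (2 * l) ^ (p - 1) * (d * l) = (2 * l) ^ p * ((real p)\<^sup>2 * d)" by simp
        then show ?thesis by (simp add: e_def distrib_left power_mult_distrib)
      qed
      finally have "(2 * l) ^ p * ?G \<le> (2 * l) ^ p * (e * ?B)" by (simp only: mult.assoc)
      moreover have "0 < (2 * l) ^ p" using l by simp
      ultimately have "?G \<le> e * ?B" by (rule mult_left_le_imp_le)
      moreover have "2 * l \<le> (stopped \<tau> (rho 0) n \<omega>)\<^sup>2 \<longleftrightarrow> sqrt (2 * l) \<le> stopped \<tau> (rho 0) n \<omega>"
        "l \<le> (stopped \<tau> (rho 0) n \<omega>)\<^sup>2 \<longleftrightarrow> sqrt l \<le> stopped \<tau> (rho 0) n \<omega>" for \<omega>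
        using V(5)[of \<omega>] by (metis abs_of_nonneg real_sqrt_abs real_sqrt_le_iff)+
      ultimately show "measure P {\<omega> \<in> space P. 2 * l \<le> (stopped \<tau> (rho 0) n \<omega>)\<^sup>2 \<and> stopped \<tau> A n \<omega> < d * l}
         \<le> e * measure P {\<omega> \<in> space P. l \<le> (stopped \<tau> (rho 0) n \<omega>)\<^sup>2}" by simp
    qed (use d k k' ek in \<open>auto simp: e_def\<close>)
    then show "(\<integral>\<^sup>+\<omega>. ennreal (\<Phi> (stopped \<tau> (rho 0) n \<omega>)) \<partial>P) \<le> ennreal (2 * k * k') * (\<integral>\<^sup>+\<omega>. ennreal (\<Phi> (sqrt (stopped \<tau> A n \<omega>))) \<partial>P)"
      using V(5) by simp
  qed
qed

end

section \<open>The logarithmic clock and the normalized maximum\<close>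

text \<open>
  The scale on which \<open>\<Phi>\<close> of the normalized maximum and \<open>\<Phi>\<close> of
  \<^const>\<open>g\<close> become the same function of the potential and of the logarithmic clock.
\<close>

definition log_scale :: "(real \<Rightarrow> real) \<Rightarrow> real \<Rightarrow> real" where
  "log_scale \<Phi> x = \<Phi> (sqrt (ln (1 + x)))"

lemma log_scale_g: "log_scale \<Phi> (ln (1 + a)) = \<Phi> (g a)"
  by (simp add: log_scale_def g_def)

lemma log_scale_moderate:
  assumes "moderate \<Phi>"
  shows "mono_on {0..} (log_scale \<Phi>)" "continuous_on {0..} (log_scale \<Phi>)" "log_scale \<Phi> 0 = 0"
proof -
  note m = moderateD[OF assms]
  show "mono_on {0..} (log_scale \<Phi>)" unfolding log_scale_def by (intro mono_onI mono_onD[OF m(3)]) auto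
  show "continuous_on {0..} (log_scale \<Phi>)" unfolding log_scale_def
    by (intro continuous_on_compose2[OF m(2)] continuous_intros) auto
  show "log_scale \<Phi> 0 = 0" using m by (simp add: log_scale_def)
qed

lemma ln_mult_le:
  fixes x :: real assumes "0 \<le> x" shows "ln (1 + real j * x) \<le> real j * ln (1 + x)"
proof -
  have "1 + real j * x \<le> (1 + x) ^ j" using Bernoulli_inequality[of x j] assms by simp
  then have "ln (1 + real j * x) \<le> ln ((1 + x) ^ j)" using assms by (subst ln_le_cancel_iff) (auto intro: add_pos_nonneg)
  then show ?thesis using assms by (simp add: ln_realpow)
qed

lemma log_scale_growth:
  assumes \<Phi>: "moderate \<Phi>"
  obtains C where "1 \<le> C" "\<And>x. 0 \<le> x \<Longrightarrow> log_scale \<Phi> (real j * x) \<le> C * log_scale \<Phi> x"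
proof -
  note m = moderateD[OF \<Phi>]
  obtain C where C: "1 \<le> C" "\<And>x. 0 \<le> x \<Longrightarrow> \<Phi> (sqrt (real j) * x) \<le> C * \<Phi> x"
    by (rule moderate_growth[OF \<Phi>, of "sqrt (real j)"]) (simp, blast)
  show ?thesis
  proof (rule that[OF C(1)])
    fix x :: real assume x: "0 \<le> x"
    have "log_scale \<Phi> (real j * x) \<le> \<Phi> (sqrt (real j) * sqrt (ln (1 + x)))"
      unfolding log_scale_def real_sqrt_mult[symmetric]
      using x ln_mult_le[OF x, of j] by (intro mono_onD[OF m(3)]) auto
    also have "\<dots> \<le> C * log_scale \<Phi> x" unfolding log_scale_def using x by (intro C(2)) auto
    finally show "log_scale \<Phi> (real j * x) \<le> C * log_scale \<Phi> x" .
  qed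
qed

text \<open>
  Multiplying \<open>x \<ge> 1\<close> by \<open>b\<close> multiplies \<open>sqrt (ln (1 +
  x))\<close> by about \<open>sqrt (ln b)\<close> at most, so the growth constant is only a power of
  \<open>ln b\<close>. Below \<open>1\<close> this fails, since there the logarithm is linear.
\<close>

lemma log_scale_slow_growth:
  assumes \<Phi>: "moderate \<Phi>"
  obtains b k where "1 < b" "1 \<le> k" "2 * k / b \<le> 1 / 2" "\<And>x. 1 \<le> x \<Longrightarrow> log_scale \<Phi> (b * x) \<le> k * log_scale \<Phi> x"
proof -
  note m = moderateD[OF \<Phi>]
  obtain c where c: "1 \<le> c" "\<And>x. 0 \<le> x \<Longrightarrow> \<Phi> (2 * x) \<le> c * \<Phi> x"
    by (rule moderate_growth[OF \<Phi>, of 2]) (simp, blast)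
  have pow: "\<Phi> (2 ^ j * x) \<le> c ^ j * \<Phi> x" if "0 \<le> x" for j x
  proof (induction j)
    case (Suc j)
    have "\<Phi> (2 ^ Suc j * x) = \<Phi> (2 * (2 ^ j * x))" by (simp add: mult.assoc)
    also have "\<dots> \<le> c * \<Phi> (2 ^ j * x)" using that by (intro c) auto
    also have "\<dots> \<le> c * (c ^ j * \<Phi> x)" using c by (intro mult_left_mono Suc.IH) auto
    finally show ?case by (simp add: mult.assoc)
  qed simp
  obtain j0 where "c < 2 ^ j0" using real_arch_pow[of 2 c] by auto
  define j where "j = max j0 2"
  have "(2::real) ^ j0 \<le> 2 ^ j" by (intro power_increasing) (auto simp: j_def)
  then have cj: "c \<le> 2 ^ j" using \<open>c < 2 ^ j0\<close> by linarith
  have j2: "2 \<le> j" by (simp add: j_def)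
  have jj: "j * j + 3 \<le> 4 ^ j"
    using j2
  proof (induction j rule: dec_induct)
    case (step i)
    have "2 * i + 1 \<le> 3 * (i * i)" using step(1) by (cases i) auto
    then show ?case using step by simp
  qed simp
  \<comment> \<open>With this \<open>b\<close>, \<open>sqrt (ln (1 + b x)) \<le> 2\<^sup>j sqrt (ln (1 + x))\<close> exactly, which costs \<open>c\<^sup>j \<le> 2^(j\<^sup>2)\<close>, negligible against \<open>b\<close>.\<close>
  define b :: real where "b = 2 ^ (4 ^ j - 1)"
  show ?thesis
  proof (rule that[of b "c ^ j"])
    have "(4::nat) ^ 1 \<le> 4 ^ j" using j2 by (intro power_increasing) auto
    then have "4 ^ j - 1 \<noteq> (0::nat)" by simp
    then show "1 < b" unfolding b_def by (intro one_less_power) auto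
    show "1 \<le> c ^ j" using c(1) by (rule one_le_power)
    have "c ^ j \<le> (2 ^ j) ^ j" using cj c by (intro power_mono) auto
    then have "4 * c ^ j \<le> 2 ^ 2 * 2 ^ (j * j)" by (simp add: power_mult)
    also have "\<dots> = (2::real) ^ (j * j + 2)" by (simp add: power_add)
    also have "\<dots> \<le> b" unfolding b_def using jj by (intro power_increasing) auto
    finally show "2 * c ^ j / b \<le> 1 / 2" using \<open>1 < b\<close> by (simp add: divide_le_eq)
    fix x :: real assume x: "1 \<le> x"
    have l2: "ln 2 \<le> ln (1 + x)" using x by simp
    have "1 + b * x \<le> b * (1 + x)" using \<open>1 < b\<close> by (simp add: distrib_left)
    then have "ln (1 + b * x) \<le> ln (b * (1 + x))" using \<open>1 < b\<close> x by (subst ln_le_cancel_iff) (auto intro: add_pos_nonneg)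
    also have "\<dots> = real (4 ^ j - 1) * ln 2 + ln (1 + x)" using \<open>1 < b\<close> x by (simp add: ln_mult b_def ln_realpow)
    also have "\<dots> \<le> real (4 ^ j - 1) * ln (1 + x) + ln (1 + x)" using l2 by (intro add_right_mono mult_left_mono) auto
    also have "\<dots> = (real (4 ^ j - 1) + 1) * ln (1 + x)" by (simp only: distrib_right mult_1)
    also have "real (4 ^ j - 1) + 1 = (2 ^ j)\<^sup>2" by (simp add: of_nat_diff power_mult_distrib[symmetric] power2_eq_square)
    finally have "sqrt (ln (1 + b * x)) \<le> sqrt ((2 ^ j)\<^sup>2 * ln (1 + x))" by (rule real_sqrt_le_mono)
    also have "\<dots> = 2 ^ j * sqrt (ln (1 + x))" by (simp add: real_sqrt_mult)
    finally have "sqrt (ln (1 + b * x)) \<le> 2 ^ j * sqrt (ln (1 + x))" .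
    then have "log_scale \<Phi> (b * x) \<le> \<Phi> (2 ^ j * sqrt (ln (1 + x)))"
      unfolding log_scale_def using x \<open>1 < b\<close> by (intro mono_onD[OF m(3)]) auto
    also have "\<dots> \<le> c ^ j * log_scale \<Phi> x" unfolding log_scale_def using x by (intro pow) auto
    finally show "log_scale \<Phi> (b * x) \<le> c ^ j * log_scale \<Phi> x" .
  qed
qed

lemma g_mono: "0 \<le> a \<Longrightarrow> a \<le> b \<Longrightarrow> g a \<le> g b"
  unfolding g_def by (intro real_sqrt_le_mono ln_mono add_left_mono add_pos_nonneg) auto

lemma g_nonneg: "0 \<le> a \<Longrightarrow> 0 \<le> g a"
  by (simp add: g_def)

text \<open>Two applications of \<open>x/2 \<le> ln (1 + x)\<close> on \<open>[0, 1]\<close>.\<close>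

lemma sqrt_le_g:
  assumes "0 \<le> a" "a \<le> 1" shows "sqrt a \<le> 2 * g a"
proof -
  have half: "x / 2 \<le> ln (1 + x)" if "0 \<le> x" "x \<le> 1" for x :: real
  proof -
    have "ln (1 / (1 + x)) \<le> 1 / (1 + x) - 1" using that by (intro ln_le_minus_one) auto
    then have "x / (1 + x) \<le> ln (1 + x)" using that by (simp add: ln_div field_simps)
    moreover have "x / 2 \<le> x / (1 + x)" using that by (intro divide_left_mono) auto
    ultimately show ?thesis by linarith
  qed
  define y where "y = ln (1 + a)"
  have y: "a / 2 \<le> y" "0 \<le> y" "y \<le> 1" using half[OF assms] assms ln_add_one_self_le_self[of a] by (auto simp: y_def)
  have "y / 2 \<le> ln (1 + y)" using y by (intro half) auto
  then have "a \<le> 4 * ln (1 + y)" using y by linarith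
  then have "sqrt a \<le> sqrt (4 * ln (1 + y))" by (rule real_sqrt_le_mono)
  also have "\<dots> = 2 * g a" by (simp add: real_sqrt_mult g_def y_def)
  finally show ?thesis .
qed

lemma ln_ou_potential_bounds:
  assumes "0 \<le> r" shows "ln (1 + ou_potential (r\<^sup>2)) \<le> r\<^sup>2" "r\<^sup>2 \<le> 4 * ln (1 + ou_potential (r\<^sup>2))" "0 \<le> ou_potential (r\<^sup>2)"
proof -
  note b = ou_potential_bounds[of "r\<^sup>2", OF zero_le_power2]
  show h0: "0 \<le> ou_potential (r\<^sup>2)" using ou_potential_le_iff[of 0 "r\<^sup>2"] by simp
  have "ln (1 + ou_potential (r\<^sup>2)) \<le> ln (exp (r\<^sup>2 / 2))" using h0 b(2) by (subst ln_le_cancel_iff) auto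
  also have "\<dots> \<le> r\<^sup>2" by simp
  finally show "ln (1 + ou_potential (r\<^sup>2)) \<le> r\<^sup>2" .
  have "ln (exp (r\<^sup>2 / 4)) \<le> ln (1 + ou_potential (r\<^sup>2))" using h0 b(1) by (subst ln_le_cancel_iff) auto
  then show "r\<^sup>2 \<le> 4 * ln (1 + ou_potential (r\<^sup>2))" by simp
qed

lemma ou_potential_square_less_iff: "0 \<le> r \<Longrightarrow> 0 \<le> s \<Longrightarrow> ou_potential (r\<^sup>2) < ou_potential (s\<^sup>2) \<longleftrightarrow> r < s"
  by (metis ou_potential_le_iff linorder_not_le power2_le_imp_le power_mono zero_le_power2)

lemma ou_potential_square_le_iff: "0 \<le> r \<Longrightarrow> 0 \<le> s \<Longrightarrow> ou_potential (r\<^sup>2) \<le> ou_potential (s\<^sup>2) \<longleftrightarrow> r \<le> s"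
  by (metis ou_potential_square_less_iff linorder_not_le)

context planar_martingale
begin

lemma log_clock_continuous: "continuous_on {0..} (\<lambda>a. ln (1 + a :: real))"
  by (intro continuous_intros) auto

lemma log_clock_measurable: "(\<lambda>a. ln (1 + a :: real)) \<in> borel_measurable borel"
  by measurable

lemma log_clock_mono: "mono_on {0..} (\<lambda>a. ln (1 + a :: real))"
  by (rule mono_onI) auto

lemma ito_ou_potential:
  assumes \<tau>: "bounded_time \<tau> n K" and S: "stopping_time F S" and T: "stopping_time F T" and le: "\<And>\<omega>. T \<omega> \<le> \<tau> \<omega>"
  shows "(\<integral>\<omega>. ou_potential (stopped T (R 1) n \<omega>) - ou_potential (stopped (\<lambda>\<omega>. min (S \<omega>) (T \<omega>)) (R 1) n \<omega>) \<partial>P)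
     = (\<integral>\<omega>. ln (1 + stopped T A n \<omega>) - ln (1 + stopped (\<lambda>\<omega>. min (S \<omega>) (T \<omega>)) A n \<omega>) \<partial>P)"
proof -
  note DT = bounded_timeD[OF bounded_time_subset[OF \<tau> T le]]
  show ?thesis
    by (rule ito_equality[OF ou_potential_deriv ln_step log_clock_continuous log_clock_measurable zero_le_one T S DT(2,3,4) ou_potential_generator])
qed

text \<open>
  The argument for \<open>c = 0\<close> with the potential in place of \<open>r/2\<close>: levels of
  the potential correspond to levels of the modulus because the potential is an increasing bijection
  of \<open>[0, \<infinity>)\<close>.
\<close>

lemma log_clock_bounded_by_normalized_maximum:
  assumes \<Phi>: "moderate \<Phi>"
  obtains C where "\<And>\<tau> n K. bounded_time \<tau> n K \<Longrightarrow>
    (\<integral>\<^sup>+\<omega>. ennreal (\<Phi> (g (stopped \<tau> A n \<omega>))) \<partial>P) \<le> ennreal C * (\<integral>\<^sup>+\<omega>. ennreal (\<Phi> (stopped \<tau> (rho 1) n \<omega>)) \<partial>P)"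
proof -
  note m = moderateD[OF \<Phi>]
  obtain k where k: "1 \<le> k" "\<And>x. 0 \<le> x \<Longrightarrow> log_scale \<Phi> (real 2 * x) \<le> k * log_scale \<Phi> x"
    by (rule log_scale_growth[OF \<Phi>, of 2]) blast
  obtain j :: nat where j: "2 * k < real j" using reals_Archimedean2 by blast
  obtain k' where k': "1 \<le> k'" "\<And>x. 0 \<le> x \<Longrightarrow> log_scale \<Phi> (real j * x) \<le> k' * log_scale \<Phi> x"
    by (rule log_scale_growth[OF \<Phi>, of j]) blast
  define d where "d = 1 / real j"
  have d: "0 < d" "d * k \<le> 1 / 2" using j k by (auto simp: d_def field_simps)
  show ?thesis
  proof (rule that[of "2 * k * k'"])
    fix \<tau> n K assume \<tau>: "bounded_time \<tau> n K"
    note D = bounded_timeD[OF \<tau>] and V = bounded_time_values[OF \<tau> zero_le_one]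
    let ?G = "\<lambda>\<omega>. ln (1 + stopped \<tau> A n \<omega>)" and ?H = "\<lambda>\<omega>. ou_potential ((stopped \<tau> (rho 1) n \<omega>)\<^sup>2)"
    have "(\<integral>\<^sup>+\<omega>. ennreal (log_scale \<Phi> (?G \<omega>)) \<partial>P) \<le> ennreal (2 * k * k') * (\<integral>\<^sup>+\<omega>. ennreal (log_scale \<Phi> (?H \<omega>)) \<partial>P)"
    proof (rule good_lambda_domination[OF prob_space_axioms _ _ _ _ _ log_scale_moderate[OF \<Phi>], where b=2 and d=d and e=d and M="ln (1 + K)"])
      show "?G \<in> borel_measurable P" "?H \<in> borel_measurable P" using V(1,4) by measurable
      show "0 \<le> ?G \<omega>" "?G \<omega> \<le> ln (1 + K)" for \<omega> using V(2,3)[of \<omega>] by auto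
      show "0 \<le> ?H \<omega>" for \<omega> by (rule ln_ou_potential_bounds(3)[OF V(5)])
      show "log_scale \<Phi> (2 * x) \<le> k * log_scale \<Phi> x" if "0 \<le> x" for x using k(2)[OF that] by simp
      show "log_scale \<Phi> (x / d) \<le> k' * log_scale \<Phi> x" if "0 \<le> x" for x using k'(2)[OF that] by (simp add: d_def mult.commute)
      fix l :: real assume l: "0 < l"
      obtain q where q: "0 \<le> q" "ou_potential (q\<^sup>2) = d * l" using ou_potential_surj[of "d * l"] l d by auto
      have "(2 * l - l) * measure P {\<omega> \<in> space P. 2 * l \<le> ?G \<omega> \<and> stopped \<tau> (rho 1) n \<omega> < q}
         \<le> ou_potential (q\<^sup>2) * measure P {\<omega> \<in> space P. l \<le> ?G \<omega>}"
        by (rule lower_good_lambda[OF D(1-3) zero_le_one ou_potential_mono ou_potential_0 ou_potential_meas log_clock_mono log_clock_continuous _ log_clock_measurable])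
           (use l q ito_ou_potential[OF \<tau>] in auto)
      then have "l * measure P {\<omega> \<in> space P. 2 * l \<le> ?G \<omega> \<and> stopped \<tau> (rho 1) n \<omega> < q} \<le> l * (d * measure P {\<omega> \<in> space P. l \<le> ?G \<omega>})"
        unfolding q(2) by (simp add: mult_ac)
      then have "measure P {\<omega> \<in> space P. 2 * l \<le> ?G \<omega> \<and> stopped \<tau> (rho 1) n \<omega> < q} \<le> d * measure P {\<omega> \<in> space P. l \<le> ?G \<omega>}"
        using l by (rule mult_left_le_imp_le)
      moreover have "?H \<omega> < d * l \<longleftrightarrow> stopped \<tau> (rho 1) n \<omega> < q" for \<omega>
        unfolding q(2)[symmetric] by (rule ou_potential_square_less_iff[OF V(5) q(1)])
      ultimately show "measure P {\<omega> \<in> space P. 2 * l \<le> ?G \<omega> \<and> ?H \<omega> < d * l} \<le> d * measure P {\<omega> \<in> space P. l \<le> ?G \<omega>}" by simp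
    qed (use d k k' in auto)
    also have "(\<integral>\<^sup>+\<omega>. ennreal (log_scale \<Phi> (?H \<omega>)) \<partial>P) \<le> (\<integral>\<^sup>+\<omega>. ennreal (\<Phi> (stopped \<tau> (rho 1) n \<omega>)) \<partial>P)"
    proof (intro nn_integral_mono ennreal_leI)
      fix \<omega>
      have "sqrt (ln (1 + ?H \<omega>)) \<le> stopped \<tau> (rho 1) n \<omega>"
        using ln_ou_potential_bounds(1)[OF V(5), of \<omega>] V(5)[of \<omega>] by (intro real_le_lsqrt) auto
      then show "log_scale \<Phi> (?H \<omega>) \<le> \<Phi> (stopped \<tau> (rho 1) n \<omega>)"
        unfolding log_scale_def using ln_ou_potential_bounds(3)[OF V(5), of \<omega>] V(5)[of \<omega>] by (intro mono_onD[OF m(3)]) auto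
    qed
    finally show "(\<integral>\<^sup>+\<omega>. ennreal (\<Phi> (g (stopped \<tau> A n \<omega>))) \<partial>P) \<le> ennreal (2 * k * k') * (\<integral>\<^sup>+\<omega>. ennreal (\<Phi> (stopped \<tau> (rho 1) n \<omega>)) \<partial>P)"
      unfolding log_scale_g by (simp add: mult_left_mono)
  qed
qed

lemma rho_antimono:
  assumes "0 \<le> t" shows "rho 1 t \<omega> \<le> rho 0 t \<omega>"
proof -
  obtain s where s: "0 \<le> s" "s \<le> t" "rho 1 t \<omega> = sqrt (R 1 s \<omega>)"
    using running_max_attained[of "\<lambda>t \<omega>. sqrt (R 1 t \<omega>)" \<omega> t, OF sqrtR_continuous[OF zero_le_one] assms] unfolding rho_def by blast
  have "R 1 s \<omega> \<le> R 0 s \<omega>" unfolding R_def using A_nonneg[OF s(1), of \<omega>] by (intro divide_left_mono) auto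
  then have "sqrt (R 1 s \<omega>) \<le> sqrt (R 0 s \<omega>)" by (rule real_sqrt_le_mono)
  also have "\<dots> \<le> rho 0 t \<omega>"
    unfolding rho_def using running_max_upper[of "\<lambda>t \<omega>. sqrt (R 0 t \<omega>)" \<omega>, OF sqrtR_continuous[OF order_refl] s(1,2)] .
  finally show ?thesis unfolding s(3) .
qed

text \<open>
  The clock is allowed to run up to the level \<open>l\<close> already reached by the potential,
  whence the numerator \<open>l + l\<close>. At high levels a stronger restriction of the clock
  would not improve the order \<open>1/b\<close>, since an immediate excursion from \<open>l\<close>
  to \<open>b l\<close> has a probability of that order.
\<close>

lemma normalized_maximum_good_lambda:
  assumes \<tau>: "bounded_time \<tau> n K" and l: "0 < l" and b: "1 < b"
  shows "measure P {\<omega> \<in> space P. b * l \<le> ou_potential ((stopped \<tau> (rho 1) n \<omega>)\<^sup>2) \<and> ln (1 + stopped \<tau> A n \<omega>) < 1 * l}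
    \<le> 2 / b * measure P {\<omega> \<in> space P. l \<le> ou_potential ((stopped \<tau> (rho 1) n \<omega>)\<^sup>2)}"
proof -
  note D = bounded_timeD[OF \<tau>] and V = bounded_time_values[OF \<tau> zero_le_one]
  obtain p where p: "0 \<le> p" "ou_potential (p\<^sup>2) = l" using ou_potential_surj[of l] l by auto
  obtain q where q: "0 \<le> q" "ou_potential (q\<^sup>2) = b * l" using ou_potential_surj[of "b * l"] l b by auto
  have "ou_potential (p\<^sup>2) \<le> ou_potential (q\<^sup>2)" using p q l b by simp
  then have pq: "p \<le> q" using ou_potential_square_le_iff[OF p(1) q(1)] by simp
  have "ou_potential (q\<^sup>2) * measure P {\<omega> \<in> space P. q \<le> stopped \<tau> (rho 1) n \<omega> \<and> ln (1 + stopped \<tau> A n \<omega>) < l}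
     \<le> (ou_potential (p\<^sup>2) + 1 * l) * measure P {\<omega> \<in> space P. p \<le> stopped \<tau> (rho 1) n \<omega>}"
    by (rule upper_good_lambda[OF D(1-3) zero_le_one ou_potential_mono ou_potential_0 ou_potential_meas log_clock_mono log_clock_continuous _ log_clock_measurable])
       (use l p pq ito_ou_potential[OF \<tau>] in auto)
  then have "l * (b * measure P {\<omega> \<in> space P. q \<le> stopped \<tau> (rho 1) n \<omega> \<and> ln (1 + stopped \<tau> A n \<omega>) < l})
      \<le> l * (2 * measure P {\<omega> \<in> space P. p \<le> stopped \<tau> (rho 1) n \<omega>})"
    unfolding p(2) q(2) by (simp add: mult_ac)
  then have "b * measure P {\<omega> \<in> space P. q \<le> stopped \<tau> (rho 1) n \<omega> \<and> ln (1 + stopped \<tau> A n \<omega>) < l}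
      \<le> 2 * measure P {\<omega> \<in> space P. p \<le> stopped \<tau> (rho 1) n \<omega>}"
    using l by (rule mult_left_le_imp_le)
  then have "measure P {\<omega> \<in> space P. q \<le> stopped \<tau> (rho 1) n \<omega> \<and> ln (1 + stopped \<tau> A n \<omega>) < l}
      \<le> 2 / b * measure P {\<omega> \<in> space P. p \<le> stopped \<tau> (rho 1) n \<omega>}"
    using b by (simp add: field_simps)
  moreover have "b * l \<le> ou_potential ((stopped \<tau> (rho 1) n \<omega>)\<^sup>2) \<longleftrightarrow> q \<le> stopped \<tau> (rho 1) n \<omega>"
    "l \<le> ou_potential ((stopped \<tau> (rho 1) n \<omega>)\<^sup>2) \<longleftrightarrow> p \<le> stopped \<tau> (rho 1) n \<omega>" for \<omega>
    using ou_potential_square_le_iff[OF q(1) V(5)] ou_potential_square_le_iff[OF p(1) V(5)] by (simp_all add: p(2) q(2))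
  ultimately show ?thesis by simp
qed

text \<open>
  The part of \<^const>\<open>log_scale\<close> above level \<open>1\<close> is dominated by the
  clock, because its growth constant is negligible compared with \<open>b\<close>; the part below
  \<open>1\<close> is left as a separate term.
\<close>

lemma large_values_dominated:
  assumes \<Phi>: "moderate \<Phi>"
  obtains C where "1 \<le> C" "\<And>\<tau> n K. bounded_time \<tau> n K \<Longrightarrow>
    (\<integral>\<^sup>+\<omega>. ennreal (log_scale \<Phi> (ou_potential ((stopped \<tau> (rho 1) n \<omega>)\<^sup>2))) \<partial>P) \<le>
      ennreal C * ((\<integral>\<^sup>+\<omega>. ennreal (\<Phi> (g (stopped \<tau> A n \<omega>))) \<partial>P) + (\<integral>\<^sup>+\<omega>. ennreal (log_scale \<Phi> (min 1 (ou_potential ((stopped \<tau> (rho 1) n \<omega>)\<^sup>2)))) \<partial>P))"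
proof -
  let ?N = "log_scale \<Phi>"
  note N = log_scale_moderate[OF \<Phi>]
  have N0: "0 \<le> ?N x" if "0 \<le> x" for x using mono_onD[OF N(1), of 0 x] that N(3) by simp
  obtain b k where bk: "1 < b" "1 \<le> k" "2 * k / b \<le> 1 / 2" "\<And>x. 1 \<le> x \<Longrightarrow> ?N (b * x) \<le> k * ?N x"
    using log_scale_slow_growth[OF \<Phi>] by blast
  \<comment> \<open>Only the growth above level \<open>1\<close> is kept, so that \<open>dN'\<close> charges no level where the growth constant is too large.\<close>
  define N' where "N' x = ?N (max 1 x) - ?N 1" for x
  have N'm: "mono_on {0..} N'" unfolding N'_def by (intro mono_onI diff_right_mono mono_onD[OF N(1)]) auto
  have N'c: "continuous_on {0..} N'" unfolding N'_def by (intro continuous_intros continuous_on_compose2[OF N(2)]) auto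
  have N'0: "N' 0 = 0" "N' 1 = 0" by (auto simp: N'_def)
  have N'nn: "0 \<le> N' x" if "0 \<le> x" for x using mono_onD[OF N'm, of 0 x] that N'0 by simp
  have N'le: "N' x \<le> ?N x" if "0 \<le> x" for x
  proof (cases "1 \<le> x")
    case True then show ?thesis using N0[of 1] by (simp add: N'_def max_absorb2)
  next
    case False then show ?thesis using N0[OF that] by (simp add: N'_def max_absorb1)
  qed
  have split: "?N x = N' x + ?N (min 1 x)" for x
    by (cases "1 \<le> x") (auto simp: N'_def max_def min_def)
  have step: "N' x \<le> k * N' (x / b) + k * ?N (min 1 x)" if x: "0 \<le> x" for x
  proof (cases "1 \<le> x")
    case True
    have "?N x \<le> k * ?N (max 1 (x / b))"
    proof (cases "b \<le> x")
      case True
      then have "1 \<le> x / b" using bk(1) by (simp add: le_divide_eq)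
      then show ?thesis using bk(4)[of "x / b"] bk(1) by (simp add: max_absorb2)
    next
      case False
      then have "?N x \<le> ?N (b * 1)" using x by (intro mono_onD[OF N(1)]) auto
      also have "\<dots> \<le> k * ?N 1" by (rule bk(4)) simp
      also have "1 = max 1 (x / b)" using False bk(1) by (simp add: max_def divide_le_eq)
      finally show ?thesis .
    qed
    also have "\<dots> = k * N' (x / b) + k * ?N 1" by (simp add: N'_def right_diff_distrib)
    finally have "?N x \<le> k * N' (x / b) + k * ?N 1" .
    moreover have "N' x \<le> ?N x" by (rule N'le[OF x])
    ultimately show ?thesis using True by (simp add: min_absorb1)
  next
    case False
    then have "N' x = 0" by (simp add: N'_def max_absorb1)
    moreover have "0 \<le> k * N' (x / b)" "0 \<le> k * ?N (min 1 x)" using bk x by (auto intro!: mult_nonneg_nonneg N'nn N0)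
    ultimately show ?thesis by simp
  qed
  show ?thesis
  proof (rule that[of "2 * k + 1"])
    show "1 \<le> 2 * k + 1" using bk by simp
    fix \<tau> n K assume \<tau>: "bounded_time \<tau> n K"
    note D = bounded_timeD[OF \<tau>] and V = bounded_time_values[OF \<tau> zero_le_one]
    define G where "G \<omega> = ou_potential ((stopped \<tau> (rho 1) n \<omega>)\<^sup>2)" for \<omega>
    define H where "H \<omega> = ln (1 + stopped \<tau> A n \<omega>)" for \<omega>
    have Gm: "G \<in> borel_measurable P" "H \<in> borel_measurable P" unfolding G_def[abs_def] H_def[abs_def] using V(1,4) by measurable
    have G0: "0 \<le> G \<omega>" "0 \<le> H \<omega>" for \<omega> unfolding G_def H_def using ln_ou_potential_bounds(3)[OF V(5)] V(2)[of \<omega>] by auto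
    have [measurable]: "(\<lambda>\<omega>. N' (G \<omega>)) \<in> borel_measurable P" "(\<lambda>\<omega>. N' (G \<omega> / b)) \<in> borel_measurable P" "(\<lambda>\<omega>. N' (H \<omega>)) \<in> borel_measurable P"
      "(\<lambda>\<omega>. ?N (min 1 (G \<omega>))) \<in> borel_measurable P"
      using Gm G0 bk(1) by (auto intro!: measurable_comp_nonneg[OF N'c] measurable_comp_nonneg[OF N(2)])
    let ?I = "\<integral>\<^sup>+\<omega>. ennreal (N' (G \<omega>)) \<partial>P" and ?Q = "\<integral>\<^sup>+\<omega>. ennreal (?N (min 1 (G \<omega>))) \<partial>P" and ?J = "\<integral>\<^sup>+\<omega>. ennreal (?N (H \<omega>)) \<partial>P"
    have "G \<omega> \<le> ou_potential ((2 * K)\<^sup>2)" for \<omega>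
      unfolding G_def using V(5,6)[of \<omega>] by (subst ou_potential_square_le_iff) auto
    then have "?I \<le> (\<integral>\<^sup>+\<omega>. ennreal (N' (ou_potential ((2 * K)\<^sup>2))) \<partial>P)"
      using G0(1) order_trans[OF G0(1)] by (intro nn_integral_mono ennreal_leI mono_onD[OF N'm]) auto
    also have "\<dots> < \<infinity>" by (simp add: emeasure_space_1)
    finally have fin: "?I < \<infinity>" .
    have "(\<integral>\<^sup>+\<omega>. ennreal (N' (G \<omega> / b)) \<partial>P) \<le> ennreal (2 / b) * ?I + (\<integral>\<^sup>+\<omega>. ennreal (N' (H \<omega> / 1)) \<partial>P)"
    proof (rule good_lambda_integral[OF prob_space_axioms Gm G0 N'm N'c N'0(1) zero_le_one N'0(2)])
      show "measure P {\<omega> \<in> space P. b * l \<le> G \<omega> \<and> H \<omega> < 1 * l} \<le> 2 / b * measure P {\<omega> \<in> space P. l \<le> G \<omega>}" if "1 < l" for l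
        unfolding G_def H_def using that by (intro normalized_maximum_good_lambda[OF \<tau> _ bk(1)]) simp
    qed (use bk in auto)
    also have "(\<integral>\<^sup>+\<omega>. ennreal (N' (H \<omega> / 1)) \<partial>P) \<le> ?J" using N'le G0(2) by (intro nn_integral_mono ennreal_leI) auto
    finally have 1: "(\<integral>\<^sup>+\<omega>. ennreal (N' (G \<omega> / b)) \<partial>P) \<le> ennreal (2 / b) * ?I + ?J" by (simp add: add_left_mono)
    have "?I \<le> (\<integral>\<^sup>+\<omega>. ennreal k * ennreal (N' (G \<omega> / b)) + ennreal k * ennreal (?N (min 1 (G \<omega>))) \<partial>P)"
    proof (intro nn_integral_mono)
      fix \<omega>
      have nn: "0 \<le> N' (G \<omega> / b)" "0 \<le> ?N (min 1 (G \<omega>))" using G0(1)[of \<omega>] bk by (auto intro!: N'nn N0)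
      have "ennreal (N' (G \<omega>)) \<le> ennreal (k * N' (G \<omega> / b) + k * ?N (min 1 (G \<omega>)))" by (intro ennreal_leI step G0)
      then show "ennreal (N' (G \<omega>)) \<le> ennreal k * ennreal (N' (G \<omega> / b)) + ennreal k * ennreal (?N (min 1 (G \<omega>)))"
        using nn bk(2) by (simp add: ennreal_plus ennreal_mult)
    qed
    also have "\<dots> = ennreal k * (\<integral>\<^sup>+\<omega>. ennreal (N' (G \<omega> / b)) \<partial>P) + ennreal k * ?Q"
      by (subst nn_integral_add) (auto simp: nn_integral_cmult)
    also have "\<dots> \<le> ennreal k * (ennreal (2 / b) * ?I + ?J) + ennreal k * ?Q"
      by (intro add_right_mono mult_left_mono 1) simp
    also have "\<dots> = ennreal (2 * k / b) * ?I + ennreal k * (?J + ?Q)"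
    proof -
      have "ennreal k * ennreal (2 / b) = ennreal (2 * k / b)" using bk by (simp add: ennreal_mult[symmetric] mult.commute)
      then show ?thesis by (simp add: distrib_left mult.assoc[symmetric] add.assoc)
    qed
    finally have "?I \<le> 2 * (ennreal k * (?J + ?Q))" using bk by (intro ennreal_absorb[OF fin]) auto
    then have I: "?I \<le> ennreal (2 * k) * (?J + ?Q)" using bk by (simp add: ennreal_mult mult.assoc)
    have "(\<integral>\<^sup>+\<omega>. ennreal (?N (G \<omega>)) \<partial>P) = (\<integral>\<^sup>+\<omega>. ennreal (N' (G \<omega>)) + ennreal (?N (min 1 (G \<omega>))) \<partial>P)"
      using G0 by (intro nn_integral_cong) (subst split, simp add: ennreal_plus N'nn N0)
    also have "\<dots> = ?I + ?Q" by (rule nn_integral_add) measurable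
    also have "\<dots> \<le> ennreal (2 * k) * (?J + ?Q) + 1 * (?J + ?Q)" using I by (intro add_mono) auto
    also have "\<dots> = ennreal (2 * k + 1) * (?J + ?Q)" using bk by (simp add: ennreal_plus distrib_right)
    finally show "(\<integral>\<^sup>+\<omega>. ennreal (?N (ou_potential ((stopped \<tau> (rho 1) n \<omega>)\<^sup>2))) \<partial>P) \<le>
      ennreal (2 * k + 1) * ((\<integral>\<^sup>+\<omega>. ennreal (\<Phi> (g (stopped \<tau> A n \<omega>))) \<partial>P) + (\<integral>\<^sup>+\<omega>. ennreal (?N (min 1 (ou_potential ((stopped \<tau> (rho 1) n \<omega>)\<^sup>2)))) \<partial>P))"
      unfolding G_def H_def log_scale_g .
  qed
qed

text \<open>
  Either the clock \<open>A\<close> reaches \<open>1\<close>, and then \<open>\<Phi> (g A)\<close>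
  already exceeds a constant multiple of the truncated value, or the time is not changed by stopping
  at \<open>A = 1\<close>. Up to that time the unnormalized inequality applies, and \<open>sqrt A
  \<le> 2 g A\<close>.
\<close>

lemma small_values_dominated:
  assumes \<Phi>: "moderate \<Phi>"
  obtains C where "0 \<le> C" "\<And>\<tau> n K. bounded_time \<tau> n K \<Longrightarrow>
    (\<integral>\<^sup>+\<omega>. ennreal (log_scale \<Phi> (min 1 (ou_potential ((stopped \<tau> (rho 1) n \<omega>)\<^sup>2)))) \<partial>P) \<le> ennreal C * (\<integral>\<^sup>+\<omega>. ennreal (\<Phi> (g (stopped \<tau> A n \<omega>))) \<partial>P)"
proof -
  note m = moderateD[OF \<Phi>]
  note N = log_scale_moderate[OF \<Phi>]
  have N0: "0 \<le> log_scale \<Phi> x" if "0 \<le> x" for x using mono_onD[OF N(1), of 0 x] that N(3) by simp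
  obtain c where c: "1 \<le> c" "\<And>x. 0 \<le> x \<Longrightarrow> \<Phi> (2 * x) \<le> c * \<Phi> x"
    by (rule moderate_growth[OF \<Phi>, of 2]) (simp, blast)
  obtain C0 where C0: "\<And>\<tau> n K. bounded_time \<tau> n K \<Longrightarrow>
    (\<integral>\<^sup>+\<omega>. ennreal (\<Phi> (stopped \<tau> (rho 0) n \<omega>)) \<partial>P) \<le> ennreal C0 * (\<integral>\<^sup>+\<omega>. ennreal (\<Phi> (sqrt (stopped \<tau> A n \<omega>))) \<partial>P)"
    using maximum_bounded_by_clock[OF \<Phi>] by blast
  define C1 where "C1 = max 0 C0"
  have sg: "\<Phi> (sqrt a) \<le> c * \<Phi> (g a)" if "0 \<le> a" "a \<le> 1" for a
  proof -
    have "\<Phi> (sqrt a) \<le> \<Phi> (2 * g a)" using sqrt_le_g[OF that] that g_nonneg[OF that(1)] by (intro mono_onD[OF m(3)]) auto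
    also have "\<dots> \<le> c * \<Phi> (g a)" by (rule c(2)[OF g_nonneg[OF that(1)]])
    finally show ?thesis .
  qed
  show ?thesis
  proof (rule that[of "C1 * c + c"])
    show "0 \<le> C1 * c + c" using c by (simp add: C1_def)
    fix \<tau> n K assume \<tau>: "bounded_time \<tau> n K"
    note D = bounded_timeD[OF \<tau>] and V = bounded_time_values[OF \<tau> zero_le_one]
    have n0: "0 \<le> n" using D(3) by simp
    \<comment> \<open>Up to \<open>\<sigma>\<close> the clock stays in \<open>[0, 1]\<close>, where \<^const>\<open>g\<close> is comparable with the square root.\<close>
    define \<sigma> where "\<sigma> \<omega> = min (\<tau> \<omega>) (hit A 1 \<omega>)" for \<omega>
    have s: "bounded_time \<sigma> n K"
      by (rule bounded_time_subset[OF \<tau>]) (auto simp: \<sigma>_def[abs_def] intro!: stopping_time_min D(1) stopping_time_hit A_continuous A_mono A_adapted)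
    note Ds = bounded_timeD[OF s] and Vs0 = bounded_time_values[OF s order_refl]
    define r where "r \<omega> = clamp 0 n (\<sigma> \<omega>)" for \<omega>
    define w where "w \<omega> = clamp 0 n (\<tau> \<omega>)" for \<omega>
    have r: "stopped \<sigma> N n \<omega> = N (r \<omega>) \<omega>" "ennreal (r \<omega>) = \<sigma> \<omega>" "0 \<le> r \<omega>" for N \<omega>
      unfolding r_def using stopped_at_bounded_time[of \<sigma> \<omega> n, OF Ds(2) n0] by auto
    have w: "stopped \<tau> N n \<omega> = N (w \<omega>) \<omega>" "ennreal (w \<omega>) = \<tau> \<omega>" "0 \<le> w \<omega>" for N \<omega>
      unfolding w_def using stopped_at_bounded_time[of \<tau> \<omega> n, OF D(2) n0] by auto
    have rw: "r \<omega> \<le> w \<omega>" for \<omega>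
      using r(2)[of \<omega>] w(2,3)[of \<omega>] by (metis \<sigma>_def ennreal_le_iff min.cobounded1)
    have A1: "A (r \<omega>) \<omega> \<le> 1" for \<omega>
      using r(2,3)[of \<omega>] by (rule_tac below_hit[of A \<omega>, OF A_continuous A_mono]) (auto simp: \<sigma>_def start)
    have Arw: "A (r \<omega>) \<omega> \<le> A (w \<omega>) \<omega>" for \<omega> using rw[of \<omega>] r(3)[of \<omega>] w(3)[of \<omega>] by (auto intro!: mono_onD[OF A_mono])
    have small: "log_scale \<Phi> (min 1 (ou_potential ((rho 1 (w \<omega>) \<omega>)\<^sup>2))) \<le> \<Phi> (rho 0 (r \<omega>) \<omega>) + c * \<Phi> (g (A (w \<omega>) \<omega>))" for \<omega>
    proof (cases "1 \<le> A (w \<omega>) \<omega>")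
      case True
      have "log_scale \<Phi> (min 1 (ou_potential ((rho 1 (w \<omega>) \<omega>)\<^sup>2))) \<le> log_scale \<Phi> 1"
        using ln_ou_potential_bounds(3)[OF rho_nonneg[OF zero_le_one w(3)], of \<omega>] by (intro mono_onD[OF N(1)]) auto
      also have "\<dots> \<le> \<Phi> (sqrt 1)" unfolding log_scale_def using ln_add_one_self_le_self[of 1] by (intro mono_onD[OF m(3)]) auto
      also have "\<dots> \<le> c * \<Phi> (g 1)" by (rule sg) auto
      also have "\<dots> \<le> c * \<Phi> (g (A (w \<omega>) \<omega>))" using c True g_nonneg[of 1] g_nonneg[of "A (w \<omega>) \<omega>"] g_mono[of 1 "A (w \<omega>) \<omega>"]
        by (intro mult_left_mono mono_onD[OF m(3)]) auto
      also have "\<dots> \<le> \<Phi> (rho 0 (r \<omega>) \<omega>) + c * \<Phi> (g (A (w \<omega>) \<omega>))" using m(1)[OF rho_nonneg[OF order_refl r(3)]] by simp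
      finally show ?thesis .
    next
      case False
      then have "\<not> hit A 1 \<omega> \<le> \<tau> \<omega>" unfolding w(2)[symmetric] hit_le_iff[of A \<omega>, OF A_continuous A_mono w(3)] .
      then have "\<sigma> \<omega> = \<tau> \<omega>" unfolding \<sigma>_def by (intro min_absorb1) (simp add: not_le less_imp_le)
      then have eq: "w \<omega> = r \<omega>" by (simp add: w_def r_def)
      let ?h = "ou_potential ((rho 1 (r \<omega>) \<omega>)\<^sup>2)"
      have h0: "0 \<le> ?h" by (rule ln_ou_potential_bounds(3)[OF rho_nonneg[OF zero_le_one r(3)]])
      have "log_scale \<Phi> (min 1 ?h) \<le> log_scale \<Phi> ?h" using h0 by (intro mono_onD[OF N(1)]) auto
      also have "\<dots> \<le> \<Phi> (rho 0 (r \<omega>) \<omega>)"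
      proof -
        have "sqrt (ln (1 + ?h)) \<le> rho 1 (r \<omega>) \<omega>"
          using ln_ou_potential_bounds(1)[OF rho_nonneg[OF zero_le_one r(3)], of \<omega>] rho_nonneg[OF zero_le_one r(3), of \<omega>] by (intro real_le_lsqrt) auto
        also have "\<dots> \<le> rho 0 (r \<omega>) \<omega>" by (rule rho_antimono[OF r(3)])
        finally show ?thesis unfolding log_scale_def using h0 rho_nonneg[OF order_refl r(3), of \<omega>] by (intro mono_onD[OF m(3)]) auto
      qed
      also have "\<dots> \<le> \<Phi> (rho 0 (r \<omega>) \<omega>) + c * \<Phi> (g (A (w \<omega>) \<omega>))"
        using c m(1)[OF g_nonneg[OF A_nonneg[OF w(3)]], of \<omega>] by simp
      finally show ?thesis unfolding eq .
    qed
    let ?J = "\<integral>\<^sup>+\<omega>. ennreal (\<Phi> (g (stopped \<tau> A n \<omega>))) \<partial>P"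
    have gm: "(\<lambda>\<omega>. \<Phi> (g (stopped \<tau> A n \<omega>))) \<in> borel_measurable P"
      unfolding log_scale_g[symmetric] using V(1,2) by (intro measurable_comp_nonneg[OF N(2)]) (auto intro!: borel_measurable_ln)
    have rm: "(\<lambda>\<omega>. \<Phi> (stopped \<sigma> (rho 0) n \<omega>)) \<in> borel_measurable P"
      using Vs0(4,5) by (intro measurable_comp_nonneg[OF m(2)]) auto
    have "(\<integral>\<^sup>+\<omega>. ennreal (log_scale \<Phi> (min 1 (ou_potential ((stopped \<tau> (rho 1) n \<omega>)\<^sup>2)))) \<partial>P)
       \<le> (\<integral>\<^sup>+\<omega>. ennreal (\<Phi> (stopped \<sigma> (rho 0) n \<omega>)) + ennreal c * ennreal (\<Phi> (g (stopped \<tau> A n \<omega>))) \<partial>P)"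
    proof (intro nn_integral_mono)
      fix \<omega>
      have nn: "0 \<le> \<Phi> (rho 0 (r \<omega>) \<omega>)" "0 \<le> \<Phi> (g (A (w \<omega>) \<omega>))"
        by (auto intro!: m(1) rho_nonneg[OF order_refl r(3)] g_nonneg A_nonneg w(3))
      show "ennreal (log_scale \<Phi> (min 1 (ou_potential ((stopped \<tau> (rho 1) n \<omega>)\<^sup>2)))) \<le> ennreal (\<Phi> (stopped \<sigma> (rho 0) n \<omega>)) + ennreal c * ennreal (\<Phi> (g (stopped \<tau> A n \<omega>)))"
        unfolding r(1) w(1) using ennreal_leI[OF small[of \<omega>]] nn c(1) by (simp add: ennreal_plus ennreal_mult)
    qed
    also have "\<dots> = (\<integral>\<^sup>+\<omega>. ennreal (\<Phi> (stopped \<sigma> (rho 0) n \<omega>)) \<partial>P) + ennreal c * ?J"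
      using gm rm by (subst nn_integral_add) (auto simp: nn_integral_cmult)
    also have "(\<integral>\<^sup>+\<omega>. ennreal (\<Phi> (stopped \<sigma> (rho 0) n \<omega>)) \<partial>P) \<le> ennreal C1 * (\<integral>\<^sup>+\<omega>. ennreal (\<Phi> (sqrt (stopped \<sigma> A n \<omega>))) \<partial>P)"
      by (rule order_trans[OF C0[OF s]]) (auto simp: C1_def intro!: mult_right_mono ennreal_leI)
    also have "(\<integral>\<^sup>+\<omega>. ennreal (\<Phi> (sqrt (stopped \<sigma> A n \<omega>))) \<partial>P) \<le> (\<integral>\<^sup>+\<omega>. ennreal c * ennreal (\<Phi> (g (stopped \<tau> A n \<omega>))) \<partial>P)"
    proof (intro nn_integral_mono)
      fix \<omega>
      have "\<Phi> (sqrt (A (r \<omega>) \<omega>)) \<le> c * \<Phi> (g (A (r \<omega>) \<omega>))" by (rule sg[OF A_nonneg[OF r(3)] A1])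
      also have "\<dots> \<le> c * \<Phi> (g (A (w \<omega>) \<omega>))"
        using c g_nonneg[OF A_nonneg[OF r(3)], of \<omega>] g_nonneg[OF A_nonneg[OF w(3)], of \<omega>] g_mono[OF A_nonneg[OF r(3)] Arw]
        by (intro mult_left_mono mono_onD[OF m(3)]) auto
      finally have "ennreal (\<Phi> (sqrt (A (r \<omega>) \<omega>))) \<le> ennreal (c * \<Phi> (g (A (w \<omega>) \<omega>)))" by (rule ennreal_leI)
      then show "ennreal (\<Phi> (sqrt (stopped \<sigma> A n \<omega>))) \<le> ennreal c * ennreal (\<Phi> (g (stopped \<tau> A n \<omega>)))"
        unfolding r(1) w(1) using c m(1)[OF g_nonneg[OF A_nonneg[OF w(3)]], of \<omega>] by (simp add: ennreal_mult)
    qed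
    also have "\<dots> = ennreal c * ?J" using gm by (intro nn_integral_cmult) auto
    finally have "(\<integral>\<^sup>+\<omega>. ennreal (log_scale \<Phi> (min 1 (ou_potential ((stopped \<tau> (rho 1) n \<omega>)\<^sup>2)))) \<partial>P) \<le> ennreal C1 * (ennreal c * ?J) + ennreal c * ?J"
      by (simp add: mult_left_mono add_right_mono)
    also have "\<dots> = ennreal (C1 * c + c) * ?J"
      using c by (simp add: C1_def ennreal_plus ennreal_mult distrib_right mult.assoc)
    finally show "(\<integral>\<^sup>+\<omega>. ennreal (log_scale \<Phi> (min 1 (ou_potential ((stopped \<tau> (rho 1) n \<omega>)\<^sup>2)))) \<partial>P) \<le> ennreal (C1 * c + c) * ?J" .
  qed
qed

lemma normalized_maximum_bounded_by_log_clock: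
  assumes \<Phi>: "moderate \<Phi>"
  obtains C where "\<And>\<tau> n K. bounded_time \<tau> n K \<Longrightarrow>
    (\<integral>\<^sup>+\<omega>. ennreal (\<Phi> (stopped \<tau> (rho 1) n \<omega>)) \<partial>P) \<le> ennreal C * (\<integral>\<^sup>+\<omega>. ennreal (\<Phi> (g (stopped \<tau> A n \<omega>))) \<partial>P)"
proof -
  note m = moderateD[OF \<Phi>]
  note N = log_scale_moderate[OF \<Phi>]
  obtain c where c: "1 \<le> c" "\<And>x. 0 \<le> x \<Longrightarrow> \<Phi> (2 * x) \<le> c * \<Phi> x"
    by (rule moderate_growth[OF \<Phi>, of 2]) (simp, blast)
  obtain CL where CL: "1 \<le> CL" "\<And>\<tau> n K. bounded_time \<tau> n K \<Longrightarrow>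
    (\<integral>\<^sup>+\<omega>. ennreal (log_scale \<Phi> (ou_potential ((stopped \<tau> (rho 1) n \<omega>)\<^sup>2))) \<partial>P) \<le>
      ennreal CL * ((\<integral>\<^sup>+\<omega>. ennreal (\<Phi> (g (stopped \<tau> A n \<omega>))) \<partial>P) + (\<integral>\<^sup>+\<omega>. ennreal (log_scale \<Phi> (min 1 (ou_potential ((stopped \<tau> (rho 1) n \<omega>)\<^sup>2)))) \<partial>P))"
    using large_values_dominated[OF \<Phi>] by blast
  obtain CS where CS: "0 \<le> CS" "\<And>\<tau> n K. bounded_time \<tau> n K \<Longrightarrow>
    (\<integral>\<^sup>+\<omega>. ennreal (log_scale \<Phi> (min 1 (ou_potential ((stopped \<tau> (rho 1) n \<omega>)\<^sup>2)))) \<partial>P) \<le> ennreal CS * (\<integral>\<^sup>+\<omega>. ennreal (\<Phi> (g (stopped \<tau> A n \<omega>))) \<partial>P)"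
    using small_values_dominated[OF \<Phi>] by blast
  show ?thesis
  proof (rule that[of "c * (CL * (1 + CS))"])
    fix \<tau> n K assume \<tau>: "bounded_time \<tau> n K"
    note V = bounded_time_values[OF \<tau> zero_le_one]
    let ?J = "\<integral>\<^sup>+\<omega>. ennreal (\<Phi> (g (stopped \<tau> A n \<omega>))) \<partial>P"
    let ?G = "\<lambda>\<omega>. ou_potential ((stopped \<tau> (rho 1) n \<omega>)\<^sup>2)"
    have G0: "0 \<le> ?G \<omega>" for \<omega> by (rule ln_ou_potential_bounds(3)[OF V(5)])
    have Gm: "(\<lambda>\<omega>. log_scale \<Phi> (?G \<omega>)) \<in> borel_measurable P"
      using V(4) G0 by (intro measurable_comp_nonneg[OF N(2)]) auto
    have "(\<integral>\<^sup>+\<omega>. ennreal (\<Phi> (stopped \<tau> (rho 1) n \<omega>)) \<partial>P) \<le> (\<integral>\<^sup>+\<omega>. ennreal c * ennreal (log_scale \<Phi> (?G \<omega>)) \<partial>P)"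
    proof (intro nn_integral_mono)
      fix \<omega>
      have "stopped \<tau> (rho 1) n \<omega> \<le> sqrt (4 * ln (1 + ?G \<omega>))"
        using ln_ou_potential_bounds(2)[OF V(5), of \<omega>] by (rule real_le_rsqrt)
      also have "\<dots> = 2 * sqrt (ln (1 + ?G \<omega>))" by (simp add: real_sqrt_mult)
      finally have "\<Phi> (stopped \<tau> (rho 1) n \<omega>) \<le> \<Phi> (2 * sqrt (ln (1 + ?G \<omega>)))"
        using V(5)[of \<omega>] G0[of \<omega>] by (intro mono_onD[OF m(3)]) auto
      also have "\<dots> \<le> c * log_scale \<Phi> (?G \<omega>)" unfolding log_scale_def using G0[of \<omega>] by (intro c(2)) auto
      finally have "ennreal (\<Phi> (stopped \<tau> (rho 1) n \<omega>)) \<le> ennreal (c * log_scale \<Phi> (?G \<omega>))" by (rule ennreal_leI)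
      then show "ennreal (\<Phi> (stopped \<tau> (rho 1) n \<omega>)) \<le> ennreal c * ennreal (log_scale \<Phi> (?G \<omega>))"
        using c(1) mono_onD[OF N(1), of 0 "?G \<omega>"] G0[of \<omega>] N(3) by (simp add: ennreal_mult)
    qed
    also have "\<dots> = ennreal c * (\<integral>\<^sup>+\<omega>. ennreal (log_scale \<Phi> (?G \<omega>)) \<partial>P)" using Gm by (intro nn_integral_cmult) auto
    also have "\<dots> \<le> ennreal c * (ennreal CL * (?J + ennreal CS * ?J))"
      by (intro mult_left_mono order_trans[OF CL(2)[OF \<tau>]] add_left_mono CS(2)[OF \<tau>]) auto
    also have "\<dots> = ennreal (c * (CL * (1 + CS))) * ?J"
      using c CL(1) CS(1) by (simp add: ennreal_plus ennreal_mult distrib_right mult.assoc)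
    finally show "(\<integral>\<^sup>+\<omega>. ennreal (\<Phi> (stopped \<tau> (rho 1) n \<omega>)) \<partial>P) \<le> ennreal (c * (CL * (1 + CS))) * ?J" .
  qed
qed

end

section \<open>Arbitrary stopping times\<close>

lemma value_at_cong:
  assumes "\<And>t. 0 \<le> t \<Longrightarrow> Z t \<omega> = Z' t \<omega>"
  shows "value_at \<tau> Z \<omega> = value_at \<tau> Z' \<omega>"
  using assms by (auto simp: value_at_def)

lemma running_max_cong:
  assumes "\<And>s. 0 \<le> s \<Longrightarrow> s \<le> t \<Longrightarrow> Z s \<omega> = Z' s \<omega>"
  shows "running_max Z t \<omega> = running_max Z' t \<omega>"
  unfolding running_max_def using assms by (intro SUP_cong) auto

lemma hit_mono: "l \<le> l' \<Longrightarrow> hit G l \<omega> \<le> hit G l' \<omega>"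
  unfolding hit_def by (intro Inf_superset_mono) auto

context planar_martingale
begin

definition size_max :: "real \<Rightarrow> 'a \<Rightarrow> real" where
  "size_max = running_max (\<lambda>t \<omega>. \<bar>X t \<omega>\<bar> + \<bar>Y t \<omega>\<bar> + A t \<omega>)"

text \<open>
  Stopping before the size of \<open>(X, Y, A)\<close> exceeds \<open>n + 1\<close>; the successor
  keeps the time horizon positive.
\<close>

definition cutoff :: "('a \<Rightarrow> ennreal) \<Rightarrow> nat \<Rightarrow> 'a \<Rightarrow> ennreal" where
  "cutoff \<tau> n \<omega> = min (min (\<tau> \<omega>) (ennreal (real (Suc n)))) (hit size_max (real (Suc n)) \<omega>)"

lemma size_continuous: "continuous_on {0..} (\<lambda>t. \<bar>X t \<omega>\<bar> + \<bar>Y t \<omega>\<bar> + A t \<omega>)"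
  by (intro continuous_intros XY_continuous A_continuous)

lemma size_max_props: "continuous_on {0..} (\<lambda>t. size_max t \<omega>)" "mono_on {0..} (\<lambda>t. size_max t \<omega>)" "adapted F size_max" "size_max 0 \<omega> = 0"
proof -
  show "continuous_on {0..} (\<lambda>t. size_max t \<omega>)" unfolding size_max_def by (rule running_max_continuous[OF size_continuous])
  show "mono_on {0..} (\<lambda>t. size_max t \<omega>)" unfolding size_max_def by (rule running_max_mono[OF size_continuous])
  have "adapted F (\<lambda>t \<omega>. \<bar>X t \<omega>\<bar> + \<bar>Y t \<omega>\<bar> + A t \<omega>)"
    using XY_adapted A_adapted unfolding adapted_def
    by (intro allI impI borel_measurable_add borel_measurable_abs) auto
  then show "adapted F size_max" unfolding size_max_def by (rule running_max_adapted[OF size_continuous])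
  show "size_max 0 \<omega> = 0" by (simp add: size_max_def running_max_0 start)
qed

lemma bounded_time_cutoff:
  assumes \<tau>: "stopping_time F \<tau>"
  shows "bounded_time (cutoff \<tau> n) (real (Suc n)) (real (Suc n))"
  unfolding bounded_time_def
proof (intro conjI allI impI)
  show "stopping_time F (cutoff \<tau> n)" unfolding cutoff_def[abs_def]
    by (intro stopping_time_min \<tau> stopping_time_const stopping_time_hit size_max_props)
  show "cutoff \<tau> n \<omega> \<le> ennreal (real (Suc n))" for \<omega> by (simp add: cutoff_def min_le_iff_disj)
  fix t \<omega> assume t: "0 \<le> t" "ennreal t \<le> cutoff \<tau> n \<omega>"
  then have "size_max t \<omega> \<le> real (Suc n)"
    by (rule_tac below_hit[of size_max \<omega>, OF size_max_props(1,2)]) (auto simp: cutoff_def size_max_props(4))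
  moreover have "\<bar>X t \<omega>\<bar> + \<bar>Y t \<omega>\<bar> + A t \<omega> \<le> size_max t \<omega>"
    unfolding size_max_def using running_max_upper[of "\<lambda>t \<omega>. \<bar>X t \<omega>\<bar> + \<bar>Y t \<omega>\<bar> + A t \<omega>" \<omega>, OF size_continuous, of t t] t(1) by simp
  ultimately show "\<bar>X t \<omega>\<bar> \<le> real (Suc n)" "\<bar>Y t \<omega>\<bar> \<le> real (Suc n)" "A t \<omega> \<le> real (Suc n)"
    using A_nonneg[OF t(1), of \<omega>] by linarith+
qed simp

lemma cutoff_mono: "n \<le> n' \<Longrightarrow> cutoff \<tau> n \<omega> \<le> cutoff \<tau> n' \<omega>"
  unfolding cutoff_def by (intro min.mono order_refl ennreal_leI hit_mono) auto

text \<open>By continuity the size is bounded on \<open>[0, t]\<close>.\<close>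

lemma cutoff_eventually_ge:
  assumes "0 \<le> t" shows "\<exists>n. min (\<tau> \<omega>) (ennreal t) \<le> cutoff \<tau> n \<omega>"
proof -
  obtain n :: nat where n: "max t (size_max t \<omega>) < real n" using reals_Archimedean2 by blast
  have "\<not> hit size_max (real (Suc n)) \<omega> \<le> ennreal t"
    unfolding hit_le_iff[of size_max \<omega>, OF size_max_props(1,2) assms] using n by simp
  then have "ennreal t \<le> hit size_max (real (Suc n)) \<omega>" by simp
  moreover have "ennreal t \<le> ennreal (real (Suc n))" using n by (intro ennreal_leI) simp
  ultimately have "min (\<tau> \<omega>) (ennreal t) \<le> cutoff \<tau> n \<omega>" unfolding cutoff_def by (simp add: min_le_iff_disj)
  then show ?thesis ..
qed

text \<open>
  Where \<open>\<tau>\<close> is finite the cut-off times are eventually equal to it; where it is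
  infinite they tend to infinity.
\<close>

lemma value_at_cutoff:
  assumes Z: "mono_on {0..} (\<lambda>t. Z t \<omega>)"
  shows "incseq (\<lambda>n. ennreal (stopped (cutoff \<tau> n) Z (real (Suc n)) \<omega>))"
    "value_at \<tau> Z \<omega> = (SUP n. ennreal (stopped (cutoff \<tau> n) Z (real (Suc n)) \<omega>))"
proof -
  define s where "s n = clamp 0 (real (Suc n)) (cutoff \<tau> n \<omega>)" for n
  have s: "stopped (cutoff \<tau> n) Z (real (Suc n)) \<omega> = Z (s n) \<omega>" "ennreal (s n) = cutoff \<tau> n \<omega>" "0 \<le> s n" for n
    unfolding s_def using stopped_at_bounded_time[of "cutoff \<tau> n" \<omega> "real (Suc n)"] by (auto simp: cutoff_def min_le_iff_disj)
  have smono: "s n \<le> s n'" if "n \<le> n'" for n n' using cutoff_mono[OF that, of \<tau> \<omega>] s(2,3) by (metis ennreal_le_iff)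
  show "incseq (\<lambda>n. ennreal (stopped (cutoff \<tau> n) Z (real (Suc n)) \<omega>))"
    unfolding s(1) using s(3) smono by (intro incseq_def[THEN iffD2] allI impI ennreal_leI mono_onD[OF Z]) auto
  show "value_at \<tau> Z \<omega> = (SUP n. ennreal (stopped (cutoff \<tau> n) Z (real (Suc n)) \<omega>))"
    unfolding s(1)
  proof (rule antisym)
    have le: "\<exists>n. ennreal (Z t \<omega>) \<le> ennreal (Z (s n) \<omega>)" if t: "0 \<le> t" "ennreal t \<le> \<tau> \<omega>" for t
    proof -
      obtain n where "min (\<tau> \<omega>) (ennreal t) \<le> cutoff \<tau> n \<omega>" using cutoff_eventually_ge[OF t(1)] by blast
      then have "ennreal t \<le> ennreal (s n)" using t(2) unfolding s(2) by (simp add: min_absorb2)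
      then have "t \<le> s n" using s(3) by simp
      then have "ennreal (Z t \<omega>) \<le> ennreal (Z (s n) \<omega>)" using t(1) s(3)[of n] by (intro ennreal_leI mono_onD[OF Z]) auto
      then show ?thesis ..
    qed
    show "value_at \<tau> Z \<omega> \<le> (SUP n. ennreal (Z (s n) \<omega>))"
    proof (cases "\<tau> \<omega> = \<infinity>")
      case True
      then show ?thesis unfolding value_at_def using le by (auto intro!: SUP_mono)
    next
      case False
      then have "ennreal (enn2real (\<tau> \<omega>)) \<le> \<tau> \<omega>" by (simp add: less_top)
      then obtain n where "ennreal (Z (enn2real (\<tau> \<omega>)) \<omega>) \<le> ennreal (Z (s n) \<omega>)" using le[of "enn2real (\<tau> \<omega>)"] by auto
      then show ?thesis unfolding value_at_def using False by (auto intro: SUP_upper2)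
    qed
    show "(SUP n. ennreal (Z (s n) \<omega>)) \<le> value_at \<tau> Z \<omega>"
    proof (rule SUP_least)
      fix n
      show "ennreal (Z (s n) \<omega>) \<le> value_at \<tau> Z \<omega>"
      proof (cases "\<tau> \<omega> = \<infinity>")
        case True
        then show ?thesis unfolding value_at_def using s(3)[of n] by (auto intro!: SUP_upper)
      next
        case False
        have "ennreal (s n) \<le> \<tau> \<omega>" unfolding s(2) by (simp add: cutoff_def min_le_iff_disj)
        then have "s n \<le> enn2real (\<tau> \<omega>)" using False s(3)[of n] by (metis enn2real_ennreal enn2real_mono infinity_ennreal_def less_top)
        then show ?thesis unfolding value_at_def using False s(3)[of n] by (auto intro!: ennreal_leI mono_onD[OF Z])
      qed
    qed
  qed
qed

lemma value_at_comparison: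
  assumes \<tau>: "stopping_time F \<tau>"
    and Z: "\<And>\<omega>. mono_on {0..} (\<lambda>t. Z t \<omega>)" "\<And>\<omega>. mono_on {0..} (\<lambda>t. Z' t \<omega>)"
    and meas: "\<And>\<tau> n K. bounded_time \<tau> n K \<Longrightarrow> stopped \<tau> Z n \<in> borel_measurable P"
    and le: "\<And>\<tau> n K. bounded_time \<tau> n K \<Longrightarrow> (\<integral>\<^sup>+\<omega>. ennreal (stopped \<tau> Z n \<omega>) \<partial>P) \<le> ennreal C * (\<integral>\<^sup>+\<omega>. ennreal (stopped \<tau> Z' n \<omega>) \<partial>P)"
  shows "(\<integral>\<^sup>+\<omega>. value_at \<tau> Z \<omega> \<partial>P) \<le> ennreal C * (\<integral>\<^sup>+\<omega>. value_at \<tau> Z' \<omega> \<partial>P)"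
proof -
  note b = bounded_time_cutoff[OF \<tau>]
  have "(\<integral>\<^sup>+\<omega>. value_at \<tau> Z \<omega> \<partial>P) = (\<integral>\<^sup>+\<omega>. (SUP n. ennreal (stopped (cutoff \<tau> n) Z (real (Suc n)) \<omega>)) \<partial>P)"
    by (intro nn_integral_cong value_at_cutoff(2) Z)
  also have "\<dots> = (SUP n. \<integral>\<^sup>+\<omega>. ennreal (stopped (cutoff \<tau> n) Z (real (Suc n)) \<omega>) \<partial>P)"
  proof (rule nn_integral_monotone_convergence_SUP)
    show "incseq (\<lambda>n \<omega>. ennreal (stopped (cutoff \<tau> n) Z (real (Suc n)) \<omega>))"
      by (intro incseq_def[THEN iffD2] allI impI le_funI incseqD[OF value_at_cutoff(1)[OF Z(1)]])
    show "(\<lambda>\<omega>. ennreal (stopped (cutoff \<tau> n) Z (real (Suc n)) \<omega>)) \<in> borel_measurable P" for n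
      by (rule measurable_compose[OF meas[OF b] measurable_ennreal])
  qed
  also have "\<dots> \<le> ennreal C * (\<integral>\<^sup>+\<omega>. value_at \<tau> Z' \<omega> \<partial>P)"
  proof (rule SUP_least)
    fix n
    have "(\<integral>\<^sup>+\<omega>. ennreal (stopped (cutoff \<tau> n) Z' (real (Suc n)) \<omega>) \<partial>P) \<le> (\<integral>\<^sup>+\<omega>. value_at \<tau> Z' \<omega> \<partial>P)"
      unfolding value_at_cutoff(2)[OF Z(2)] by (intro nn_integral_mono SUP_upper) auto
    then show "(\<integral>\<^sup>+\<omega>. ennreal (stopped (cutoff \<tau> n) Z (real (Suc n)) \<omega>) \<partial>P) \<le> ennreal C * (\<integral>\<^sup>+\<omega>. value_at \<tau> Z' \<omega> \<partial>P)"
      using le[OF b[of n]] by (meson mult_left_mono order_trans zero_le)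
  qed
  finally show ?thesis .
qed

lemma compose_mono:
  assumes "moderate \<Phi>" "mono_on {0..} (\<lambda>t. Z t \<omega>)" "\<And>t. 0 \<le> t \<Longrightarrow> 0 \<le> Z t \<omega>"
  shows "mono_on {0..} (\<lambda>t. \<Phi> (Z t \<omega>))"
  by (intro mono_onI mono_onD[OF moderateD(3)[OF assms(1)]] mono_onD[OF assms(2)]) (auto simp: assms(3))

text \<open>
  The constants for bounded times do not depend on the bounds, so monotone convergence along
  \<^const>\<open>cutoff\<close> applies.
\<close>

theorem maximal_inequalities:
  assumes \<Phi>: "moderate \<Phi>"
  shows "\<exists>c>0. \<exists>C>0. \<forall>\<tau>. stopping_time F \<tau> \<longrightarrow>
      ennreal c * (\<integral>\<^sup>+\<omega>. value_at \<tau> (\<lambda>t \<omega>. \<Phi> (sqrt (A t \<omega>))) \<omega> \<partial>P) \<le> (\<integral>\<^sup>+\<omega>. value_at \<tau> (\<lambda>t \<omega>. \<Phi> (rho 0 t \<omega>)) \<omega> \<partial>P) \<and>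
      (\<integral>\<^sup>+\<omega>. value_at \<tau> (\<lambda>t \<omega>. \<Phi> (rho 0 t \<omega>)) \<omega> \<partial>P) \<le> ennreal C * (\<integral>\<^sup>+\<omega>. value_at \<tau> (\<lambda>t \<omega>. \<Phi> (sqrt (A t \<omega>))) \<omega> \<partial>P) \<and>
      ennreal c * (\<integral>\<^sup>+\<omega>. value_at \<tau> (\<lambda>t \<omega>. \<Phi> (g (A t \<omega>))) \<omega> \<partial>P) \<le> (\<integral>\<^sup>+\<omega>. value_at \<tau> (\<lambda>t \<omega>. \<Phi> (rho 1 t \<omega>)) \<omega> \<partial>P) \<and>
      (\<integral>\<^sup>+\<omega>. value_at \<tau> (\<lambda>t \<omega>. \<Phi> (rho 1 t \<omega>)) \<omega> \<partial>P) \<le> ennreal C * (\<integral>\<^sup>+\<omega>. value_at \<tau> (\<lambda>t \<omega>. \<Phi> (g (A t \<omega>))) \<omega> \<partial>P)"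
proof -
  note m = moderateD[OF \<Phi>]
  obtain C1 where C1: "\<And>\<tau> n K. bounded_time \<tau> n K \<Longrightarrow>
    (\<integral>\<^sup>+\<omega>. ennreal (\<Phi> (sqrt (stopped \<tau> A n \<omega>))) \<partial>P) \<le> ennreal C1 * (\<integral>\<^sup>+\<omega>. ennreal (\<Phi> (stopped \<tau> (rho 0) n \<omega>)) \<partial>P)"
    using clock_bounded_by_maximum[OF \<Phi>] by blast
  obtain C2 where C2: "\<And>\<tau> n K. bounded_time \<tau> n K \<Longrightarrow>
    (\<integral>\<^sup>+\<omega>. ennreal (\<Phi> (stopped \<tau> (rho 0) n \<omega>)) \<partial>P) \<le> ennreal C2 * (\<integral>\<^sup>+\<omega>. ennreal (\<Phi> (sqrt (stopped \<tau> A n \<omega>))) \<partial>P)"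
    using maximum_bounded_by_clock[OF \<Phi>] by blast
  obtain C3 where C3: "\<And>\<tau> n K. bounded_time \<tau> n K \<Longrightarrow>
    (\<integral>\<^sup>+\<omega>. ennreal (\<Phi> (g (stopped \<tau> A n \<omega>))) \<partial>P) \<le> ennreal C3 * (\<integral>\<^sup>+\<omega>. ennreal (\<Phi> (stopped \<tau> (rho 1) n \<omega>)) \<partial>P)"
    using log_clock_bounded_by_normalized_maximum[OF \<Phi>] by blast
  obtain C4 where C4: "\<And>\<tau> n K. bounded_time \<tau> n K \<Longrightarrow>
    (\<integral>\<^sup>+\<omega>. ennreal (\<Phi> (stopped \<tau> (rho 1) n \<omega>)) \<partial>P) \<le> ennreal C4 * (\<integral>\<^sup>+\<omega>. ennreal (\<Phi> (g (stopped \<tau> A n \<omega>))) \<partial>P)"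
    using normalized_maximum_bounded_by_log_clock[OF \<Phi>] by blast
  let ?Z1 = "\<lambda>t \<omega>. \<Phi> (sqrt (A t \<omega>))" and ?Z2 = "\<lambda>t \<omega>. \<Phi> (rho 0 t \<omega>)"
  let ?Z3 = "\<lambda>t \<omega>. \<Phi> (g (A t \<omega>))" and ?Z4 = "\<lambda>t \<omega>. \<Phi> (rho 1 t \<omega>)"
  have st: "stopped \<tau> ?Z1 n = (\<lambda>\<omega>. \<Phi> (sqrt (stopped \<tau> A n \<omega>)))" "stopped \<tau> ?Z2 n = (\<lambda>\<omega>. \<Phi> (stopped \<tau> (rho 0) n \<omega>))"
    "stopped \<tau> ?Z3 n = (\<lambda>\<omega>. \<Phi> (g (stopped \<tau> A n \<omega>)))" "stopped \<tau> ?Z4 n = (\<lambda>\<omega>. \<Phi> (stopped \<tau> (rho 1) n \<omega>))" for \<tau> n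
    by (auto simp: stopped_def)
  have mono: "mono_on {0..} (\<lambda>t. ?Z1 t \<omega>)" "mono_on {0..} (\<lambda>t. ?Z2 t \<omega>)" "mono_on {0..} (\<lambda>t. ?Z3 t \<omega>)" "mono_on {0..} (\<lambda>t. ?Z4 t \<omega>)" for \<omega>
  proof -
    show "mono_on {0..} (\<lambda>t. ?Z1 t \<omega>)"
      by (rule compose_mono[OF \<Phi>]) (auto intro!: mono_onI mono_onD[OF A_mono] A_nonneg)
    show "mono_on {0..} (\<lambda>t. ?Z3 t \<omega>)"
      by (rule compose_mono[OF \<Phi>]) (auto intro!: mono_onI g_mono mono_onD[OF A_mono] A_nonneg g_nonneg)
    show "mono_on {0..} (\<lambda>t. ?Z2 t \<omega>)" "mono_on {0..} (\<lambda>t. ?Z4 t \<omega>)"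
      by (rule compose_mono[OF \<Phi>], rule rho_mono, simp, simp add: rho_nonneg)+
  qed
  have meas: "stopped \<tau> ?Z1 n \<in> borel_measurable P" "stopped \<tau> ?Z2 n \<in> borel_measurable P"
    "stopped \<tau> ?Z3 n \<in> borel_measurable P" "stopped \<tau> ?Z4 n \<in> borel_measurable P" if \<tau>: "bounded_time \<tau> n K" for \<tau> n K
  proof -
    note V0 = bounded_time_values[OF \<tau> order_refl] and V1 = bounded_time_values[OF \<tau> zero_le_one]
    note [measurable] = V0(1,4) V1(4)
    show "stopped \<tau> ?Z2 n \<in> borel_measurable P" "stopped \<tau> ?Z4 n \<in> borel_measurable P"
      unfolding st using V0(5) V1(5) by (auto intro!: measurable_comp_nonneg[OF m(2)])
    show "stopped \<tau> ?Z1 n \<in> borel_measurable P"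
      unfolding st using V0(2) by (intro measurable_comp_nonneg[OF m(2)]) auto
    show "stopped \<tau> ?Z3 n \<in> borel_measurable P"
      unfolding st using V0(2) by (intro measurable_comp_nonneg[OF m(2)]) (auto simp: g_def[abs_def])
  qed
  define C where "C = Max {1, C1, C2, C3, C4}"
  have C: "1 \<le> C" "C1 \<le> C" "C2 \<le> C" "C3 \<le> C" "C4 \<le> C" unfolding C_def by (auto intro: Max_ge)
  have up: "x \<le> ennreal B * y \<Longrightarrow> B \<le> C \<Longrightarrow> x \<le> ennreal C * y" for x y :: ennreal and B
    by (erule order_trans) (intro mult_right_mono ennreal_leI, auto)
  have lo: "ennreal (1 / C) * x \<le> y" if "x \<le> ennreal C * y" for x y :: ennreal
  proof -
    have "ennreal (1 / C) * x \<le> ennreal (1 / C) * (ennreal C * y)" using that by (intro mult_left_mono) auto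
    also have "\<dots> = y" using C(1) by (simp add: mult.assoc[symmetric] ennreal_mult[symmetric])
    finally show ?thesis .
  qed
  have pos: "0 < 1 / C" "0 < C" using C(1) by auto
  show ?thesis
  proof (rule exI[of _ "1 / C"], rule conjI[OF pos(1)], rule exI[of _ C], rule conjI[OF pos(2)], intro allI impI conjI)
    fix \<tau> assume \<tau>: "stopping_time F \<tau>"
    show "ennreal (1 / C) * (\<integral>\<^sup>+\<omega>. value_at \<tau> ?Z1 \<omega> \<partial>P) \<le> (\<integral>\<^sup>+\<omega>. value_at \<tau> ?Z2 \<omega> \<partial>P)"
      by (rule lo[OF value_at_comparison[OF \<tau> mono(1,2) meas(1)]], assumption, unfold st, rule up[OF C1 C(2)])
    show "(\<integral>\<^sup>+\<omega>. value_at \<tau> ?Z2 \<omega> \<partial>P) \<le> ennreal C * (\<integral>\<^sup>+\<omega>. value_at \<tau> ?Z1 \<omega> \<partial>P)"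
      by (rule value_at_comparison[OF \<tau> mono(2,1) meas(2)], assumption, unfold st, rule up[OF C2 C(3)])
    show "ennreal (1 / C) * (\<integral>\<^sup>+\<omega>. value_at \<tau> ?Z3 \<omega> \<partial>P) \<le> (\<integral>\<^sup>+\<omega>. value_at \<tau> ?Z4 \<omega> \<partial>P)"
      by (rule lo[OF value_at_comparison[OF \<tau> mono(3,4) meas(3)]], assumption, unfold st, rule up[OF C3 C(4)])
    show "(\<integral>\<^sup>+\<omega>. value_at \<tau> ?Z4 \<omega> \<partial>P) \<le> ennreal C * (\<integral>\<^sup>+\<omega>. value_at \<tau> ?Z3 \<omega> \<partial>P)"
      by (rule value_at_comparison[OF \<tau> mono(4,3) meas(4)], assumption, unfold st, rule up[OF C4 C(5)])
  qed
qed

end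

section \<open>Passing to versions with regular paths\<close>

context usual_conditions
begin

text \<open>
  This is where completeness of the filtration enters: processes can be set to \<open>0\<close> on a
  null set without losing adaptedness.
\<close>

lemma AE_set_in_F0:
  assumes "AE \<omega> in P. Q \<omega>" shows "{\<omega> \<in> space P. Q \<omega>} \<in> sets (F 0)"
proof -
  obtain N where N: "{\<omega> \<in> space P. \<not> Q \<omega>} \<subseteq> N" "N \<in> null_sets P"
    using assms by (auto elim!: AE_E simp: null_sets_def)
  have "space (F 0) - {\<omega> \<in> space P. \<not> Q \<omega>} \<in> sets (F 0)"
    using complete[OF N(2,1)] by (rule sets.compl_sets)
  also have "space (F 0) - {\<omega> \<in> space P. \<not> Q \<omega>} = {\<omega> \<in> space P. Q \<omega>}" by (auto simp: space_F)
  finally show ?thesis .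
qed

lemma local_martingale_cong:
  assumes N: "local_martingale N" and eq: "\<And>t \<omega>. 0 \<le> t \<Longrightarrow> N t \<omega> = N' t \<omega>"
  shows "local_martingale N'"
proof -
  have "adapted F N \<longleftrightarrow> adapted F N'" using eq unfolding adapted_def by (metis (no_types, lifting) ext)
  moreover have "continuous_on {0..} (\<lambda>t. N t \<omega>) \<longleftrightarrow> continuous_on {0..} (\<lambda>t. N' t \<omega>)" for \<omega>
    using eq by (intro continuous_on_cong) auto
  moreover have "stopped T N = stopped T N'" for T by (intro ext) (simp add: stopped_def eq)
  ultimately show ?thesis using N unfolding local_martingale_def by simp
qed

lemma restrict_adapted:
  assumes G: "G \<in> sets (F 0)" and N: "adapted F N"
  shows "adapted F (\<lambda>t \<omega>. indicator G \<omega> * N t \<omega>)"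
  unfolding adapted_def
proof (intro allI impI)
  fix t :: real assume t: "0 \<le> t"
  have [measurable]: "G \<in> sets (F (ennreal t))" by (rule sets_mono[OF G]) simp
  have [measurable]: "N t \<in> borel_measurable (F (ennreal t))" by (rule adaptedD[OF N t])
  show "(\<lambda>\<omega>. indicator G \<omega> * N t \<omega>) \<in> borel_measurable (F (ennreal t))" by measurable
qed

text \<open>
  Setting a continuous local martingale to \<open>0\<close> on the exceptional null set changes each
  of its stopped variables on that null set only.
\<close>

lemma restrict_local_martingale:
  assumes N: "continuous_local_martingale P F N" and G: "G \<in> sets (F 0)" "AE \<omega> in P. \<omega> \<in> G"
    and c: "\<And>\<omega>. \<omega> \<in> G \<Longrightarrow> continuous_on {0..} (\<lambda>t. N t \<omega>)" and 0: "\<And>\<omega>. \<omega> \<in> G \<Longrightarrow> N 0 \<omega> = 0"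
  shows "local_martingale (\<lambda>t \<omega>. indicator G \<omega> * N t \<omega>)" (is "local_martingale ?N")
proof -
  obtain T :: "nat \<Rightarrow> 'a \<Rightarrow> ennreal" where T: "\<And>n. stopping_time F (T n)"
      "AE \<omega> in P. incseq (\<lambda>n. T n \<omega>) \<and> (SUP n. T n \<omega>) = \<infinity>"
      "\<And>n. martingale P F (\<lambda>t \<omega>. stopped (T n) N t \<omega> - N 0 \<omega>)" and ad: "adapted F N"
    using N unfolding continuous_local_martingale_def by blast
  have ad': "adapted F ?N" by (rule restrict_adapted[OF G(1) ad])
  have c': "continuous_on {0..} (\<lambda>t. ?N t \<omega>)" for \<omega>
    using c[of \<omega>] by (cases "\<omega> \<in> G") auto
  show ?thesis unfolding local_martingale_def
  proof (intro conjI allI exI[of _ T] ad' c' T(1))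
    show "AE \<omega> in P. \<forall>t. \<forall>\<^sub>F n in sequentially. ennreal t < T n \<omega>"
      using T(2)
    proof eventually_elim
      case (elim \<omega>)
      show ?case
      proof
        fix t
        have "ennreal t < \<infinity>" by simp
        then have "ennreal t < (SUP n. T n \<omega>)" by (simp only: elim)
        then obtain m where m: "ennreal t < T m \<omega>" by (auto simp: less_SUP_iff)
        show "\<forall>\<^sub>F n in sequentially. ennreal t < T n \<omega>"
          using eventually_ge_at_top[of m]
        proof eventually_elim
          case (elim n)
          have "T m \<omega> \<le> T n \<omega>" using \<open>incseq (\<lambda>n. T n \<omega>) \<and> _\<close> elim by (auto simp: incseq_def)
          then show ?case using m by (rule less_le_trans[rotated])
        qed
      qed
    qed
    fix n
    note D = martingaleD[OF T(3)[of n]]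
    have GP: "G \<in> sets P" by (rule sets_P[OF G(1)])
    have adS: "adapted F (stopped (T n) ?N)" by (rule stopped_adapted[OF ad' c' T(1)])
    have eq: "AE \<omega> in P. stopped (T n) N t \<omega> - N 0 \<omega> = stopped (T n) ?N t \<omega>" for t
      using G(2) by eventually_elim (simp add: stopped_def 0)
    show "martingale P F (stopped (T n) ?N)"
      unfolding martingale_iff
    proof (intro conjI adS allI impI)
      fix t :: real assume t: "0 \<le> t"
      have m: "stopped (T n) ?N t \<in> borel_measurable P" by (rule adapted_measurable_P[OF adS t])
      show "integrable P (stopped (T n) ?N t)"
        by (rule integrable_cong_AE_imp[OF D(2)[OF t] m]) (use eq[of t] in \<open>auto elim: eventually_mono\<close>)
    next
      fix s t :: real and B assume st: "0 \<le> s" "s \<le> t" and B: "B \<in> sets (F (ennreal s))"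
      have [measurable]: "B \<in> sets P" by (rule sets_P[OF B])
      have "(\<integral>\<omega>. indicator B \<omega> * stopped (T n) ?N r \<omega> \<partial>P) = (\<integral>\<omega>. indicator B \<omega> * (stopped (T n) N r \<omega> - N 0 \<omega>) \<partial>P)" if r: "0 \<le> r" for r
      proof (rule integral_cong_AE)
        have [measurable]: "stopped (T n) ?N r \<in> borel_measurable P" by (rule adapted_measurable_P[OF adS r])
        have [measurable]: "(\<lambda>\<omega>. stopped (T n) N r \<omega> - N 0 \<omega>) \<in> borel_measurable P" by (rule borel_measurable_integrable[OF D(2)[OF r]])
        show "(\<lambda>\<omega>. indicator B \<omega> * stopped (T n) ?N r \<omega>) \<in> borel_measurable P" by measurable
        show "(\<lambda>\<omega>. indicator B \<omega> * (stopped (T n) N r \<omega> - N 0 \<omega>)) \<in> borel_measurable P" by measurable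
        show "AE \<omega> in P. indicator B \<omega> * stopped (T n) ?N r \<omega> = indicator B \<omega> * (stopped (T n) N r \<omega> - N 0 \<omega>)"
          using eq[of r] by eventually_elim simp
      qed
      then show "(\<integral>\<omega>. indicator B \<omega> * stopped (T n) ?N t \<omega> \<partial>P) = (\<integral>\<omega>. indicator B \<omega> * stopped (T n) ?N s \<omega> \<partial>P)"
        using st D(3)[OF st B] by simp
    qed
  qed
qed

end

theorem corollary8p3:
  fixes P :: "'a measure" and F :: "ennreal \<Rightarrow> 'a measure"
    and M :: "real \<Rightarrow> 'a \<Rightarrow> complex" and A :: "real \<Rightarrow> 'a \<Rightarrow> real"
    and \<Phi> :: "real \<Rightarrow> real"
  assumes "usual_conditions P F"
    and "conformal_local_martingale P F M"
    and "AE \<omega> in P. M 0 \<omega> = 0"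
    and "is_quadratic_variation P F (\<lambda>t \<omega>. Re (M t \<omega>)) A"
    and "moderate \<Phi>"
  shows "\<exists>c>0. \<exists>C>0. \<forall>\<tau>. stopping_time F \<tau> \<longrightarrow>
      ennreal c * (\<integral>\<^sup>+\<omega>. value_at \<tau> (\<lambda>t \<omega>. \<Phi> (sqrt (A t \<omega>))) \<omega> \<partial>P)
        \<le> (\<integral>\<^sup>+\<omega>. value_at \<tau> (\<lambda>t \<omega>. \<Phi> (running_max (\<lambda>s \<omega>. cmod (M s \<omega>)) t \<omega>)) \<omega> \<partial>P) \<and>
      (\<integral>\<^sup>+\<omega>. value_at \<tau> (\<lambda>t \<omega>. \<Phi> (running_max (\<lambda>s \<omega>. cmod (M s \<omega>)) t \<omega>)) \<omega> \<partial>P)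
        \<le> ennreal C * (\<integral>\<^sup>+\<omega>. value_at \<tau> (\<lambda>t \<omega>. \<Phi> (sqrt (A t \<omega>))) \<omega> \<partial>P) \<and>
      ennreal c * (\<integral>\<^sup>+\<omega>. value_at \<tau> (\<lambda>t \<omega>. \<Phi> (g (A t \<omega>))) \<omega> \<partial>P)
        \<le> (\<integral>\<^sup>+\<omega>. value_at \<tau> (\<lambda>t \<omega>. \<Phi> (running_max
              (\<lambda>s \<omega>. cmod (M s \<omega>) / sqrt (1 + A s \<omega>)) t \<omega>)) \<omega> \<partial>P) \<and>
      (\<integral>\<^sup>+\<omega>. value_at \<tau> (\<lambda>t \<omega>. \<Phi> (running_max
              (\<lambda>s \<omega>. cmod (M s \<omega>) / sqrt (1 + A s \<omega>)) t \<omega>)) \<omega> \<partial>P)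
        \<le> ennreal C * (\<integral>\<^sup>+\<omega>. value_at \<tau> (\<lambda>t \<omega>. \<Phi> (g (A t \<omega>))) \<omega> \<partial>P)"
proof -
  interpret usual_conditions P F by fact
  define X where "X t \<omega> = Re (M t \<omega>)" for t \<omega>
  define Y where "Y t \<omega> = Im (M t \<omega>)" for t \<omega>
  obtain A' B' C' where conf: "continuous_local_martingale P F X" "continuous_local_martingale P F Y"
    "is_quadratic_variation P F X A'" "is_quadratic_variation P F Y B'" "is_quadratic_covariation P F X Y C'"
    "AE \<omega> in P. \<forall>t\<ge>0. complex_of_real (A' t \<omega>) - complex_of_real (B' t \<omega>) + 2 * \<i> * complex_of_real (C' t \<omega>) = 0"
    using assms(2) unfolding conformal_local_martingale_def Let_def X_def[abs_def] Y_def[abs_def] by blast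
  obtain U V where UV: "is_quadratic_variation P F (\<lambda>t \<omega>. X t \<omega> + Y t \<omega>) U" "is_quadratic_variation P F (\<lambda>t \<omega>. X t \<omega> - Y t \<omega>) V"
    "\<forall>t\<ge>0. \<forall>\<omega>\<in>space P. C' t \<omega> = (U t \<omega> - V t \<omega>) / 4"
    using conf(5) unfolding is_quadratic_covariation_def by blast
  have qA: "is_quadratic_variation P F X A" using assms(4) by (simp add: X_def[abs_def])
  have qv: "adapted F B \<and> (AE \<omega> in P. continuous_on {0..} (\<lambda>t. B t \<omega>)) \<and> (AE \<omega> in P. B 0 \<omega> = 0 \<and> mono_on {0..} (\<lambda>t. B t \<omega>)) \<and>
     continuous_local_martingale P F (\<lambda>t \<omega>. (Z t \<omega>)\<^sup>2 - B t \<omega>)" if "is_quadratic_variation P F Z B" for Z B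
    using that by (simp add: is_quadratic_variation_def continuous_paths_def)
  define good where "good \<omega> \<longleftrightarrow> M 0 \<omega> = 0 \<and> continuous_on {0..} (\<lambda>t. X t \<omega>) \<and> continuous_on {0..} (\<lambda>t. Y t \<omega>) \<and>
     (\<forall>B\<in>{A, A', B', U, V}. continuous_on {0..} (\<lambda>t. B t \<omega>) \<and> B 0 \<omega> = 0) \<and> mono_on {0..} (\<lambda>t. A t \<omega>) \<and>
     (\<forall>t\<ge>0. A' t \<omega> = B' t \<omega> \<and> C' t \<omega> = 0)" for \<omega>
  define G where "G = {\<omega> \<in> space P. good \<omega>}"
  have ae: "AE \<omega> in P. good \<omega>"
    using assms(3) conf(1,2)[unfolded continuous_local_martingale_def continuous_paths_def, THEN conjunct2, THEN conjunct1] conf(6)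
      qv[OF qA, THEN conjunct2, THEN conjunct1] qv[OF conf(3), THEN conjunct2, THEN conjunct1] qv[OF conf(4), THEN conjunct2, THEN conjunct1]
      qv[OF UV(1), THEN conjunct2, THEN conjunct1] qv[OF UV(2), THEN conjunct2, THEN conjunct1]
      qv[OF qA, THEN conjunct2, THEN conjunct2, THEN conjunct1] qv[OF conf(3), THEN conjunct2, THEN conjunct2, THEN conjunct1]
      qv[OF conf(4), THEN conjunct2, THEN conjunct2, THEN conjunct1]
      qv[OF UV(1), THEN conjunct2, THEN conjunct2, THEN conjunct1] qv[OF UV(2), THEN conjunct2, THEN conjunct2, THEN conjunct1]
  proof eventually_elim
    case (elim \<omega>)
    have "A' t \<omega> = B' t \<omega> \<and> C' t \<omega> = 0" if "0 \<le> t" for t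
      using elim(4)[rule_format, OF that] by (simp add: complex_eq_iff)
    then show ?case unfolding good_def using elim by simp
  qed
  have GF: "G \<in> sets (F 0)" unfolding G_def by (rule AE_set_in_F0[OF ae])
  have Gae: "AE \<omega> in P. \<omega> \<in> G" using ae AE_space by eventually_elim (simp add: G_def)
  have gG: "good \<omega>" if "\<omega> \<in> G" for \<omega> using that by (simp add: G_def)
  have start: "X 0 \<omega> = 0" "Y 0 \<omega> = 0" if "\<omega> \<in> G" for \<omega> using gG[OF that] by (simp_all add: good_def X_def Y_def)
  have XYc: "continuous_on {0..} (\<lambda>t. X t \<omega>)" "continuous_on {0..} (\<lambda>t. Y t \<omega>)" if "\<omega> \<in> G" for \<omega>
    using gG[OF that] by (auto simp: good_def)
  have Bc: "continuous_on {0..} (\<lambda>t. B t \<omega>)" "B 0 \<omega> = 0" if "\<omega> \<in> G" "B \<in> {A, A', B', U, V}" for \<omega> B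
    using gG[OF that(1)] that(2) unfolding good_def by blast+
  note res = restrict_local_martingale[OF _ GF Gae]
  have lX: "local_martingale (\<lambda>t \<omega>. indicator G \<omega> * X t \<omega>)" by (rule res[OF conf(1)]) (auto simp: XYc start)
  have lY: "local_martingale (\<lambda>t \<omega>. indicator G \<omega> * Y t \<omega>)" by (rule res[OF conf(2)]) (auto simp: XYc start)
  have lQ: "local_martingale (\<lambda>t \<omega>. indicator G \<omega> * ((Z t \<omega>)\<^sup>2 - B t \<omega>))"
    if "is_quadratic_variation P F Z B" "B \<in> {A, A', B', U, V}" "\<And>\<omega>. \<omega> \<in> G \<Longrightarrow> continuous_on {0..} (\<lambda>t. Z t \<omega>)" "\<And>\<omega>. \<omega> \<in> G \<Longrightarrow> Z 0 \<omega> = 0" for Z B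
    by (rule res[OF qv[OF that(1), THEN conjunct2, THEN conjunct2, THEN conjunct2]])
       (auto intro!: continuous_intros that(3) Bc(1)[OF _ that(2)] simp: that(4) Bc(2)[OF _ that(2)])
  have lA: "local_martingale (\<lambda>t \<omega>. indicator G \<omega> * ((X t \<omega>)\<^sup>2 - A t \<omega>))" by (rule lQ[OF qA]) (auto simp: XYc start)
  have lA': "local_martingale (\<lambda>t \<omega>. indicator G \<omega> * ((X t \<omega>)\<^sup>2 - A' t \<omega>))" by (rule lQ[OF conf(3)]) (auto simp: XYc start)
  have lB': "local_martingale (\<lambda>t \<omega>. indicator G \<omega> * ((Y t \<omega>)\<^sup>2 - B' t \<omega>))" by (rule lQ[OF conf(4)]) (auto simp: XYc start)
  have lU: "local_martingale (\<lambda>t \<omega>. indicator G \<omega> * ((X t \<omega> + Y t \<omega>)\<^sup>2 - U t \<omega>))"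
    by (rule lQ[OF UV(1)]) (auto simp: XYc start intro!: continuous_intros)
  have lV: "local_martingale (\<lambda>t \<omega>. indicator G \<omega> * ((X t \<omega> - Y t \<omega>)\<^sup>2 - V t \<omega>))"
    by (rule lQ[OF UV(2)]) (auto simp: XYc start intro!: continuous_intros)
  have AB: "A' t \<omega> = B' t \<omega>" "U t \<omega> = V t \<omega>" if "\<omega> \<in> G" "0 \<le> t" for t \<omega>
    using gG[OF that(1)] that UV(3)[rule_format, of t \<omega>] by (auto simp: good_def G_def)
  \<comment> \<open>\<open>Y\<^sup>2 - A = (Y\<^sup>2 - B') + (X\<^sup>2 - A) - (X\<^sup>2 - A')\<close> because \<open>A' = B'\<close>.\<close>
  have lYY: "local_martingale (\<lambda>t \<omega>. (indicator G \<omega> * Y t \<omega>)\<^sup>2 - indicator G \<omega> * A t \<omega>)"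
    using local_martingale_linear[OF local_martingale_linear[OF lB' lA, of 1 1] lA', of 1 "-1"]
    by (rule local_martingale_cong) (auto simp: indicator_def AB)
  \<comment> \<open>Polarisation, with \<open>U = V\<close> because the covariation vanishes.\<close>
  have lXY: "local_martingale (\<lambda>t \<omega>. (indicator G \<omega> * X t \<omega>) * (indicator G \<omega> * Y t \<omega>))"
    using local_martingale_linear[OF lU lV, of "1/4" "-1/4"]
    by (rule local_martingale_cong) (auto simp: indicator_def AB power2_sum power2_diff field_simps)
  have lXX: "local_martingale (\<lambda>t \<omega>. (indicator G \<omega> * X t \<omega>)\<^sup>2 - indicator G \<omega> * A t \<omega>)"
    using lA by (rule local_martingale_cong) (auto simp: indicator_def)
  interpret Z: planar_martingale P F "\<lambda>t \<omega>. indicator G \<omega> * X t \<omega>" "\<lambda>t \<omega>. indicator G \<omega> * Y t \<omega>" "\<lambda>t \<omega>. indicator G \<omega> * A t \<omega>"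
  proof
    show "adapted F (\<lambda>t \<omega>. indicator G \<omega> * A t \<omega>)" by (rule restrict_adapted[OF GF]) (use qv[OF qA] in blast)
    show "continuous_on {0..} (\<lambda>t. indicator G \<omega> * A t \<omega>)" for \<omega>
      using Bc(1)[of \<omega> A] by (cases "\<omega> \<in> G") auto
    show "mono_on {0..} (\<lambda>t. indicator G \<omega> * A t \<omega>)" for \<omega>
      using gG[of \<omega>] by (cases "\<omega> \<in> G") (auto simp: good_def intro: mono_onI)
    show "indicator G \<omega> * X 0 \<omega> = 0" "indicator G \<omega> * Y 0 \<omega> = 0" "indicator G \<omega> * A 0 \<omega> = 0" for \<omega>
      using start[of \<omega>] Bc(2)[of \<omega> A] by (auto simp: indicator_def)
  qed (fact lX lY lXX lYY lXY)+
  have rho0: "Z.rho 0 t \<omega> = running_max (\<lambda>s \<omega>. cmod (M s \<omega>)) t \<omega>" if "\<omega> \<in> G" for t \<omega>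
    unfolding Z.rho_def Z.R_def using that by (intro running_max_cong) (simp add: cmod_def X_def Y_def)
  have rho1: "Z.rho 1 t \<omega> = running_max (\<lambda>s \<omega>. cmod (M s \<omega>) / sqrt (1 + A s \<omega>)) t \<omega>" if "\<omega> \<in> G" for t \<omega>
    unfolding Z.rho_def Z.R_def using that by (intro running_max_cong) (simp add: cmod_def X_def Y_def real_sqrt_divide)
  have e1: "(\<integral>\<^sup>+\<omega>. value_at \<tau> (\<lambda>t \<omega>. \<Phi> (sqrt (indicator G \<omega> * A t \<omega>))) \<omega> \<partial>P) = (\<integral>\<^sup>+\<omega>. value_at \<tau> (\<lambda>t \<omega>. \<Phi> (sqrt (A t \<omega>))) \<omega> \<partial>P)" for \<tau>
    using Gae by (intro nn_integral_cong_AE) (auto elim!: eventually_mono intro!: value_at_cong)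
  have e2: "(\<integral>\<^sup>+\<omega>. value_at \<tau> (\<lambda>t \<omega>. \<Phi> (g (indicator G \<omega> * A t \<omega>))) \<omega> \<partial>P) = (\<integral>\<^sup>+\<omega>. value_at \<tau> (\<lambda>t \<omega>. \<Phi> (g (A t \<omega>))) \<omega> \<partial>P)" for \<tau>
    using Gae by (intro nn_integral_cong_AE) (auto elim!: eventually_mono intro!: value_at_cong)
  have e3: "(\<integral>\<^sup>+\<omega>. value_at \<tau> (\<lambda>t \<omega>. \<Phi> (Z.rho 0 t \<omega>)) \<omega> \<partial>P) = (\<integral>\<^sup>+\<omega>. value_at \<tau> (\<lambda>t \<omega>. \<Phi> (running_max (\<lambda>s \<omega>. cmod (M s \<omega>)) t \<omega>)) \<omega> \<partial>P)" for \<tau>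
    using Gae by (intro nn_integral_cong_AE) (auto elim!: eventually_mono intro!: value_at_cong simp: rho0)
  have e4: "(\<integral>\<^sup>+\<omega>. value_at \<tau> (\<lambda>t \<omega>. \<Phi> (Z.rho 1 t \<omega>)) \<omega> \<partial>P) = (\<integral>\<^sup>+\<omega>. value_at \<tau> (\<lambda>t \<omega>. \<Phi> (running_max (\<lambda>s \<omega>. cmod (M s \<omega>) / sqrt (1 + A s \<omega>)) t \<omega>)) \<omega> \<partial>P)" for \<tau>
    using Gae by (intro nn_integral_cong_AE) (auto elim!: eventually_mono intro!: value_at_cong simp: rho1)
  show ?thesis using Z.maximal_inequalities[OF assms(5)] unfolding e1 e2 e3 e4 .
qed

end
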